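(* Let $n\ge 3$ and $1\le p\le\infty$. Let $\varphi:B\to B$ be a non-constant $C^2$ map whose Jacobian determinant $J_\varphi$ does not change sign in $B$, and let $\psi$ be a $C^2$ function on $B$. Let $W_{\varphi,\psi}f:=\psi\cdot(f\circ\varphi)$. Then $W_{\varphi,\psi}$ is bounded on $h^p(B)$ if and only if both of the following hold: (i) $\varphi$ is the restriction to $B$ of a Möbius transformation of $\widehat{\mathbb{R}}^n$; (ii) $\psi$ is a constant multiple of $|D\varphi|^{\frac{n-2}{2}}$. More precisely, $W_{\varphi,\psi}$ is bounded on $h^p(B)$ if and only if $\varphi$ has the form $$\varphi(x)=b+\frac{\alpha A(x-a)}{|x-a|^{\epsilon}}$$ and $\psi$ is a constant multiple of $|x-a|^{\frac{\epsilon(2-n)}{2}}$, where $a\in\mathbb{R}^n\setminus B$, $b\in\mathbb{R}^n$, $\alpha\in\mathbb{R}$, $A$ is an orthogonal matrix, and $\epsilon$ is either $0$ or $2$.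
   Context: $B$ is the open unit ball and $S=\partial B$ the unit sphere of $\mathbb{R}^n$; $\sigma$ is the surface area measure on $S$ normalized so that $\sigma(S)=1$. For $1\le p<\infty$, $h^p(B)$ is the space of complex-valued harmonic functions $f$ on $B$ with $\|f\|_{h^p}:=\sup_{0\le r<1}\left(\int_S|f(r\zeta)|^p\,d\sigma(\zeta)\right)^{1/p}<\infty$; $h^\infty(B)$ is the space of bounded complex-valued harmonic functions on $B$ with $\|f\|_{h^\infty}:=\sup_{x\in B}|f(x)|$. "$W_{\varphi,\psi}$ is bounded on $h^p(B)$" means that $W_{\varphi,\psi}f\in h^p(B)$ for every $f\in h^p(B)$ and that $W_{\varphi,\psi}:h^p(B)\to h^p(B)$ is a bounded linear operator. $D\varphi(x)$ is the Jacobian matrix, $J_\varphi(x)=\det D\varphi(x)$, and $|D\varphi(x)|:=|J_\varphi(x)|^{1/n}$. "$J_\varphi$ does not change sign" means that $J_\varphi\ge 0$ throughout $B$ or $J_\varphi\le 0$ throughout $B$. $\widehat{\mathbb{R}}^n=\mathbb{R}^n\cup\{\infty\}$ is the one-point compactification of $\mathbb{R}^n$. A Möbius transformation of $\widehat{\mathbb{R}}^n$ is a finite composition of reflections in spheres ($x\mapsto a+r^2(x-a)/|x-a|^2$, with $a\mapsto\infty$, $\infty\mapsto a$, where $a\in\mathbb{R}^n$, $r>0$) and reflections in hyperplanes ($x\mapsto x-2(x\cdot a-t)a$, $\infty\mapsto\infty$, where $|a|=1$, $t\in\mathbb{R}$).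
   Formalization: ψ is additionally assumed not identically zero on B; for ψ = 0 the operator is 0, hence bounded for every φ, e.g. φ(x) = (x₁/2, 0, …, 0) with J_φ = 0, which is not Möbius, so the equivalence as stated fails. *)

theory Defs
  imports "HOL-Analysis.Analysis"
begin

text \<open>Differentiability and harmonicity are only used on open sets. Functions on the ball are
  modelled by total functions of which only the values on the ball matter.\<close>

definition C2_on :: "('a::real_normed_vector \<Rightarrow> 'b::real_normed_vector) \<Rightarrow> 'a set \<Rightarrow> bool" where
  "C2_on f S \<longleftrightarrow>
     (\<exists>f' f''.
        (\<forall>x\<in>S. (f has_derivative blinfun_apply (f' x)) (at x)) \<and>
        (\<forall>x\<in>S. (f' has_derivative blinfun_apply (f'' x)) (at x)) \<and>
        continuous_on S f'')"

definition partial_deriv ::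
    "'a::real_normed_vector \<Rightarrow> ('a \<Rightarrow> 'b::real_normed_vector) \<Rightarrow> 'a \<Rightarrow> 'b" where
  "partial_deriv e f x = vector_derivative (\<lambda>t. f (x + t *\<^sub>R e)) (at 0)"

definition laplacian :: "('a::euclidean_space \<Rightarrow> 'b::real_normed_vector) \<Rightarrow> 'a \<Rightarrow> 'b" where
  "laplacian f x = (\<Sum>e\<in>Basis. partial_deriv e (partial_deriv e f) x)"

definition harmonic_on :: "('a::euclidean_space \<Rightarrow> 'b::real_normed_vector) \<Rightarrow> 'a set \<Rightarrow> bool" where
  "harmonic_on f S \<longleftrightarrow> C2_on f S \<and> (\<forall>x\<in>S. laplacian f x = 0)"

text \<open>Normalized surface measure on the unit sphere, by the usual polar coordinates (cone)
  definition: the measure of \<open>A\<close> is the volume of \<open>{x \<in> ball 0 1. x / |x| \<in> A}\<close> divided by the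
  volume of the unit ball. It is a Borel measure on the whole space, concentrated on
  \<open>sphere 0 1\<close>; the origin, where \<open>sgn\<close> takes the value 0, is a null set.\<close>

definition sphere_measure :: "'a::euclidean_space measure" where
  "sphere_measure = distr (uniform_measure lborel (ball 0 1)) borel sgn"

text \<open>For \<open>f\<close> continuous on the ball the integrals below are finite (the sphere of radius \<open>r < 1\<close>
  is compact), so only the supremum can be infinite.\<close>

definition hp_norm :: "ereal \<Rightarrow> ('a::euclidean_space \<Rightarrow> complex) \<Rightarrow> ereal" where
  "hp_norm p f =
     (if p = \<infinity> then (SUP x\<in>ball 0 1. ereal (cmod (f x)))
      else (SUP r\<in>{0..<1}. ereal
        ((LINT z:sphere 0 1|sphere_measure. cmod (f (r *\<^sub>R z)) powr real_of_ereal p)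
           powr (1 / real_of_ereal p))))"

definition hp :: "ereal \<Rightarrow> ('a::euclidean_space \<Rightarrow> complex) set" where
  "hp p = {f. harmonic_on f (ball 0 1) \<and> hp_norm p f < \<infinity>}"

definition bounded_on_hp ::
    "ereal \<Rightarrow> (('a::euclidean_space \<Rightarrow> complex) \<Rightarrow> ('a \<Rightarrow> complex)) \<Rightarrow> bool" where
  "bounded_on_hp p T \<longleftrightarrow>
     (\<forall>f\<in>hp p. T f \<in> hp p) \<and>
     (\<forall>f\<in>hp p. \<forall>g\<in>hp p. \<forall>c d. \<forall>x\<in>ball 0 1.
        T (\<lambda>y. c * f y + d * g y) x = c * T f x + d * T g x) \<and>
     (\<exists>C::real. \<forall>f\<in>hp p. hp_norm p (T f) \<le> ereal C * hp_norm p f)"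

definition weighted_comp ::
    "('a \<Rightarrow> 'a) \<Rightarrow> ('a \<Rightarrow> complex) \<Rightarrow> ('a \<Rightarrow> complex) \<Rightarrow> ('a \<Rightarrow> complex)" where
  "weighted_comp \<phi> \<psi> f = (\<lambda>x. \<psi> x * f (\<phi> x))"

definition jacobian_det :: "(real^'n \<Rightarrow> real^'n) \<Rightarrow> real^'n \<Rightarrow> real" where
  "jacobian_det \<phi> x = det (jacobian \<phi> (at x))"

text \<open>This is \<open>|D\<phi>(x)|\<close>, by convention not an operator norm.\<close>

definition jacobian_abs :: "(real^'n \<Rightarrow> real^'n) \<Rightarrow> real^'n \<Rightarrow> real" where
  "jacobian_abs \<phi> x = \<bar>jacobian_det \<phi> x\<bar> powr (1 / real CARD('n))"

text \<open>The one-point compactification is the type \<open>'a option\<close>, with \<open>None\<close> as the point at infinity.\<close>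

definition sphere_reflection :: "'a::real_inner \<Rightarrow> real \<Rightarrow> 'a option \<Rightarrow> 'a option" where
  "sphere_reflection a r y =
     (case y of
        None \<Rightarrow> Some a
      | Some x \<Rightarrow> if x = a then None else Some (a + (r\<^sup>2 / (norm (x - a))\<^sup>2) *\<^sub>R (x - a)))"

definition hyperplane_reflection :: "'a::real_inner \<Rightarrow> real \<Rightarrow> 'a option \<Rightarrow> 'a option" where
  "hyperplane_reflection a t y =
     (case y of
        None \<Rightarrow> None
      | Some x \<Rightarrow> Some (x - (2 * (x \<bullet> a - t)) *\<^sub>R a))"

inductive moebius_map :: "('a::real_inner option \<Rightarrow> 'a option) \<Rightarrow> bool" where
  moebius_id: "moebius_map id"
| moebius_sphere: "moebius_map M \<Longrightarrow> r > 0 \<Longrightarrow> moebius_map (sphere_reflection a r \<circ> M)"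
| moebius_hyperplane: "moebius_map M \<Longrightarrow> norm a = 1 \<Longrightarrow> moebius_map (hyperplane_reflection a t \<circ> M)"

end

theory Submission imports Defs begin

text \<open>Write \<open>n\<close> for the dimension.

  \<^emph>\<open>Sufficiency.\<close> An inversion form \<open>b + \<alpha> L (x - a) / |x - a|\<^sup>2\<close> with the weight \<open>|x - a| powr (2 - n)\<close> is a Kelvin
  transform, so it carries harmonic functions to harmonic functions (\<open>harmonic_on_moebius_form\<close>); a similarity
  with constant weight does so trivially. For the norm bound, \<open>|f| powr q\<close> is sub-mean by Jensen's inequality,
  hence on a ball of radius \<open>R < 1\<close> it is dominated by the Poisson integral of its values on the boundary
  sphere (\<open>poisson_integral_majorant\<close>). The Poisson kernel composed with \<open>\<phi>\<close> and multiplied by the weight is again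
  harmonic, so its mean over a sphere about the origin is its value there. Interchanging the two integrations bounds
  the means of \<open>|\<psi> (f \<circ> \<phi>)| powr q\<close> by those of \<open>|f| powr q\<close> (\<open>moebius_weighted_mean_le\<close>).

  \<^emph>\<open>Necessity.\<close> The operator is applied to bounded harmonic functions only: the constant 1, the linear functions
  \<open>u \<bullet> x\<close>, and the products \<open>(u \<bullet> x) (v \<bullet> x)\<close> with \<open>u\<close> orthogonal to \<open>v\<close>. Expanding the Laplacians of the images shows
  that \<open>\<psi>\<close> is harmonic, that \<open>D\<phi>\<close> is a multiple \<open>\<lambda>\<close> of an isometry wherever \<open>\<psi> \<noteq> 0\<close> (\<open>adjoint_conformal\<close>,
  \<open>conformal\<close>), and that on connected open sets where also \<open>\<lambda> \<noteq> 0\<close> the weight \<open>\<psi>\<close> is a constant times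
  \<open>\<lambda> powr ((n - 2) / 2)\<close> (\<open>psi_eq_mu_powr\<close>).

  What remains is Liouville's theorem on conformal maps in dimension at least 3, which is delicate for maps
  that are only \<open>C\<^sup>2\<close>. Here the weight removes the difficulty. Put \<open>\<rho> = 1 / \<lambda>\<close>. Up to a constant factor
  \<open>\<rho> powr ((2 - n) / 2)\<close> is the harmonic function \<open>\<psi>\<close>, so \<open>\<rho>\<close> is \<open>C\<^sup>2\<close>, one derivative more than \<open>\<phi>\<close> alone provides.
  Differentiating \<open>D\<phi> u \<bullet> D\<phi> v = (u \<bullet> v) / \<rho>\<^sup>2\<close> expresses \<open>D\<^sup>2\<phi>\<close> through \<open>\<rho>\<close>, \<open>D\<rho>\<close> and \<open>D\<phi>\<close> (\<open>second_derivative\<close>), so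
  \<open>D\<phi>\<close> is itself \<open>C\<^sup>2\<close>. For \<open>i\<close> orthogonal to \<open>j\<close>, a third direction orthogonal to both and the symmetry of the third
  derivatives give \<open>D\<^sup>2\<rho>(i, j) = 0\<close> (\<open>hessian_orthogonal\<close>); hence \<open>D\<^sup>2\<rho> = \<sigma> Id\<close>. Harmonicity of
  \<open>\<rho> powr ((2 - n) / 2)\<close> then reads \<open>2 \<rho> \<sigma> = |\<nabla>\<rho>|\<^sup>2\<close> and forces \<open>\<sigma>\<close> to be constant (\<open>sigma_const\<close>). If \<open>\<sigma> = 0\<close>, then \<open>\<phi>\<close> is a
  similarity (\<open>affine_case\<close>); otherwise \<open>\<rho> = (\<sigma> / 2) |x - a|\<^sup>2\<close> and \<open>\<phi>\<close> is an inversion followed by a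
  similarity (\<open>inversion_case\<close>).

  This is a local result, on a component of the set where \<open>\<psi>\<close> and \<open>D\<phi>\<close> do not vanish. That set is nonempty by unique
  continuation for the harmonic function \<open>\<psi>\<close> (\<open>regular_nonempty\<close>), and the component is the whole ball
  because the explicit formulas keep \<open>\<lambda>\<close> and \<open>|\<psi>|\<close> away from 0 up to its boundary
  (\<open>moebius_form_of_harmonic_preserving\<close>).

  \<^emph>\<open>Equivalence of the two descriptions.\<close> The similarities and the inversion forms, extended to the pole and to infinity, are
  exactly the Moebius transformations (\<open>moebius_map_normal_form\<close>, \<open>moebius_form_extends_to_moebius_map\<close>),
  and \<open>|D\<phi>| = |\<alpha>| / |x - a| powr \<epsilon>\<close> (\<open>jacobian_abs_moebius_form\<close>).\<close>

section \<open>Twice continuously differentiable functions\<close>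

text \<open>The derivatives are kept as plain functions, \<open>f' x u\<close> in direction \<open>u\<close> and \<open>f'' x u v\<close> for the derivative of
  \<open>f' _ u\<close> in direction \<open>v\<close>. Products, compositions and Laplacians can then be computed by the ordinary derivative
  rules. In Euclidean spaces this agrees with the formulation by bounded linear maps, as the lemmas
  \<open>C2_on_imp_C2_derivs\<close> and \<open>C2_derivs_imp_C2_on\<close> show.\<close>

definition C2_derivs ::
  "('a::real_normed_vector \<Rightarrow> 'b::real_normed_vector) \<Rightarrow> ('a \<Rightarrow> 'a \<Rightarrow> 'b) \<Rightarrow> ('a \<Rightarrow> 'a \<Rightarrow> 'a \<Rightarrow> 'b) \<Rightarrow> 'a set \<Rightarrow> bool"
  where "C2_derivs f f' f'' S \<longleftrightarrow>
     (\<forall>x\<in>S. (f has_derivative f' x) (at x)) \<and>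
     (\<forall>x\<in>S. \<forall>u. ((\<lambda>y. f' y u) has_derivative f'' x u) (at x)) \<and>
     (\<forall>u v. continuous_on S (\<lambda>x. f'' x u v))"

lemma C2_derivsD:
  assumes "C2_derivs f f' f'' S"
  shows "x \<in> S \<Longrightarrow> (f has_derivative f' x) (at x)"
    and "x \<in> S \<Longrightarrow> ((\<lambda>y. f' y u) has_derivative f'' x u) (at x)"
    and "continuous_on S (\<lambda>x. f'' x u v)"
  using assms unfolding C2_derivs_def by auto

lemma C2_derivs_subset: "C2_derivs f f' f'' S \<Longrightarrow> T \<subseteq> S \<Longrightarrow> C2_derivs f f' f'' T"
  unfolding C2_derivs_def by (meson continuous_on_subset subsetD)

lemma linear_deriv1:
  assumes "C2_derivs f f' f'' S" "x \<in> S"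
  shows "linear (f' x)"
  using C2_derivsD(1)[OF assms] by (rule has_derivative_linear)

lemma linear_deriv2_right:
  assumes "C2_derivs f f' f'' S" "x \<in> S"
  shows "linear (f'' x u)"
  using C2_derivsD(2)[OF assms] by (rule has_derivative_linear)

text \<open>Linearity in the first direction comes from uniqueness of derivatives, since \<open>f' y\<close> is linear for all \<open>y\<close>
  near \<open>x\<close>.\<close>

lemma linear_deriv2_left:
  assumes C: "C2_derivs f f' f'' S" and x: "x \<in> S" and S: "open S"
  shows "linear (\<lambda>u. f'' x u v)"
proof -
  have lin: "linear (f' y)" if "y \<in> S" for y using linear_deriv1[OF C that] .
  have 1: "f'' x (u + w) v = f'' x u v + f'' x w v" for u w
  proof -
    have "((\<lambda>y. f' y (u + w)) has_derivative (\<lambda>v. f'' x u v + f'' x w v)) (at x)"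
    proof (rule has_derivative_transform_within_open[OF _ S x])
      show "((\<lambda>y. f' y u + f' y w) has_derivative (\<lambda>v. f'' x u v + f'' x w v)) (at x)"
        by (intro has_derivative_add C2_derivsD(2)[OF C x])
    qed (simp add: lin linear_add)
    from has_derivative_unique[OF this C2_derivsD(2)[OF C x]] show ?thesis by metis
  qed
  have 2: "f'' x (r *\<^sub>R u) v = r *\<^sub>R f'' x u v" for u r
  proof -
    have "((\<lambda>y. f' y (r *\<^sub>R u)) has_derivative (\<lambda>v. r *\<^sub>R f'' x u v)) (at x)"
    proof (rule has_derivative_transform_within_open[OF _ S x])
      show "((\<lambda>y. r *\<^sub>R f' y u) has_derivative (\<lambda>v. r *\<^sub>R f'' x u v)) (at x)"
        by (intro has_derivative_scaleR_right C2_derivsD(2)[OF C x])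
    qed (simp add: lin linear_scale)
    from has_derivative_unique[OF this C2_derivsD(2)[OF C x]] show ?thesis by metis
  qed
  show ?thesis by (rule linearI) (auto simp: 1 2)
qed

lemma linear_eq_sum_Basis:
  fixes f :: "'a::euclidean_space \<Rightarrow> 'b::real_vector"
  assumes "linear f" shows "f x = (\<Sum>e\<in>Basis. (x \<bullet> e) *\<^sub>R f e)"
proof -
  have "f x = f (\<Sum>e\<in>Basis. (x \<bullet> e) *\<^sub>R e)" by (simp add: euclidean_representation)
  also have "\<dots> = (\<Sum>e\<in>Basis. (x \<bullet> e) *\<^sub>R f e)"
    by (simp add: linear_sum[OF assms] linear_scale[OF assms])
  finally show ?thesis .
qed

lemma C2_on_imp_C2_derivs:
  assumes "C2_on f S"
  obtains f' f'' where "C2_derivs f f' f'' S"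
proof -
  obtain F' F'' where
    F': "\<And>x. x\<in>S \<Longrightarrow> (f has_derivative blinfun_apply (F' x)) (at x)" and
    F'': "\<And>x. x\<in>S \<Longrightarrow> (F' has_derivative blinfun_apply (F'' x)) (at x)" and
    c: "continuous_on S F''"
    using assms unfolding C2_on_def by auto
  have "C2_derivs f (\<lambda>x. blinfun_apply (F' x)) (\<lambda>x u v. blinfun_apply (blinfun_apply (F'' x) v) u) S"
    unfolding C2_derivs_def
  proof (intro conjI ballI allI)
    fix x u assume "x \<in> S"
    show "((\<lambda>y. blinfun_apply (F' y) u) has_derivative (\<lambda>v. blinfun_apply (blinfun_apply (F'' x) v) u)) (at x)"
      by (rule bounded_linear.has_derivative[OF blinfun.bounded_linear_left F''[OF \<open>x \<in> S\<close>]])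
  next
    fix u v
    show "continuous_on S (\<lambda>x. blinfun_apply (blinfun_apply (F'' x) v) u)"
      by (intro continuous_intros c)
  qed (use F' in auto)
  then show ?thesis by (rule that)
qed

definition rank1_blinfun :: "'a::real_inner \<Rightarrow> 'b::real_normed_vector \<Rightarrow> 'a \<Rightarrow>\<^sub>L 'b"
  where "rank1_blinfun e b = blinfun_scaleR_left b o\<^sub>L blinfun_inner_left e"

lemma rank1_blinfun_apply [simp]: "blinfun_apply (rank1_blinfun e b) x = (x \<bullet> e) *\<^sub>R b"
  by (simp add: rank1_blinfun_def)

lemma bounded_linear_rank1_blinfun: "bounded_linear (rank1_blinfun e)"
  unfolding rank1_blinfun_def
  by (rule bounded_linear_compose[OF bounded_bilinear.bounded_linear_left[OF bounded_bilinear_blinfun_compose] bounded_linear_blinfun_scaleR_left])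

text \<open>Expanding a linear map over the basis writes it as a sum of rank-one maps; the derivative as a bounded
  linear map is therefore as regular as its values on basis vectors.\<close>

lemma C2_derivs_imp_C2_on:
  fixes f :: "'a::euclidean_space \<Rightarrow> 'b::real_normed_vector"
  assumes C: "C2_derivs f f' f'' S" and S: "open S"
  shows "C2_on f S"
proof -
  define F' where "F' x = (\<Sum>e\<in>Basis. rank1_blinfun e (f' x e))" for x :: 'a
  define F'' where "F'' x = (\<Sum>e\<in>Basis. \<Sum>d\<in>Basis. rank1_blinfun d
      (rank1_blinfun e (f'' x e d)))" for x :: 'a
  have F': "blinfun_apply (F' x) = f' x" if "x \<in> S" for x
    unfolding F'_def
    by (rule ext) (simp add: blinfun.sum_left inner_commute linear_eq_sum_Basis[OF linear_deriv1[OF C that], symmetric])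
  have F'': "blinfun_apply (F'' x) v = (\<Sum>e\<in>Basis. rank1_blinfun e (f'' x e v))"
    if x: "x \<in> S" for x v
  proof -
    have "rank1_blinfun e (f'' x e v) =
       (\<Sum>d\<in>Basis. (v \<bullet> d) *\<^sub>R rank1_blinfun e (f'' x e d))" for e
      by (subst linear_eq_sum_Basis[OF linear_deriv2_right[OF C x]])
        (simp add: linear_sum linear_scale bounded_linear.linear[OF bounded_linear_rank1_blinfun])
    then show ?thesis
      unfolding F''_def by (simp add: blinfun.sum_left inner_commute)
  qed
  show ?thesis
    unfolding C2_on_def
  proof (intro exI conjI ballI)
    fix x assume x: "x \<in> S"
    show "(f has_derivative blinfun_apply (F' x)) (at x)"
      using C2_derivsD(1)[OF C x] F'[OF x] by simp
    have "(F' has_derivative (\<lambda>v. \<Sum>e\<in>Basis. rank1_blinfun e (f'' x e v))) (at x)"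
      unfolding F'_def
      by (intro has_derivative_sum bounded_linear.has_derivative[OF bounded_linear_rank1_blinfun]
          C2_derivsD(2)[OF C x])
    then show "(F' has_derivative blinfun_apply (F'' x)) (at x)"
      unfolding F''[OF x, symmetric] .
  next
    show "continuous_on S F''"
      unfolding F''_def
      by (intro continuous_on_sum bounded_linear.continuous_on[OF bounded_linear_rank1_blinfun]
          C2_derivsD(3)[OF C])
  qed
qed

lemma partial_deriv_eq:
  assumes "(f has_derivative f') (at x)"
  shows "partial_deriv e f x = f' e"
proof -
  have "((\<lambda>t. f (x + t *\<^sub>R e)) has_derivative (\<lambda>t. f' (0 + t *\<^sub>R e))) (at 0)"
    by (rule has_derivative_compose[of "\<lambda>t. x + t *\<^sub>R e" _ 0 UNIV f, simplified])
       (auto intro!: derivative_eq_intros assms)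
  then have "((\<lambda>t. f (x + t *\<^sub>R e)) has_vector_derivative f' e) (at 0)"
    unfolding has_vector_derivative_def
    by (simp add: linear_scale[OF has_derivative_linear[OF assms]])
  then show ?thesis unfolding partial_deriv_def by (rule vector_derivative_at)
qed

lemma laplacian_eq:
  fixes f :: "'a::euclidean_space \<Rightarrow> 'b::real_normed_vector"
  assumes C: "C2_derivs f f' f'' S" and S: "open S" and x: "x \<in> S"
  shows "laplacian f x = (\<Sum>e\<in>Basis. f'' x e e)"
  unfolding laplacian_def
proof (rule sum.cong[OF refl])
  fix e :: 'a
  have "(partial_deriv e f has_derivative f'' x e) (at x)"
    by (rule has_derivative_transform_within_open[OF C2_derivsD(2)[OF C x] S x])
       (simp add: partial_deriv_eq[OF C2_derivsD(1)[OF C]])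
  then show "partial_deriv e (partial_deriv e f) x = f'' x e e"
    by (rule partial_deriv_eq)
qed

lemma harmonic_on_iff:
  fixes f :: "'a::euclidean_space \<Rightarrow> 'b::real_normed_vector"
  assumes C: "C2_derivs f f' f'' S" and S: "open S"
  shows "harmonic_on f S \<longleftrightarrow> (\<forall>x\<in>S. (\<Sum>e\<in>Basis. f'' x e e) = 0)"
  using laplacian_eq[OF C S] C2_derivs_imp_C2_on[OF C S] unfolding harmonic_on_def by auto

lemma harmonic_onE:
  fixes f :: "'a::euclidean_space \<Rightarrow> 'b::real_normed_vector"
  assumes "harmonic_on f S" and S: "open S"
  obtains f' f'' where "C2_derivs f f' f'' S" "\<And>x. x \<in> S \<Longrightarrow> (\<Sum>e\<in>Basis. f'' x e e) = 0"
  using assms(1) harmonic_on_iff[OF _ S] C2_on_imp_C2_derivs unfolding harmonic_on_def by metis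

lemma C2_derivs_continuous:
  assumes C: "C2_derivs f f' f'' S"
  shows "continuous_on S f" "continuous_on S (\<lambda>x. f' x u)"
  using C2_derivsD(1,2)[OF C] by (meson continuous_at_imp_continuous_on has_derivative_continuous)+

lemma C2_derivs_bounded_linear:
  assumes C: "C2_derivs f f' f'' S" and L: "bounded_linear L"
  shows "C2_derivs (\<lambda>x. L (f x)) (\<lambda>x u. L (f' x u)) (\<lambda>x u v. L (f'' x u v)) S"
  unfolding C2_derivs_def
  by (auto intro!: bounded_linear.has_derivative[OF L] bounded_linear.continuous_on[OF L] C2_derivsD[OF C])

lemma C2_derivs_bilinear:
  assumes B: "bounded_bilinear B" and G: "C2_derivs g g' g'' S" and H: "C2_derivs h h' h'' S"
  shows "C2_derivs (\<lambda>x. B (g x) (h x)) (\<lambda>x u. B (g x) (h' x u) + B (g' x u) (h x))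
     (\<lambda>x u v. B (g x) (h'' x u v) + B (g' x v) (h' x u) + (B (g' x u) (h' x v) + B (g'' x u v) (h x))) S"
  unfolding C2_derivs_def
  by (auto intro!: has_derivative_add bounded_bilinear.FDERIV[OF B] bounded_bilinear.continuous_on[OF B]
      continuous_on_add C2_derivsD[OF G] C2_derivsD[OF H] C2_derivs_continuous[OF G] C2_derivs_continuous[OF H])

text \<open>Expanding \<open>\<phi>' y u\<close> over the basis turns the first derivative into a sum of real scalars times
  \<open>f' (\<phi> y) e\<close> with fixed directions \<open>e\<close>, to which the chain and product rules apply.\<close>

lemma C2_derivs_compose:
  fixes \<phi> :: "'a::real_normed_vector \<Rightarrow> 'c::euclidean_space"
  assumes F: "C2_derivs f f' f'' V" and P: "C2_derivs \<phi> \<phi>' \<phi>'' S" and V: "open V" and sub: "\<phi> ` S \<subseteq> V"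
    and S: "open S"
  shows "C2_derivs (\<lambda>x. f (\<phi> x)) (\<lambda>x u. f' (\<phi> x) (\<phi>' x u))
     (\<lambda>x u v. f'' (\<phi> x) (\<phi>' x u) (\<phi>' x v) + f' (\<phi> x) (\<phi>'' x u v)) S"
  unfolding C2_derivs_def
proof (intro conjI ballI allI)
  fix x assume x: "x \<in> S"
  then have Px: "\<phi> x \<in> V" using sub by auto
  show "((\<lambda>x. f (\<phi> x)) has_derivative (\<lambda>u. f' (\<phi> x) (\<phi>' x u))) (at x)"
    by (rule has_derivative_compose[OF C2_derivsD(1)[OF P x] C2_derivsD(1)[OF F Px]])
  fix u
  have "((\<lambda>y. \<Sum>e\<in>Basis. (\<phi>' y u \<bullet> e) *\<^sub>R f' (\<phi> y) e) has_derivative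
     (\<lambda>v. \<Sum>e\<in>Basis. (\<phi>' x u \<bullet> e) *\<^sub>R f'' (\<phi> x) e (\<phi>' x v) + (\<phi>'' x u v \<bullet> e) *\<^sub>R f' (\<phi> x) e)) (at x)"
    by (intro has_derivative_sum has_derivative_scaleR has_derivative_inner_left C2_derivsD(2)[OF P x]
         has_derivative_compose[OF C2_derivsD(1)[OF P x] C2_derivsD(2)[OF F Px]])
  moreover have "(\<Sum>e\<in>Basis. (\<phi>' x u \<bullet> e) *\<^sub>R f'' (\<phi> x) e (\<phi>' x v) + (\<phi>'' x u v \<bullet> e) *\<^sub>R f' (\<phi> x) e)
      = f'' (\<phi> x) (\<phi>' x u) (\<phi>' x v) + f' (\<phi> x) (\<phi>'' x u v)" for v
    using linear_eq_sum_Basis[OF linear_deriv2_left[OF F Px V], of "\<phi>' x u" "\<phi>' x v"]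
      linear_eq_sum_Basis[OF linear_deriv1[OF F Px], of "\<phi>'' x u v"]
    by (simp add: sum.distrib)
  ultimately have "((\<lambda>y. \<Sum>e\<in>Basis. (\<phi>' y u \<bullet> e) *\<^sub>R f' (\<phi> y) e) has_derivative
      (\<lambda>v. f'' (\<phi> x) (\<phi>' x u) (\<phi>' x v) + f' (\<phi> x) (\<phi>'' x u v))) (at x)"
    by simp
  then show "((\<lambda>y. f' (\<phi> y) (\<phi>' y u)) has_derivative
      (\<lambda>v. f'' (\<phi> x) (\<phi>' x u) (\<phi>' x v) + f' (\<phi> x) (\<phi>'' x u v))) (at x)"
    by (rule has_derivative_transform_within_open[OF _ S x])
      (use sub in \<open>auto intro!: linear_eq_sum_Basis[OF linear_deriv1[OF F], symmetric]\<close>)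
next
  fix u v
  have cc: "continuous_on S (\<lambda>x. g (\<phi> x))" if "continuous_on V g" for g :: "'c \<Rightarrow> 'b"
    using continuous_on_compose2[OF that C2_derivs_continuous(1)[OF P] sub] .
  have "continuous_on S (\<lambda>x. (\<Sum>e\<in>Basis. (\<phi>' x u \<bullet> e) *\<^sub>R (\<Sum>d\<in>Basis. (\<phi>' x v \<bullet> d) *\<^sub>R f'' (\<phi> x) e d))
      + (\<Sum>e\<in>Basis. (\<phi>'' x u v \<bullet> e) *\<^sub>R f' (\<phi> x) e))"
    by (intro continuous_intros cc C2_derivs_continuous[OF P] C2_derivs_continuous[OF F]
       C2_derivsD(3)[OF P] C2_derivsD(3)[OF F])
  moreover have "(\<Sum>e\<in>Basis. (\<phi>' x u \<bullet> e) *\<^sub>R (\<Sum>d\<in>Basis. (\<phi>' x v \<bullet> d) *\<^sub>R f'' (\<phi> x) e d))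
      + (\<Sum>e\<in>Basis. (\<phi>'' x u v \<bullet> e) *\<^sub>R f' (\<phi> x) e)
     = f'' (\<phi> x) (\<phi>' x u) (\<phi>' x v) + f' (\<phi> x) (\<phi>'' x u v)" if x: "x \<in> S" for x
  proof -
    have Px: "\<phi> x \<in> V" using sub x by auto
    show ?thesis
      by (simp add: linear_eq_sum_Basis[OF linear_deriv2_right[OF F Px], of _ "\<phi>' x v", symmetric]
         linear_eq_sum_Basis[OF linear_deriv2_left[OF F Px V], of "\<phi>' x u", symmetric]
         linear_eq_sum_Basis[OF linear_deriv1[OF F Px], of "\<phi>'' x u v", symmetric])
  qed
  ultimately show "continuous_on S (\<lambda>x. f'' (\<phi> x) (\<phi>' x u) (\<phi>' x v) + f' (\<phi> x) (\<phi>'' x u v))"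
    by (simp cong: continuous_on_cong)
qed

text \<open>Two applications of the mean value theorem to the second difference, one for each direction. The second
  difference is symmetric in \<open>u\<close> and \<open>v\<close>, which is what yields the symmetry of second derivatives.\<close>

lemma second_difference_mean_value:
  fixes f :: "'a::euclidean_space \<Rightarrow> real"
  assumes C: "C2_derivs f f' f'' S" and b: "ball x r \<subseteq> S" and r: "r > 0" and t: "0 < t" "t * (norm u + norm v) < r"
  obtains y where "norm (y - x) < r" "norm (y - x) \<le> t * (norm u + norm v)"
      "f (x + t *\<^sub>R u + t *\<^sub>R v) - f (x + t *\<^sub>R u) - f (x + t *\<^sub>R v) + f x = t * (t * f'' y u v)"
proof -
  have inS: "x + s *\<^sub>R u + s' *\<^sub>R v \<in> S \<and> norm ((x + s *\<^sub>R u + s' *\<^sub>R v) - x) \<le> t * (norm u + norm v)"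
    if "0 \<le> s" "s \<le> t" "0 \<le> s'" "s' \<le> t" for s s'
  proof -
    have "norm ((x + s *\<^sub>R u + s' *\<^sub>R v) - x) \<le> norm (s *\<^sub>R u) + norm (s' *\<^sub>R v)"
      using norm_triangle_ineq[of "s *\<^sub>R u" "s' *\<^sub>R v"] by (simp add: algebra_simps)
    also have "\<dots> \<le> t * (norm u + norm v)"
      using that by (simp add: distrib_left add_mono mult_right_mono)
    finally have *: "norm ((x + s *\<^sub>R u + s' *\<^sub>R v) - x) \<le> t * (norm u + norm v)" .
    then have "dist (x + s *\<^sub>R u + s' *\<^sub>R v) x < r" using t unfolding dist_norm by linarith
    then have "x + s *\<^sub>R u + s' *\<^sub>R v \<in> ball x r" by (subst mem_ball, subst dist_commute)
    with b * show ?thesis by auto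
  qed
  define g where "g s = f (x + s *\<^sub>R u + t *\<^sub>R v) - f (x + s *\<^sub>R u)" for s
  have g': "(g has_real_derivative f' (x + s *\<^sub>R u + t *\<^sub>R v) u - f' (x + s *\<^sub>R u) u) (at s)"
    if "0 \<le> s" "s \<le> t" for s
  proof -
    have i: "x + s *\<^sub>R u + t *\<^sub>R v \<in> S" "x + s *\<^sub>R u \<in> S"
      using inS[of s t] inS[of s 0] that t by auto
    have "(g has_derivative (\<lambda>h. f' (x + s *\<^sub>R u + t *\<^sub>R v) (h *\<^sub>R u) - f' (x + s *\<^sub>R u) (h *\<^sub>R u))) (at s)"
      unfolding g_def
      by (intro has_derivative_diff
          has_derivative_compose[of "\<lambda>s. x + s *\<^sub>R u + t *\<^sub>R v" "\<lambda>h. h *\<^sub>R u" s UNIV f, OF _ C2_derivsD(1)[OF C i(1)]]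
          has_derivative_compose[of "\<lambda>s. x + s *\<^sub>R u" "\<lambda>h. h *\<^sub>R u" s UNIV f, OF _ C2_derivsD(1)[OF C i(2)]])
        (auto intro!: derivative_eq_intros)
    moreover have "(\<lambda>h. f' (x + s *\<^sub>R u + t *\<^sub>R v) (h *\<^sub>R u) - f' (x + s *\<^sub>R u) (h *\<^sub>R u))
        = (*) (f' (x + s *\<^sub>R u + t *\<^sub>R v) u - f' (x + s *\<^sub>R u) u)"
      by (rule ext) (simp only: linear_scale[OF linear_deriv1[OF C i(1)]] linear_scale[OF linear_deriv1[OF C i(2)]],
         simp add: algebra_simps)
    ultimately show ?thesis unfolding has_field_derivative_def by simp
  qed
  obtain s where s: "0 < s" "s < t" "g t - g 0 = (t - 0) * (f' (x + s *\<^sub>R u + t *\<^sub>R v) u - f' (x + s *\<^sub>R u) u)"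
    using MVT2[OF t(1), of g "\<lambda>s. f' (x + s *\<^sub>R u + t *\<^sub>R v) u - f' (x + s *\<^sub>R u) u", OF g'] by auto
  define k where "k s' = f' (x + s *\<^sub>R u + s' *\<^sub>R v) u" for s'
  have k': "(k has_real_derivative f'' (x + s *\<^sub>R u + s' *\<^sub>R v) u v) (at s')"
    if "0 \<le> s'" "s' \<le> t" for s'
  proof -
    have i: "x + s *\<^sub>R u + s' *\<^sub>R v \<in> S" 
      using inS[of s s'] that s by auto
    have "(k has_derivative (\<lambda>h. f'' (x + s *\<^sub>R u + s' *\<^sub>R v) u (h *\<^sub>R v))) (at s')"
      unfolding k_def
      by (intro has_derivative_compose[of "\<lambda>s'. x + s *\<^sub>R u + s' *\<^sub>R v" "\<lambda>h. h *\<^sub>R v" s' UNIV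
          "\<lambda>y. f' y u", OF _ C2_derivsD(2)[OF C i(1)]])
        (auto intro!: derivative_eq_intros)
    moreover have "(\<lambda>h. f'' (x + s *\<^sub>R u + s' *\<^sub>R v) u (h *\<^sub>R v)) = (*) (f'' (x + s *\<^sub>R u + s' *\<^sub>R v) u v)"
      by (rule ext) (simp only: linear_scale[OF linear_deriv2_right[OF C i(1)]], simp)
    ultimately show ?thesis unfolding has_field_derivative_def by simp
  qed
  obtain s' where s': "0 < s'" "s' < t" "k t - k 0 = (t - 0) * (f'' (x + s *\<^sub>R u + s' *\<^sub>R v) u v)"
    using MVT2[OF t(1), of k "\<lambda>s'. f'' (x + s *\<^sub>R u + s' *\<^sub>R v) u v", OF k'] by auto
  show ?thesis
  proof (rule that)
    show "norm ((x + s *\<^sub>R u + s' *\<^sub>R v) - x) \<le> t * (norm u + norm v)" using inS[of s s'] s s' by simp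
    then show "norm ((x + s *\<^sub>R u + s' *\<^sub>R v) - x) < r" using t by linarith
    show "f (x + t *\<^sub>R u + t *\<^sub>R v) - f (x + t *\<^sub>R u) - f (x + t *\<^sub>R v) + f x = t * (t * f'' (x + s *\<^sub>R u + s' *\<^sub>R v) u v)"
      using s(3) s'(3) unfolding g_def k_def by (simp add: algebra_simps)
  qed
qed

lemma symmetric_second_derivative_real:
  fixes f :: "'a::euclidean_space \<Rightarrow> real"
  assumes C: "C2_derivs f f' f'' S" and S: "open S" and x: "x \<in> S"
  shows "f'' x u v = f'' x v u"
proof (rule ccontr)
  assume ne: "f'' x u v \<noteq> f'' x v u"
  define e where "e = \<bar>f'' x u v - f'' x v u\<bar> / 2"
  have e: "e > 0" using ne by (simp add: e_def)
  have "isCont (\<lambda>y. f'' y u v) x" "isCont (\<lambda>y. f'' y v u) x"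
    using C2_derivsD(3)[OF C] S x by (auto simp: continuous_on_eq_continuous_at)
  then obtain d1 d2 where d: "d1 > 0" "d2 > 0" 
    "\<And>y. dist y x < d1 \<Longrightarrow> dist (f'' y u v) (f'' x u v) < e"
    "\<And>y. dist y x < d2 \<Longrightarrow> dist (f'' y v u) (f'' x v u) < e"
    using e unfolding continuous_at_eps_delta dist_real_def dist_norm by (metis real_norm_def)
  obtain r where r: "r > 0" "ball x r \<subseteq> S" using S x open_contains_ball by blast
  define R where "R = min r (min d1 d2)"
  have R: "R > 0" "ball x R \<subseteq> S" using r d by (auto simp: R_def)
  define t where "t = R / (2 * (norm u + norm v + 1))"
  have n: "0 < norm u + norm v + 1" by (smt (verit) norm_ge_zero)
  have t: "0 < t" using R n unfolding t_def by (auto intro!: divide_pos_pos)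
  have "t * (norm u + norm v + 1) = R / 2" using n unfolding t_def by (simp add: field_simps)
  then have t2: "t * (norm u + norm v) < R" "t * (norm v + norm u) < R" using t R by (auto simp: algebra_simps)
  obtain y where y: "norm (y - x) < R"
      "f (x + t *\<^sub>R u + t *\<^sub>R v) - f (x + t *\<^sub>R u) - f (x + t *\<^sub>R v) + f x = t * (t * f'' y u v)"
    using second_difference_mean_value[OF C R(2,1) t t2(1)] by blast
  obtain z where z: "norm (z - x) < R"
      "f (x + t *\<^sub>R v + t *\<^sub>R u) - f (x + t *\<^sub>R v) - f (x + t *\<^sub>R u) + f x = t * (t * f'' z v u)"
    using second_difference_mean_value[OF C R(2,1) t t2(2)] by blast
  have "t * (t * f'' y u v) = t * (t * f'' z v u)" using y(2) z(2) by (simp add: algebra_simps)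
  then have "f'' y u v = f'' z v u" using t by simp
  moreover have "\<bar>f'' y u v - f'' x u v\<bar> < e" "\<bar>f'' z v u - f'' x v u\<bar> < e"
    using d y(1) z(1) by (auto simp: dist_norm R_def)
  ultimately show False unfolding e_def by (auto simp: abs_if split: if_splits)
qed

text \<open>Schwarz's theorem, applied to each coordinate.\<close>

lemma symmetric_second_derivative:
  fixes f :: "'a::euclidean_space \<Rightarrow> 'b::euclidean_space"
  assumes C: "C2_derivs f f' f'' S" and S: "open S" and x: "x \<in> S"
  shows "f'' x u v = f'' x v u"
proof (rule euclidean_eqI)
  fix b :: 'b
  show "f'' x u v \<bullet> b = f'' x v u \<bullet> b"
    using symmetric_second_derivative_real[OF C2_derivs_bounded_linear[OF C bounded_linear_inner_left] S x] .
qed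

section \<open>Differentiation under the integral sign\<close>

lemma has_vector_derivative_at_0_iff:
  fixes f :: "real \<Rightarrow> 'b::real_normed_vector"
  shows "(f has_vector_derivative D) (at 0) \<longleftrightarrow> ((\<lambda>t. (f t - f 0) /\<^sub>R t) \<longlongrightarrow> D) (at 0)"
proof -
  have "((\<lambda>t. (f t - f 0) /\<^sub>R t) \<longlongrightarrow> D) (at 0) \<longleftrightarrow> ((\<lambda>t. norm ((f t - f 0) /\<^sub>R t - D)) \<longlongrightarrow> 0) (at 0)"
    by (subst tendsto_norm_zero_iff) (rule Lim_null)
  also have "\<dots> \<longleftrightarrow> ((\<lambda>t. norm ((f t - f 0) - t *\<^sub>R D) / norm t) \<longlongrightarrow> 0) (at 0)"
  proof (rule filterlim_cong[OF refl refl], rule eventually_at_filter[THEN iffD2], rule always_eventually, intro allI impI)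
    fix t :: real assume "t \<noteq> 0"
    then have "(f t - f 0) /\<^sub>R t - D = inverse t *\<^sub>R ((f t - f 0) - t *\<^sub>R D)" by (simp add: scaleR_diff_right)
    then show "norm ((f t - f 0) /\<^sub>R t - D) = norm ((f t - f 0) - t *\<^sub>R D) / norm t"
      by (simp add: divide_inverse)
  qed
  finally show ?thesis
    unfolding has_vector_derivative_def has_derivative_iff_norm by (simp add: bounded_linear_scaleR_left)
qed

text \<open>The difference quotients are dominated by \<open>G\<close>, so dominated convergence applies. Differentiability of the
  integrand is required only almost everywhere: the integrands below have a kink on a sphere.\<close>

lemma has_vector_derivative_integral:
  fixes F :: "real \<Rightarrow> 'a \<Rightarrow> 'b::{banach, second_countable_topology}"
  assumes t0: "t0 > 0" and int: "\<And>t. \<bar>t\<bar> < t0 \<Longrightarrow> integrable M (F t)"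
    and G: "integrable M G"
    and bound: "\<And>t y. \<bar>t\<bar> < t0 \<Longrightarrow> y \<in> space M \<Longrightarrow> norm (F t y - F 0 y) \<le> \<bar>t\<bar> * G y"
    and deriv: "AE y in M. ((\<lambda>t. F t y) has_vector_derivative F' y) (at 0)"
    and meas: "F' \<in> borel_measurable M"
  shows "integrable M F'" "((\<lambda>t. LINT y|M. F t y) has_vector_derivative (LINT y|M. F' y)) (at 0)"
proof -
  define Q where "Q t y = (F t y - F 0 y) /\<^sub>R t" for t y
  have Qint: "integrable M (Q t)" if "\<bar>t\<bar> < t0" for t
    unfolding Q_def using int[OF that] int[of 0] t0 by auto
  have Qbound: "norm (Q t y) \<le> G y" if "\<bar>t\<bar> < t0" "t \<noteq> 0" "y \<in> space M" for t y
    using bound[OF that(1,3)] that(2) unfolding Q_def norm_scaleR by (simp add: divide_simps mult.commute)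
  have main: "integrable M F' \<and> (\<lambda>n. LINT y|M. Q (X n) y) \<longlonglongrightarrow> (LINT y|M. F' y)"
    if X: "\<And>n. X n \<noteq> 0" "\<And>n. \<bar>X n\<bar> < t0" "X \<longlonglongrightarrow> 0" for X
  proof -
    have lim: "AE y in M. (\<lambda>n. Q (X n) y) \<longlonglongrightarrow> F' y"
      using deriv
    proof eventually_elim
      case (elim y)
      then have "((\<lambda>t. Q t y) \<longlongrightarrow> F' y) (at 0)"
        unfolding has_vector_derivative_at_0_iff Q_def .
      then show ?case using X(1,3) unfolding tendsto_at_iff_sequentially by (auto simp: o_def)
    qed
    have m: "Q (X n) \<in> borel_measurable M" for n using Qint[OF X(2)] by auto
    have b: "AE y in M. norm (Q (X n) y) \<le> G y" for n using Qbound[OF X(2,1)] by auto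
    show ?thesis
      using integrable_dominated_convergence[OF meas m G lim b]
        integral_dominated_convergence[OF meas m G lim b] by auto
  qed
  show "integrable M F'"
  proof -
    have "(\<lambda>n. t0 / (real n + 2)) \<longlonglongrightarrow> 0"
      using LIMSEQ_ignore_initial_segment[OF lim_const_over_n[of t0], of 2] by (simp add: add.commute)
    moreover have "t0 / (real n + 2) < t0" for n using t0 by (simp add: field_simps add_pos_nonneg)
    ultimately show ?thesis using main[of "\<lambda>n. t0 / (real n + 2)"] t0 by (auto simp: less_imp_neq[symmetric] )
  qed
  show "((\<lambda>t. LINT y|M. F t y) has_vector_derivative (LINT y|M. F' y)) (at 0)"
    unfolding has_vector_derivative_at_0_iff tendsto_at_iff_sequentially
  proof (intro allI impI)
    fix X :: "nat \<Rightarrow> real" assume X: "\<forall>i. X i \<in> UNIV - {0}" "X \<longlonglongrightarrow> 0"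
    have "eventually (\<lambda>n. \<bar>X n\<bar> < t0) sequentially"
      using tendstoD[OF X(2) t0] by (simp add: dist_real_def)
    then obtain N where N: "\<And>n. n \<ge> N \<Longrightarrow> \<bar>X n\<bar> < t0" by (auto simp: eventually_sequentially)
    have "(\<lambda>n. LINT y|M. Q (X (n + N)) y) \<longlonglongrightarrow> (LINT y|M. F' y)"
      using main[of "\<lambda>n. X (n + N)"] X N LIMSEQ_ignore_initial_segment[OF X(2)] by auto
    moreover have "(LINT y|M. Q (X (n + N)) y) = ((LINT y|M. F (X (n + N)) y) - (LINT y|M. F 0 y)) /\<^sub>R X (n + N)" for n
      unfolding Q_def using int N t0 by (simp add: Bochner_Integration.integral_diff)
    ultimately have "(\<lambda>n. ((LINT y|M. F (X (n + N)) y) - (LINT y|M. F 0 y)) /\<^sub>R X (n + N)) \<longlonglongrightarrow> (LINT y|M. F' y)" by simp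
    then show "((\<lambda>t. ((LINT y|M. F t y) - (LINT y|M. F 0 y)) /\<^sub>R t) \<circ> X) \<longlonglongrightarrow> (LINT y|M. F' y)"
      unfolding o_def by (rule LIMSEQ_offset)
  qed
qed

lemma integral_translate:
  fixes h :: "'a::euclidean_space \<Rightarrow> 'b::{banach, second_countable_topology}"
  shows "integrable lborel (\<lambda>y. h (y + c)) \<longleftrightarrow> integrable lborel h" (is ?I)
    and "(LINT y|lborel. h (y + c)) = (LINT y|lborel. h y)" (is ?E)
proof -
  have 1: "integrable lborel (\<lambda>y. k (y + c))" if "integrable lborel k" for k :: "'a \<Rightarrow> 'b" and c
    using integrable_distr[of "(+) c" lborel borel k] that lborel_distr_plus[of c]
    by (simp add: add.commute)
  then show ?I using 1[of "\<lambda>y. h (y + c)" "- c"] by auto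
  show ?E
  proof (cases "integrable lborel h")
    case True
    then have "(LINT y|distr lborel borel ((+) c). h y) = (LINT y|lborel. h (c + y))"
      by (intro integral_distr) auto
    then show ?thesis by (simp add: lborel_distr_plus add.commute)
  next
    case False
    then show ?thesis using \<open>?I\<close> by (simp add: not_integrable_integral_eq)
  qed
qed

text \<open>By translation invariance the integral of \<open>h\<close> shifted by \<open>t *\<^sub>R v\<close> is constant in \<open>t\<close>. Applied to each coordinate of
  a vector field that vanishes on the boundary of a ball, this serves as the divergence theorem.\<close>

lemma integral_directional_derivative_eq_0:
  fixes h :: "'a::euclidean_space \<Rightarrow> 'b::{banach, second_countable_topology}"
  assumes t0: "t0 > 0" and int: "integrable lborel h" and G: "integrable lborel G"
    and bound: "\<And>t y. \<bar>t\<bar> < t0 \<Longrightarrow> norm (h (y + t *\<^sub>R v) - h y) \<le> \<bar>t\<bar> * G y"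
    and deriv: "AE y in lborel. ((\<lambda>t. h (y + t *\<^sub>R v)) has_vector_derivative D y) (at 0)"
    and meas: "D \<in> borel_measurable borel"
  shows "integrable lborel D" "(LINT y|lborel. D y) = 0"
proof -
  note * = has_vector_derivative_integral[of t0 lborel "\<lambda>t y. h (y + t *\<^sub>R v)" G D, OF t0 _ G _ deriv]
  show "integrable lborel D" 
    by (rule *(1)) (use int bound meas in \<open>auto simp: integral_translate(1)\<close>)
  have "((\<lambda>t. LINT y|lborel. h (y + t *\<^sub>R v)) has_vector_derivative (LINT y|lborel. D y)) (at 0)"
    by (rule *(2)) (use int bound meas in \<open>auto simp: integral_translate(1)\<close>)
  then have "((\<lambda>t::real. LINT y|lborel. h y) has_vector_derivative (LINT y|lborel. D y)) (at 0)"
    by (simp add: integral_translate(2))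
  then show "(LINT y|lborel. D y) = 0"
    using has_vector_derivative_const vector_derivative_at by metis
qed

lemma lipschitz_of_continuous_derivative:
  fixes g :: "'a::euclidean_space \<Rightarrow> 'b::real_normed_vector"
  assumes C: "compact C" "convex C" and d: "\<And>x. x \<in> C \<Longrightarrow> (g has_derivative g' x) (at x)"
    and c: "\<And>e. e \<in> Basis \<Longrightarrow> continuous_on C (\<lambda>x. g' x e)"
  obtains K where "K \<ge> 0" "\<And>x y. x \<in> C \<Longrightarrow> y \<in> C \<Longrightarrow> norm (g x - g y) \<le> K * norm (x - y)"
proof -
  have "\<exists>B. \<forall>x\<in>C. norm (g' x e) \<le> B" if "e \<in> Basis" for e
    using compact_imp_bounded[OF compact_continuous_image[OF c[OF that] C(1)]]
    unfolding bounded_iff by auto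
  then obtain B where B: "\<And>e x. e \<in> Basis \<Longrightarrow> x \<in> C \<Longrightarrow> norm (g' x e) \<le> B e" by metis
  define K where "K = (\<Sum>e\<in>Basis. \<bar>B e\<bar>)"
  have on: "onorm (g' x) \<le> K" if x: "x \<in> C" for x
  proof (rule onorm_le)
    fix v :: 'a
    have "norm (g' x v) = norm (\<Sum>e\<in>Basis. (v \<bullet> e) *\<^sub>R g' x e)"
      using linear_eq_sum_Basis[OF has_derivative_linear[OF d[OF x]], of v] by simp
    also have "\<dots> \<le> (\<Sum>e\<in>Basis. norm ((v \<bullet> e) *\<^sub>R g' x e))" by (rule norm_sum)
    also have "\<dots> \<le> (\<Sum>e\<in>Basis. \<bar>B e\<bar> * norm v)"
    proof (rule sum_mono)
      fix e :: 'a assume e: "e \<in> Basis"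
      have "\<bar>v \<bullet> e\<bar> * norm (g' x e) \<le> norm v * \<bar>B e\<bar>"
        using B[OF e x] Basis_le_norm[OF e, of v] by (intro mult_mono) auto
      then show "norm ((v \<bullet> e) *\<^sub>R g' x e) \<le> \<bar>B e\<bar> * norm v" by (simp add: mult.commute)
    qed
    also have "\<dots> = K * norm v" by (simp add: K_def sum_distrib_right)
    finally show "norm (g' x v) \<le> K * norm v" .
  qed
  show ?thesis
  proof (rule that[of K])
    show "K \<ge> 0" by (simp add: K_def sum_nonneg)
    show "norm (g x - g y) \<le> K * norm (x - y)" if "x \<in> C" "y \<in> C" for x y
      using differentiable_bound[OF C(2) has_derivative_at_withinI[OF d] on that(1) that(2)]
      by (simp add: norm_minus_commute)
  qed
qed

lemma sphere_null: "sphere (a::'a::euclidean_space) r \<in> null_sets lborel"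
  using negligible_sphere[of a r] null_sets_completion_iff[of "sphere a r" lborel]
  by (simp add: negligible_iff_null_sets)

lemma AE_not_sphere: "AE y in lborel. norm (y::'a::euclidean_space) \<noteq> r"
  using AE_not_in[OF sphere_null[of 0 r]] by (simp add: dist_norm)

section \<open>Weighted mean values over balls\<close>

lemma has_vector_derivative_along:
  assumes "(f has_derivative f') (at (x + s *\<^sub>R y))"
  shows "((\<lambda>t. f (x + (s + t) *\<^sub>R y)) has_vector_derivative f' y) (at 0)"
proof -
  have "((\<lambda>t. f (x + (s + t) *\<^sub>R y)) has_derivative (\<lambda>h. f' (h *\<^sub>R y))) (at 0)"
    by (rule has_derivative_compose[of "\<lambda>t. x + (s + t) *\<^sub>R y" "\<lambda>h. h *\<^sub>R y" 0 UNIV f, simplified])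
      (auto intro!: derivative_eq_intros simp: assms[simplified])
  then show ?thesis
    unfolding has_vector_derivative_def by (simp add: linear_scale[OF has_derivative_linear[OF assms]])
qed

lemma one_minus_inner_power_bounds:
  fixes y :: "'a::real_inner"
  assumes "norm y \<le> 1"
  shows "0 \<le> (1 - y \<bullet> y) ^ m" "(1 - y \<bullet> y) ^ m \<le> 1" "(1 - y \<bullet> y) ^ Suc m \<le> 2 * (1 - norm y)"
proof -
  have *: "0 \<le> 1 - y \<bullet> y" "1 - y \<bullet> y \<le> 1"
    using assms power_le_one[of "norm y" 2] by (auto simp: power2_norm_eq_inner[symmetric])
  then show "0 \<le> (1 - y \<bullet> y) ^ m" "(1 - y \<bullet> y) ^ m \<le> 1" by (auto intro: power_le_one)
  have "(1 - y \<bullet> y) ^ Suc m \<le> (1 - y \<bullet> y)"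
    using * power_le_one[of "1 - y \<bullet> y" m] mult_left_mono[of "(1 - y \<bullet> y) ^ m" 1 "1 - y \<bullet> y"] by auto
  also have "\<dots> = (1 + norm y) * (1 - norm y)" by (simp add: power2_norm_eq_inner[symmetric] power2_eq_square algebra_simps)
  also have "\<dots> \<le> 2 * (1 - norm y)" using assms by (intro mult_right_mono) auto
  finally show "(1 - y \<bullet> y) ^ Suc m \<le> 2 * (1 - norm y)" .
qed

text \<open>The vector field with components \<open>(1 - |y|\<^sup>2) ^ Suc m * f' (x + s y) e\<close> vanishes on the unit sphere, so its
  divergence has integral 0. As \<open>f\<close> is harmonic the divergence is
  \<open>- 2 (m + 1) (1 - |y|\<^sup>2) ^ m * f' (x + s y) y\<close>.\<close>

lemma integral_radial_derivative_eq_0: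
  fixes f :: "'a::euclidean_space \<Rightarrow> 'b::{banach, second_countable_topology}"
  assumes C: "C2_derivs f f' f'' (ball x R)" and h: "\<And>y. y \<in> ball x R \<Longrightarrow> (\<Sum>e\<in>Basis. f'' y e e) = 0"
    and s: "\<bar>s\<bar> < R"
  shows "(LINT y|lborel. indicator (cball 0 1) y *\<^sub>R ((1 - y \<bullet> y) ^ m *\<^sub>R f' (x + s *\<^sub>R y) y)) = 0"
proof -
  have inb: "x + s *\<^sub>R y \<in> ball x R" if "y \<in> cball 0 1" for y :: 'a
  proof -
    have "\<bar>s\<bar> * norm y \<le> \<bar>s\<bar> * 1" using that by (intro mult_left_mono) auto
    then show ?thesis using s by (simp add: dist_norm)
  qed
  note lin1 = linear_deriv1[OF C inb] and lin2 = linear_deriv2_right[OF C inb]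
  have cc: "continuous_on (cball 0 1) (\<lambda>y. g (x + s *\<^sub>R y))" if "continuous_on (ball x R) g" for g :: "'a \<Rightarrow> 'b"
    by (rule continuous_on_compose2[OF that]) (use inb in \<open>auto intro!: continuous_intros\<close>)
  define k where "k e y = (1 - y \<bullet> y) ^ Suc m *\<^sub>R f' (x + s *\<^sub>R y) e" for e y
  define k' where "k' e y v = (1 - y \<bullet> y) ^ Suc m *\<^sub>R f'' (x + s *\<^sub>R y) e (s *\<^sub>R v)
       + (real (Suc m) * (- (v \<bullet> y + y \<bullet> v)) * (1 - y \<bullet> y) ^ m) *\<^sub>R f' (x + s *\<^sub>R y) e" for e y v
  have kd: "(k e has_derivative k' e y) (at y)" if "y \<in> cball 0 1" for e y
  proof -
    have 1: "((\<lambda>y. f' (x + s *\<^sub>R y) e) has_derivative (\<lambda>v. f'' (x + s *\<^sub>R y) e (s *\<^sub>R v))) (at y)"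
      by (rule has_derivative_compose[of "\<lambda>y. x + s *\<^sub>R y" "\<lambda>v. s *\<^sub>R v" y UNIV "\<lambda>z. f' z e"])
        (auto intro!: derivative_eq_intros C2_derivsD(2)[OF C inb[OF that]])
    have "((\<lambda>y. 1 - y \<bullet> y) has_derivative (\<lambda>v. - (v \<bullet> y + y \<bullet> v))) (at y)"
      by (auto intro!: derivative_eq_intros)
    from has_derivative_power[OF this, of "Suc m"]
    have p: "((\<lambda>y. (1 - y \<bullet> y) ^ Suc m) has_derivative
        (\<lambda>v. real (Suc m) * (- (v \<bullet> y + y \<bullet> v)) * (1 - y \<bullet> y) ^ m)) (at y)"
      unfolding diff_Suc_1 .
    show ?thesis unfolding k_def k'_def
      by (rule has_derivative_scaleR[OF p 1])
  qed
  have k'c: "continuous_on (cball 0 1) (\<lambda>y. k' e y v)" for e v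
  proof -
    have "continuous_on (cball 0 1) (\<lambda>y. (1 - y \<bullet> y) ^ Suc m *\<^sub>R s *\<^sub>R f'' (x + s *\<^sub>R y) e v
       + (real (Suc m) * (- (v \<bullet> y + y \<bullet> v)) * (1 - y \<bullet> y) ^ m) *\<^sub>R f' (x + s *\<^sub>R y) e)"
      by (intro continuous_intros cc C2_derivsD(3)[OF C] C2_derivs_continuous[OF C])
    then show ?thesis unfolding k'_def
      by (rule continuous_on_eq) (simp add: linear_scale[OF lin2])
  qed
  have kc: "continuous_on (cball 0 1) (k e)" for e
    by (rule continuous_at_imp_continuous_on) (use kd has_derivative_continuous in blast)
  have zero: "integrable lborel (\<lambda>y. indicator (cball 0 1) y *\<^sub>R k' e y e) \<and>
      (LINT y|lborel. indicator (cball 0 1) y *\<^sub>R k' e y e) = 0" if e: "e \<in> Basis" for e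
  proof -
    obtain K where K: "K \<ge> 0" "\<And>y z. y \<in> cball 0 1 \<Longrightarrow> z \<in> cball 0 1 \<Longrightarrow> norm (k e y - k e z) \<le> K * norm (y - z)"
      using lipschitz_of_continuous_derivative[OF compact_cball convex_cball kd k'c] by metis
    have "bounded ((\<lambda>y. f' (x + s *\<^sub>R y) e) ` cball 0 1)"
      by (intro compact_imp_bounded compact_continuous_image cc C2_derivs_continuous[OF C] compact_cball)
    then obtain M where M: "\<And>y. y \<in> cball 0 1 \<Longrightarrow> norm (f' (x + s *\<^sub>R y) e) \<le> M" 
      unfolding bounded_iff by (meson imageI)
    have M0: "M \<ge> 0" using order_trans[OF norm_ge_zero M[of 0]] by simp
    have kb: "norm (k e y) \<le> 2 * M * (1 - norm y)" if "y \<in> cball 0 1" for y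
    proof -
      have "norm (k e y) = (1 - y \<bullet> y) ^ Suc m * norm (f' (x + s *\<^sub>R y) e)"
        unfolding k_def using one_minus_inner_power_bounds(1)[of y "Suc m"] that by simp
      also have "\<dots> \<le> 2 * (1 - norm y) * M"
        using one_minus_inner_power_bounds(1,3)[of y] that M[OF that] by (intro mult_mono) auto
      finally show ?thesis by (simp add: algebra_simps)
    qed
    define H where "H y = indicator (cball 0 1) y *\<^sub>R k e y" for y
    \<comment> \<open>If the step crosses the sphere, one of the two values is 0 and the other point is within \<open>\<bar>t\<bar>\<close> of the sphere, where \<open>kb\<close> bounds it by \<open>2 M \<bar>t\<bar>\<close>; inside, the Lipschitz constant \<open>K\<close> applies.\<close>
    have bound: "norm (H (y + t *\<^sub>R e) - H y) \<le> \<bar>t\<bar> * (indicator (cball 0 2) y *\<^sub>R (K + 2 * M))"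
      if t: "\<bar>t\<bar> < 1" for t y
    proof -
      have n1: "norm (y + t *\<^sub>R e) \<le> norm y + \<bar>t\<bar>" "norm y \<le> norm (y + t *\<^sub>R e) + \<bar>t\<bar>"
        using norm_triangle_ineq[of y "t *\<^sub>R e"] norm_triangle_ineq4[of "y + t *\<^sub>R e" "t *\<^sub>R e"] e by auto
      have KM: "\<bar>t\<bar> * K \<ge> 0" "\<bar>t\<bar> * M \<ge> 0" using K(1) M0 by auto
      consider "norm y \<le> 1" "norm (y + t *\<^sub>R e) \<le> 1" | "norm y \<le> 1" "norm (y + t *\<^sub>R e) > 1"
        | "norm y > 1" "norm (y + t *\<^sub>R e) \<le> 1" | "norm y > 1" "norm (y + t *\<^sub>R e) > 1" by linarith
      then show ?thesis
      proof cases
        case 1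
        then have "norm (H (y + t *\<^sub>R e) - H y) \<le> K * norm ((y + t *\<^sub>R e) - y)"
          unfolding H_def using K(2)[of "y + t *\<^sub>R e" y] by simp
        then show ?thesis using 1 e KM by (simp add: algebra_simps)
      next
        case 2
        then have "norm (H (y + t *\<^sub>R e) - H y) \<le> 2 * M * (1 - norm y)" using kb[of y] by (simp add: H_def)
        also have "\<dots> \<le> 2 * M * \<bar>t\<bar>" using 2 n1 M0 by (intro mult_left_mono) auto
        finally show ?thesis using 2 e KM by (simp add: algebra_simps)
      next
        case 3
        then have "norm (H (y + t *\<^sub>R e) - H y) \<le> 2 * M * (1 - norm (y + t *\<^sub>R e))"
          using kb[of "y + t *\<^sub>R e"] by (simp add: H_def)
        also have "\<dots> \<le> 2 * M * \<bar>t\<bar>" using 3 n1 M0 by (intro mult_left_mono) auto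
        finally show ?thesis using 3 n1 t e KM by (simp add: algebra_simps)
      next
        case 4
        then show ?thesis using KM by (simp add: H_def algebra_simps indicator_def)
      qed
    qed
    have deriv: "AE y in lborel. ((\<lambda>t. H (y + t *\<^sub>R e)) has_vector_derivative indicator (cball 0 1) y *\<^sub>R k' e y e) (at 0)"
      using AE_not_sphere[of 1]
    proof eventually_elim
      case (elim y)
      consider "norm y < 1" | "norm y > 1" using elim by linarith
      then have "(H has_derivative (\<lambda>v. indicator (cball 0 1) y *\<^sub>R k' e y v)) (at y)"
      proof cases
        case 1
        then show ?thesis
          by (intro has_derivative_transform_within_open[OF kd[of y e], of "ball 0 1", THEN has_derivative_eq_rhs])
             (auto simp: H_def)
      next
        case 2
        have "((\<lambda>y. 0) has_derivative (\<lambda>v. indicator (cball 0 1) y *\<^sub>R k' e y v)) (at y)"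
          using 2 by simp
        then show ?thesis
          by (rule has_derivative_transform_within_open[of _ _ _ _ "- cball 0 1"])
             (use 2 in \<open>auto simp: H_def\<close>)
      qed
      then show ?case using has_vector_derivative_along[of H _ y 0 e] by simp
    qed
    show ?thesis
      using integral_directional_derivative_eq_0[of 1 H "\<lambda>y. indicator (cball 0 2) y *\<^sub>R (K + 2 * M)" e
          "\<lambda>y. indicator (cball 0 1) y *\<^sub>R k' e y e", OF _ _ _ bound deriv]
        borel_integrable_compact[OF compact_cball kc, of e] borel_integrable_compact[OF compact_cball k'c, of e e]
        borel_integrable_compact[OF compact_cball continuous_on_const, of 0 2 "K + 2 * M"]
      unfolding H_def by auto
  qed
  have sumeq: "(\<Sum>e\<in>Basis. indicator (cball 0 1) y *\<^sub>R k' e y e) =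
     (- 2 * real (Suc m)) *\<^sub>R (indicator (cball 0 1) y *\<^sub>R ((1 - y \<bullet> y) ^ m *\<^sub>R f' (x + s *\<^sub>R y) y))" for y
  proof (cases "y \<in> cball 0 1")
    case True
    have "(\<Sum>e\<in>Basis. k' e y e) = (1 - y \<bullet> y) ^ Suc m *\<^sub>R s *\<^sub>R (\<Sum>e\<in>Basis. f'' (x + s *\<^sub>R y) e e)
        + (- 2 * real (Suc m) * (1 - y \<bullet> y) ^ m) *\<^sub>R (\<Sum>e\<in>Basis. (y \<bullet> e) *\<^sub>R f' (x + s *\<^sub>R y) e)"
      unfolding k'_def sum.distrib scaleR_sum_right
      by (intro arg_cong2[where f="(+)"] sum.cong)
        (auto simp: linear_scale[OF lin2[OF True]] inner_commute scaleR_minus_left[symmetric] simp del: scaleR_minus_left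
          intro!: arg_cong2[where f="(*\<^sub>R)"] simp: algebra_simps)
    then show ?thesis using True h[OF inb[OF True]] linear_eq_sum_Basis[OF lin1[OF True], of y] by simp
  qed auto
  have "(LINT y|lborel. (- 2 * real (Suc m)) *\<^sub>R (indicator (cball 0 1) y *\<^sub>R ((1 - y \<bullet> y) ^ m *\<^sub>R f' (x + s *\<^sub>R y) y))) = 0"
    unfolding sumeq[symmetric] using zero by (subst Bochner_Integration.integral_sum) auto
  then show ?thesis by (subst (asm) integral_scaleR_right) auto
qed

lemma continuous_affine_on_cball:
  fixes f :: "'a::euclidean_space \<Rightarrow> 'b::topological_space"
  assumes "continuous_on (ball x R) f" "\<bar>s\<bar> < R"
  shows "continuous_on (cball 0 1) (\<lambda>y. f (x + s *\<^sub>R y))"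
proof (rule continuous_on_compose2[OF assms(1)])
  show "(\<lambda>y. x + s *\<^sub>R y) ` cball 0 1 \<subseteq> ball x R"
  proof safe
    fix y :: 'a assume "y \<in> cball 0 1"
    then have "\<bar>s\<bar> * norm y \<le> \<bar>s\<bar> * 1" by (intro mult_left_mono) auto
    then show "x + s *\<^sub>R y \<in> ball x R" using assms(2) by (simp add: dist_norm)
  qed
qed (auto intro!: continuous_intros)

text \<open>The derivative in \<open>s\<close> of the left-hand side is the integral that was just shown to vanish, and at
  \<open>s = 0\<close> the claim is clear. The case \<open>m = 0\<close> is the mean value property over balls; the higher weights are
  used for unique continuation.\<close>

lemma weighted_ball_mean:
  fixes f :: "'a::euclidean_space \<Rightarrow> 'b::{banach, second_countable_topology}"
  assumes harm: "harmonic_on f (ball x R)" and s: "\<bar>s\<bar> < R"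
  shows "(LINT y|lborel. indicator (cball 0 1) y *\<^sub>R ((1 - y \<bullet> y) ^ m *\<^sub>R f (x + s *\<^sub>R y)))
       = (LINT y|lborel. indicator (cball 0 1) (y::'a) *\<^sub>R (1 - y \<bullet> y) ^ m) *\<^sub>R f x"
proof -
  obtain f' f'' where C: "C2_derivs f f' f'' (ball x R)"
    and h: "\<And>y. y \<in> ball x R \<Longrightarrow> (\<Sum>e\<in>Basis. f'' y e e) = 0"
    using harmonic_onE[OF harm open_ball] by metis
  define I where "I s = (LINT y|lborel. indicator (cball 0 1) y *\<^sub>R ((1 - y \<bullet> y) ^ m *\<^sub>R f (x + s *\<^sub>R y)))" for s
  have fc: "continuous_on (ball x R) f" by (rule C2_derivs_continuous(1)[OF C])
  have int: "integrable lborel (\<lambda>y. indicator (cball 0 1) y *\<^sub>R ((1 - y \<bullet> y) ^ m *\<^sub>R f (x + s *\<^sub>R y)))" if "\<bar>s\<bar> < R" for s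
    by (intro borel_integrable_compact compact_cball continuous_intros continuous_affine_on_cball[OF fc that])
  have I': "(I has_vector_derivative 0) (at s)" if s: "\<bar>s\<bar> < R" for s
  proof -
    define R' where "R' = (\<bar>s\<bar> + R) / 2"
    have R': "\<bar>s\<bar> < R'" "R' < R" using s by (auto simp: R'_def)
    have sub: "cball x R' \<subseteq> ball x R" using R' by auto
    obtain K where K: "K \<ge> 0" "\<And>y z. y \<in> cball x R' \<Longrightarrow> z \<in> cball x R' \<Longrightarrow> norm (f y - f z) \<le> K * norm (y - z)"
      using lipschitz_of_continuous_derivative[OF compact_cball convex_cball, of x R' f f']
        C2_derivsD(1)[OF C] C2_derivs_continuous(2)[OF C] continuous_on_subset[OF _ sub] sub by (metis subsetD)
    have bound: "norm (indicator (cball 0 1) y *\<^sub>R ((1 - y \<bullet> y) ^ m *\<^sub>R f (x + (s + t) *\<^sub>R y)) -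
            indicator (cball 0 1) y *\<^sub>R ((1 - y \<bullet> y) ^ m *\<^sub>R f (x + (s + 0) *\<^sub>R y)))
          \<le> \<bar>t\<bar> * (indicator (cball 0 1) y *\<^sub>R K)" if t: "\<bar>t\<bar> < R' - \<bar>s\<bar>" for t and y :: 'a
    proof (cases "norm y \<le> 1")
      case True
      have in': "x + r *\<^sub>R y \<in> cball x R'" if "\<bar>r\<bar> \<le> R'" for r
        using True that mult_mono[of "\<bar>r\<bar>" R' "norm y" 1] by (simp add: dist_norm)
      have "norm (f (x + (s + t) *\<^sub>R y) - f (x + (s + 0) *\<^sub>R y)) \<le> K * norm ((x + (s + t) *\<^sub>R y) - (x + (s + 0) *\<^sub>R y))"
        by (rule K(2)) (use in' t R' in auto)
      also have "(x + (s + t) *\<^sub>R y) - (x + (s + 0) *\<^sub>R y) = t *\<^sub>R y" by (simp add: algebra_simps)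
      also have "K * norm (t *\<^sub>R y) \<le> \<bar>t\<bar> * K" using True K(1) mult_left_le[of "norm y" "\<bar>t\<bar> * K"] by (simp add: algebra_simps)
      finally have "norm (f (x + (s + t) *\<^sub>R y) - f (x + (s + 0) *\<^sub>R y)) \<le> \<bar>t\<bar> * K" .
      moreover have "norm ((1 - y \<bullet> y) ^ m *\<^sub>R f (x + (s + t) *\<^sub>R y) - (1 - y \<bullet> y) ^ m *\<^sub>R f (x + (s + 0) *\<^sub>R y))
          \<le> 1 * norm (f (x + (s + t) *\<^sub>R y) - f (x + (s + 0) *\<^sub>R y))"
        unfolding scaleR_diff_right[symmetric] norm_scaleR
        using one_minus_inner_power_bounds(1,2)[OF True, of m] by (intro mult_right_mono) auto
      ultimately show ?thesis using True by simp
    qed auto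
    have deriv: "AE y in lborel. ((\<lambda>t. indicator (cball 0 1) y *\<^sub>R ((1 - y \<bullet> y) ^ m *\<^sub>R f (x + (s + t) *\<^sub>R y))) has_vector_derivative
        indicator (cball 0 1) y *\<^sub>R ((1 - y \<bullet> y) ^ m *\<^sub>R f' (x + s *\<^sub>R y) y)) (at 0)"
    proof (rule AE_I2)
      fix y :: 'a
      show "((\<lambda>t. indicator (cball 0 1) y *\<^sub>R ((1 - y \<bullet> y) ^ m *\<^sub>R f (x + (s + t) *\<^sub>R y))) has_vector_derivative
        indicator (cball 0 1) y *\<^sub>R ((1 - y \<bullet> y) ^ m *\<^sub>R f' (x + s *\<^sub>R y) y)) (at 0)"
      proof (cases "norm y \<le> 1")
        case True
        then have "\<bar>s\<bar> * norm y \<le> \<bar>s\<bar> * 1" by (intro mult_left_mono) auto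
        then have "x + s *\<^sub>R y \<in> ball x R" using s by (simp add: dist_norm)
        from has_vector_derivative_along[OF C2_derivsD(1)[OF C this]]
        show ?thesis by (intro bounded_linear.has_vector_derivative[OF bounded_linear_scaleR_right])
      qed simp
    qed
    have c': "continuous_on (cball 0 1) (\<lambda>y. f' (x + s *\<^sub>R y) y)"
    proof -
      have "continuous_on (cball 0 1) (\<lambda>y. \<Sum>e\<in>Basis. (y \<bullet> e) *\<^sub>R f' (x + s *\<^sub>R y) e)"
        by (intro continuous_intros continuous_affine_on_cball[OF C2_derivs_continuous(2)[OF C] s])
      then show ?thesis
      proof (rule continuous_on_eq)
        fix y :: 'a assume "y \<in> cball 0 1"
        then have "\<bar>s\<bar> * norm y \<le> \<bar>s\<bar> * 1" by (intro mult_left_mono) auto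
        then have "x + s *\<^sub>R y \<in> ball x R" using s by (simp add: dist_norm)
        then show "(\<Sum>e\<in>Basis. (y \<bullet> e) *\<^sub>R f' (x + s *\<^sub>R y) e) = f' (x + s *\<^sub>R y) y"
          using linear_eq_sum_Basis[OF linear_deriv1[OF C], of _ y] by metis
      qed
    qed
    have "integrable lborel (\<lambda>y. indicator (cball 0 1) y *\<^sub>R ((1 - y \<bullet> y) ^ m *\<^sub>R f' (x + s *\<^sub>R y) y))"
      by (intro borel_integrable_compact compact_cball continuous_intros c')
    then have meas: "(\<lambda>y. indicator (cball 0 1) y *\<^sub>R ((1 - y \<bullet> y) ^ m *\<^sub>R f' (x + s *\<^sub>R y) y)) \<in> borel_measurable lborel"
      by auto
    have "((\<lambda>t. I (s + t)) has_vector_derivative (LINT y|lborel. indicator (cball 0 1) y *\<^sub>R ((1 - y \<bullet> y) ^ m *\<^sub>R f' (x + s *\<^sub>R y) y))) (at 0)"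
      unfolding I_def
      by (rule has_vector_derivative_integral(2)[of "R' - \<bar>s\<bar>" _ _ "\<lambda>y. indicator (cball 0 1) y *\<^sub>R K", OF _ int _ bound deriv meas])
        (use R' in \<open>auto intro!: borel_integrable_compact[OF compact_cball continuous_on_const, of 0 1 K, simplified]\<close>)
    then have "((\<lambda>t. I (s + t)) has_vector_derivative 0) (at 0)"
      using integral_radial_derivative_eq_0[OF C h s] by simp
    then have "((\<lambda>t. I (s + t)) \<circ> (\<lambda>r. r - s) has_vector_derivative 1 *\<^sub>R 0) (at s)"
      by (intro vector_diff_chain_at) (auto intro!: derivative_eq_intros)
    then show ?thesis by (simp add: o_def)
  qed
  have "I s = I 0"
  proof (rule has_vector_derivative_zero_constant[of "{-R<..<R}" I])
    show "convex {- R<..<R}" by simp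
    show "(I has_vector_derivative 0) (at s within {-R<..<R})" if "s \<in> {-R<..<R}" for s
      by (rule has_vector_derivative_at_within, rule I') (use that in auto)
    fix c assume "\<And>r. r \<in> {-R<..<R} \<Longrightarrow> I r = c"
    moreover have "s \<in> {-R<..<R}" "0 \<in> {-R<..<R}" using s by auto
    ultimately show "I s = I 0" by metis
  qed
  also have "I 0 = (LINT y|lborel. (indicator (cball 0 1) (y::'a) *\<^sub>R (1 - y \<bullet> y) ^ m) *\<^sub>R f x)" by (simp add: I_def)
  also have "\<dots> = (LINT y|lborel. indicator (cball 0 1) (y::'a) *\<^sub>R (1 - y \<bullet> y) ^ m) *\<^sub>R f x"
    by (intro integral_scaleR_left borel_integrable_compact compact_cball continuous_intros)
  finally show ?thesis unfolding I_def .
qed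

section \<open>Mean values over spheres\<close>

lemma sgn_measurable [measurable]: "(sgn :: 'a::euclidean_space \<Rightarrow> 'a) \<in> borel_measurable borel"
  unfolding sgn_div_norm by measurable

lemma sets_sphere_measure [simp, measurable_cong]: "sets sphere_measure = sets borel"
  and space_sphere_measure [simp]: "space sphere_measure = UNIV"
  unfolding sphere_measure_def by simp_all

lemma unit_ball_content:
  "0 < measure lborel (ball (0::'a::euclidean_space) 1)"
  "emeasure lborel (ball (0::'a::euclidean_space) 1) = ennreal (measure lborel (ball (0::'a) 1))"
  using content_ball_pos[of 1 "0::'a"] emeasure_lborel_ball_finite[of "0::'a" 1]
  by (auto simp: emeasure_eq_ennreal_measure)

text \<open>The definition of the measure as an image under \<open>sgn\<close> turns integrals over the sphere into integrals of radially
  constant functions over the ball.\<close>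

lemma integral_sphere_measure:
  fixes G :: "'a::euclidean_space \<Rightarrow> 'b::{banach, second_countable_topology}"
  assumes [measurable]: "G \<in> borel_measurable borel"
  shows "(LINT z|sphere_measure. G z) = (LINT y|lborel. indicator (ball 0 1) y *\<^sub>R G (sgn y)) /\<^sub>R measure lborel (ball (0::'a) 1)"
proof -
  have "uniform_measure lborel (ball (0::'a) 1) = density lborel (\<lambda>y. ennreal (indicator (ball 0 1) y / measure lborel (ball (0::'a) 1)))"
    unfolding uniform_measure_def unit_ball_content(2)
    by (intro arg_cong[where f="density lborel"] ext)
      (use unit_ball_content(1)[where 'a='a] in \<open>auto simp: indicator_def divide_ennreal ennreal_1[symmetric] simp del: ennreal_1\<close>)
  then have "(LINT z|sphere_measure. G z)
      = (LINT y|density lborel (\<lambda>y. ennreal (indicator (ball 0 1) y / measure lborel (ball (0::'a) 1))). G (sgn y))"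
    unfolding sphere_measure_def by (subst integral_distr) auto
  also have "\<dots> = (LINT y|lborel. (indicator (ball 0 1) y / measure lborel (ball (0::'a) 1)) *\<^sub>R G (sgn y))"
    by (subst integral_density) (auto intro!: borel_measurable_divide borel_measurable_indicator)
  also have "\<dots> = (LINT y|lborel. inverse (measure lborel (ball (0::'a) 1)) *\<^sub>R (indicator (ball 0 1) y *\<^sub>R G (sgn y)))"
    by (simp add: divide_inverse mult.commute)
  finally show ?thesis by (simp only: integral_scaleR_right)
qed

lemma finite_measure_sphere_measure: "finite_measure (sphere_measure :: 'a::euclidean_space measure)"
proof
  have "emeasure (uniform_measure lborel (ball (0::'a) 1)) UNIV = 1"
    using unit_ball_content[where 'a='a] by (subst emeasure_uniform_measure) (auto simp: divide_ennreal)
  then show "emeasure (sphere_measure :: 'a measure) (space sphere_measure) \<noteq> \<infinity>"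
    unfolding sphere_measure_def by (simp add: emeasure_distr)
qed

interpretation sphere_measure: finite_measure "sphere_measure :: 'a::euclidean_space measure"
  by (rule finite_measure_sphere_measure)

definition sphere_mean :: "('a::euclidean_space \<Rightarrow> 'b::{banach, second_countable_topology}) \<Rightarrow> 'b"
  where "sphere_mean g = (LINT z:sphere 0 1|sphere_measure. g z)"

lemma sphere_integrable:
  fixes g :: "'a::euclidean_space \<Rightarrow> 'b::{banach, second_countable_topology}"
  assumes "continuous_on (sphere 0 1) g"
  shows "set_integrable sphere_measure (sphere 0 1) g"
proof -
  have m: "(\<lambda>z. indicator (sphere 0 1) z *\<^sub>R g z) \<in> borel_measurable borel"
    by (rule borel_measurable_continuous_on_indicator[OF _ assms]) auto
  obtain B where B: "\<And>z. z \<in> sphere 0 1 \<Longrightarrow> norm (g z) \<le> B"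
    using compact_imp_bounded[OF compact_continuous_image[OF assms compact_sphere]]
    unfolding bounded_iff by (meson imageI)
  show ?thesis
    unfolding set_integrable_def
  proof (rule sphere_measure.integrable_const_bound[of _ "\<bar>B\<bar>"])
    show "AE z in sphere_measure. norm (indicator (sphere 0 1) z *\<^sub>R g z) \<le> \<bar>B\<bar>"
      using B by (intro AE_I2) (force simp: indicator_def abs_real_def)
  qed (use m in auto)
qed

lemma sphere_mean_eq:
  fixes g :: "'a::euclidean_space \<Rightarrow> 'b::{banach, second_countable_topology}"
  assumes "continuous_on (sphere 0 1) g"
  shows "sphere_mean g = (LINT y|lborel. indicator (ball 0 1) y *\<^sub>R (indicator (sphere 0 1) (sgn y) *\<^sub>R g (sgn y))) /\<^sub>R measure lborel (ball (0::'a) 1)"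
  unfolding sphere_mean_def set_lebesgue_integral_def
  by (rule integral_sphere_measure) (rule borel_measurable_continuous_on_indicator[OF _ assms], auto)

lemma measure_sphere: "measure sphere_measure (sphere (0::'a::euclidean_space) 1) = 1"
proof -
  have i1: "indicat_real (ball (0::'a) 1) \<in> borel_measurable borel" by (rule borel_measurable_indicator) auto
  have i2: "(\<lambda>y. indicat_real (sphere (0::'a) 1) (sgn y)) \<in> borel_measurable borel"
    by (rule measurable_compose[OF sgn_measurable borel_measurable_indicator]) auto
  have "measure sphere_measure (sphere (0::'a) 1) = (LINT z|sphere_measure. indicator (sphere (0::'a) 1) z)"
    by (simp add: sphere_measure.emeasure_finite less_top[symmetric])
  also have "\<dots> = (LINT y|lborel. indicator (ball 0 1) y *\<^sub>R indicator (sphere (0::'a) 1) (sgn y)) /\<^sub>R measure lborel (ball (0::'a) 1)"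
    by (rule integral_sphere_measure, rule borel_measurable_indicator) auto
  also have "(LINT y|lborel. indicator (ball 0 1) y *\<^sub>R indicator (sphere (0::'a) 1) (sgn y)) = (LINT y|lborel. (indicator (ball (0::'a) 1) y :: real))"
  proof (rule integral_cong_AE)
    show "AE y in lborel. indicator (ball 0 1) y *\<^sub>R indicator (sphere (0::'a) 1) (sgn y) = (indicator (ball (0::'a) 1) y :: real)"
      using AE_not_sphere[of 0] by eventually_elim (auto simp: norm_sgn)
  qed (use i1 i2 in auto)
  also have "\<dots> = measure lborel (ball (0::'a) 1)" using emeasure_lborel_ball_finite[of "0::'a" 1] by simp
  finally show ?thesis using unit_ball_content(1)[where 'a='a] by simp
qed

lemma sphere_mean_const [simp]: "sphere_mean (\<lambda>_::'a::euclidean_space. c) = c"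
  unfolding sphere_mean_def by (subst set_integral_const) (auto simp: measure_sphere)

lemma sphere_mean_cong: "(\<And>z. norm z = 1 \<Longrightarrow> f z = g z) \<Longrightarrow> sphere_mean f = sphere_mean g"
  unfolding sphere_mean_def by (rule set_lebesgue_integral_cong) auto

lemma sphere_mean_add: "continuous_on (sphere 0 1) f \<Longrightarrow> continuous_on (sphere 0 1) g \<Longrightarrow>
   sphere_mean (\<lambda>z. f z + g z) = sphere_mean f + sphere_mean g"
  unfolding sphere_mean_def by (intro set_integral_add sphere_integrable)

lemma sphere_mean_diff: "continuous_on (sphere 0 1) f \<Longrightarrow> continuous_on (sphere 0 1) g \<Longrightarrow>
   sphere_mean (\<lambda>z. f z - g z) = sphere_mean f - sphere_mean g"
  unfolding sphere_mean_def by (intro set_integral_diff sphere_integrable)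

lemma sphere_mean_cmult: "sphere_mean (\<lambda>z. (c::real) * f z) = c * sphere_mean f"
  unfolding sphere_mean_def by (rule set_integral_mult_right)

lemma sphere_mean_mono:
  fixes f g :: "'a::euclidean_space \<Rightarrow> real"
  assumes "continuous_on (sphere 0 1) f" "continuous_on (sphere 0 1) g" "\<And>z. norm z = 1 \<Longrightarrow> f z \<le> g z"
  shows "sphere_mean f \<le> sphere_mean g"
  unfolding sphere_mean_def by (intro set_integral_mono sphere_integrable assms) auto

lemma norm_sphere_mean_le:
  fixes f :: "'a::euclidean_space \<Rightarrow> 'b::{banach, second_countable_topology}"
  shows "norm (sphere_mean f) \<le> sphere_mean (\<lambda>z. norm (f z))"
  unfolding sphere_mean_def set_lebesgue_integral_def
  by (rule order_trans[OF integral_norm_bound]) simp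

text \<open>Fubini's theorem for the finite measure on the sphere; the indicators make the continuous integrand a
  bounded Borel function on the whole product space.\<close>

lemma sphere_mean_swap:
  fixes h :: "'a::euclidean_space \<Rightarrow> 'c::euclidean_space \<Rightarrow> 'b::{banach, second_countable_topology}"
  assumes c: "continuous_on (sphere 0 1 \<times> sphere 0 1) (\<lambda>(z, w). h z w)"
  shows "sphere_mean (\<lambda>z. sphere_mean (\<lambda>w. h z w)) = sphere_mean (\<lambda>w. sphere_mean (\<lambda>z. h z w))"
proof -
  interpret pair_sigma_finite "sphere_measure :: 'c measure" "sphere_measure :: 'a measure" ..
  let ?S = "sphere (0::'c) 1 \<times> sphere (0::'a) 1"
  define H where "H = (\<lambda>(w, z). indicator ?S (w, z) *\<^sub>R h z w)"
  have "continuous_on ?S (\<lambda>p. (case (snd p, fst p) of (z, w) \<Rightarrow> h z w))"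
    by (rule continuous_on_compose2[OF c]) (auto intro!: continuous_intros)
  then have c': "continuous_on ?S (\<lambda>p. h (snd p) (fst p))" by simp
  have S: "compact ?S" by (intro compact_Times compact_sphere)
  have Heq: "H = (\<lambda>p. indicator ?S p *\<^sub>R h (snd p) (fst p))" by (auto simp: H_def fun_eq_iff)
  have m: "H \<in> borel_measurable borel"
    unfolding Heq by (rule borel_measurable_continuous_on_indicator[OF borel_compact[OF S] c'])
  have m': "H \<in> borel_measurable (sphere_measure \<Otimes>\<^sub>M sphere_measure)"
    using m by (simp add: borel_prod[symmetric] cong: measurable_cong_sets sets_pair_measure_cong)
  obtain B where B: "\<And>p. p \<in> ?S \<Longrightarrow> norm (h (snd p) (fst p)) \<le> B"
    using compact_imp_bounded[OF compact_continuous_image[OF c' S]]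
    unfolding bounded_iff by (meson imageI)
  have fin: "finite_measure ((sphere_measure :: 'c measure) \<Otimes>\<^sub>M (sphere_measure :: 'a measure))"
    by (rule finite_measure_pair_measure[OF finite_measure_sphere_measure finite_measure_sphere_measure])
  have "integrable (sphere_measure \<Otimes>\<^sub>M sphere_measure) H"
  proof (rule finite_measure.integrable_const_bound[OF fin, of _ "\<bar>B\<bar>"])
    show "AE p in sphere_measure \<Otimes>\<^sub>M sphere_measure. norm (H p) \<le> \<bar>B\<bar>"
      using B unfolding H_def by (intro AE_I2) (force simp: indicator_def abs_real_def)
  qed (rule m')
  then have "integrable (sphere_measure \<Otimes>\<^sub>M sphere_measure) (case_prod (\<lambda>w z. H (w, z)))" by simp
  from Fubini_integral[OF this]
  have "(LINT z|sphere_measure. LINT w|sphere_measure. H (w, z)) = (LINT w|sphere_measure. LINT z|sphere_measure. H (w, z))" .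
  moreover have "(LINT w|sphere_measure. H (w, z)) = indicator (sphere 0 1) z *\<^sub>R (LINT w|sphere_measure. indicator (sphere 0 1) w *\<^sub>R h z w)" for z
    unfolding H_def integral_scaleR_right[symmetric] by (intro Bochner_Integration.integral_cong) (auto simp: indicator_def)
  moreover have "(LINT z|sphere_measure. H (w, z)) = indicator (sphere 0 1) w *\<^sub>R (LINT z|sphere_measure. indicator (sphere 0 1) z *\<^sub>R h z w)" for w
    unfolding H_def integral_scaleR_right[symmetric] by (intro Bochner_Integration.integral_cong) (auto simp: indicator_def)
  ultimately show ?thesis unfolding sphere_mean_def set_lebesgue_integral_def by simp
qed

lemma continuous_on_sphere_mean:
  fixes h :: "'c::euclidean_space \<Rightarrow> 'a::euclidean_space \<Rightarrow> real"
  assumes K: "compact K" and c: "continuous_on (K \<times> sphere 0 1) (\<lambda>(x, z). h x z)"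
  shows "continuous_on K (\<lambda>x. sphere_mean (h x))"
proof (rule continuous_onI)
  fix x e assume x: "x \<in> K" and e: "(0::real) < e"
  have cz: "continuous_on (sphere 0 1) (h y)" if "y \<in> K" for y
  proof -
    have "continuous_on (sphere 0 1) (\<lambda>z. (y, z))"
      by (intro continuous_on_Pair continuous_on_const continuous_on_id)
    from continuous_on_compose2[OF c this] that show ?thesis by auto
  qed
  have "uniformly_continuous_on (K \<times> sphere 0 1) (\<lambda>(x, z). h x z)"
    by (rule compact_uniformly_continuous[OF c compact_Times[OF K compact_sphere]])
  then obtain d where d: "d > 0" "\<And>p q. p \<in> K \<times> sphere 0 1 \<Longrightarrow> q \<in> K \<times> sphere 0 1 \<Longrightarrow> dist q p < d \<Longrightarrow>
      dist (case q of (x, z) \<Rightarrow> h x z) (case p of (x, z) \<Rightarrow> h x z) < e"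
    unfolding uniformly_continuous_on_def using e by metis
  have "dist (sphere_mean (h y)) (sphere_mean (h x)) \<le> e" if y: "y \<in> K" "dist y x < d" for y
  proof -
    have "dist (sphere_mean (h y)) (sphere_mean (h x)) = norm (sphere_mean (\<lambda>z. h y z - h x z))"
      by (simp add: dist_norm sphere_mean_diff[OF cz[OF y(1)] cz[OF x]])
    also have "\<dots> \<le> sphere_mean (\<lambda>z. norm (h y z - h x z))" by (rule norm_sphere_mean_le)
    also have "\<dots> \<le> sphere_mean (\<lambda>z::'a. e)"
    proof (rule sphere_mean_mono)
      show "continuous_on (sphere 0 1) (\<lambda>z. norm (h y z - h x z))"
        by (intro continuous_intros cz x y(1))
      show "norm (h y z - h x z) \<le> e" if "norm z = 1" for z
        using d(2)[of "(x, z)" "(y, z)"] that x y by (auto simp: dist_Pair_Pair dist_norm)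
    qed (intro continuous_intros)
    finally show ?thesis by simp
  qed
  then show "\<exists>d>0. \<forall>y\<in>K. dist y x < d \<longrightarrow> dist (sphere_mean (h y)) (sphere_mean (h x)) \<le> e"
    using d(1) by blast
qed

lemma integral_lborel_scale:
  fixes k :: "'a::euclidean_space \<Rightarrow> 'b::{banach, second_countable_topology}"
  assumes r: "r > 0" and [measurable]: "k \<in> borel_measurable borel"
  shows "(LINT y|lborel. k y) = r ^ DIM('a) *\<^sub>R (LINT y|lborel. k (r *\<^sub>R y))"
proof -
  have "(LINT y|lborel. k y) = (LINT y|density (distr lborel borel (\<lambda>x. 0 + r *\<^sub>R x)) (\<lambda>_. ennreal (\<bar>r\<bar> ^ DIM('a))). k y)"
    using lborel_affine[of r "0::'a"] r by (simp add: ennreal_power)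
  also have "\<dots> = (LINT y|distr lborel borel (\<lambda>x. r *\<^sub>R x). \<bar>r\<bar> ^ DIM('a) *\<^sub>R k y)"
    by (subst integral_density) auto
  also have "\<dots> = (LINT y|lborel. \<bar>r\<bar> ^ DIM('a) *\<^sub>R k (r *\<^sub>R y))"
    by (subst integral_distr) auto
  finally show ?thesis using r by simp
qed

text \<open>Let \<open>g y = f (x + s y)\<close> and let \<open>U r\<close> be the integral of \<open>g y - g (sgn y)\<close> over the ball of radius \<open>r\<close>. Both
  terms have, by the mean value property over balls and by radial constancy, averages that do not depend on
  \<open>r\<close>, so \<open>U r = r ^ n * U 1\<close>. Over a thin shell below the unit sphere the integrand is uniformly small; hence
  \<open>(1 - r ^ n) * U 1\<close> is at most the volume of the shell times an arbitrary \<open>e\<close>, and \<open>U 1 = 0\<close>.\<close>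

lemma sphere_mean_harmonic_ball:
  fixes f :: "'a::euclidean_space \<Rightarrow> 'b::{banach, second_countable_topology}"
  assumes harm: "harmonic_on f (ball x R)" and s: "0 \<le> s" "s < R"
  shows "sphere_mean (\<lambda>z. f (x + s *\<^sub>R z)) = f x"
proof -
  define g where "g y = f (x + s *\<^sub>R y)" for y
  obtain f' f'' where C: "C2_derivs f f' f'' (ball x R)" using harmonic_onE[OF harm open_ball] by metis
  have gc: "continuous_on (cball 0 1) g"
    unfolding g_def using continuous_affine_on_cball[OF C2_derivs_continuous(1)[OF C]] s by auto
  have gs: "continuous_on (sphere 0 1) g" by (rule continuous_on_subset[OF gc]) auto
  define V where "V = measure lborel (ball (0::'a) 1)"
  have V: "V > 0" unfolding V_def by (rule unit_ball_content)
  define G where "G z = indicator (sphere 0 1) z *\<^sub>R g z" for z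
  have Gm[measurable]: "G \<in> borel_measurable borel"
    unfolding G_def by (rule borel_measurable_continuous_on_indicator[OF _ gs]) auto
  define U where "U r = (LINT y|lborel. indicator (ball 0 r) y *\<^sub>R (g y - G (sgn y)))" for r
  obtain B where B: "\<And>y. y \<in> cball 0 1 \<Longrightarrow> norm (g y) \<le> B"
    using compact_imp_bounded[OF compact_continuous_image[OF gc compact_cball]]
    unfolding bounded_iff by (meson imageI)
  have B0: "B \<ge> 0" using order_trans[OF norm_ge_zero B[of 0]] by simp
  have intg: "integrable lborel (\<lambda>y. indicator (ball 0 r) y *\<^sub>R g (t *\<^sub>R y))" if "0 \<le> r" "0 \<le> t" "r * t \<le> 1" for r t
  proof -
    have "continuous_on (cball 0 r) (\<lambda>y. g (t *\<^sub>R y))"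
    proof (rule continuous_on_compose2[OF gc])
      show "(\<lambda>y. t *\<^sub>R y) ` cball 0 r \<subseteq> cball (0::'a) 1"
      proof (rule image_subsetI)
        fix y :: 'a assume "y \<in> cball 0 r"
        then have "t * norm y \<le> t * r" using that by (intro mult_left_mono) auto
        then show "t *\<^sub>R y \<in> cball 0 1" using that by (simp add: mult.commute)
      qed
    qed (auto intro!: continuous_intros)
    from borel_integrable_compact[OF compact_cball this]
    have "integrable lborel (\<lambda>y. indicator (ball 0 r) y *\<^sub>R (indicator (cball 0 r) y *\<^sub>R g (t *\<^sub>R y)))"
      by (rule integrable_mult_indicator[rotated]) auto
    moreover have "(\<lambda>y. indicator (ball 0 r) y *\<^sub>R (indicator (cball 0 r) y *\<^sub>R g (t *\<^sub>R y))) = (\<lambda>y. indicator (ball 0 r) y *\<^sub>R g (t *\<^sub>R y))"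
      by (auto simp: fun_eq_iff indicator_def)
    ultimately show ?thesis by (simp only:)
  qed
  have intG: "integrable lborel (\<lambda>y. indicator (ball 0 r) y *\<^sub>R G (sgn y))" for r
  proof (rule Bochner_Integration.integrable_bound)
    show "integrable lborel (\<lambda>y::'a. indicator (ball 0 r) y *\<^sub>R B)"
      using emeasure_lborel_ball_finite[of "0::'a" r] by (intro integrable_scaleR_left) simp
    show "AE y in lborel. norm (indicator (ball 0 r) y *\<^sub>R G (sgn y)) \<le> norm (indicator (ball 0 r) y *\<^sub>R B)"
      unfolding G_def using B B0 by (intro AE_I2) (auto simp: indicator_def)
  qed (auto intro!: borel_measurable_scaleR borel_measurable_indicator measurable_compose[OF sgn_measurable Gm])
  have mean: "(LINT y|lborel. indicator (ball 0 1) y *\<^sub>R g (r *\<^sub>R y)) = V *\<^sub>R f x" if r: "0 \<le> r" "r \<le> 1" for r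
  proof -
    have eq: "(LINT y|lborel. indicator (ball 0 1) y *\<^sub>R k y) = (LINT y|lborel. indicator (cball 0 1) y *\<^sub>R k y)"
      if "integrable lborel (\<lambda>y. indicator (ball 0 1) y *\<^sub>R k y)" "integrable lborel (\<lambda>y. indicator (cball 0 1) y *\<^sub>R k y)"
      for k :: "'a \<Rightarrow> 'c::{banach, second_countable_topology}"
    proof (rule integral_cong_AE)
      show "AE y in lborel. indicator (ball 0 1) y *\<^sub>R k y = indicator (cball 0 1) y *\<^sub>R k y"
        using AE_not_sphere[of 1] by eventually_elim (auto simp: indicator_def)
    qed (use that in auto)
    have rs: "\<bar>r * s\<bar> < R" using r s mult_right_mono[of r 1 s] by (auto simp: abs_mult)
    have "(LINT y|lborel. indicator (ball 0 1) y *\<^sub>R g (r *\<^sub>R y)) = (LINT y|lborel. indicator (cball 0 1) y *\<^sub>R ((1 - y \<bullet> y) ^ 0 *\<^sub>R f (x + (r * s) *\<^sub>R y)))"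
      using r intg[of 1 r] borel_integrable_compact[OF compact_cball continuous_affine_on_cball[OF C2_derivs_continuous(1)[OF C] rs]]
      by (subst eq) (auto simp: g_def mult.commute)
    also have "\<dots> = (LINT y|lborel. indicator (cball 0 1) (y::'a) *\<^sub>R (1 - y \<bullet> y) ^ 0) *\<^sub>R f x"
      by (rule weighted_ball_mean[OF harm rs])
    also have "(LINT y|lborel. indicator (cball 0 1) (y::'a) *\<^sub>R (1 - y \<bullet> y) ^ 0) = (LINT y|lborel. indicator (ball 0 1) (y::'a) *\<^sub>R (1::real))"
      using emeasure_lborel_ball_finite[of "0::'a" 1] emeasure_lborel_cball_finite[of "0::'a" 1]
      by (subst eq) auto
    also have "\<dots> = V" using emeasure_lborel_ball_finite[of "0::'a" 1] by (simp add: V_def)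
    finally show ?thesis .
  qed
  have U1: "U 1 = V *\<^sub>R (f x - sphere_mean g)"
    unfolding U_def scaleR_diff_right
    using mean[of 1] V intg[of 1 1] intG[of 1] sphere_mean_eq[OF gs]
    by (simp add: Bochner_Integration.integral_diff G_def V_def)
  have Ur: "U r = r ^ DIM('a) *\<^sub>R U 1" if r: "0 < r" "r < 1" for r
  proof -
    have "(\<lambda>y. indicator (ball 0 r) y *\<^sub>R g y - indicator (ball 0 r) y *\<^sub>R G (sgn y)) \<in> borel_measurable borel"
      using borel_measurable_integrable[OF intg[of r 1]] borel_measurable_integrable[OF intG[of r]] r by simp
    then have "U r = r ^ DIM('a) *\<^sub>R (LINT y|lborel. indicator (ball 0 r) (r *\<^sub>R y) *\<^sub>R (g (r *\<^sub>R y) - G (sgn (r *\<^sub>R y))))"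
      unfolding U_def scaleR_diff_right[symmetric] by (rule integral_lborel_scale[OF r(1)])
    also have "(LINT y|lborel. indicator (ball 0 r) (r *\<^sub>R y) *\<^sub>R (g (r *\<^sub>R y) - G (sgn (r *\<^sub>R y))))
       = (LINT y|lborel. indicator (ball 0 1) y *\<^sub>R g (r *\<^sub>R y) - indicator (ball 0 1) y *\<^sub>R G (sgn y))"
      using r by (intro Bochner_Integration.integral_cong) (auto simp: indicator_def sgn_scaleR)
    also have "\<dots> = U 1"
      using mean[of r] mean[of 1] r intg[of 1 r] intG[of 1] intg[of 1 1]
      by (simp add: U_def scaleR_diff_right Bochner_Integration.integral_diff)
    finally show ?thesis .
  qed
  have small: "norm (U 1) \<le> V * e" if e: "e > 0" for e
  proof -
    have "uniformly_continuous_on (cball 0 1) g" by (rule compact_uniformly_continuous[OF gc compact_cball])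
    then obtain d where d: "d > 0" "\<And>p q. p \<in> cball 0 1 \<Longrightarrow> q \<in> cball 0 1 \<Longrightarrow> dist q p < d \<Longrightarrow> dist (g q) (g p) < e"
      unfolding uniformly_continuous_on_def using e by metis
    \<comment> \<open>close enough to 1 that points of the shell are moved by less than \<open>d\<close> when projected to the sphere\<close>
    define r where "r = max (1/2) (1 - d / 2)"
    have r: "0 < r" "r < 1" "1 - r < d" using d(1) by (auto simp: r_def)
    have rn: "r ^ DIM('a) < 1" using r power_Suc_less_one[of r "DIM('a) - 1"] by simp
    have fin: "emeasure lborel (ball (0::'a) 1 - ball 0 r) < \<infinity>"
      by (rule le_less_trans[OF emeasure_mono emeasure_lborel_ball_finite[of "0::'a" 1]]) auto
    have "U 1 - U r = (LINT y|lborel. indicator (ball 0 1 - ball 0 r) y *\<^sub>R (g y - G (sgn y)))"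
    proof -
      have "U 1 - U r = (LINT y|lborel. indicator (ball 0 1) y *\<^sub>R (g y - G (sgn y)) - indicator (ball 0 r) y *\<^sub>R (g y - G (sgn y)))"
        unfolding U_def using r intg[of 1 1] intg[of r 1] intG[of 1] intG[of r]
        by (subst Bochner_Integration.integral_diff) (auto simp: scaleR_diff_right)
      also have "\<dots> = (LINT y|lborel. indicator (ball 0 1 - ball 0 r) y *\<^sub>R (g y - G (sgn y)))"
        using r by (intro Bochner_Integration.integral_cong) (auto simp: indicator_def)
      finally show ?thesis .
    qed
    also have "norm \<dots> \<le> (LINT y|lborel. indicator (ball (0::'a) 1 - ball 0 r) y *\<^sub>R e)"
    proof (rule Bochner_Integration.integral_norm_bound_integral)
      show "integrable lborel (\<lambda>y. indicator (ball 0 1 - ball 0 r) y *\<^sub>R (g y - G (sgn y)))"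
      proof -
        have "integrable lborel (\<lambda>y. indicator (- ball 0 r) y *\<^sub>R (indicator (ball 0 1) y *\<^sub>R g y - indicator (ball 0 1) y *\<^sub>R G (sgn y)))"
          by (rule integrable_mult_indicator[OF _ Bochner_Integration.integrable_diff])
            (use intg[of 1 1] intG[of 1] in auto)
        moreover have "(\<lambda>y. indicator (- ball 0 r) y *\<^sub>R (indicator (ball 0 1) y *\<^sub>R g y - indicator (ball 0 1) y *\<^sub>R G (sgn y)))
            = (\<lambda>y. indicator (ball 0 1 - ball 0 r) y *\<^sub>R (g y - G (sgn y)))"
          by (auto simp: fun_eq_iff indicator_def)
        ultimately show ?thesis by (simp only:)
      qed
      show "integrable lborel (\<lambda>y. indicator (ball (0::'a) 1 - ball 0 r) y *\<^sub>R e)"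
        by (intro integrable_scaleR_left integrable_real_indicator fin) auto
      fix y :: 'a
      show "norm (indicator (ball 0 1 - ball 0 r) y *\<^sub>R (g y - G (sgn y))) \<le> indicator (ball (0::'a) 1 - ball 0 r) y *\<^sub>R e"
      proof (cases "y \<in> ball 0 1 - ball 0 r")
        case True
        then have y: "norm y < 1" "r \<le> norm y" "y \<noteq> 0" using r by auto
        have "y - sgn y = (1 - inverse (norm y)) *\<^sub>R y" by (simp add: sgn_div_norm algebra_simps)
        then have "norm (y - sgn y) = \<bar>1 - inverse (norm y)\<bar> * norm y" by simp
        also have "\<dots> = \<bar>(1 - inverse (norm y)) * norm y\<bar>" by (simp only: abs_mult abs_norm_cancel)
        also have "(1 - inverse (norm y)) * norm y = norm y - 1" using y by (simp add: field_simps)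
        finally have "dist y (sgn y) < d" using y r by (simp add: dist_norm)
        then show ?thesis using d(2)[of "sgn y" y] y True by (auto simp: G_def norm_sgn dist_norm)
      qed auto
    qed
    also have "\<dots> = e * (V - r ^ DIM('a) * V)"
    proof -
      have "measure lborel (ball (0::'a) 1 - ball 0 r) = measure lborel (ball (0::'a) 1) - measure lborel (ball (0::'a) r)"
        using r emeasure_lborel_ball_finite[of "0::'a" 1] by (intro measure_Diff) (auto simp: less_top[symmetric])
      then show ?thesis
        using fin content_ball_conv_unit_ball[of r "0::'a"] r by (simp add: V_def)
    qed
    finally have "norm (U 1 - r ^ DIM('a) *\<^sub>R U 1) \<le> e * (V - r ^ DIM('a) * V)" using Ur[OF r(1,2)] by simp
    moreover have "U 1 - r ^ DIM('a) *\<^sub>R U 1 = (1 - r ^ DIM('a)) *\<^sub>R U 1" by (simp add: algebra_simps)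
    moreover have "norm ((1 - r ^ DIM('a)) *\<^sub>R U 1) = (1 - r ^ DIM('a)) * norm (U 1)"
      unfolding norm_scaleR using rn by (subst abs_of_pos) auto
    moreover have "e * (V - r ^ DIM('a) * V) = (1 - r ^ DIM('a)) * (V * e)" by (simp add: left_diff_distrib right_diff_distrib mult.commute mult.left_commute)
    ultimately have "(1 - r ^ DIM('a)) * norm (U 1) \<le> (1 - r ^ DIM('a)) * (V * e)" by (simp only:)
    then show ?thesis by (rule mult_left_le_imp_le) (use rn in linarith)
  qed
  have "norm (U 1) \<le> 0"
  proof (rule field_le_epsilon)
    fix e :: real assume "e > 0"
    then show "norm (U 1) \<le> 0 + e" using small[of "e / V"] V by simp
  qed
  then have "U 1 = 0" by (simp only: norm_le_zero_iff)
  then have "V *\<^sub>R (f x - sphere_mean g) = 0" using U1 by (simp only:)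
  then have "sphere_mean g = f x" using V by simp
  then show ?thesis by (simp add: g_def[abs_def])
qed

text \<open>A compact ball inside an open set has a positive distance from its complement. This passes from
  mean values inside an open ball to closed balls in an arbitrary open set.\<close>

lemma cball_subset_open_imp_ball:
  fixes x :: "'a::euclidean_space"
  assumes "open S" "cball x s \<subseteq> S" "0 \<le> s"
  obtains R where "s < R" "ball x R \<subseteq> S"
proof -
  obtain e where e: "e > 0" "(\<Union>y\<in>cball x s. ball y e) \<subseteq> S"
    using compact_subset_open_imp_ball_epsilon_subset[OF compact_cball assms(1,2)] by blast
  have "ball x (s + e) \<subseteq> S"
  proof
    fix y assume y: "y \<in> ball x (s + e)"
    show "y \<in> S"
    proof (cases "y \<in> cball x s")
      case False
      define z where "z = x + (s / norm (y - x)) *\<^sub>R (y - x)"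
      have n: "norm (y - x) > s" using False by (simp add: dist_norm norm_minus_commute)
      have "z \<in> cball x s" using assms(3) n by (simp add: z_def dist_norm)
      moreover have "dist z y < e"
      proof -
        have "z - y = (s / norm (y - x) - 1) *\<^sub>R (y - x)" by (simp add: z_def algebra_simps)
        then have "norm (z - y) = \<bar>(s / norm (y - x) - 1) * norm (y - x)\<bar>" by (simp add: abs_mult)
        also have "(s / norm (y - x) - 1) * norm (y - x) = s - norm (y - x)"
        proof -
          have "norm (y - x) \<noteq> 0" using n assms(3) by linarith
          then show ?thesis by (simp add: left_diff_distrib)
        qed
        finally show ?thesis using n y by (simp add: dist_norm norm_minus_commute)
      qed
      ultimately show ?thesis using e(2) by (meson UN_I mem_ball subsetD)
    qed (use assms in auto)
  qed
  then show ?thesis using that[of "s + e"] e by auto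
qed

lemma harmonic_on_subset:
  fixes f :: "'a::euclidean_space \<Rightarrow> 'b::real_normed_vector"
  shows "harmonic_on f S \<Longrightarrow> T \<subseteq> S \<Longrightarrow> harmonic_on f T"
  unfolding harmonic_on_def C2_on_def by (meson continuous_on_subset subsetD)

lemma sphere_mean_harmonic:
  fixes f :: "'a::euclidean_space \<Rightarrow> 'b::{banach, second_countable_topology}"
  assumes "harmonic_on f S" "open S" "cball x s \<subseteq> S" "0 \<le> s"
  shows "sphere_mean (\<lambda>z. f (x + s *\<^sub>R z)) = f x"
proof -
  obtain R where R: "s < R" "ball x R \<subseteq> S" using cball_subset_open_imp_ball[OF assms(2-4)] .
  show ?thesis by (rule sphere_mean_harmonic_ball[OF harmonic_on_subset[OF assms(1) R(2)] assms(4) R(1)])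
qed

section \<open>Harmonicity under Kelvin transforms\<close>

lemma C2_derivs_cong:
  assumes C: "C2_derivs f f' f'' S" and S: "open S"
    and eq: "\<And>x. x \<in> S \<Longrightarrow> f x = g x" "\<And>x u. x \<in> S \<Longrightarrow> f' x u = g' x u" "\<And>x u v. x \<in> S \<Longrightarrow> f'' x u v = g'' x u v"
  shows "C2_derivs g g' g'' S"
  unfolding C2_derivs_def
proof (intro conjI ballI allI)
  fix x assume x: "x \<in> S"
  have "f' x = g' x" using eq(2)[OF x] by auto
  then show "(g has_derivative g' x) (at x)"
    using has_derivative_transform_within_open[OF C2_derivsD(1)[OF C x] S x eq(1)] by simp
  fix u
  have "f'' x u = g'' x u" using eq(3)[OF x] by auto
  then show "((\<lambda>y. g' y u) has_derivative g'' x u) (at x)"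
    using has_derivative_transform_within_open[OF C2_derivsD(2)[OF C x, of u] S x, of "\<lambda>y. g' y u"] eq(2) by auto
next
  fix u v
  show "continuous_on S (\<lambda>x. g'' x u v)"
    using C2_derivsD(3)[OF C, of u v] eq(3) by (rule continuous_on_eq)
qed

lemma C2_derivs_const: "C2_derivs (\<lambda>_. c) (\<lambda>_ _. 0) (\<lambda>_ _ _. 0) S"
  unfolding C2_derivs_def by auto

lemma C2_derivs_linear:
  assumes "bounded_linear L"
  shows "C2_derivs (\<lambda>x. L (x - a)) (\<lambda>_ u. L u) (\<lambda>_ _ _. 0) S"
  unfolding C2_derivs_def
  by (auto intro!: derivative_eq_intros bounded_linear.has_derivative[OF assms])

lemma C2_derivs_add:
  assumes F: "C2_derivs f f' f'' S" and G: "C2_derivs g g' g'' S"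
  shows "C2_derivs (\<lambda>x. f x + g x) (\<lambda>x u. f' x u + g' x u) (\<lambda>x u v. f'' x u v + g'' x u v) S"
  unfolding C2_derivs_def
  by (auto intro!: has_derivative_add continuous_on_add C2_derivsD[OF F] C2_derivsD[OF G])

lemma C2_derivs_sqdist:
  fixes a :: "'a::real_inner"
  shows "C2_derivs (\<lambda>x. (x - a) \<bullet> (x - a)) (\<lambda>x u. 2 * ((x - a) \<bullet> u)) (\<lambda>x u v. 2 * (u \<bullet> v)) S"
  unfolding C2_derivs_def
  by (auto intro!: derivative_eq_intros simp: inner_commute)

lemma C2_derivs_powr:
  fixes s :: real
  shows "C2_derivs (\<lambda>t. t powr s) (\<lambda>t u. s * (t powr s / t) * u)
    (\<lambda>t u v. s * (s - 1) * (t powr s / t\<^sup>2) * u * v) {0<..}"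
  unfolding C2_derivs_def
proof (intro conjI ballI allI)
  fix t :: real assume "t \<in> {0<..}"
  then have t: "t > 0" by simp
  have eq: "t powr (s - 1) = t powr s / t" "t powr (s - 1 - 1) = t powr s / t\<^sup>2" for s
    using t by (simp_all add: powr_diff power2_eq_square)
  show "((\<lambda>t. t powr s) has_derivative (\<lambda>u. s * (t powr s / t) * u)) (at t)"
    using has_real_derivative_powr[OF t, of s] unfolding has_field_derivative_def eq(1) .
  fix u
  have "((\<lambda>t. s * (t powr (s - 1)) * u) has_derivative (\<lambda>v. s * (s - 1) * (t powr s / t\<^sup>2) * u * v)) (at t)"
  proof -
    have 1: "((\<lambda>t. t powr (s - 1)) has_derivative (\<lambda>v. (s - 1) * t powr (s - 1 - 1) * v)) (at t)"
      using has_real_derivative_powr[OF t, of "s - 1"] unfolding has_field_derivative_def .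
    show ?thesis
      by (rule has_derivative_eq_rhs, rule has_derivative_mult_left, rule has_derivative_mult_right, rule 1)
        (use eq(1)[of s] eq(2)[of s] in \<open>simp add: fun_eq_iff\<close>)
  qed
  then show "((\<lambda>t. s * (t powr s / t) * u) has_derivative (\<lambda>v. s * (s - 1) * (t powr s / t\<^sup>2) * u * v)) (at t)"
    by (rule has_derivative_transform_within_open[of _ _ _ _ "{0<..}"])
      (use t in \<open>auto simp: powr_diff\<close>)
next
  fix u v :: real
  show "continuous_on {0<..} (\<lambda>t. s * (s - 1) * (t powr s / t\<^sup>2) * u * v)"
    by (auto intro!: continuous_intros)
qed

lemma C2_derivs_sqdist_powr:
  fixes a :: "'a::euclidean_space"
  assumes S: "open S" "a \<notin> S"
  shows "C2_derivs (\<lambda>x. ((x - a) \<bullet> (x - a)) powr s)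
     (\<lambda>x u. 2 * s * (((x - a) \<bullet> (x - a)) powr s / ((x - a) \<bullet> (x - a))) * ((x - a) \<bullet> u))
     (\<lambda>x u v. 4 * s * (s - 1) * (((x - a) \<bullet> (x - a)) powr s / ((x - a) \<bullet> (x - a))\<^sup>2) * ((x - a) \<bullet> u) * ((x - a) \<bullet> v)
       + 2 * s * (((x - a) \<bullet> (x - a)) powr s / ((x - a) \<bullet> (x - a))) * (u \<bullet> v)) S"
proof -
  have sub: "(\<lambda>x. (x - a) \<bullet> (x - a)) ` S \<subseteq> {0<..}" using S(2) by auto
  show ?thesis
    by (rule C2_derivs_cong[OF C2_derivs_compose[OF C2_derivs_powr[of s] C2_derivs_sqdist[of a] open_greaterThan sub S(1)] S(1)])
      (simp_all add: algebra_simps)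
qed

lemma sum_Basis_inner: "(\<Sum>e\<in>Basis. (e \<bullet> p) * (e \<bullet> q)) = p \<bullet> (q::'a::euclidean_space)"
  by (subst (3) euclidean_inner) (simp add: inner_commute)

text \<open>If \<open>p\<close> maps the basis to the columns of a matrix whose rows are orthogonal of equal length, the trace of \<open>B\<close> over these
  columns is a multiple of its trace over the basis: expand every \<open>p e\<close> over the basis.\<close>

lemma sum_bilinear_conformal:
  fixes B :: "'c::euclidean_space \<Rightarrow> 'c \<Rightarrow> 'b::real_vector" and p :: "'a::euclidean_space \<Rightarrow> 'c"
  assumes l: "\<And>v. linear (\<lambda>u. B u v)" "\<And>u. linear (B u)"
    and conf: "\<And>u v. (\<Sum>e\<in>Basis. (p e \<bullet> u) * (p e \<bullet> v)) = \<mu> * (u \<bullet> v)"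
  shows "(\<Sum>e\<in>Basis. B (p e) (p e)) = \<mu> *\<^sub>R (\<Sum>d\<in>Basis. B d d)"
proof -
  have "B (p e) (p e) = (\<Sum>d\<in>Basis. \<Sum>d'\<in>Basis. ((p e \<bullet> d) * (p e \<bullet> d')) *\<^sub>R B d d')" for e
    by (subst linear_eq_sum_Basis[OF l(1)], subst linear_eq_sum_Basis[OF l(2)]) (simp add: scaleR_sum_right)
  then have "(\<Sum>e\<in>Basis. B (p e) (p e)) = (\<Sum>e\<in>Basis. \<Sum>d\<in>Basis. \<Sum>d'\<in>Basis. ((p e \<bullet> d) * (p e \<bullet> d')) *\<^sub>R B d d')" by simp
  also have "\<dots> = (\<Sum>d\<in>Basis. \<Sum>d'\<in>Basis. \<Sum>e\<in>Basis. ((p e \<bullet> d) * (p e \<bullet> d')) *\<^sub>R B d d')"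
    by (subst sum.swap, rule sum.cong[OF refl], rule sum.swap)
  also have "\<dots> = (\<Sum>d\<in>Basis. \<Sum>d'\<in>Basis. (\<mu> * (d \<bullet> d')) *\<^sub>R B d d')"
    by (simp add: scaleR_sum_left[symmetric] conf)
  also have "\<dots> = (\<Sum>d\<in>Basis. \<mu> *\<^sub>R B d d)"
  proof (rule sum.cong[OF refl])
    fix d :: 'c assume d: "d \<in> Basis"
    have "(\<Sum>d'\<in>Basis. (\<mu> * (d \<bullet> d')) *\<^sub>R B d d') = (\<Sum>d'\<in>Basis. if d' = d then \<mu> *\<^sub>R B d d else 0)"
      by (rule sum.cong[OF refl]) (use d in \<open>auto simp: inner_Basis\<close>)
    then show "(\<Sum>d'\<in>Basis. (\<mu> * (d \<bullet> d')) *\<^sub>R B d d') = \<mu> *\<^sub>R B d d" using d by simp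
  qed
  finally show ?thesis by (simp add: scaleR_sum_right)
qed

text \<open>The Laplacian of \<open>\<psi> x *\<^sub>R f (\<phi> x)\<close> splits into a part with \<open>f\<close>, one with the first and one with the second
  derivatives of \<open>f\<close>. The three hypotheses \<open>h1\<close>, \<open>h2\<close>, \<open>h3\<close> make them vanish one by one; in the last one the trace of the
  Hessian of \<open>f\<close> appears.\<close>

lemma harmonic_on_conformal_compose:
  fixes \<phi> :: "'a::euclidean_space \<Rightarrow> 'c::euclidean_space" and \<psi> :: "'a \<Rightarrow> real" and f :: "'c \<Rightarrow> 'b::real_normed_vector"
  assumes P: "C2_derivs \<phi> \<phi>' \<phi>'' S" and W: "C2_derivs \<psi> \<psi>' \<psi>'' S"
    and harm: "harmonic_on f V" and V: "open V" and S: "open S" and sub: "\<phi> ` S \<subseteq> V"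
    and h1: "\<And>x. x \<in> S \<Longrightarrow> (\<Sum>e\<in>Basis. \<psi>'' x e e) = 0"
    and h2: "\<And>x. x \<in> S \<Longrightarrow> (\<Sum>e\<in>Basis. (2 * \<psi>' x e) *\<^sub>R \<phi>' x e) + \<psi> x *\<^sub>R (\<Sum>e\<in>Basis. \<phi>'' x e e) = 0"
    and h3: "\<And>x u v. x \<in> S \<Longrightarrow> (\<Sum>e\<in>Basis. (\<phi>' x e \<bullet> u) * (\<phi>' x e \<bullet> v)) = \<mu> x * (u \<bullet> v)"
  shows "harmonic_on (\<lambda>x. \<psi> x *\<^sub>R f (\<phi> x)) S"
proof -
  obtain f' f'' where F: "C2_derivs f f' f'' V" and f0: "\<And>y. y \<in> V \<Longrightarrow> (\<Sum>e\<in>Basis. f'' y e e) = 0"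
    using harmonic_onE[OF harm V] by metis
  note C = C2_derivs_bilinear[OF bounded_bilinear_scaleR W C2_derivs_compose[OF F P V sub S]]
  show ?thesis
    unfolding harmonic_on_iff[OF C S]
  proof
    fix x assume x: "x \<in> S"
    then have Px: "\<phi> x \<in> V" using sub by auto
    note lin = linear_deriv1[OF F Px]
    have two: "(2 * c) *\<^sub>R v = c *\<^sub>R v + c *\<^sub>R v" for c and v :: "'d::real_vector"
      by (metis scaleR_2 scaleR_scaleR)
    have 1: "(\<Sum>e\<in>Basis. f'' (\<phi> x) (\<phi>' x e) (\<phi>' x e)) = 0"
      using sum_bilinear_conformal[of "f'' (\<phi> x)" "\<phi>' x" "\<mu> x", OF linear_deriv2_left[OF F Px V] linear_deriv2_right[OF F Px] h3[OF x]]
        f0[OF Px] by simp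
    have "(\<Sum>e\<in>Basis. \<psi> x *\<^sub>R f' (\<phi> x) (\<phi>'' x e e) + 2 *\<^sub>R \<psi>' x e *\<^sub>R f' (\<phi> x) (\<phi>' x e))
        = f' (\<phi> x) ((\<Sum>e\<in>Basis. (2 * \<psi>' x e) *\<^sub>R \<phi>' x e) + \<psi> x *\<^sub>R (\<Sum>e\<in>Basis. \<phi>'' x e e))"
      by (simp add: linear_add[OF lin] linear_sum[OF lin] linear_scale[OF lin] sum.distrib scaleR_sum_right add.commute two)
    also have "\<dots> = 0" unfolding h2[OF x] by (rule linear_0[OF lin])
    finally have 2: "(\<Sum>e\<in>Basis. \<psi> x *\<^sub>R f' (\<phi> x) (\<phi>'' x e e) + 2 *\<^sub>R \<psi>' x e *\<^sub>R f' (\<phi> x) (\<phi>' x e)) = 0" .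
    have "(\<Sum>e\<in>Basis. \<psi> x *\<^sub>R (f'' (\<phi> x) (\<phi>' x e) (\<phi>' x e) + f' (\<phi> x) (\<phi>'' x e e)) + \<psi>' x e *\<^sub>R f' (\<phi> x) (\<phi>' x e)
        + (\<psi>' x e *\<^sub>R f' (\<phi> x) (\<phi>' x e) + \<psi>'' x e e *\<^sub>R f (\<phi> x)))
      = \<psi> x *\<^sub>R (\<Sum>e\<in>Basis. f'' (\<phi> x) (\<phi>' x e) (\<phi>' x e))
       + (\<Sum>e\<in>Basis. \<psi> x *\<^sub>R f' (\<phi> x) (\<phi>'' x e e) + 2 *\<^sub>R \<psi>' x e *\<^sub>R f' (\<phi> x) (\<phi>' x e))
       + (\<Sum>e\<in>Basis. \<psi>'' x e e) *\<^sub>R f (\<phi> x)"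
      by (simp add: scaleR_sum_right scaleR_sum_left sum.distrib[symmetric] algebra_simps two)
    then show "(\<Sum>e\<in>Basis. \<psi> x *\<^sub>R (f'' (\<phi> x) (\<phi>' x e) (\<phi>' x e) + f' (\<phi> x) (\<phi>'' x e e)) + \<psi>' x e *\<^sub>R f' (\<phi> x) (\<phi>' x e)
        + (\<psi>' x e *\<^sub>R f' (\<phi> x) (\<phi>' x e) + \<psi>'' x e e *\<^sub>R f (\<phi> x))) = 0"
      unfolding 1 2 h1[OF x] by simp
  qed
qed

lemma sqdist_powr: "((x - a) \<bullet> (x - a)) powr s = norm (x - a) powr (2 * s)"
proof (cases "x = a")
  case False
  then have "(x - a) \<bullet> (x - a) = norm (x - a) powr 2" by (simp add: dot_square_norm)
  then show ?thesis by (simp only: powr_powr)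
qed simp

text \<open>A similarity for \<open>\<epsilon> = 0\<close>, and an inversion about \<open>a\<close> followed by a similarity for \<open>\<epsilon> = 2\<close>.\<close>

definition moebius_form :: "'a::euclidean_space \<Rightarrow> 'a \<Rightarrow> real \<Rightarrow> ('a \<Rightarrow> 'a) \<Rightarrow> real \<Rightarrow> 'a \<Rightarrow> 'a"
  where "moebius_form a b \<alpha> L \<epsilon> x = b + (\<alpha> / norm (x - a) powr \<epsilon>) *\<^sub>R L (x - a)"

lemma C2_derivs_inversion:
  fixes L :: "'a::euclidean_space \<Rightarrow> 'a"
  assumes L: "bounded_linear L" and S: "open S" "a \<notin> S"
  shows "C2_derivs (moebius_form a b \<alpha> L 2)
    (\<lambda>x u. (\<alpha> / ((x - a) \<bullet> (x - a))) *\<^sub>R (L u - (2 * ((x - a) \<bullet> u) / ((x - a) \<bullet> (x - a))) *\<^sub>R L (x - a)))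
    (\<lambda>x u v. (2 * \<alpha> / ((x - a) \<bullet> (x - a))\<^sup>2) *\<^sub>R ((4 * ((x - a) \<bullet> u) * ((x - a) \<bullet> v) / ((x - a) \<bullet> (x - a)) - u \<bullet> v) *\<^sub>R L (x - a)
        - ((x - a) \<bullet> v) *\<^sub>R L u - ((x - a) \<bullet> u) *\<^sub>R L v)) S"
proof -
  note C = C2_derivs_add[OF C2_derivs_const[of b]
     C2_derivs_bounded_linear[OF C2_derivs_bilinear[OF bounded_bilinear_scaleR C2_derivs_sqdist_powr[OF S, of "-1"] C2_derivs_linear[OF L, of a]]
        bounded_linear_scaleR_right[of \<alpha>]]]
  show ?thesis
  proof (rule C2_derivs_cong[OF C S(1)])
    fix x assume x: "x \<in> S"
    define N where "N = (x - a) \<bullet> (x - a)"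
    have N: "N > 0" using x S(2) unfolding N_def by auto
    have P: "N powr - 1 = 1 / N" using N by (simp add: powr_minus divide_inverse)
    have nP: "norm (x - a) powr 2 = N" using x S(2) by (auto simp: N_def dot_square_norm)
    show "b + \<alpha> *\<^sub>R ((x - a) \<bullet> (x - a)) powr - 1 *\<^sub>R L (x - a) = moebius_form a b \<alpha> L 2 x"
      unfolding moebius_form_def nP N_def[symmetric] P by simp
    fix u v
    define p where "p = (x - a) \<bullet> u"
    define q where "q = (x - a) \<bullet> v"
    define w where "w = L (x - a)"
    show "0 + \<alpha> *\<^sub>R (((x - a) \<bullet> (x - a)) powr - 1 *\<^sub>R L u + (2 * - 1 * (((x - a) \<bullet> (x - a)) powr - 1 / ((x - a) \<bullet> (x - a))) * ((x - a) \<bullet> u)) *\<^sub>R L (x - a))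
      = (\<alpha> / ((x - a) \<bullet> (x - a))) *\<^sub>R (L u - (2 * ((x - a) \<bullet> u) / ((x - a) \<bullet> (x - a))) *\<^sub>R L (x - a))"
      unfolding N_def[symmetric] P p_def[symmetric] w_def[symmetric] by (simp add: algebra_simps)
    show "0 + \<alpha> *\<^sub>R
           (((x - a) \<bullet> (x - a)) powr - 1 *\<^sub>R 0 +
            (2 * - 1 * (((x - a) \<bullet> (x - a)) powr - 1 / ((x - a) \<bullet> (x - a))) * ((x - a) \<bullet> v)) *\<^sub>R L u +
            ((2 * - 1 * (((x - a) \<bullet> (x - a)) powr - 1 / ((x - a) \<bullet> (x - a))) * ((x - a) \<bullet> u)) *\<^sub>R L v +
             (4 * - 1 * (- 1 - 1) * (((x - a) \<bullet> (x - a)) powr - 1 / ((x - a) \<bullet> (x - a))\<^sup>2) * ((x - a) \<bullet> u) * ((x - a) \<bullet> v) +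
              2 * - 1 * (((x - a) \<bullet> (x - a)) powr - 1 / ((x - a) \<bullet> (x - a))) * (u \<bullet> v)) *\<^sub>R L (x - a)))
       = (2 * \<alpha> / ((x - a) \<bullet> (x - a))\<^sup>2) *\<^sub>R ((4 * ((x - a) \<bullet> u) * ((x - a) \<bullet> v) / ((x - a) \<bullet> (x - a)) - u \<bullet> v) *\<^sub>R L (x - a)
        - ((x - a) \<bullet> v) *\<^sub>R L u - ((x - a) \<bullet> u) *\<^sub>R L v)"
      unfolding N_def[symmetric] P p_def[symmetric] q_def[symmetric] w_def[symmetric] by (simp add: algebra_simps power2_eq_square)
  qed
qed

text \<open>The Kelvin transform. With \<open>N = |x - a|\<^sup>2\<close> the weight is \<open>N powr ((2 - n) / 2)\<close>, the fundamental solution up to a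
  factor, and the derivatives of the inversion satisfy the three conditions of the criterion above.\<close>

lemma harmonic_on_kelvin:
  fixes f :: "'a::euclidean_space \<Rightarrow> 'b::real_normed_vector"
  assumes harm: "harmonic_on f V" and V: "open V" and S: "open S" "a \<notin> S"
    and L: "orthogonal_transformation L" and sub: "moebius_form a b \<alpha> L 2 ` S \<subseteq> V"
  shows "harmonic_on (\<lambda>x. norm (x - a) powr (2 - real DIM('a)) *\<^sub>R f (moebius_form a b \<alpha> L 2 x)) S"
proof -
  have lL: "linear L" by (rule orthogonal_transformation_linear[OF L])
  then have bL: "bounded_linear L" by (rule linear_conv_bounded_linear[THEN iffD1])
  define s where "s = (2 - real DIM('a)) / 2"
  have "harmonic_on (\<lambda>x. ((x - a) \<bullet> (x - a)) powr s *\<^sub>R f (moebius_form a b \<alpha> L 2 x)) S"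
  proof (rule harmonic_on_conformal_compose[OF C2_derivs_inversion[OF bL S] C2_derivs_sqdist_powr[OF S] harm V S(1) sub])
    fix x assume x: "x \<in> S"
    define y where "y = x - a"
    define N where "N = y \<bullet> y"
    define P where "P = N powr s"
    have N: "N > 0" using x S(2) unfolding N_def y_def by auto
    have Ly: "L y = (\<Sum>e\<in>Basis. (y \<bullet> e) *\<^sub>R L e)" by (rule linear_eq_sum_Basis[OF lL])
    have yy: "(\<Sum>e\<in>Basis. (y \<bullet> e) * (y \<bullet> e)) = N" unfolding N_def using sum_Basis_inner[of y y] by (simp add: inner_commute)
    have "(\<Sum>e\<in>Basis. 4 * s * (s - 1) * (P / N\<^sup>2) * (y \<bullet> e) * (y \<bullet> e) + 2 * s * (P / N) * (e \<bullet> e))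
        = 4 * s * (s - 1) * (P / N\<^sup>2) * (\<Sum>e\<in>Basis. (y \<bullet> e) * (y \<bullet> e)) + 2 * s * (P / N) * (\<Sum>e\<in>(Basis::'a set). e \<bullet> e)"
      unfolding sum.distrib sum_distrib_left by (simp add: mult.assoc)
    also have "\<dots> = 2 * s * (P / N) * (2 * (s - 1) + real DIM('a))"
      unfolding yy using N by (simp add: field_simps power2_eq_square)
    also have "\<dots> = 0" by (simp add: s_def field_simps)
    finally show "(\<Sum>e\<in>Basis. 4 * s * (s - 1) * (((x - a) \<bullet> (x - a)) powr s / ((x - a) \<bullet> (x - a))\<^sup>2) * ((x - a) \<bullet> e) * ((x - a) \<bullet> e)
       + 2 * s * (((x - a) \<bullet> (x - a)) powr s / ((x - a) \<bullet> (x - a))) * (e \<bullet> e)) = 0"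
      unfolding y_def[symmetric] N_def[symmetric] P_def[symmetric] .
    have "(\<Sum>e\<in>Basis. (2 * (2 * s * (P / N) * (y \<bullet> e))) *\<^sub>R (\<alpha> / N) *\<^sub>R (L e - (2 * (y \<bullet> e) / N) *\<^sub>R L y))
        = (4 * s * P * \<alpha> / N\<^sup>2) *\<^sub>R ((\<Sum>e\<in>Basis. (y \<bullet> e) *\<^sub>R L e) - (2 / N * (\<Sum>e\<in>Basis. (y \<bullet> e) * (y \<bullet> e))) *\<^sub>R L y)"
      unfolding scaleR_diff_right scaleR_sum_right sum_distrib_left scaleR_sum_left sum_subtractf
      by (intro arg_cong2[where f="(-)"] sum.cong) (auto simp: power2_eq_square algebra_simps)
    also have "\<dots> = (- 4 * s * P * \<alpha> / N\<^sup>2) *\<^sub>R L y"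
      unfolding yy Ly[symmetric] using N by (simp add: algebra_simps scaleR_2)
    finally have A: "(\<Sum>e\<in>Basis. (2 * (2 * s * (P / N) * (y \<bullet> e))) *\<^sub>R (\<alpha> / N) *\<^sub>R (L e - (2 * (y \<bullet> e) / N) *\<^sub>R L y))
       = (- 4 * s * P * \<alpha> / N\<^sup>2) *\<^sub>R L y" .
    have "(\<Sum>e\<in>Basis. (2 * \<alpha> / N\<^sup>2) *\<^sub>R ((4 * (y \<bullet> e) * (y \<bullet> e) / N - e \<bullet> e) *\<^sub>R L y - (y \<bullet> e) *\<^sub>R L e - (y \<bullet> e) *\<^sub>R L e))
       = (2 * \<alpha> / N\<^sup>2) *\<^sub>R ((4 / N * (\<Sum>e\<in>Basis. (y \<bullet> e) * (y \<bullet> e)) - (\<Sum>e\<in>(Basis::'a set). e \<bullet> e)) *\<^sub>R L y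
           - (\<Sum>e\<in>Basis. (y \<bullet> e) *\<^sub>R L e) - (\<Sum>e\<in>Basis. (y \<bullet> e) *\<^sub>R L e))"
      unfolding scaleR_sum_right[symmetric] sum_distrib_left sum_subtractf scaleR_diff_left scaleR_sum_left
      by (simp add: mult.assoc)
    also have "\<dots> = (2 * \<alpha> / N\<^sup>2) *\<^sub>R ((4 - real DIM('a)) *\<^sub>R L y - L y - L y)"
      unfolding yy Ly[symmetric] using N by simp
    also have "(4 - real DIM('a)) *\<^sub>R L y - L y - L y = (2 - real DIM('a)) *\<^sub>R L y"
      by (simp add: scaleR_2[symmetric] scaleR_diff_left[symmetric] diff_diff_add)
    also have "(2 * \<alpha> / N\<^sup>2) *\<^sub>R (2 - real DIM('a)) *\<^sub>R L y = (2 * \<alpha> / N\<^sup>2 * (2 - real DIM('a))) *\<^sub>R L y" by simp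
    finally have B: "(\<Sum>e\<in>Basis. (2 * \<alpha> / N\<^sup>2) *\<^sub>R ((4 * (y \<bullet> e) * (y \<bullet> e) / N - e \<bullet> e) *\<^sub>R L y - (y \<bullet> e) *\<^sub>R L e - (y \<bullet> e) *\<^sub>R L e))
       = (2 * \<alpha> / N\<^sup>2 * (2 - real DIM('a))) *\<^sub>R L y" .
    have "(- 4 * s * P * \<alpha> / N\<^sup>2) *\<^sub>R L y + P *\<^sub>R (2 * \<alpha> / N\<^sup>2 * (2 - real DIM('a))) *\<^sub>R L y = 0"
    proof -
      have "- 4 * s * P * \<alpha> / N\<^sup>2 + P * (2 * \<alpha> / N\<^sup>2 * (2 - real DIM('a))) = (P * \<alpha> / N\<^sup>2) * (2 * (2 - real DIM('a)) - 4 * s)"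
        by (simp add: algebra_simps diff_divide_distrib add_divide_distrib)
      also have "\<dots> = 0" by (simp add: s_def)
      finally show ?thesis unfolding scaleR_scaleR scaleR_add_left[symmetric] by simp
    qed
    then show "(\<Sum>e\<in>Basis. (2 * (2 * s * (((x - a) \<bullet> (x - a)) powr s / ((x - a) \<bullet> (x - a))) * ((x - a) \<bullet> e))) *\<^sub>R
          (\<alpha> / ((x - a) \<bullet> (x - a))) *\<^sub>R (L e - (2 * ((x - a) \<bullet> e) / ((x - a) \<bullet> (x - a))) *\<^sub>R L (x - a)))
       + ((x - a) \<bullet> (x - a)) powr s *\<^sub>R (\<Sum>e\<in>Basis. (2 * \<alpha> / ((x - a) \<bullet> (x - a))\<^sup>2) *\<^sub>R
          ((4 * ((x - a) \<bullet> e) * ((x - a) \<bullet> e) / ((x - a) \<bullet> (x - a)) - e \<bullet> e) *\<^sub>R L (x - a) - ((x - a) \<bullet> e) *\<^sub>R L e - ((x - a) \<bullet> e) *\<^sub>R L e)) = 0"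
      unfolding y_def[symmetric] N_def[symmetric] P_def[symmetric] A B .
    fix u v :: 'a
    obtain u0 v0 where uv: "u = L u0" "v = L v0"
      using orthogonal_transformation_surj[OF L] by (metis surjD)
    have i: "L p \<bullet> L q = p \<bullet> q" for p q using L unfolding orthogonal_transformation_def by simp
    have "(\<Sum>e\<in>Basis. ((\<alpha> / N) *\<^sub>R (L e - (2 * (y \<bullet> e) / N) *\<^sub>R L y) \<bullet> u) * ((\<alpha> / N) *\<^sub>R (L e - (2 * (y \<bullet> e) / N) *\<^sub>R L y) \<bullet> v))
       = (\<Sum>e\<in>Basis. (\<alpha> / N)\<^sup>2 * ((e \<bullet> u0) * (e \<bullet> v0) - (2 * (y \<bullet> v0) / N) * ((e \<bullet> u0) * (e \<bullet> y))
           - (2 * (y \<bullet> u0) / N) * ((e \<bullet> y) * (e \<bullet> v0)) + (4 * (y \<bullet> u0) * (y \<bullet> v0) / N\<^sup>2) * ((e \<bullet> y) * (e \<bullet> y))))"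
      by (rule sum.cong[OF refl])
        (simp add: uv i inner_diff_left inner_commute[of y] power2_eq_square algebra_simps)
    also have "\<dots> = (\<alpha> / N)\<^sup>2 * ((u0 \<bullet> v0) - (2 * (y \<bullet> v0) / N) * (u0 \<bullet> y)
           - (2 * (y \<bullet> u0) / N) * (y \<bullet> v0) + (4 * (y \<bullet> u0) * (y \<bullet> v0) / N\<^sup>2) * N)"
      unfolding sum_distrib_left[symmetric] sum.distrib sum_subtractf sum_Basis_inner N_def ..
    also have "\<dots> = (\<alpha> / N)\<^sup>2 * (u \<bullet> v)"
      unfolding uv i using N by (simp add: inner_commute field_simps power2_eq_square)
    finally show "(\<Sum>e\<in>Basis. ((\<alpha> / ((x - a) \<bullet> (x - a))) *\<^sub>R (L e - (2 * ((x - a) \<bullet> e) / ((x - a) \<bullet> (x - a))) *\<^sub>R L (x - a)) \<bullet> u) *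
        ((\<alpha> / ((x - a) \<bullet> (x - a))) *\<^sub>R (L e - (2 * ((x - a) \<bullet> e) / ((x - a) \<bullet> (x - a))) *\<^sub>R L (x - a)) \<bullet> v)) = (\<alpha> / ((x - a) \<bullet> (x - a)))\<^sup>2 * (u \<bullet> v)"
      unfolding y_def N_def .
  qed
  moreover have "2 * s = 2 - real DIM('a)" by (simp add: s_def)
  ultimately show ?thesis unfolding sqdist_powr by (simp only:)
qed

lemma harmonic_on_similarity:
  fixes L :: "'a::euclidean_space \<Rightarrow> 'a" and f :: "'a::euclidean_space \<Rightarrow> 'b::real_normed_vector"
  assumes harm: "harmonic_on f V" and V: "open V" and S: "open S"
    and L: "orthogonal_transformation L" and sub: "(\<lambda>x. b + \<alpha> *\<^sub>R L (x - a)) ` S \<subseteq> V"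
  shows "harmonic_on (\<lambda>x. f (b + \<alpha> *\<^sub>R L (x - a))) S"
proof -
  have lL: "linear L" by (rule orthogonal_transformation_linear[OF L])
  then have bL: "bounded_linear L" by (rule linear_conv_bounded_linear[THEN iffD1])
  note P = C2_derivs_add[OF C2_derivs_const[of b] C2_derivs_bounded_linear[OF C2_derivs_linear[OF bL, of a] bounded_linear_scaleR_right[of \<alpha>]]]
  have "harmonic_on (\<lambda>x. 1 *\<^sub>R f (b + \<alpha> *\<^sub>R L (x - a))) S"
  proof (rule harmonic_on_conformal_compose[OF P C2_derivs_const[of 1] harm V S sub, where \<mu> = "\<lambda>_. \<alpha>\<^sup>2"])
    fix u v :: 'a
    obtain u0 v0 where uv: "u = L u0" "v = L v0"
      using orthogonal_transformation_surj[OF L] by (metis surjD)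
    have i: "L p \<bullet> L q = p \<bullet> q" for p q using L unfolding orthogonal_transformation_def by simp
    have "(\<Sum>e\<in>Basis. ((0 + \<alpha> *\<^sub>R L e) \<bullet> u) * ((0 + \<alpha> *\<^sub>R L e) \<bullet> v)) = \<alpha>\<^sup>2 * (\<Sum>e\<in>Basis. (e \<bullet> u0) * (e \<bullet> v0))"
      unfolding sum_distrib_left by (rule sum.cong[OF refl]) (simp add: uv i power2_eq_square)
    then show "(\<Sum>e\<in>Basis. ((0 + \<alpha> *\<^sub>R L e) \<bullet> u) * ((0 + \<alpha> *\<^sub>R L e) \<bullet> v)) = \<alpha>\<^sup>2 * (u \<bullet> v)"
      unfolding sum_Basis_inner uv i .
  qed auto
  then show ?thesis by simp
qed

lemma harmonic_on_moebius_form: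
  fixes L :: "'a::euclidean_space \<Rightarrow> 'a" and f :: "'a::euclidean_space \<Rightarrow> 'b::real_normed_vector"
  assumes harm: "harmonic_on f V" and V: "open V" and S: "open S" "a \<notin> S"
    and L: "orthogonal_transformation L" and eps: "\<epsilon> = 0 \<or> \<epsilon> = 2" and sub: "moebius_form a b \<alpha> L \<epsilon> ` S \<subseteq> V"
  shows "harmonic_on (\<lambda>x. norm (x - a) powr (\<epsilon> * (2 - real DIM('a)) / 2) *\<^sub>R f (moebius_form a b \<alpha> L \<epsilon> x)) S"
  using eps
proof
  assume e: "\<epsilon> = 2"
  have eq: "2 * (2 - real DIM('a)) / 2 = 2 - real DIM('a)" by simp
  show ?thesis unfolding e eq
    by (rule harmonic_on_kelvin[OF harm V S L]) (use sub e in simp)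
next
  assume e: "\<epsilon> = 0"
  have eq: "moebius_form a b \<alpha> L \<epsilon> x = b + \<alpha> *\<^sub>R L (x - a)" if "x \<in> S" for x
    using e that S(2) by (auto simp: moebius_form_def)
  obtain g' g'' where C: "C2_derivs (\<lambda>x. f (b + \<alpha> *\<^sub>R L (x - a))) g' g'' S" "\<And>x. x \<in> S \<Longrightarrow> (\<Sum>e\<in>Basis. g'' x e e) = 0"
    using harmonic_onE[OF harmonic_on_similarity[OF harm V S(1) L, of b \<alpha> a] S(1)] sub eq by (smt (verit) image_subset_iff)
  have "C2_derivs (\<lambda>x. norm (x - a) powr (\<epsilon> * (2 - real DIM('a)) / 2) *\<^sub>R f (moebius_form a b \<alpha> L \<epsilon> x)) g' g'' S"
    by (rule C2_derivs_cong[OF C(1) S(1)]) (use eq e S(2) in auto)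
  then show ?thesis using harmonic_on_iff[OF _ S(1)] C(2) by blast
qed

section \<open>The Poisson integral and harmonic majorants\<close>

lemma harmonic_on_cong:
  fixes f :: "'a::euclidean_space \<Rightarrow> 'b::real_normed_vector"
  assumes "harmonic_on f S" and S: "open S" and eq: "\<And>x. x \<in> S \<Longrightarrow> f x = g x"
  shows "harmonic_on g S"
proof -
  obtain f' f'' where C: "C2_derivs f f' f'' S" "\<And>x. x \<in> S \<Longrightarrow> (\<Sum>e\<in>Basis. f'' x e e) = 0"
    using harmonic_onE[OF assms(1) S] by metis
  have "C2_derivs g f' f'' S" by (rule C2_derivs_cong[OF C(1) S eq]) auto
  then show ?thesis using C(2) harmonic_on_iff[OF _ S] by blast
qed

lemma harmonic_on_affine:
  fixes c :: "'a::euclidean_space" and d :: real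
  assumes "open S"
  shows "harmonic_on (\<lambda>x. d + c \<bullet> x) S"
proof -
  have "C2_derivs (\<lambda>x. d + c \<bullet> (x - 0)) (\<lambda>_ u. 0 + c \<bullet> u) (\<lambda>_ _ _. 0 + 0) S"
    by (rule C2_derivs_add[OF C2_derivs_const C2_derivs_linear[OF bounded_linear_inner_right]])
  from harmonic_on_iff[OF this assms] show ?thesis by simp
qed

lemma harmonic_on_continuous:
  fixes f :: "'a::euclidean_space \<Rightarrow> 'b::real_normed_vector"
  assumes "harmonic_on f S" "open S" shows "continuous_on S f"
  using harmonic_onE[OF assms] C2_derivs_continuous(1) by metis

definition poisson :: "'a::euclidean_space \<Rightarrow> 'a \<Rightarrow> real"
  where "poisson x \<zeta> = (1 - (norm x)\<^sup>2) / norm (x - \<zeta>) ^ DIM('a)"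

text \<open>The kernel is the Kelvin transform about \<open>\<zeta>\<close> of the affine function \<open>- 1 - 2 (\<zeta> \<bullet> w)\<close>, because
  \<open>1 - |x|\<^sup>2 = - |x - \<zeta>|\<^sup>2 - 2 (\<zeta> \<bullet> (x - \<zeta>))\<close>.\<close>

lemma poisson_harmonic:
  fixes \<zeta> :: "'a::euclidean_space"
  assumes z: "norm \<zeta> = 1"
  shows "harmonic_on (\<lambda>x. poisson x \<zeta>) (ball 0 1)"
proof (rule harmonic_on_cong)
  show "harmonic_on (\<lambda>x. norm (x - \<zeta>) powr (2 - real DIM('a)) *\<^sub>R (- 1 + (- 2 *\<^sub>R \<zeta>) \<bullet> (moebius_form \<zeta> 0 1 (\<lambda>x. x) 2 x))) (ball 0 1)"
    by (rule harmonic_on_kelvin[OF harmonic_on_affine[OF open_UNIV] open_UNIV]) (use z in auto)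
  fix x :: 'a assume x: "x \<in> ball 0 1"
  define y where "y = x - \<zeta>"
  have y: "norm y > 0" using x z by (auto simp: y_def)
  have "x = y + \<zeta>" by (simp add: y_def)
  then have "(norm x)\<^sup>2 = (norm y)\<^sup>2 + 2 * (\<zeta> \<bullet> y) + 1"
    using z by (simp add: power2_norm_eq_inner inner_add_left inner_add_right inner_commute norm_eq_1)
  then have 1: "1 - (norm x)\<^sup>2 = - ((norm y)\<^sup>2 + 2 * (\<zeta> \<bullet> y))" by simp
  have 2: "norm y powr (2 - real DIM('a)) = (norm y)\<^sup>2 / norm y ^ DIM('a)"
    using y by (simp add: powr_diff powr_realpow)
  show "norm (x - \<zeta>) powr (2 - real DIM('a)) *\<^sub>R (- 1 + (- 2 *\<^sub>R \<zeta>) \<bullet> (moebius_form \<zeta> 0 1 (\<lambda>x. x) 2 x)) = poisson x \<zeta>"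
    unfolding poisson_def moebius_form_def y_def[symmetric] 1 2 using y by (simp add: field_simps)
qed simp

lemma poisson_nonneg: "norm x < 1 \<Longrightarrow> 0 \<le> poisson x \<zeta>"
  unfolding poisson_def by (simp add: power_le_one)

lemma continuous_on_poisson: "continuous_on (ball 0 1 \<times> sphere 0 1) (\<lambda>(x, \<zeta>). poisson x \<zeta>)"
  unfolding poisson_def case_prod_beta by (intro continuous_intros) auto

lemma continuous_on_poisson_compose:
  assumes "continuous_on A g" "continuous_on A h" "\<And>x. x \<in> A \<Longrightarrow> norm (g x) < 1" "\<And>x. x \<in> A \<Longrightarrow> norm (h x) = 1"
  shows "continuous_on A (\<lambda>x. poisson (g x) (h x))"
  using continuous_on_compose2[OF continuous_on_poisson continuous_on_Pair[OF assms(1,2)]] assms(3,4)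
  by (auto simp: image_subset_iff)

lemma poisson_symmetric:
  assumes "norm \<xi> = 1" "norm \<zeta> = 1"
  shows "poisson (r *\<^sub>R \<xi>) \<zeta> = poisson (r *\<^sub>R \<zeta>) \<xi>"
proof -
  have "(norm (r *\<^sub>R \<xi> - \<zeta>))\<^sup>2 = (norm (r *\<^sub>R \<zeta> - \<xi>))\<^sup>2"
    using assms by (simp add: power2_norm_eq_inner inner_diff_left inner_diff_right inner_commute norm_eq_1)
  then have "norm (r *\<^sub>R \<xi> - \<zeta>) = norm (r *\<^sub>R \<zeta> - \<xi>)" by simp
  then show ?thesis using assms by (simp add: poisson_def)
qed

text \<open>With \<open>\<xi> = sgn x\<close> the symmetry of the kernel turns the integrand into \<open>poisson (|x| \<zeta>) \<xi>\<close>. This is the mean of a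
  harmonic function over the sphere of radius \<open>|x|\<close>, hence its value 1 at the origin.\<close>

lemma sphere_mean_poisson:
  fixes x :: "'a::euclidean_space"
  assumes x: "norm x < 1"
  shows "sphere_mean (\<lambda>\<zeta>. poisson x \<zeta>) = 1"
proof (cases "x = 0")
  case True
  then show ?thesis by (subst sphere_mean_cong[of _ "\<lambda>_. 1"]) (auto simp: poisson_def)
next
  case False
  define \<xi> where "\<xi> = sgn x"
  have xi: "norm \<xi> = 1" "x = norm x *\<^sub>R \<xi>" using False by (auto simp: \<xi>_def norm_sgn sgn_div_norm)
  have "sphere_mean (\<lambda>\<zeta>. poisson x \<zeta>) = sphere_mean (\<lambda>\<zeta>. poisson (0 + norm x *\<^sub>R \<zeta>) \<xi>)"
    by (rule sphere_mean_cong) (use poisson_symmetric[OF xi(1), of _ "norm x"] xi(2) in simp)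
  also have "\<dots> = poisson 0 \<xi>"
    by (rule sphere_mean_harmonic[OF poisson_harmonic[OF xi(1)]]) (use x in auto)
  also have "\<dots> = 1" using xi(1) by (simp add: poisson_def)
  finally show ?thesis .
qed

definition poisson_integral :: "('a::euclidean_space \<Rightarrow> real) \<Rightarrow> 'a \<Rightarrow> real"
  where "poisson_integral v x = sphere_mean (\<lambda>\<zeta>. poisson x \<zeta> * v \<zeta>)"

lemma continuous_affine_on_sphere:
  fixes x :: "'a::real_normed_vector"
  assumes "continuous_on S f" "cball x s \<subseteq> S" "0 \<le> s"
  shows "continuous_on (sphere 0 1) (\<lambda>z. f (x + s *\<^sub>R z))"
  by (rule continuous_on_compose2[OF assms(1)]) (use assms(2,3) in \<open>auto intro!: continuous_intros simp: dist_norm subset_iff\<close>)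

text \<open>Fubini and the mean value property for each fixed \<open>\<zeta>\<close>. This avoids showing that a Poisson integral is
  harmonic by differentiating under the integral sign.\<close>

lemma sphere_mean_weighted_poisson_integral:
  fixes v :: "'a::euclidean_space \<Rightarrow> real" and g :: "'a \<Rightarrow> 'a"
  assumes harm: "\<And>\<zeta>. norm \<zeta> = 1 \<Longrightarrow> harmonic_on (\<lambda>y. w y * poisson (g y) \<zeta>) S"
    and S: "open S" "cball x s \<subseteq> S" "0 \<le> s" and w: "continuous_on S w" and g: "continuous_on S g" "g ` S \<subseteq> ball 0 1"
    and v: "continuous_on (sphere 0 1) v"
  shows "sphere_mean (\<lambda>z. w (x + s *\<^sub>R z) * poisson_integral v (g (x + s *\<^sub>R z))) = w x * poisson_integral v (g x)"
proof -
  have inS: "x + s *\<^sub>R z \<in> S" if "norm z = 1" for z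
    using S(2,3) that by (auto simp: subset_iff dist_norm)
  have gn: "norm (g y) < 1" if "y \<in> S" for y using g(2) that by auto
  have c1: "continuous_on (sphere 0 1 \<times> sphere 0 1) (\<lambda>p. h (x + s *\<^sub>R fst p))" if "continuous_on S h" for h :: "'a \<Rightarrow> 'b::topological_space"
    by (rule continuous_on_compose2[OF that]) (use inS in \<open>auto intro!: continuous_intros\<close>)
  have c2: "continuous_on (sphere 0 1 \<times> sphere 0 1) (\<lambda>p::'a\<times>'a. v (snd p))"
    by (rule continuous_on_compose2[OF v]) (auto intro!: continuous_intros)
  have c: "continuous_on (sphere 0 1 \<times> sphere 0 1) (\<lambda>(z, \<zeta>). w (x + s *\<^sub>R z) * (poisson (g (x + s *\<^sub>R z)) \<zeta> * v \<zeta>))"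
    unfolding case_prod_beta
    by (intro continuous_on_mult c1[OF w] c2 continuous_on_poisson_compose c1[OF g(1)] continuous_on_snd continuous_on_id)
      (use inS gn in auto)
  have "sphere_mean (\<lambda>z. w (x + s *\<^sub>R z) * poisson_integral v (g (x + s *\<^sub>R z)))
      = sphere_mean (\<lambda>z. sphere_mean (\<lambda>\<zeta>. w (x + s *\<^sub>R z) * (poisson (g (x + s *\<^sub>R z)) \<zeta> * v \<zeta>)))"
    unfolding poisson_integral_def by (simp add: sphere_mean_cmult)
  also have "\<dots> = sphere_mean (\<lambda>\<zeta>. sphere_mean (\<lambda>z. w (x + s *\<^sub>R z) * (poisson (g (x + s *\<^sub>R z)) \<zeta> * v \<zeta>)))"
    by (rule sphere_mean_swap[OF c])
  also have "\<dots> = sphere_mean (\<lambda>\<zeta>. w x * (poisson (g x) \<zeta> * v \<zeta>))"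
  proof (rule sphere_mean_cong)
    fix \<zeta> :: 'a assume z: "norm \<zeta> = 1"
    have "sphere_mean (\<lambda>z. w (x + s *\<^sub>R z) * (poisson (g (x + s *\<^sub>R z)) \<zeta> * v \<zeta>))
       = v \<zeta> * sphere_mean (\<lambda>z. w (x + s *\<^sub>R z) * poisson (g (x + s *\<^sub>R z)) \<zeta>)"
      unfolding sphere_mean_cmult[symmetric] by (simp add: mult_ac)
    also have "sphere_mean (\<lambda>z. w (x + s *\<^sub>R z) * poisson (g (x + s *\<^sub>R z)) \<zeta>) = w x * poisson (g x) \<zeta>"
      by (rule sphere_mean_harmonic[OF harm[OF z] S])
    finally show "sphere_mean (\<lambda>z. w (x + s *\<^sub>R z) * (poisson (g (x + s *\<^sub>R z)) \<zeta> * v \<zeta>)) = w x * (poisson (g x) \<zeta> * v \<zeta>)"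
      by simp
  qed
  finally show ?thesis unfolding poisson_integral_def by (simp add: sphere_mean_cmult)
qed

lemma continuous_on_poisson_integral:
  fixes v :: "'a::euclidean_space \<Rightarrow> real"
  assumes v: "continuous_on (sphere 0 1) v" and K: "compact K" "K \<subseteq> ball 0 1"
  shows "continuous_on K (poisson_integral v)"
proof -
  have c2: "continuous_on (K \<times> sphere 0 1) (\<lambda>p::'a\<times>'a. v (snd p))"
    by (rule continuous_on_compose2[OF v]) (auto intro!: continuous_intros)
  have "continuous_on (K \<times> sphere 0 1) (\<lambda>(x, \<zeta>). poisson x \<zeta> * v \<zeta>)"
    unfolding case_prod_beta
    by (intro continuous_on_mult c2 continuous_on_poisson_compose continuous_on_snd continuous_on_fst continuous_on_id)
      (use K in auto)
  from continuous_on_sphere_mean[OF K(1) this] show ?thesis unfolding poisson_integral_def[abs_def] .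
qed

text \<open>Adding \<open>\<eta> |x|\<^sup>2\<close> turns the sub-mean inequality into a strict one, which excludes an interior maximum; then
  \<open>\<eta>\<close> tends to 0.\<close>

lemma sub_mean_max_principle:
  fixes d :: "'a::euclidean_space \<Rightarrow> real"
  assumes c: "continuous_on (cball 0 r) d" and r: "0 < r"
    and sub: "\<And>x s. 0 < s \<Longrightarrow> cball x s \<subseteq> ball 0 r \<Longrightarrow> d x \<le> sphere_mean (\<lambda>z. d (x + s *\<^sub>R z))"
    and bd: "\<And>x. norm x = r \<Longrightarrow> d x \<le> e" and x: "norm x \<le> r"
  shows "d x \<le> e"
proof -
  have pert: "d x \<le> e + \<eta> * r\<^sup>2" if eta: "\<eta> > 0" for \<eta>
  proof -
    define k where "k y = d y + \<eta> * (y \<bullet> y)" for y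
    have kc: "continuous_on (cball 0 r) k" unfolding k_def by (intro continuous_intros c)
    obtain m where m: "m \<in> cball 0 r" "\<And>y. y \<in> cball 0 r \<Longrightarrow> k y \<le> k m"
      using continuous_attains_sup[OF compact_cball _ kc] r by force
    have "norm m = r"
    proof (rule ccontr)
      assume "norm m \<noteq> r"
      then have mr: "norm m < r" using m(1) by simp
      define s where "s = (r - norm m) / 2"
      have s: "s > 0" "cball m s \<subseteq> ball 0 r"
      proof -
        show "s > 0" using mr by (simp add: s_def)
        show "cball m s \<subseteq> ball 0 r"
        proof
          fix y assume "y \<in> cball m s"
          then have "norm (y - m) \<le> s" by (simp add: dist_norm norm_minus_commute)
          then have "norm y \<le> norm m + s" using norm_triangle_ineq[of m "y - m"] by simp
          then show "y \<in> ball 0 r" using mr by (simp add: s_def field_simps)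
        qed
      qed
      have sc: "cball m s \<subseteq> cball 0 r" using s(2) by auto
      note dc = continuous_affine_on_sphere[OF c sc less_imp_le[OF s(1)]]
      note kc' = continuous_affine_on_sphere[OF kc sc less_imp_le[OF s(1)]]
      have lin: "sphere_mean (\<lambda>z. 0 + m \<bullet> (0 + 1 *\<^sub>R z)) = 0 + m \<bullet> 0"
        by (rule sphere_mean_harmonic[OF harmonic_on_affine[OF open_UNIV] open_UNIV]) auto
      have cl: "continuous_on (sphere 0 1) (\<lambda>z. \<eta> * (m \<bullet> m + s\<^sup>2) + (2 * s * \<eta>) * (m \<bullet> z))"
        by (intro continuous_intros)
      have "sphere_mean (\<lambda>z. k (m + s *\<^sub>R z)) = sphere_mean (\<lambda>z. d (m + s *\<^sub>R z) + (\<eta> * (m \<bullet> m + s\<^sup>2) + (2 * s * \<eta>) * (m \<bullet> z)))"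
        by (rule sphere_mean_cong)
          (simp add: k_def inner_add_left inner_add_right inner_commute norm_eq_1 algebra_simps power2_eq_square)
      also have "\<dots> = sphere_mean (\<lambda>z. d (m + s *\<^sub>R z)) + sphere_mean (\<lambda>z. \<eta> * (m \<bullet> m + s\<^sup>2) + (2 * s * \<eta>) * (m \<bullet> z))"
        by (rule sphere_mean_add[OF dc cl])
      also have "sphere_mean (\<lambda>z. \<eta> * (m \<bullet> m + s\<^sup>2) + (2 * s * \<eta>) * (m \<bullet> z)) = \<eta> * (m \<bullet> m + s\<^sup>2) + (2 * s * \<eta>) * sphere_mean (\<lambda>z. m \<bullet> z)"
        by (subst sphere_mean_add) (auto intro!: continuous_intros simp: sphere_mean_cmult)
      also have "sphere_mean (\<lambda>z. m \<bullet> z) = 0" using lin by simp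
      finally have "sphere_mean (\<lambda>z. k (m + s *\<^sub>R z)) \<ge> d m + \<eta> * (m \<bullet> m + s\<^sup>2)" using sub[OF s] by simp
      moreover have "sphere_mean (\<lambda>z. k (m + s *\<^sub>R z)) \<le> sphere_mean (\<lambda>z::'a. k m)"
        by (rule sphere_mean_mono[OF kc']) (use m(2) sc s(1) in \<open>auto simp: subset_iff dist_norm\<close>)
      ultimately have "\<eta> * s\<^sup>2 \<le> 0" by (simp add: k_def algebra_simps)
      then show False using eta s(1) by (simp add: mult_le_0_iff)
    qed
    have "d x \<le> k x" using eta by (simp add: k_def)
    also have "\<dots> \<le> k m" using m(2) x by simp
    also have "\<dots> \<le> e + \<eta> * r\<^sup>2" using bd[OF \<open>norm m = r\<close>] \<open>norm m = r\<close> by (simp add: k_def power2_norm_eq_inner[symmetric])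
    finally show ?thesis .
  qed
  show ?thesis
  proof (rule field_le_epsilon)
    fix t :: real assume t: "t > 0"
    have "d x \<le> e + t / r\<^sup>2 * r\<^sup>2" using t r by (intro pert) simp
    then show "d x \<le> e + t" using r by simp
  qed
qed

text \<open>The kernel has mean 1 and concentrates at \<open>x\<close>: at points \<open>\<zeta>\<close> at distance at least \<open>\<delta>\<close> it is at most
  \<open>(1 - |x|\<^sup>2) / \<delta> ^ n\<close>. Uniform continuity of \<open>v\<close> on the closed ball makes the estimate uniform in \<open>x\<close>.\<close>

lemma poisson_integral_boundary:
  fixes v :: "'a::euclidean_space \<Rightarrow> real"
  assumes v: "continuous_on (cball 0 1) v" and e: "0 < e"
  obtains r0 where "r0 < 1" "\<And>x. r0 < norm x \<Longrightarrow> norm x < 1 \<Longrightarrow> \<bar>poisson_integral v x - v x\<bar> \<le> e"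
proof -
  have vs: "continuous_on (sphere 0 1) v" by (rule continuous_on_subset[OF v]) auto
  have "uniformly_continuous_on (cball 0 1) v" by (rule compact_uniformly_continuous[OF v compact_cball])
  moreover have "e / 2 > 0" using e by simp
  ultimately obtain \<delta> where d: "\<delta> > 0" "\<And>p q. p \<in> cball 0 1 \<Longrightarrow> q \<in> cball 0 1 \<Longrightarrow> dist q p < \<delta> \<Longrightarrow> dist (v q) (v p) < e / 2"
    unfolding uniformly_continuous_on_def by metis
  obtain M where M: "\<And>y. y \<in> cball 0 1 \<Longrightarrow> norm (v y) \<le> M"
    using compact_imp_bounded[OF compact_continuous_image[OF v compact_cball]]
    unfolding bounded_iff by (meson imageI)
  have M0: "M \<ge> 0" using order_trans[OF norm_ge_zero M[of 0]] by simp
  let ?n = "DIM('a)"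
  \<comment> \<open>chosen such that \<open>2 M (1 - |x|\<^sup>2) / \<delta> ^ n \<le> e / 2\<close> for \<open>|x| > r0\<close>\<close>
  define r0 where "r0 = 1 - e * \<delta> ^ ?n / (8 * (M + 1))"
  have dn: "\<delta> ^ ?n > 0" using d(1) by simp
  have r0: "r0 < 1" using e dn M0 by (simp add: r0_def)
  have "\<bar>poisson_integral v x - v x\<bar> \<le> e" if x: "r0 < norm x" "norm x < 1" for x
  proof -
    have c: "continuous_on (sphere 0 1) (poisson x)"
      by (rule continuous_on_poisson_compose) (use x in \<open>auto intro!: continuous_intros\<close>)
    have c3: "continuous_on (sphere 0 1) (\<lambda>\<zeta>. poisson x \<zeta> * (v \<zeta> - v x))" by (intro continuous_intros c vs)
    have "sphere_mean (\<lambda>\<zeta>. v x * poisson x \<zeta>) = v x" using x by (simp add: sphere_mean_cmult sphere_mean_poisson)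
    then have "poisson_integral v x - v x = sphere_mean (\<lambda>\<zeta>. poisson x \<zeta> * v \<zeta>) - sphere_mean (\<lambda>\<zeta>. v x * poisson x \<zeta>)"
      by (simp add: poisson_integral_def)
    also have "\<dots> = sphere_mean (\<lambda>\<zeta>. poisson x \<zeta> * v \<zeta> - v x * poisson x \<zeta>)"
      by (rule sphere_mean_diff[symmetric]) (intro continuous_intros c vs)+
    also have "\<dots> = sphere_mean (\<lambda>\<zeta>. poisson x \<zeta> * (v \<zeta> - v x))" by (simp add: algebra_simps)
    finally have "\<bar>poisson_integral v x - v x\<bar> \<le> sphere_mean (\<lambda>\<zeta>. norm (poisson x \<zeta> * (v \<zeta> - v x)))"
      using norm_sphere_mean_le[of "\<lambda>\<zeta>. poisson x \<zeta> * (v \<zeta> - v x)"] by simp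
    also have "\<dots> \<le> sphere_mean (\<lambda>\<zeta>. e / 2 * poisson x \<zeta> + 2 * M * ((1 - (norm x)\<^sup>2) / \<delta> ^ ?n))"
    proof (rule sphere_mean_mono)
      show "continuous_on (sphere 0 1) (\<lambda>\<zeta>. norm (poisson x \<zeta> * (v \<zeta> - v x)))" by (intro continuous_intros c3)
      show "continuous_on (sphere 0 1) (\<lambda>\<zeta>. e / 2 * poisson x \<zeta> + 2 * M * ((1 - (norm x)\<^sup>2) / \<delta> ^ ?n))" by (intro continuous_intros c)
      fix \<zeta> :: 'a assume z: "norm \<zeta> = 1"
      have P0: "poisson x \<zeta> \<ge> 0" by (rule poisson_nonneg[OF x(2)])
      have x0: "1 - (norm x)\<^sup>2 \<ge> 0" using x(2) by (simp add: power_le_one)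
      show "norm (poisson x \<zeta> * (v \<zeta> - v x)) \<le> e / 2 * poisson x \<zeta> + 2 * M * ((1 - (norm x)\<^sup>2) / \<delta> ^ ?n)"
      proof (cases "dist \<zeta> x < \<delta>")
        case True
        then have "\<bar>v \<zeta> - v x\<bar> \<le> e / 2" using d(2)[of x \<zeta>] x z by (simp add: dist_real_def)
        then have "poisson x \<zeta> * \<bar>v \<zeta> - v x\<bar> \<le> poisson x \<zeta> * (e / 2)" using P0 by (rule mult_left_mono)
        moreover have "2 * M * ((1 - (norm x)\<^sup>2) / \<delta> ^ ?n) \<ge> 0" using M0 x0 dn by simp
        ultimately show ?thesis using P0 by (simp add: abs_mult mult.commute)
      next
        case False
        then have "norm (x - \<zeta>) \<ge> \<delta>" by (simp add: dist_norm norm_minus_commute)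
        then have "\<delta> ^ ?n \<le> norm (x - \<zeta>) ^ ?n" using d(1) by (intro power_mono) auto
        then have "poisson x \<zeta> \<le> (1 - (norm x)\<^sup>2) / \<delta> ^ ?n"
          unfolding poisson_def using x0 dn by (intro divide_left_mono) auto
        moreover have "\<bar>v \<zeta> - v x\<bar> \<le> 2 * M" using M[of \<zeta>] M[of x] x z by auto
        ultimately have "poisson x \<zeta> * \<bar>v \<zeta> - v x\<bar> \<le> (1 - (norm x)\<^sup>2) / \<delta> ^ ?n * (2 * M)"
          using x0 dn by (intro mult_mono) auto
        moreover have "e / 2 * poisson x \<zeta> \<ge> 0" using P0 e by simp
        ultimately show ?thesis using P0 by (simp add: abs_mult mult.commute)
      qed
    qed
    also have "\<dots> = sphere_mean (\<lambda>\<zeta>. e / 2 * poisson x \<zeta>) + 2 * M * ((1 - (norm x)\<^sup>2) / \<delta> ^ ?n)"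
      by (subst sphere_mean_add) (auto intro!: continuous_intros c)
    also have "sphere_mean (\<lambda>\<zeta>. e / 2 * poisson x \<zeta>) = e / 2"
      using x by (simp only: sphere_mean_cmult sphere_mean_poisson)
    also have "2 * M * ((1 - (norm x)\<^sup>2) / \<delta> ^ ?n) \<le> e / 2"
    proof -
      have "1 - (norm x)\<^sup>2 = (1 - norm x) * (1 + norm x)" by (simp add: power2_eq_square algebra_simps)
      also have "\<dots> \<le> (1 - norm x) * 2" using x by (intro mult_left_mono) auto
      also have "\<dots> \<le> e * \<delta> ^ ?n / (4 * (M + 1))" using x M0 by (simp add: r0_def field_simps)
      finally have "2 * M * (1 - (norm x)\<^sup>2) \<le> 2 * M * (e * \<delta> ^ ?n / (4 * (M + 1)))" using M0 by (intro mult_left_mono) auto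
      also have "\<dots> = (M / (M + 1)) * (e / 2 * \<delta> ^ ?n)" using M0 by (simp add: divide_simps)
      also have "\<dots> \<le> 1 * (e / 2 * \<delta> ^ ?n)" using M0 e dn by (intro mult_right_mono) auto
      finally show ?thesis using dn by (simp add: field_simps)
    qed
    finally show ?thesis by simp
  qed
  then show ?thesis using that[OF r0] by blast
qed

text \<open>The difference of \<open>v\<close> and its Poisson integral is sub-mean and is at most \<open>e\<close> on a sphere close to the boundary,
  so the maximum principle applies.\<close>

lemma poisson_integral_majorant:
  fixes v :: "'a::euclidean_space \<Rightarrow> real"
  assumes v: "continuous_on (cball 0 1) v"
    and sub: "\<And>x s. 0 < s \<Longrightarrow> cball x s \<subseteq> ball 0 1 \<Longrightarrow> v x \<le> sphere_mean (\<lambda>z. v (x + s *\<^sub>R z))"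
    and x: "norm x < 1"
  shows "v x \<le> poisson_integral v x"
proof (rule field_le_epsilon)
  fix e :: real assume e: "e > 0"
  have vs: "continuous_on (sphere 0 1) v" by (rule continuous_on_subset[OF v]) auto
  obtain r0 where r0: "r0 < 1" "\<And>x. r0 < norm x \<Longrightarrow> norm x < 1 \<Longrightarrow> \<bar>poisson_integral v x - v x\<bar> \<le> e"
    using poisson_integral_boundary[OF v e] by metis
  define r where "r = (1 + max r0 (norm x)) / 2"
  have r: "r0 < r" "norm x < r" "r < 1" using r0(1) x by (auto simp: r_def max_def)
  then have "0 < r" using norm_ge_zero[of x] by linarith
  note r = r this
  have sb: "cball (0::'a) r \<subseteq> ball 0 1" using r by auto
  have sb': "cball (0::'a) r \<subseteq> cball 0 1" using r by auto
  have cd: "continuous_on (cball 0 r) (\<lambda>x. v x - poisson_integral v x)"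
    by (intro continuous_on_diff continuous_on_subset[OF v sb'] continuous_on_poisson_integral[OF vs compact_cball sb])
  have "v x - poisson_integral v x \<le> e"
  proof (rule sub_mean_max_principle[OF cd r(4), where x = x])
    fix x :: 'a and s assume s: "0 < s" "cball x s \<subseteq> ball 0 r"
    have s1: "cball x s \<subseteq> ball 0 1" "cball x s \<subseteq> cball 0 r"
      using order_trans[OF s(2) ball_subset_cball] sb by blast+
    have "sphere_mean (\<lambda>z. 1 * poisson_integral v (x + s *\<^sub>R z)) = 1 * poisson_integral v x"
      by (rule sphere_mean_weighted_poisson_integral[where S = "ball 0 1" and g = "\<lambda>x. x" and w = "\<lambda>_. 1"])
        (use s1(1) s(1) vs poisson_harmonic in \<open>auto intro!: continuous_intros\<close>)
    moreover have "sphere_mean (\<lambda>z. v (x + s *\<^sub>R z) - poisson_integral v (x + s *\<^sub>R z)) =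
        sphere_mean (\<lambda>z. v (x + s *\<^sub>R z)) - sphere_mean (\<lambda>z. poisson_integral v (x + s *\<^sub>R z))"
      by (intro sphere_mean_diff continuous_affine_on_sphere[OF continuous_on_subset[OF v sb'] s1(2)]
         continuous_affine_on_sphere[OF continuous_on_poisson_integral[OF vs compact_cball sb] s1(2)]) (use s(1) in auto)
    ultimately show "v x - poisson_integral v x \<le> sphere_mean (\<lambda>z. v (x + s *\<^sub>R z) - poisson_integral v (x + s *\<^sub>R z))"
      using sub[OF s(1) s1(1)] by simp
  next
    fix x :: 'a assume "norm x = r"
    then show "v x - poisson_integral v x \<le> e" using r0(2)[of x] r by (simp add: abs_le_iff)
  qed (use r in simp)
  then show "v x \<le> poisson_integral v x + e" by simp
qed

section \<open>Weighted means along a Moebius transformation\<close>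

lemma powr_ge_tangent:
  fixes t A q :: real
  assumes q: "1 \<le> q" and A: "0 < A" and t: "0 \<le> t"
  shows "A powr q + q * A powr (q - 1) * (t - A) \<le> t powr q"
proof (cases "t = 0")
  case True
  have "A powr q = A powr (q - 1) * A" using A by (simp add: powr_diff)
  then have "A powr q + q * A powr (q - 1) * (t - A) = (1 - q) * A powr q" using True by (simp add: algebra_simps)
  also have "\<dots> \<le> 0" using q by (simp add: mult_nonpos_nonneg)
  finally show ?thesis using True by simp
next
  case False
  have "t powr q - A powr q \<ge> (q * A powr (q - 1)) * (t - A)"
  proof (rule convex_on_imp_above_tangent[OF powr_convex[OF q] connected_Ioi])
    show "((\<lambda>x. x powr q) has_real_derivative q * A powr (q - 1)) (at A within {0<..})"
      by (rule has_field_derivative_at_within, rule has_real_derivative_powr[OF A])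
  qed (use A False t in \<open>auto simp: interior_open\<close>)
  then show ?thesis by simp
qed

text \<open>Jensen's inequality, from the tangent of the convex function \<open>t powr q\<close> at the mean.\<close>

lemma sphere_mean_powr_ge:
  fixes g :: "'a::euclidean_space \<Rightarrow> real"
  assumes q: "1 \<le> q" and c: "continuous_on (sphere 0 1) g" and g: "\<And>z. norm z = 1 \<Longrightarrow> 0 \<le> g z"
  shows "sphere_mean g powr q \<le> sphere_mean (\<lambda>z. g z powr q)"
proof -
  have c2: "continuous_on (sphere 0 1) (\<lambda>z. g z powr q)"
    by (rule continuous_on_powr'[OF c]) (use q g in auto)
  define A where "A = sphere_mean g"
  have "0 \<le> A" using sphere_mean_mono[of "\<lambda>_. 0" g] c g by (simp add: A_def)
  then consider "A = 0" | "A > 0" by linarith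
  then show ?thesis
  proof cases
    case 1
    then show ?thesis using sphere_mean_mono[of "\<lambda>_. 0" "\<lambda>z. g z powr q"] c2 by (simp add: A_def)
  next
    case 2
    define m where "m = q * A powr (q - 1)"
    have "sphere_mean (\<lambda>z. (A powr q - m * A) + m * g z) \<le> sphere_mean (\<lambda>z. g z powr q)"
    proof (rule sphere_mean_mono)
      show "continuous_on (sphere 0 1) (\<lambda>z. (A powr q - m * A) + m * g z)" by (intro continuous_intros c)
      show "(A powr q - m * A) + m * g z \<le> g z powr q" if "norm z = 1" for z
        using powr_ge_tangent[OF q 2 g[OF that]] by (simp add: m_def algebra_simps)
    qed (rule c2)
    moreover have "sphere_mean (\<lambda>z. (A powr q - m * A) + m * g z) = (A powr q - m * A) + m * A"
      by (subst sphere_mean_add) (auto intro!: continuous_intros c simp: sphere_mean_cmult A_def)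
    ultimately show ?thesis by (simp add: A_def)
  qed
qed

lemma norm_powr_sub_mean:
  fixes f :: "'a::euclidean_space \<Rightarrow> 'b::{banach, second_countable_topology}"
  assumes q: "1 \<le> q" and harm: "harmonic_on f S" and S: "open S" "cball x s \<subseteq> S" "0 \<le> s"
  shows "norm (f x) powr q \<le> sphere_mean (\<lambda>z. norm (f (x + s *\<^sub>R z)) powr q)"
proof -
  have c: "continuous_on (sphere 0 1) (\<lambda>z. norm (f (x + s *\<^sub>R z)))"
    by (intro continuous_on_norm continuous_affine_on_sphere[OF harmonic_on_continuous[OF harm S(1)] S(2,3)])
  have "norm (f x) \<le> sphere_mean (\<lambda>z. norm (f (x + s *\<^sub>R z)))"
    using norm_sphere_mean_le[of "\<lambda>z. f (x + s *\<^sub>R z)"] sphere_mean_harmonic[OF harm S] by simp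
  then have "norm (f x) powr q \<le> sphere_mean (\<lambda>z. norm (f (x + s *\<^sub>R z))) powr q" using q by (intro powr_mono2) auto
  also have "\<dots> \<le> sphere_mean (\<lambda>z. norm (f (x + s *\<^sub>R z)) powr q)" by (rule sphere_mean_powr_ge[OF q c]) simp
  finally show ?thesis .
qed

lemma continuous_on_moebius_form:
  assumes L: "orthogonal_transformation L" and a: "a \<notin> S"
  shows "continuous_on S (moebius_form a b \<alpha> L \<epsilon>)"
  unfolding moebius_form_def
  by (intro continuous_intros linear_continuous_on_compose[OF _ orthogonal_transformation_linear[OF L]])
    (use a in auto)

lemma moebius_form_scale: "moebius_form a b \<alpha> L \<epsilon> x /\<^sub>R R = moebius_form a (b /\<^sub>R R) (\<alpha> / R) L \<epsilon> x"
  unfolding moebius_form_def scaleR_add_right scaleR_scaleR by (simp only: divide_inverse mult_ac)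

text \<open>On the ball of radius \<open>R\<close> the function \<open>|f| powr q\<close> is below the Poisson integral of its values on the sphere of
  radius \<open>R\<close>. Composed with \<open>\<phi>\<close> and multiplied by the weight, that Poisson integral has the mean value
  property, so the mean is controlled by its value at 0. Only one factor of the weight is used for this; the
  remaining power \<open>q - 1\<close> is estimated by \<open>K\<close>. The bound does not depend on \<open>r\<close>.\<close>

lemma moebius_weighted_mean_le:
  fixes L :: "'a::euclidean_space \<Rightarrow> 'a" and f :: "'a \<Rightarrow> 'b::{banach, second_countable_topology}"
  defines "\<psi> \<equiv> \<lambda>x \<epsilon> (a::'a). norm (x - a) powr (\<epsilon> * (2 - real DIM('a)) / 2)"
  assumes q: "1 \<le> q" and L: "orthogonal_transformation L" and eps: "\<epsilon> = 0 \<or> \<epsilon> = 2" and a: "a \<notin> ball 0 1"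
    and maps: "moebius_form a b \<alpha> L \<epsilon> ` ball 0 1 \<subseteq> ball 0 1"
    and K: "\<And>x. x \<in> ball 0 1 \<Longrightarrow> \<psi> x \<epsilon> a \<le> K"
    and harm: "harmonic_on f (ball 0 1)"
    and N: "\<And>R. 0 \<le> R \<Longrightarrow> R < 1 \<Longrightarrow> sphere_mean (\<lambda>z. norm (f (R *\<^sub>R z)) powr q) \<le> N"
    and r: "0 \<le> r" "r < 1"
  defines "t \<equiv> norm (moebius_form a b \<alpha> L \<epsilon> 0)"
  shows "sphere_mean (\<lambda>z. (\<psi> (r *\<^sub>R z) \<epsilon> a * norm (f (moebius_form a b \<alpha> L \<epsilon> (r *\<^sub>R z)))) powr q)
     \<le> K powr (q - 1) * (\<psi> 0 \<epsilon> a * (N / (1 - 2 * t / (1 + t)) ^ DIM('a)))"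
proof -
  let ?n = "DIM('a)"
  define \<phi> where "\<phi> = moebius_form a b \<alpha> L \<epsilon>"
  define w where "w x = \<psi> x \<epsilon> a" for x
  have w0: "w x > 0" if "x \<in> ball 0 1" for x using that a by (auto simp: w_def \<psi>_def)
  have phc: "continuous_on (ball 0 1) \<phi>" unfolding \<phi>_def by (rule continuous_on_moebius_form[OF L a])
  have wc: "continuous_on (ball 0 1) w" unfolding w_def \<psi>_def by (intro continuous_intros) (use a in auto)
  have t: "0 \<le> t" "t < 1" using maps by (auto simp: t_def image_subset_iff)
  have rb: "cball (0::'a) r \<subseteq> ball 0 1" using r by auto
  have "\<exists>m\<in>cball 0 r. \<forall>x\<in>cball 0 r. norm (\<phi> x) \<le> norm (\<phi> m)"
    by (rule continuous_attains_sup[OF compact_cball _ continuous_on_norm[OF continuous_on_subset[OF phc rb]]]) (use r(1) in auto)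
  then obtain m where m: "m \<in> cball 0 r" "\<And>x. x \<in> cball 0 r \<Longrightarrow> norm (\<phi> x) \<le> norm (\<phi> m)" by blast
  have m1: "norm (\<phi> m) < 1" using maps m(1) rb by (auto simp: \<phi>_def image_subset_iff subset_iff)
  \<comment> \<open>\<open>R > |\<phi>|\<close> on the ball of radius \<open>r\<close>, so that \<open>\<phi> / R\<close> stays in the unit ball there; \<open>R \<ge> (1 + t) / 2\<close> bounds \<open>|\<phi> 0| / R\<close> away from 1 independently of \<open>r\<close>.\<close>
  define R where "R = (1 + max t (norm (\<phi> m))) / 2"
  have R: "R < 1" "0 < R" "norm (\<phi> m) < R" "(1 + t) / 2 \<le> R" "t < R" using t m1 norm_ge_zero[of "\<phi> m"] by (auto simp: R_def max_def)
  define S where "S = {x \<in> ball 0 1. norm (\<phi> x) < R}"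
  have S: "open S"
  proof -
    have "open (ball 0 1 \<inter> (\<lambda>x. norm (\<phi> x)) -` {..<R})"
      by (rule continuous_open_preimage[OF continuous_on_norm[OF phc]]) auto
    moreover have "S = ball 0 1 \<inter> (\<lambda>x. norm (\<phi> x)) -` {..<R}" by (auto simp: S_def)
    ultimately show ?thesis by simp
  qed
  have rS: "cball 0 r \<subseteq> S" using rb m(2) R(3) by (force simp: S_def)
  have S1: "S \<subseteq> ball 0 1" by (auto simp: S_def)
  have aS: "a \<notin> S" using a S1 by auto
  define g where "g = moebius_form a (b /\<^sub>R R) (\<alpha> / R) L \<epsilon>"
  have g: "g x = \<phi> x /\<^sub>R R" for x unfolding g_def \<phi>_def by (rule moebius_form_scale[symmetric])
  have gS: "g ` S \<subseteq> ball 0 1" using R(2) by (auto simp: g S_def field_simps)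
  have gc: "continuous_on S g" by (rule continuous_on_eq[OF continuous_on_scaleR[OF continuous_on_const continuous_on_subset[OF phc S1]]]) (rule g[symmetric])
  define v where "v y = norm (f (R *\<^sub>R y)) powr q" for y
  have Rb: "R *\<^sub>R y \<in> ball 0 1" if "norm y \<le> 1" for y :: 'a
  proof -
    have "R * norm y \<le> R * 1" using R(2) that by (intro mult_left_mono) auto
    then have "R * norm y < 1" using R(1) by linarith
    then show ?thesis using R(2) by simp
  qed
  have fc: "continuous_on (ball 0 1) f" by (rule harmonic_on_continuous[OF harm open_ball])
  have fRc: "continuous_on (cball 0 1) (\<lambda>y. norm (f (R *\<^sub>R y)))"
    by (intro continuous_on_norm continuous_on_compose2[OF fc continuous_on_scaleR[OF continuous_on_const continuous_on_id]])
      (use Rb in auto)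
  have v: "continuous_on (cball 0 1) v" unfolding v_def
    by (rule continuous_on_powr'[OF fRc continuous_on_const]) (use q in auto)
  have vs: "continuous_on (sphere 0 1) v" by (rule continuous_on_subset[OF v]) auto
  have vsub: "v x \<le> sphere_mean (\<lambda>z. v (x + s *\<^sub>R z))" if s: "0 < s" "cball x s \<subseteq> ball 0 1" for x s
  proof -
    have "cball (R *\<^sub>R x) (R * s) \<subseteq> ball 0 1"
    proof
      fix y assume y: "y \<in> cball (R *\<^sub>R x) (R * s)"
      have "dist x (y /\<^sub>R R) = dist (R *\<^sub>R x) y / R"
      proof -
        have "x - y /\<^sub>R R = (R *\<^sub>R x - y) /\<^sub>R R" using R(2) by (simp add: scaleR_diff_right)
        then show ?thesis using R(2) by (simp add: dist_norm divide_inverse mult.commute)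
      qed
      also have "dist (R *\<^sub>R x) y / R \<le> s" using y R(2) by (simp add: pos_divide_le_eq mult.commute)
      finally have "y /\<^sub>R R \<in> cball x s" by (simp only: mem_cball)
      then have "norm (y /\<^sub>R R) \<le> 1" using s(2) by (auto simp: subset_iff)
      from Rb[OF this] show "y \<in> ball 0 1" using R(2) by simp
    qed
    from norm_powr_sub_mean[OF q harm open_ball this] show ?thesis
      using R(2) s(1) by (simp add: v_def scaleR_add_right)
  qed
  have maj: "(w x * norm (f (\<phi> x))) powr q \<le> K powr (q - 1) * (w x * poisson_integral v (g x))" if x: "x \<in> S" for x
  proof -
    have gx: "norm (g x) < 1" using gS x by auto
    have "norm (f (\<phi> x)) powr q = v (g x)" using R(2) by (simp add: v_def g)
    also have "\<dots> \<le> poisson_integral v (g x)" by (rule poisson_integral_majorant[OF v vsub gx])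
    finally have 1: "norm (f (\<phi> x)) powr q \<le> poisson_integral v (g x)" .
    have wx: "w x > 0" "w x \<le> K" using w0 K x S1 by (auto simp: w_def)
    have 2: "w x powr q \<le> K powr (q - 1) * w x"
    proof -
      have "w x powr q = w x powr (q - 1) * w x" using wx by (simp add: powr_diff)
      also have "\<dots> \<le> K powr (q - 1) * w x" using wx q by (intro mult_right_mono powr_mono2) auto
      finally show ?thesis .
    qed
    have "(w x * norm (f (\<phi> x))) powr q = w x powr q * norm (f (\<phi> x)) powr q" using wx by (simp add: powr_mult)
    also have "\<dots> \<le> (K powr (q - 1) * w x) * poisson_integral v (g x)"
      using 1 2 wx by (intro mult_mono) auto
    finally show ?thesis by (simp add: mult.assoc)
  qed
  have zS: "r *\<^sub>R z \<in> S" if "norm z = 1" for z using rS r that by auto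
  have crz: "continuous_on (sphere 0 1) (\<lambda>z. h (r *\<^sub>R z))" if "continuous_on S h" for h :: "'a \<Rightarrow> real"
    using continuous_affine_on_sphere[OF that rS r(1)] by simp
  have fphc: "continuous_on S (\<lambda>x. f (\<phi> x))"
    by (rule continuous_on_compose2[OF fc continuous_on_subset[OF phc S1]]) (use maps S1 in \<open>auto simp: \<phi>_def image_subset_iff\<close>)
  have cl: "continuous_on S (\<lambda>x. (w x * norm (f (\<phi> x))) powr q)"
  proof (rule continuous_on_powr'[OF _ continuous_on_const])
    show "continuous_on S (\<lambda>x. w x * norm (f (\<phi> x)))"
      by (intro continuous_on_mult continuous_on_norm fphc continuous_on_subset[OF wc S1])
    show "\<forall>x\<in>S. 0 \<le> w x * norm (f (\<phi> x)) \<and> (w x * norm (f (\<phi> x)) = 0 \<longrightarrow> 0 < q)"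
    proof
      fix x assume "x \<in> S"
      then have "0 \<le> w x" using w0[of x] S1 by auto
      then show "0 \<le> w x * norm (f (\<phi> x)) \<and> (w x * norm (f (\<phi> x)) = 0 \<longrightarrow> 0 < q)" using q by simp
    qed
  qed
  have "sphere_mean (\<lambda>z. (w (r *\<^sub>R z) * norm (f (\<phi> (r *\<^sub>R z)))) powr q)
     \<le> sphere_mean (\<lambda>z. K powr (q - 1) * (w (r *\<^sub>R z) * poisson_integral v (g (r *\<^sub>R z))))"
  proof (rule sphere_mean_mono)
    show "continuous_on (sphere 0 1) (\<lambda>z. (w (r *\<^sub>R z) * norm (f (\<phi> (r *\<^sub>R z)))) powr q)" using crz[OF cl] .
    have "continuous_on (cball 0 r) (\<lambda>x. poisson_integral v (g x))"
    proof -
      have gcr: "continuous_on (cball 0 r) g" by (rule continuous_on_subset[OF gc rS])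
      have "compact (g ` cball 0 r)" by (rule compact_continuous_image[OF gcr compact_cball])
      moreover have "g ` cball 0 r \<subseteq> ball 0 1" using gS rS by auto
      ultimately show ?thesis
        using continuous_on_compose2[OF continuous_on_poisson_integral[OF vs] gcr] by blast
    qed
    then have "continuous_on (sphere 0 1) (\<lambda>z. poisson_integral v (g (0 + r *\<^sub>R z)))"
      by (rule continuous_affine_on_sphere) (use r in auto)
    then have pc: "continuous_on (sphere 0 1) (\<lambda>z. poisson_integral v (g (r *\<^sub>R z)))" by simp
    show "continuous_on (sphere 0 1) (\<lambda>z. K powr (q - 1) * (w (r *\<^sub>R z) * poisson_integral v (g (r *\<^sub>R z))))"
      by (intro continuous_on_mult continuous_on_const pc crz continuous_on_subset[OF wc S1])
  qed (use maj zS in auto)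
  also have "\<dots> = K powr (q - 1) * (w 0 * poisson_integral v (g 0))"
  proof -
    have "sphere_mean (\<lambda>z. w (0 + r *\<^sub>R z) * poisson_integral v (g (0 + r *\<^sub>R z))) = w 0 * poisson_integral v (g 0)"
    proof (rule sphere_mean_weighted_poisson_integral[OF _ S rS r(1) continuous_on_subset[OF wc S1] gc gS vs])
      fix \<zeta> :: 'a assume z: "norm \<zeta> = 1"
      from harmonic_on_moebius_form[OF poisson_harmonic[OF z] open_ball S aS L eps, of "b /\<^sub>R R" "\<alpha> / R"] gS
      show "harmonic_on (\<lambda>y. w y * poisson (g y) \<zeta>) S" unfolding g_def[symmetric] by (simp add: w_def \<psi>_def)
    qed
    then show ?thesis by (simp add: sphere_mean_cmult)
  qed
  also have "\<dots> \<le> K powr (q - 1) * (w 0 * (N / (1 - 2 * t / (1 + t)) ^ ?n))"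
  proof (intro mult_left_mono)
    have "norm (g 0) \<le> 2 * t / (1 + t)"
    proof -
      have "norm (g 0) = t / R" using R(2) by (simp add: g t_def \<phi>_def divide_inverse mult.commute)
      also have "\<dots> \<le> t / ((1 + t) / 2)" using R t by (intro divide_left_mono) auto
      finally show ?thesis by (simp add: field_simps)
    qed
    moreover have T: "2 * t / (1 + t) < 1" using t by (simp add: field_simps)
    ultimately have g0: "norm (g 0) < 1" "1 - 2 * t / (1 + t) \<le> 1 - norm (g 0)" by auto
    have P: "poisson (g 0) \<zeta> \<le> 1 / (1 - 2 * t / (1 + t)) ^ ?n" if z: "norm \<zeta> = 1" for \<zeta>
    proof -
      have "1 - norm (g 0) \<le> norm (g 0 - \<zeta>)" using norm_triangle_ineq2[of \<zeta> "g 0"] z by (simp add: norm_minus_commute)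
      then have "(1 - 2 * t / (1 + t)) ^ ?n \<le> norm (g 0 - \<zeta>) ^ ?n" using g0 T by (intro power_mono) auto
      moreover have "0 < (1 - 2 * t / (1 + t)) ^ ?n" using T by (intro zero_less_power) auto
      ultimately show ?thesis unfolding poisson_def by (intro frac_le) auto
    qed
    have v0: "0 \<le> v \<zeta>" for \<zeta> by (simp add: v_def)
    have "poisson_integral v (g 0) \<le> sphere_mean (\<lambda>\<zeta>. (1 / (1 - 2 * t / (1 + t)) ^ ?n) * v \<zeta>)"
      unfolding poisson_integral_def
    proof (rule sphere_mean_mono)
      show "continuous_on (sphere 0 1) (\<lambda>\<zeta>. poisson (g 0) \<zeta> * v \<zeta>)"
        by (intro continuous_on_mult vs continuous_on_poisson_compose continuous_on_const continuous_on_id) (use g0 in auto)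
      show "continuous_on (sphere 0 1) (\<lambda>\<zeta>. (1 / (1 - 2 * t / (1 + t)) ^ ?n) * v \<zeta>)"
        by (intro continuous_on_mult vs continuous_on_const)
      show "poisson (g 0) \<zeta> * v \<zeta> \<le> (1 / (1 - 2 * t / (1 + t)) ^ ?n) * v \<zeta>" if "norm \<zeta> = 1" for \<zeta>
        using P[OF that] v0 by (rule mult_right_mono)
    qed
    also have "\<dots> = (1 / (1 - 2 * t / (1 + t)) ^ ?n) * sphere_mean v" by (rule sphere_mean_cmult)
    also have "\<dots> \<le> (1 / (1 - 2 * t / (1 + t)) ^ ?n) * N"
      using N[of R] R(1,2) T by (intro mult_left_mono) (auto simp: v_def[abs_def])
    finally show "poisson_integral v (g 0) \<le> N / (1 - 2 * t / (1 + t)) ^ ?n" by simp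
    show "0 \<le> w 0" using w0[of 0] by simp
  qed auto
  finally show ?thesis by (simp add: w_def \<phi>_def)
qed

section \<open>Boundedness on Hardy spaces\<close>

lemma harmonic_on_bounded_linear:
  fixes f :: "'a::euclidean_space \<Rightarrow> 'b::real_normed_vector"
  assumes f: "harmonic_on f S" and S: "open S" and T: "bounded_linear T"
  shows "harmonic_on (\<lambda>x. T (f x)) S"
proof (rule harmonic_onE[OF f S])
  fix f' f'' assume C: "C2_derivs f f' f'' S" and 0: "\<And>x. x \<in> S \<Longrightarrow> (\<Sum>e\<in>Basis. f'' x e e) = 0"
  have lin: "linear T" by (rule bounded_linear.linear[OF T])
  show ?thesis
    unfolding harmonic_on_iff[OF C2_derivs_bounded_linear[OF C T] S]
    by (simp add: linear_sum[OF lin, symmetric] 0 linear_0[OF lin])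
qed

lemma sphere_mean_nonneg: "(\<And>z. 0 \<le> (f z :: real)) \<Longrightarrow> 0 \<le> sphere_mean f"
  unfolding sphere_mean_def set_lebesgue_integral_def by (intro integral_nonneg_AE AE_I2) (simp add: indicator_def)

lemma hp_norm_infinity: "hp_norm \<infinity> f = (SUP x\<in>ball 0 1. ereal (cmod (f x)))"
  by (simp add: hp_norm_def)

lemma hp_norm_real:
  "hp_norm (ereal q) f = (SUP r\<in>{0..<1}. ereal (sphere_mean (\<lambda>z. cmod (f (r *\<^sub>R z)) powr q) powr (1 / q)))"
  by (simp add: hp_norm_def sphere_mean_def)

lemma hp_norm_nonneg: "0 \<le> hp_norm p f"
proof (cases "p = \<infinity>")
  case True
  have "ereal 0 \<le> ereal (cmod (f 0))" by simp
  also have "\<dots> \<le> hp_norm p f" unfolding True hp_norm_infinity by (rule SUP_upper) simp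
  finally show ?thesis by (simp add: zero_ereal_def)
next
  case False
  let ?g = "\<lambda>r. ereal ((LINT z:sphere 0 1|sphere_measure. cmod (f (r *\<^sub>R z)) powr real_of_ereal p) powr (1 / real_of_ereal p))"
  have eq: "hp_norm p f = (SUP r\<in>{0..<1}. ?g r)" using False by (simp add: hp_norm_def)
  have "ereal 0 \<le> ?g 0" by simp
  also have "\<dots> \<le> hp_norm p f" unfolding eq by (rule SUP_upper) simp
  finally show ?thesis by (simp add: zero_ereal_def)
qed

lemma hp_mean_le:
  assumes q: "1 \<le> q" and m: "hp_norm (ereal q) f \<le> ereal m" and R: "0 \<le> R" "R < 1"
  shows "sphere_mean (\<lambda>z. cmod (f (R *\<^sub>R z)) powr q) \<le> m powr q"
proof -
  let ?A = "sphere_mean (\<lambda>z. cmod (f (R *\<^sub>R z)) powr q)"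
  have A: "0 \<le> ?A" by (rule sphere_mean_nonneg) simp
  have "ereal (?A powr (1 / q)) \<le> hp_norm (ereal q) f"
    unfolding hp_norm_real by (rule SUP_upper[of R]) (use R in auto)
  then have "?A powr (1 / q) \<le> m" using m by (metis ereal_less_eq(3) order_trans)
  then have "(?A powr (1 / q)) powr q \<le> m powr q" using q by (intro powr_mono2) auto
  then show ?thesis using q A by (simp add: powr_powr)
qed

text \<open>In the inversion case \<open>|\<phi> x - b| = \<bar>\<alpha>\<bar> / |x - a|\<close>, so a map with bounded image keeps the pole \<open>a\<close> away from the
  ball.\<close>

lemma moebius_weight_bounded:
  fixes L :: "'a::euclidean_space \<Rightarrow> 'a"
  assumes dim: "2 \<le> DIM('a)" and L: "orthogonal_transformation L" and eps: "\<epsilon> = 0 \<or> \<epsilon> = 2" and a: "a \<notin> ball 0 1"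
    and \<alpha>: "\<alpha> \<noteq> 0" and maps: "moebius_form a b \<alpha> L \<epsilon> ` ball 0 1 \<subseteq> ball 0 1"
  obtains K where "\<And>x. x \<in> ball 0 1 \<Longrightarrow> norm (x - a) powr (\<epsilon> * (2 - real DIM('a)) / 2) \<le> K"
  using eps
proof
  assume "\<epsilon> = 0"
  then show ?thesis by (intro that[of 1]) simp
next
  assume e: "\<epsilon> = 2"
  define \<delta> where "\<delta> = \<bar>\<alpha>\<bar> / (1 + norm b)"
  have d: "\<delta> > 0" using \<alpha> norm_ge_zero[of b] by (auto simp: \<delta>_def add_pos_nonneg)
  show ?thesis
  proof (rule that)
    fix x :: 'a assume x: "x \<in> ball 0 1"
    have n: "norm (x - a) > 0" using x a by auto
    have "norm ((\<alpha> / norm (x - a) powr 2) *\<^sub>R L (x - a)) = \<bar>\<alpha>\<bar> / norm (x - a)"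
      using n by (simp add: orthogonal_transformation_norm[OF L] power2_eq_square)
    moreover have "(\<alpha> / norm (x - a) powr 2) *\<^sub>R L (x - a) = moebius_form a b \<alpha> L \<epsilon> x - b"
      by (simp add: moebius_form_def e)
    moreover have "norm (moebius_form a b \<alpha> L \<epsilon> x - b) \<le> 1 + norm b"
    proof -
      have "norm (moebius_form a b \<alpha> L \<epsilon> x) < 1" using maps x by (auto simp: image_subset_iff)
      then show ?thesis using norm_triangle_ineq4[of "moebius_form a b \<alpha> L \<epsilon> x" b] by linarith
    qed
    ultimately have "\<bar>\<alpha>\<bar> / norm (x - a) \<le> 1 + norm b" by (simp only:)
    then have "\<bar>\<alpha>\<bar> \<le> (1 + norm b) * norm (x - a)" using n by (simp add: pos_divide_le_eq)
    then have "\<delta> \<le> norm (x - a)" unfolding \<delta>_def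
      by (subst pos_divide_le_eq) (auto simp: add_pos_nonneg mult.commute)
    then show "norm (x - a) powr (\<epsilon> * (2 - real DIM('a)) / 2) \<le> \<delta> powr (\<epsilon> * (2 - real DIM('a)) / 2)"
      using d dim e by (intro powr_mono2') auto
  qed
qed

text \<open>The image of a harmonic function is harmonic by the Kelvin transform. The norm estimate is the bounded weight
  alone for \<open>p = \<infinity>\<close>, and the estimate of spherical means for finite \<open>p\<close>.\<close>

theorem moebius_form_imp_bounded_on_hp:
  fixes \<phi> L :: "'a::euclidean_space \<Rightarrow> 'a" and \<psi> :: "'a \<Rightarrow> complex"
  assumes p: "1 \<le> p" and dim: "2 \<le> DIM('a)" and L: "orthogonal_transformation L"
    and eps: "\<epsilon> = 0 \<or> \<epsilon> = 2" and a: "a \<notin> ball 0 1" and \<alpha>: "\<alpha> \<noteq> 0"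
    and maps: "\<phi> ` ball 0 1 \<subseteq> ball 0 1"
    and phi: "\<And>x. x \<in> ball 0 1 \<Longrightarrow> \<phi> x = moebius_form a b \<alpha> L \<epsilon> x"
    and psi: "\<And>x. x \<in> ball 0 1 \<Longrightarrow> \<psi> x = c * of_real (norm (x - a) powr (\<epsilon> * (2 - real DIM('a)) / 2))"
  shows "bounded_on_hp p (weighted_comp \<phi> \<psi>)"
proof -
  define w where "w x = norm (x - a) powr (\<epsilon> * (2 - real DIM('a)) / 2)" for x
  let ?F = "moebius_form a b \<alpha> L \<epsilon>"
  have maps': "?F ` ball 0 1 \<subseteq> ball 0 1" using maps phi by (auto simp: image_subset_iff)
  obtain K where K: "\<And>x. x \<in> ball 0 1 \<Longrightarrow> w x \<le> K"
    using moebius_weight_bounded[OF dim L eps a \<alpha> maps'] unfolding w_def by metis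
  have w0: "0 \<le> w x" for x by (simp add: w_def)
  have K0: "0 \<le> K" using order_trans[OF w0 K[of 0]] by simp
  have Tn: "cmod (weighted_comp \<phi> \<psi> f x) = cmod c * (w x * cmod (f (?F x)))" if "x \<in> ball 0 1" for f x
    using that w0[of x] by (simp add: weighted_comp_def phi psi w_def[symmetric] norm_mult)
  have harm: "harmonic_on (weighted_comp \<phi> \<psi> f) (ball 0 1)" if f: "harmonic_on f (ball 0 1)" for f
  proof -
    have "harmonic_on (\<lambda>x. w x *\<^sub>R f (?F x)) (ball 0 1)"
      unfolding w_def by (rule harmonic_on_moebius_form[OF f open_ball open_ball a L eps maps'])
    from harmonic_on_bounded_linear[OF this open_ball bounded_linear_mult_right]
    have "harmonic_on (\<lambda>x. c * (w x *\<^sub>R f (?F x))) (ball 0 1)" .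
    then show ?thesis
      by (rule harmonic_on_cong[OF _ open_ball]) (simp add: weighted_comp_def phi psi w_def[symmetric] scaleR_conv_of_real)
  qed
  have bound: "\<exists>C. \<forall>f\<in>hp p. hp_norm p (weighted_comp \<phi> \<psi> f) \<le> ereal C * hp_norm p f"
  proof (cases p)
    case (real q)
    then have q: "1 \<le> q" using p by (simp add: one_ereal_def)
    define t where "t = norm (?F 0)"
    have t: "0 \<le> t" "t < 1" using maps' by (auto simp: t_def image_subset_iff)
    then have T: "2 * t / (1 + t) < 1" by (simp add: field_simps)
    define D where "D = cmod c powr q * (K powr (q - 1) * (w 0 / (1 - 2 * t / (1 + t)) ^ DIM('a)))"
    have D0: "0 \<le> D" unfolding D_def using w0 T by (intro mult_nonneg_nonneg divide_nonneg_nonneg) auto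
    have "hp_norm p (weighted_comp \<phi> \<psi> f) \<le> ereal (D powr (1 / q)) * hp_norm p f" if f: "f \<in> hp p" for f
    proof -
      have "hp_norm p f < \<infinity>" "hp_norm p f \<ge> 0" using f hp_norm_nonneg by (auto simp: hp_def)
      then obtain m where m: "hp_norm p f = ereal m" "0 \<le> m" by (cases "hp_norm p f") auto
      have mean: "sphere_mean (\<lambda>z. cmod (f (R *\<^sub>R z)) powr q) \<le> m powr q" if "0 \<le> R" "R < 1" for R
        using hp_mean_le[OF q _ that, of f m] m(1) real by simp
      have "sphere_mean (\<lambda>z. cmod (weighted_comp \<phi> \<psi> f (r *\<^sub>R z)) powr q) powr (1 / q) \<le> D powr (1 / q) * m"
        if r: "0 \<le> r" "r < 1" for r
      proof -
        have "sphere_mean (\<lambda>z. cmod (weighted_comp \<phi> \<psi> f (r *\<^sub>R z)) powr q)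
          = sphere_mean (\<lambda>z. cmod c powr q * (w (r *\<^sub>R z) * norm (f (?F (r *\<^sub>R z)))) powr q)"
          by (rule sphere_mean_cong) (use r w0 in \<open>simp add: Tn powr_mult\<close>)
        also have "\<dots> = cmod c powr q * sphere_mean (\<lambda>z. (w (r *\<^sub>R z) * norm (f (?F (r *\<^sub>R z)))) powr q)"
          by (rule sphere_mean_cmult)
        also have "\<dots> \<le> cmod c powr q * (K powr (q - 1) * (w 0 * (m powr q / (1 - 2 * t / (1 + t)) ^ DIM('a))))"
          using moebius_weighted_mean_le[OF q L eps a maps' _ _ mean r, of K] K f
          by (intro mult_left_mono) (auto simp: hp_def w_def t_def)
        also have "\<dots> = D * m powr q" by (simp add: D_def)
        finally have "sphere_mean (\<lambda>z. cmod (weighted_comp \<phi> \<psi> f (r *\<^sub>R z)) powr q) powr (1 / q) \<le> (D * m powr q) powr (1 / q)"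
          using q by (intro powr_mono2 sphere_mean_nonneg) auto
        also have "\<dots> = D powr (1 / q) * m" using D0 m(2) q by (simp add: powr_mult powr_powr)
        finally show ?thesis .
      qed
      then show ?thesis unfolding real hp_norm_real[of q "weighted_comp \<phi> \<psi> f"] using m(1) real
        by (intro SUP_least) auto
    qed
    then show ?thesis by blast
  next
    case PInf
    have "hp_norm p (weighted_comp \<phi> \<psi> f) \<le> ereal (cmod c * K) * hp_norm p f" for f
      unfolding PInf hp_norm_infinity[of "weighted_comp \<phi> \<psi> f"]
    proof (rule SUP_least)
      fix x :: 'a assume x: "x \<in> ball 0 1"
      have "w x * cmod (f (?F x)) \<le> K * cmod (f (?F x))" using K[OF x] by (intro mult_right_mono) auto
      then have "cmod (weighted_comp \<phi> \<psi> f x) \<le> cmod c * K * cmod (f (?F x))"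
        unfolding Tn[OF x] by (simp add: mult_left_mono mult.assoc)
      then have "ereal (cmod (weighted_comp \<phi> \<psi> f x)) \<le> ereal (cmod c * K) * ereal (cmod (f (?F x)))" by simp
      also have "\<dots> \<le> ereal (cmod c * K) * hp_norm \<infinity> f"
        unfolding hp_norm_infinity using K0 maps' x
        by (intro ereal_mult_left_mono SUP_upper) (auto simp: image_subset_iff)
      finally show "ereal (cmod (weighted_comp \<phi> \<psi> f x)) \<le> ereal (cmod c * K) * hp_norm \<infinity> f" .
    qed
    then show ?thesis by blast
  next
    case MInf
    then show ?thesis using p by simp
  qed
  then obtain C where C: "\<And>f. f \<in> hp p \<Longrightarrow> hp_norm p (weighted_comp \<phi> \<psi> f) \<le> ereal C * hp_norm p f" by blast
  have "weighted_comp \<phi> \<psi> f \<in> hp p" if f: "f \<in> hp p" for f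
  proof -
    have "hp_norm p f < \<infinity>" "hp_norm p f \<ge> 0" using f hp_norm_nonneg by (auto simp: hp_def)
    then obtain m where "hp_norm p f = ereal m" by (cases "hp_norm p f") auto
    then have "hp_norm p (weighted_comp \<phi> \<psi> f) < \<infinity>" using C[OF f] by (auto intro: le_less_trans)
    then show ?thesis using harm f by (simp add: hp_def)
  qed
  then show ?thesis
    unfolding bounded_on_hp_def using bound by (auto simp: weighted_comp_def algebra_simps)
qed

section \<open>Liouville's theorem for conformal maps with harmonic weight\<close>

text \<open>The vectors \<open>e + e0\<close> and \<open>e - e0\<close> are orthogonal for \<open>e\<close> in the basis, so all diagonal entries of \<open>B\<close> agree; the
  off-diagonal ones vanish.\<close>

lemma bilinear_multiple_of_inner:
  fixes B :: "'a::euclidean_space \<Rightarrow> 'a \<Rightarrow> real"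
  assumes l: "\<And>v. linear (\<lambda>u. B u v)" "\<And>u. linear (B u)" and sym: "\<And>u v. B u v = B v u"
    and orth: "\<And>u v. u \<bullet> v = 0 \<Longrightarrow> B u v = 0" and e0: "e0 \<in> Basis"
  shows "B u v = B e0 e0 * (u \<bullet> v)"
proof -
  have diag: "B e e = B e0 e0" if "e \<in> Basis" for e
  proof -
    have "B (e + e0) (e - e0) = 0"
      using that e0 by (intro orth) (simp add: inner_add_left inner_diff_right inner_Basis)
    then show ?thesis
      by (simp add: linear_add[OF l(1)] linear_diff[OF l(2)] sym[of e0 e])
  qed
  have "B u v = (\<Sum>e\<in>Basis. \<Sum>d\<in>Basis. (u \<bullet> e) * (v \<bullet> d) * B e d)"
    by (subst linear_eq_sum_Basis[OF l(1)], subst linear_eq_sum_Basis[OF l(2)]) (simp add: sum_distrib_left mult.assoc)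
  also have "\<dots> = (\<Sum>e\<in>Basis. (u \<bullet> e) * (v \<bullet> e) * B e0 e0)"
  proof (rule sum.cong[OF refl])
    fix e :: 'a assume e: "e \<in> Basis"
    have "(\<Sum>d\<in>Basis. (u \<bullet> e) * (v \<bullet> d) * B e d) = (\<Sum>d\<in>Basis. if d = e then (u \<bullet> e) * (v \<bullet> e) * B e0 e0 else 0)"
      by (rule sum.cong[OF refl]) (use e orth diag in \<open>auto simp: inner_Basis\<close>)
    then show "(\<Sum>d\<in>Basis. (u \<bullet> e) * (v \<bullet> d) * B e d) = (u \<bullet> e) * (v \<bullet> e) * B e0 e0" using e by simp
  qed
  also have "\<dots> = B e0 e0 * (u \<bullet> v)" by (subst (3) euclidean_inner) (simp add: sum_distrib_left mult.commute)
  finally show ?thesis .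
qed

text \<open>The third direction is what Liouville's theorem requires of the dimension: in the plane every injective
  holomorphic map is conformal.\<close>

lemma exists_orthogonal_to_pair:
  fixes u v :: "'a::euclidean_space"
  assumes "3 \<le> DIM('a)"
  obtains w where "w \<noteq> 0" "w \<bullet> u = 0" "w \<bullet> v = 0"
proof -
  have "dim {u, v} \<le> card {u, v}" by (rule dim_le_card') simp
  also have "\<dots> \<le> 2" by (simp add: card_insert_if)
  finally have "dim {u, v} < DIM('a)" using assms by simp
  from orthogonal_to_subspace_exists[OF this] obtain w where "w \<noteq> 0" "\<And>y. y \<in> span {u, v} \<Longrightarrow> orthogonal w y" by blast
  then show ?thesis using that[of w] by (simp add: orthogonal_def span_base)
qed

lemma eq_of_zero_derivative:
  fixes f :: "'a::euclidean_space \<Rightarrow> 'b::euclidean_space"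
  assumes U: "open U" "connected U" and f: "\<And>x. x \<in> U \<Longrightarrow> (f has_derivative (\<lambda>w. 0)) (at x)"
    and x: "x \<in> U" and y: "y \<in> U"
  shows "f x = f y"
proof -
  have "f constant_on U"
  proof (rule has_derivative_zero_connected_constant_on[of U "{}" f])
    show "continuous_on U f"
      using f has_derivative_continuous by (intro continuous_at_imp_continuous_on) blast
    show "\<forall>x\<in>U - {}. (f has_derivative (\<lambda>w. 0)) (at x within U)"
      using f by (intro ballI has_derivative_at_withinI[OF f]) simp
  qed (use U in auto)
  then show ?thesis using x y unfolding constant_on_def by metis
qed

text \<open>The map \<open>\<phi>\<close> pulls the Euclidean metric back to \<open>1 / \<rho>\<^sup>2\<close> times itself. The equation \<open>flat\<close> says that
  \<open>\<rho> powr ((2 - n) / 2)\<close> is harmonic, that is, that this conformal metric has scalar curvature 0.\<close>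

locale conformal_flat =
  fixes \<phi> :: "'a::euclidean_space \<Rightarrow> 'a" and \<phi>' \<phi>'' and \<rho> :: "'a \<Rightarrow> real" and \<rho>' \<rho>'' and U
  assumes dim: "3 \<le> DIM('a)" and U: "open U" "connected U" "U \<noteq> {}"
    and P: "C2_derivs \<phi> \<phi>' \<phi>'' U" and R: "C2_derivs \<rho> \<rho>' \<rho>'' U"
    and pos: "\<And>x. x \<in> U \<Longrightarrow> \<rho> x > 0"
    and conf: "\<And>x u v. x \<in> U \<Longrightarrow> \<phi>' x u \<bullet> \<phi>' x v = (u \<bullet> v) / (\<rho> x)\<^sup>2"
    and flat: "\<And>x. x \<in> U \<Longrightarrow> \<rho> x * (\<Sum>e\<in>Basis. \<rho>'' x e e) = real DIM('a) / 2 * (\<Sum>e\<in>Basis. (\<rho>' x e)\<^sup>2)"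
begin

lemma linP: "x \<in> U \<Longrightarrow> linear (\<phi>' x)" by (rule linear_deriv1[OF P])
lemma linR: "x \<in> U \<Longrightarrow> linear (\<rho>' x)" by (rule linear_deriv1[OF R])

definition grad :: "'a \<Rightarrow> 'a" where "grad x = (\<Sum>e\<in>Basis. \<rho>' x e *\<^sub>R e)"

lemma grad_inner: "x \<in> U \<Longrightarrow> grad x \<bullet> v = \<rho>' x v"
  unfolding grad_def inner_sum_left
  by (subst linear_eq_sum_Basis[OF linR, of x v]) (auto intro!: sum.cong simp: inner_commute)

lemma grad_sq: "x \<in> U \<Longrightarrow> grad x \<bullet> grad x = (\<Sum>e\<in>Basis. (\<rho>' x e)\<^sup>2)"
  by (subst euclidean_inner) (simp add: grad_inner power2_eq_square)

lemma surjP: assumes x: "x \<in> U" shows "surj (\<phi>' x)"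
proof -
  have "v = 0" if "\<phi>' x v = 0" for v
    using conf[OF x, of v v] that pos[OF x] by simp
  then show ?thesis using linear_injective_imp_surjective[OF linP[OF x]] linear_injective_0[OF linP[OF x]] by blast
qed

text \<open>Up to the factor \<open>1 / \<rho>\<close>, the image under \<open>\<phi>'\<close> of the Christoffel symbols of the conformal metric.\<close>

definition H :: "'a \<Rightarrow> 'a \<Rightarrow> 'a \<Rightarrow> 'a" where
  "H x u v = (u \<bullet> v) *\<^sub>R (\<Sum>e\<in>Basis. \<rho>' x e *\<^sub>R \<phi>' x e) - \<rho>' x u *\<^sub>R \<phi>' x v - \<rho>' x v *\<^sub>R \<phi>' x u"

lemma phi_grad: "x \<in> U \<Longrightarrow> \<phi>' x (grad x) = (\<Sum>e\<in>Basis. \<rho>' x e *\<^sub>R \<phi>' x e)"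
  unfolding grad_def by (simp add: linear_sum[OF linP] linear_scale[OF linP])

text \<open>Differentiating the conformality relation gives the sums \<open>\<phi>'' x u w \<bullet> \<phi>' x v + \<phi>' x u \<bullet> \<phi>'' x v w\<close>. Permuting
  the three directions and using the symmetry of \<open>\<phi>''\<close> isolates \<open>\<phi>'' x u v \<bullet> \<phi>' x w\<close>, as for the Levi-Civita connection.\<close>

lemma second_derivative:
  assumes x: "x \<in> U"
  shows "\<phi>'' x u v = (1 / \<rho> x) *\<^sub>R H x u v"
proof -
  have c: "\<phi>'' x u w \<bullet> \<phi>' x v + \<phi>' x u \<bullet> \<phi>'' x v w = - 2 * (u \<bullet> v) * \<rho>' x w / (\<rho> x) ^ 3" for u v w
  proof -
    have 1: "((\<lambda>y. \<phi>' y u \<bullet> \<phi>' y v) has_derivative (\<lambda>w. \<phi>' x u \<bullet> \<phi>'' x v w + \<phi>'' x u w \<bullet> \<phi>' x v)) (at x)"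
      by (intro has_derivative_inner C2_derivsD(2)[OF P x])
    have r: "((\<lambda>y. inverse (\<rho> y)) has_derivative (\<lambda>w. - (inverse (\<rho> x) * \<rho>' x w * inverse (\<rho> x)))) (at x)"
      using pos[OF x] by (intro Deriv.has_derivative_inverse C2_derivsD(1)[OF R x]) auto
    have "((\<lambda>y. (u \<bullet> v) * (inverse (\<rho> y) * inverse (\<rho> y))) has_derivative
        (\<lambda>w. (u \<bullet> v) * (inverse (\<rho> x) * - (inverse (\<rho> x) * \<rho>' x w * inverse (\<rho> x)) + - (inverse (\<rho> x) * \<rho>' x w * inverse (\<rho> x)) * inverse (\<rho> x)))) (at x)"
      by (intro has_derivative_mult_right has_derivative_mult r)
    then have 2: "((\<lambda>y. \<phi>' y u \<bullet> \<phi>' y v) has_derivative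
        (\<lambda>w. (u \<bullet> v) * (inverse (\<rho> x) * - (inverse (\<rho> x) * \<rho>' x w * inverse (\<rho> x)) + - (inverse (\<rho> x) * \<rho>' x w * inverse (\<rho> x)) * inverse (\<rho> x)))) (at x)"
      by (rule has_derivative_transform_within_open[OF _ U(1) x]) (simp add: conf field_simps power2_eq_square)
    from fun_cong[OF has_derivative_unique[OF 1 2], of w] show ?thesis
      using pos[OF x] by (simp add: field_simps power3_eq_cube)
  qed
  have sym: "\<phi>'' x u v = \<phi>'' x v u" for u v by (rule symmetric_second_derivative[OF P U(1) x])
  have "(\<phi>'' x u v - (1 / \<rho> x) *\<^sub>R H x u v) \<bullet> \<phi>' x w = 0" for w
  proof -
    have "2 * (\<phi>'' x u v \<bullet> \<phi>' x w) = (\<phi>'' x v u \<bullet> \<phi>' x w + \<phi>' x v \<bullet> \<phi>'' x w u) + (\<phi>'' x u v \<bullet> \<phi>' x w + \<phi>' x u \<bullet> \<phi>'' x w v)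
        - (\<phi>'' x u w \<bullet> \<phi>' x v + \<phi>' x u \<bullet> \<phi>'' x v w)"
      by (simp add: sym[of v u] sym[of w u] sym[of w v] inner_commute)
    also have "\<dots> = - 2 / (\<rho> x) ^ 3 * ((v \<bullet> w) * \<rho>' x u + (u \<bullet> w) * \<rho>' x v - (u \<bullet> v) * \<rho>' x w)"
      unfolding c by (simp add: algebra_simps diff_divide_distrib add_divide_distrib)
    also have "\<dots> = 2 * (- 1 / (\<rho> x) ^ 3 * ((v \<bullet> w) * \<rho>' x u + (u \<bullet> w) * \<rho>' x v - (u \<bullet> v) * \<rho>' x w))" by simp
    finally have 1: "\<phi>'' x u v \<bullet> \<phi>' x w = - 1 / (\<rho> x) ^ 3 * ((v \<bullet> w) * \<rho>' x u + (u \<bullet> w) * \<rho>' x v - (u \<bullet> v) * \<rho>' x w)"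
      by (simp only: mult_cancel_left) simp
    have Heq: "H x u v \<bullet> \<phi>' x w = ((u \<bullet> v) * \<rho>' x w - \<rho>' x u * (v \<bullet> w) - \<rho>' x v * (u \<bullet> w)) / (\<rho> x)\<^sup>2"
      unfolding H_def phi_grad[OF x, symmetric]
      by (simp add: inner_diff_left conf[OF x] grad_inner[OF x] diff_divide_distrib)
    show ?thesis unfolding inner_diff_left inner_scaleR_left 1 Heq using pos[OF x]
      by (simp add: field_simps power2_eq_square power3_eq_cube)
  qed
  then have "(\<phi>'' x u v - (1 / \<rho> x) *\<^sub>R H x u v) \<bullet> (\<phi>'' x u v - (1 / \<rho> x) *\<^sub>R H x u v) = 0"
    using surjP[OF x] by (metis surjD)
  then show ?thesis by simp
qed

text \<open>The right-hand side of \<open>second_derivative\<close> involves first derivatives only, and \<open>\<phi>\<close> and \<open>\<rho>\<close> are \<open>C\<^sup>2\<close>; so \<open>\<phi>\<close>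
  has a third derivative. In mutually orthogonal directions the terms with inner products drop out of its
  value.\<close>

lemma C2_derivs_derivative:
  obtains T where "C2_derivs (\<lambda>y. \<phi>' y i) (\<lambda>y. \<phi>'' y i) T U"
    "\<And>x v w. x \<in> U \<Longrightarrow> i \<bullet> v = 0 \<Longrightarrow> i \<bullet> w = 0 \<Longrightarrow> v \<bullet> w = 0 \<Longrightarrow>
       T x v w = (1 / \<rho> x) *\<^sub>R (- \<rho>'' x i w *\<^sub>R \<phi>' x v - \<rho>' x i *\<^sub>R \<phi>'' x v w - \<rho>'' x v w *\<^sub>R \<phi>' x i - \<rho>' x v *\<^sub>R \<phi>'' x i w - \<rho>' x w *\<^sub>R \<phi>'' x i v)"
proof -
  define H' where "H' x v w = (i \<bullet> v) *\<^sub>R (\<Sum>e\<in>Basis. \<rho>' x e *\<^sub>R \<phi>'' x e w + \<rho>'' x e w *\<^sub>R \<phi>' x e)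
      - (\<rho>' x i *\<^sub>R \<phi>'' x v w + \<rho>'' x i w *\<^sub>R \<phi>' x v) - (\<rho>' x v *\<^sub>R \<phi>'' x i w + \<rho>'' x v w *\<^sub>R \<phi>' x i)" for x v w
  define T where "T x v w = inverse (\<rho> x) *\<^sub>R H' x v w + (- (inverse (\<rho> x) * \<rho>' x w * inverse (\<rho> x))) *\<^sub>R H x i v" for x v w
  have "C2_derivs (\<lambda>y. \<phi>' y i) (\<lambda>y. \<phi>'' y i) T U"
    unfolding C2_derivs_def
  proof (intro conjI ballI allI)
    fix x assume x: "x \<in> U"
    show "((\<lambda>y. \<phi>' y i) has_derivative \<phi>'' x i) (at x)" by (rule C2_derivsD(2)[OF P x])
    fix v
    have r: "((\<lambda>y. inverse (\<rho> y)) has_derivative (\<lambda>w. - (inverse (\<rho> x) * \<rho>' x w * inverse (\<rho> x)))) (at x)"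
      using pos[OF x] by (intro Deriv.has_derivative_inverse C2_derivsD(1)[OF R x]) auto
    have "((\<lambda>y. H y i v) has_derivative H' x v) (at x)"
      unfolding H_def H'_def
      by (intro has_derivative_diff has_derivative_scaleR_right has_derivative_sum has_derivative_scaleR
          C2_derivsD(2)[OF P x] C2_derivsD(2)[OF R x])
    from has_derivative_scaleR[OF r this]
    have "((\<lambda>y. inverse (\<rho> y) *\<^sub>R H y i v) has_derivative T x v) (at x)" unfolding T_def .
    then show "((\<lambda>y. \<phi>'' y i v) has_derivative T x v) (at x)"
      by (rule has_derivative_transform_within_open[OF _ U(1) x]) (simp add: second_derivative inverse_eq_divide)
  next
    fix v w
    have "continuous_on U (\<lambda>x. inverse (\<rho> x))"
      using pos by (intro continuous_on_inverse C2_derivs_continuous(1)[OF R]) force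
    then show "continuous_on U (\<lambda>x. T x v w)"
      unfolding T_def H_def H'_def
      by (intro continuous_on_add continuous_on_diff continuous_on_scaleR continuous_on_sum continuous_on_mult continuous_on_minus
          continuous_on_const C2_derivs_continuous(2)[OF P] C2_derivs_continuous(2)[OF R] C2_derivsD(3)[OF P] C2_derivsD(3)[OF R])
  qed
  then show ?thesis
  proof (rule that)
    fix x v w assume x: "x \<in> U" and o: "i \<bullet> v = 0" "i \<bullet> w = 0" "v \<bullet> w = 0"
    show "T x v w = (1 / \<rho> x) *\<^sub>R (- \<rho>'' x i w *\<^sub>R \<phi>' x v - \<rho>' x i *\<^sub>R \<phi>'' x v w - \<rho>'' x v w *\<^sub>R \<phi>' x i - \<rho>' x v *\<^sub>R \<phi>'' x i w - \<rho>' x w *\<^sub>R \<phi>'' x i v)"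
      unfolding T_def H'_def o(1) second_derivative[OF x, of i v] using pos[OF x]
      by (simp add: algebra_simps inverse_eq_divide)
  qed
qed

lemma symP: "x \<in> U \<Longrightarrow> \<phi>'' x u v = \<phi>'' x v u" by (rule symmetric_second_derivative[OF P U(1)])
lemma symR: "x \<in> U \<Longrightarrow> \<rho>'' x u v = \<rho>'' x v u" by (rule symmetric_second_derivative[OF R U(1)])

text \<open>For \<open>k\<close> orthogonal to \<open>i\<close> and \<open>j\<close> the symmetry of the third derivative of \<open>\<phi>\<close> in \<open>j\<close> and \<open>k\<close> reduces to
  \<open>\<rho>'' x i k *\<^sub>R \<phi>' x j = \<rho>'' x i j *\<^sub>R \<phi>' x k\<close>. As \<open>\<phi>' x j\<close> is orthogonal to \<open>\<phi>' x k\<close>, the inner product with the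
  latter gives the claim.\<close>

lemma hessian_orthogonal:
  assumes x: "x \<in> U" and ij: "i \<bullet> j = 0"
  shows "\<rho>'' x i j = 0"
proof -
  obtain k where k: "k \<noteq> 0" "k \<bullet> i = 0" "k \<bullet> j = 0" using exists_orthogonal_to_pair[OF dim] by metis
  have o: "i \<bullet> k = 0" "j \<bullet> k = 0" "j \<bullet> i = 0" using k ij by (auto simp: inner_commute)
  obtain T where T: "C2_derivs (\<lambda>y. \<phi>' y i) (\<lambda>y. \<phi>'' y i) T U"
    and T2: "\<And>x v w. x \<in> U \<Longrightarrow> i \<bullet> v = 0 \<Longrightarrow> i \<bullet> w = 0 \<Longrightarrow> v \<bullet> w = 0 \<Longrightarrow>
       T x v w = (1 / \<rho> x) *\<^sub>R (- \<rho>'' x i w *\<^sub>R \<phi>' x v - \<rho>' x i *\<^sub>R \<phi>'' x v w - \<rho>'' x v w *\<^sub>R \<phi>' x i - \<rho>' x v *\<^sub>R \<phi>'' x i w - \<rho>' x w *\<^sub>R \<phi>'' x i v)"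
    using C2_derivs_derivative[of i] by blast
  have eq: "T x j k = T x k j" by (rule symmetric_second_derivative[OF T U(1) x])
  have ne: "1 / \<rho> x \<noteq> 0" using pos[OF x] by simp
  have "- \<rho>'' x i k *\<^sub>R \<phi>' x j - \<rho>' x i *\<^sub>R \<phi>'' x j k - \<rho>'' x j k *\<^sub>R \<phi>' x i - \<rho>' x j *\<^sub>R \<phi>'' x i k - \<rho>' x k *\<^sub>R \<phi>'' x i j
      = - \<rho>'' x i j *\<^sub>R \<phi>' x k - \<rho>' x i *\<^sub>R \<phi>'' x k j - \<rho>'' x k j *\<^sub>R \<phi>' x i - \<rho>' x k *\<^sub>R \<phi>'' x i j - \<rho>' x j *\<^sub>R \<phi>'' x i k"
    using eq ne unfolding T2[OF x ij o(1,2)] T2[OF x o(1) ij k(3)] scaleR_cancel_left by blast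
  then have "\<rho>'' x i k *\<^sub>R \<phi>' x j = \<rho>'' x i j *\<^sub>R \<phi>' x k"
    by (simp add: symP[OF x, of k j] symR[OF x, of k j] algebra_simps)
  then have "(\<rho>'' x i k *\<^sub>R \<phi>' x j) \<bullet> \<phi>' x k = (\<rho>'' x i j *\<^sub>R \<phi>' x k) \<bullet> \<phi>' x k" by simp
  then show ?thesis using o k pos[OF x] by (simp add: conf[OF x])
qed

definition \<sigma> :: "'a \<Rightarrow> real" where "\<sigma> x = (grad x \<bullet> grad x) / (2 * \<rho> x)"

text \<open>By the previous lemma the Hessian is a multiple of the inner product. Its trace is given by \<open>flat\<close>, which
  determines the factor.\<close>

lemma hessian:
  assumes x: "x \<in> U"
  shows "\<rho>'' x u v = \<sigma> x * (u \<bullet> v)"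
proof -
  obtain e0 :: 'a where e0: "e0 \<in> Basis" using nonempty_Basis by blast
  note B = bilinear_multiple_of_inner[of "\<rho>'' x", OF linear_deriv2_left[OF R x U(1)] linear_deriv2_right[OF R x]
      symR[OF x] hessian_orthogonal[OF x] e0]
  have "(\<Sum>e\<in>Basis. \<rho>'' x e e) = (\<Sum>e\<in>(Basis::'a set). \<rho>'' x e0 e0)"
  proof (rule sum.cong[OF refl])
    fix e :: 'a assume "e \<in> Basis"
    then show "\<rho>'' x e e = \<rho>'' x e0 e0" using B[of e e] by simp
  qed
  then have "\<rho> x * (real DIM('a) * \<rho>'' x e0 e0) = real DIM('a) / 2 * (grad x \<bullet> grad x)"
    using flat[OF x] grad_sq[OF x] by simp
  then have "real DIM('a) * (\<rho> x * \<rho>'' x e0 e0) = real DIM('a) * (grad x \<bullet> grad x / 2)" by (simp add: mult_ac)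
  then have "\<rho> x * \<rho>'' x e0 e0 = grad x \<bullet> grad x / 2" using dim by (subst (asm) mult_left_cancel) auto
  then have "\<rho>'' x e0 e0 = \<sigma> x" using pos[OF x] by (simp add: \<sigma>_def field_simps)
  then show ?thesis using B[of u v] by (simp only:)
qed

lemma grad_derivative:
  assumes x: "x \<in> U"
  shows "(grad has_derivative (\<lambda>w. \<sigma> x *\<^sub>R w)) (at x)"
proof -
  have "(grad has_derivative (\<lambda>w. \<Sum>e\<in>Basis. \<rho>'' x e w *\<^sub>R e)) (at x)"
    unfolding grad_def by (intro has_derivative_sum has_derivative_scaleR_left C2_derivsD(2)[OF R x])
  moreover have "(\<lambda>w. \<Sum>e\<in>Basis. \<rho>'' x e w *\<^sub>R e) = (\<lambda>w. \<sigma> x *\<^sub>R w)"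
  proof
    fix w :: 'a
    have "\<sigma> x *\<^sub>R w = (\<Sum>e\<in>Basis. \<sigma> x *\<^sub>R (w \<bullet> e) *\<^sub>R e)"
      by (simp only: scaleR_sum_right[symmetric] euclidean_representation)
    then show "(\<Sum>e\<in>Basis. \<rho>'' x e w *\<^sub>R e) = \<sigma> x *\<^sub>R w" by (simp add: hessian[OF x] inner_commute)
  qed
  ultimately show ?thesis by simp
qed

lemma const_of_zero_derivative:
  fixes f :: "'a \<Rightarrow> 'b::euclidean_space"
  assumes "\<And>x. x \<in> U \<Longrightarrow> (f has_derivative (\<lambda>w. 0)) (at x)" "x \<in> U" "y \<in> U"
  shows "f x = f y"
  by (rule eq_of_zero_derivative[OF U(1,2) assms])

text \<open>The derivative of \<open>\<sigma>\<close> is computed with \<open>grad_derivative\<close>; its two terms cancel.\<close>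

lemma sigma_const: "x \<in> U \<Longrightarrow> y \<in> U \<Longrightarrow> \<sigma> x = \<sigma> y"
proof (rule const_of_zero_derivative[of \<sigma>])
  fix x assume x: "x \<in> U"
  have r: "((\<lambda>y. inverse (\<rho> y)) has_derivative (\<lambda>w. - (inverse (\<rho> x) * \<rho>' x w * inverse (\<rho> x)))) (at x)"
    using pos[OF x] by (intro Deriv.has_derivative_inverse C2_derivsD(1)[OF R x]) auto
  have "((\<lambda>y. (grad y \<bullet> grad y) * inverse (\<rho> y)) has_derivative
      (\<lambda>w. (grad x \<bullet> grad x) * - (inverse (\<rho> x) * \<rho>' x w * inverse (\<rho> x)) + (grad x \<bullet> \<sigma> x *\<^sub>R w + \<sigma> x *\<^sub>R w \<bullet> grad x) * inverse (\<rho> x))) (at x)"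
    by (intro has_derivative_mult has_derivative_inner grad_derivative x r)
  from has_derivative_mult_right[OF this, of "1/2"]
  have "((\<lambda>y. 1/2 * ((grad y \<bullet> grad y) * inverse (\<rho> y))) has_derivative
     (\<lambda>w. 1/2 * ((grad x \<bullet> grad x) * - (inverse (\<rho> x) * \<rho>' x w * inverse (\<rho> x)) + (grad x \<bullet> \<sigma> x *\<^sub>R w + \<sigma> x *\<^sub>R w \<bullet> grad x) * inverse (\<rho> x)))) (at x)" .
  moreover have "(\<lambda>y. 1/2 * ((grad y \<bullet> grad y) * inverse (\<rho> y))) = \<sigma>" by (simp add: fun_eq_iff \<sigma>_def field_simps)
  moreover have "1/2 * ((grad x \<bullet> grad x) * - (inverse (\<rho> x) * \<rho>' x w * inverse (\<rho> x)) + (grad x \<bullet> \<sigma> x *\<^sub>R w + \<sigma> x *\<^sub>R w \<bullet> grad x) * inverse (\<rho> x)) = 0" for w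
    using pos[OF x] by (simp add: inner_commute[of w] grad_inner[OF x] \<sigma>_def field_simps)
  ultimately show "(\<sigma> has_derivative (\<lambda>w. 0)) (at x)" by (simp only:)
qed

lemma affine_case:
  assumes s: "\<And>x. x \<in> U \<Longrightarrow> \<sigma> x = 0"
  obtains b \<alpha> L where "\<alpha> > 0" "orthogonal_transformation L" "\<And>x. x \<in> U \<Longrightarrow> \<phi> x = b + \<alpha> *\<^sub>R L x" "\<And>x. x \<in> U \<Longrightarrow> \<rho> x = 1 / \<alpha>"
proof -
  obtain x0 where x0: "x0 \<in> U" using U(3) by blast
  have g0: "grad x = 0" if "x \<in> U" for x using s[OF that] pos[OF that] by (simp add: \<sigma>_def)
  have r0: "\<rho>' x v = 0" if "x \<in> U" for x v using g0[OF that] grad_inner[OF that, of v] by simp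
  have rho: "\<rho> x = \<rho> x0" if "x \<in> U" for x
  proof (rule const_of_zero_derivative[of "\<rho>", OF _ that x0])
    fix x assume x: "x \<in> U"
    have "\<rho>' x = (\<lambda>w. 0)" using r0[OF x] by auto
    then show "(\<rho> has_derivative (\<lambda>w. 0)) (at x)" using C2_derivsD(1)[OF R x] by simp
  qed
  have p0: "\<phi>'' x u v = 0" if "x \<in> U" for x u v
    using second_derivative[OF that] r0[OF that] by (simp add: H_def)
  have phi': "\<phi>' x u = \<phi>' x0 u" if "x \<in> U" for x u
  proof (rule const_of_zero_derivative[of "\<lambda>x. \<phi>' x u", OF _ that x0])
    fix x assume x: "x \<in> U"
    have "\<phi>'' x u = (\<lambda>w. 0)" using p0[OF x] by auto
    then show "((\<lambda>x. \<phi>' x u) has_derivative (\<lambda>w. 0)) (at x)" using C2_derivsD(2)[OF P x, of u] by simp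
  qed
  have bl: "bounded_linear (\<phi>' x0)" using linP[OF x0] linear_conv_bounded_linear by blast
  have phi: "\<phi> x - \<phi>' x0 x = \<phi> x0 - \<phi>' x0 x0" if "x \<in> U" for x
  proof (rule const_of_zero_derivative[of "\<lambda>x. \<phi> x - \<phi>' x0 x", OF _ that x0])
    fix x assume x: "x \<in> U"
    have "((\<lambda>x. \<phi> x - \<phi>' x0 x) has_derivative (\<lambda>w. \<phi>' x w - \<phi>' x0 w)) (at x)"
      by (intro has_derivative_diff C2_derivsD(1)[OF P x] bounded_linear_imp_has_derivative bl)
    then show "((\<lambda>x. \<phi> x - \<phi>' x0 x) has_derivative (\<lambda>w. 0)) (at x)" by (simp add: phi'[OF x])
  qed
  have rp: "\<rho> x0 > 0" by (rule pos[OF x0])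
  show ?thesis
  proof (rule that[of "1 / \<rho> x0" "\<lambda>v. \<rho> x0 *\<^sub>R \<phi>' x0 v" "\<phi> x0 - \<phi>' x0 x0"])
    show "orthogonal_transformation (\<lambda>v. \<rho> x0 *\<^sub>R \<phi>' x0 v)"
      unfolding orthogonal_transformation_def
      using rp linP[OF x0] by (auto simp: conf[OF x0] power2_eq_square intro: linear_compose_scale_right)
    show "\<phi> x = \<phi> x0 - \<phi>' x0 x0 + (1 / \<rho> x0) *\<^sub>R \<rho> x0 *\<^sub>R \<phi>' x0 x" if "x \<in> U" for x
      using phi[OF that] rp by (simp add: algebra_simps)
  qed (use rp rho in auto)
qed

text \<open>As the gradient of \<open>\<rho>\<close> has derivative \<open>s\<close> times the identity, it is \<open>s (x - a)\<close>, and the definition of \<open>\<sigma>\<close> gives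
  \<open>\<rho> = s / 2 * |x - a|\<^sup>2\<close>. Then \<open>b\<close> and the linear map are found as first integrals: expressions in \<open>\<phi>\<close> and
  \<open>\<phi>'\<close> that would be constant for an inversion, and are constant by the formula for \<open>\<phi>''\<close>.\<close>

lemma inversion_case:
  assumes s: "\<And>x. x \<in> U \<Longrightarrow> \<sigma> x = s" and s0: "s \<noteq> 0"
  obtains a b \<alpha> L where "a \<notin> U" "\<alpha> > 0" "orthogonal_transformation L" 
    "\<And>x. x \<in> U \<Longrightarrow> \<phi> x = b + (\<alpha> / (norm (x - a))\<^sup>2) *\<^sub>R L (x - a)" "\<And>x. x \<in> U \<Longrightarrow> \<rho> x = (norm (x - a))\<^sup>2 / \<alpha>"
proof -
  obtain x0 where x0: "x0 \<in> U" using U(3) by blast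
  have "s \<ge> 0" using s[OF x0] pos[OF x0] by (auto simp: \<sigma>_def)
  then have sp: "s > 0" using s0 by simp
  define a where "a = x0 - (1 / s) *\<^sub>R grad x0"
  have "x - (1 / s) *\<^sub>R grad x = a" if "x \<in> U" for x
    unfolding a_def
  proof (rule const_of_zero_derivative[of "\<lambda>x. x - (1 / s) *\<^sub>R grad x", OF _ that x0])
    fix x assume x: "x \<in> U"
    have "((\<lambda>x. x - (1 / s) *\<^sub>R grad x) has_derivative (\<lambda>w. w - (1 / s) *\<^sub>R (\<sigma> x *\<^sub>R w))) (at x)"
      by (intro has_derivative_diff has_derivative_ident has_derivative_scaleR_right grad_derivative x)
    then show "((\<lambda>x. x - (1 / s) *\<^sub>R grad x) has_derivative (\<lambda>w. 0)) (at x)" using sp by (simp add: s[OF x])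
  qed
  note agrad = this
  have grad: "grad x = s *\<^sub>R (x - a)" if "x \<in> U" for x
  proof -
    have "(1 / s) *\<^sub>R grad x = x - a" using agrad[OF that] by (simp add: algebra_simps)
    then have "s *\<^sub>R (1 / s) *\<^sub>R grad x = s *\<^sub>R (x - a)" by (simp only:)
    then show ?thesis using sp by simp
  qed
  have rho': "\<rho>' x w = s * ((x - a) \<bullet> w)" if "x \<in> U" for x w
    using grad_inner[OF that, of w] by (simp add: grad[OF that])
  have rho: "\<rho> x = s / 2 * ((x - a) \<bullet> (x - a))" if "x \<in> U" for x
  proof -
    have "grad x \<bullet> grad x = s * (2 * \<rho> x)" using s[OF that] pos[OF that] by (simp add: \<sigma>_def field_simps)
    moreover have "grad x \<bullet> grad x = s * (s * ((x - a) \<bullet> (x - a)))" unfolding grad[OF that] by simp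
    ultimately have "s * (s * ((x - a) \<bullet> (x - a))) = s * (2 * \<rho> x)" by (simp only:)
    then have "s * ((x - a) \<bullet> (x - a)) = 2 * \<rho> x" by (rule mult_left_cancel[THEN iffD1, rotated]) (rule s0)
    then show ?thesis by simp
  qed
  have aU: "a \<notin> U" using rho[of a] pos[of a] by auto
  have N: "(x - a) \<bullet> (x - a) > 0" if "x \<in> U" for x using that aU by auto
  have phg: "(\<Sum>e\<in>Basis. \<rho>' x e *\<^sub>R \<phi>' x e) = s *\<^sub>R \<phi>' x (x - a)" if "x \<in> U" for x
    using phi_grad[OF that] by (simp add: grad[OF that] linear_scale[OF linP[OF that]])
  have phi'': "((x - a) \<bullet> (x - a)) *\<^sub>R \<phi>'' x u w = 2 *\<^sub>R ((u \<bullet> w) *\<^sub>R \<phi>' x (x - a) - ((x - a) \<bullet> u) *\<^sub>R \<phi>' x w - ((x - a) \<bullet> w) *\<^sub>R \<phi>' x u)"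
    if x: "x \<in> U" for x u w
  proof -
    have "H x u w = s *\<^sub>R ((u \<bullet> w) *\<^sub>R \<phi>' x (x - a) - ((x - a) \<bullet> u) *\<^sub>R \<phi>' x w - ((x - a) \<bullet> w) *\<^sub>R \<phi>' x u)"
      unfolding H_def phg[OF x] unfolding rho'[OF x] by (simp add: scaleR_diff_right mult.commute)
    then have "((x - a) \<bullet> (x - a)) *\<^sub>R \<phi>'' x u w = ((x - a) \<bullet> (x - a) * (1 / \<rho> x) * s) *\<^sub>R ((u \<bullet> w) *\<^sub>R \<phi>' x (x - a) - ((x - a) \<bullet> u) *\<^sub>R \<phi>' x w - ((x - a) \<bullet> w) *\<^sub>R \<phi>' x u)"
      unfolding second_derivative[OF x] by simp
    moreover have "(x - a) \<bullet> (x - a) * (1 / \<rho> x) * s = 2" unfolding rho[OF x] using N[OF x] sp by simp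
    ultimately show ?thesis by (simp only:)
  qed
  define b where "b = \<phi> x0 + \<phi>' x0 (x0 - a)"
  \<comment> \<open>For an inversion about \<open>a\<close> the radial derivative \<open>\<phi>' x (x - a)\<close> is \<open>- (\<phi> x - b)\<close>.\<close>
  have b: "\<phi> x + \<phi>' x (x - a) = b" if "x \<in> U" for x
    unfolding b_def
  proof (rule const_of_zero_derivative[of "\<lambda>x. \<phi> x + \<phi>' x (x - a)", OF _ that x0])
    fix x assume x: "x \<in> U"
    have "((\<lambda>x. \<phi> x + (\<Sum>e\<in>Basis. ((x - a) \<bullet> e) *\<^sub>R \<phi>' x e)) has_derivative
        (\<lambda>w. \<phi>' x w + (\<Sum>e\<in>Basis. ((x - a) \<bullet> e) *\<^sub>R \<phi>'' x e w + ((w - 0) \<bullet> e) *\<^sub>R \<phi>' x e))) (at x)"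
      by (intro has_derivative_add has_derivative_sum has_derivative_scaleR has_derivative_inner_left has_derivative_diff
          has_derivative_ident has_derivative_const C2_derivsD(1)[OF P x] C2_derivsD(2)[OF P x])
    then have 1: "((\<lambda>x. \<phi> x + \<phi>' x (x - a)) has_derivative
        (\<lambda>w. \<phi>' x w + (\<Sum>e\<in>Basis. ((x - a) \<bullet> e) *\<^sub>R \<phi>'' x e w + ((w - 0) \<bullet> e) *\<^sub>R \<phi>' x e))) (at x)"
      by (rule has_derivative_transform_within_open[OF _ U(1) x]) (simp add: linear_eq_sum_Basis[OF linP, symmetric])
    have "\<phi>' x w + (\<Sum>e\<in>Basis. ((x - a) \<bullet> e) *\<^sub>R \<phi>'' x e w + ((w - 0) \<bullet> e) *\<^sub>R \<phi>' x e) = 0" for w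
    proof -
      have "(\<Sum>e\<in>Basis. ((x - a) \<bullet> e) *\<^sub>R \<phi>'' x e w + ((w - 0) \<bullet> e) *\<^sub>R \<phi>' x e) = \<phi>'' x (x - a) w + \<phi>' x w"
        unfolding sum.distrib
        using linear_eq_sum_Basis[OF linear_deriv2_left[OF P x U(1)], of "x - a" w] linear_eq_sum_Basis[OF linP[OF x], of w] by simp
      moreover have "\<phi>'' x (x - a) w = - (2 *\<^sub>R \<phi>' x w)"
      proof -
        have "((x - a) \<bullet> (x - a)) *\<^sub>R \<phi>'' x (x - a) w = ((x - a) \<bullet> (x - a)) *\<^sub>R (- (2 *\<^sub>R \<phi>' x w))"
          unfolding phi''[OF x] by (simp add: inner_commute[of w] scaleR_diff_right)
        then show ?thesis using N[OF x] by (metis less_irrefl scaleR_cancel_left)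
      qed
      ultimately show ?thesis by (simp add: scaleR_2)
    qed
    then show "((\<lambda>x. \<phi> x + \<phi>' x (x - a)) has_derivative (\<lambda>w. 0)) (at x)" using 1 by simp
  qed
  \<comment> \<open>the derivative of \<open>|x - a|\<^sup>2 *\<^sub>R (\<phi> x - b)\<close>, which for an inversion is a linear function of \<open>x - a\<close>\<close>
  define M where "M x u = (2 * ((x - a) \<bullet> u)) *\<^sub>R (\<phi> x - b) + ((x - a) \<bullet> (x - a)) *\<^sub>R \<phi>' x u" for x u
  have M: "M x u = M x0 u" if "x \<in> U" for x u
  proof (rule const_of_zero_derivative[of "\<lambda>x. M x u", OF _ that x0])
    fix x assume x: "x \<in> U"
    have "((\<lambda>x. M x u) has_derivative (\<lambda>w. ((2 * ((x - a) \<bullet> u)) *\<^sub>R (\<phi>' x w - 0) + (2 * ((w - 0) \<bullet> u)) *\<^sub>R (\<phi> x - b))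
        + (((x - a) \<bullet> (x - a)) *\<^sub>R \<phi>'' x u w + ((x - a) \<bullet> (w - 0) + (w - 0) \<bullet> (x - a)) *\<^sub>R \<phi>' x u))) (at x)"
      unfolding M_def
      by (intro has_derivative_add has_derivative_scaleR has_derivative_inner_left has_derivative_inner has_derivative_mult_right
          has_derivative_diff has_derivative_ident has_derivative_const C2_derivsD(1)[OF P x] C2_derivsD(2)[OF P x])
    moreover have "((2 * ((x - a) \<bullet> u)) *\<^sub>R (\<phi>' x w - 0) + (2 * ((w - 0) \<bullet> u)) *\<^sub>R (\<phi> x - b))
        + (((x - a) \<bullet> (x - a)) *\<^sub>R \<phi>'' x u w + ((x - a) \<bullet> (w - 0) + (w - 0) \<bullet> (x - a)) *\<^sub>R \<phi>' x u) = 0" for w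
    proof -
      have pb: "\<phi> x - b = - \<phi>' x (x - a)" using b[OF x] by (simp add: algebra_simps)
      define p q where "p = (x - a) \<bullet> u" and "q = (x - a) \<bullet> w"
      have q': "w \<bullet> (x - a) = q" by (simp add: q_def inner_commute)
      show ?thesis unfolding phi''[OF x] pb p_def[symmetric] diff_zero q' q_def[symmetric]
        by (simp add: scaleR_diff_right scaleR_2 algebra_simps inner_commute[of w u])
    qed
    ultimately show "((\<lambda>x. M x u) has_derivative (\<lambda>w. 0)) (at x)" by simp
  qed
  have Meq: "M x u = ((x - a) \<bullet> (x - a)) *\<^sub>R \<phi>' x u - (2 * ((x - a) \<bullet> u)) *\<^sub>R \<phi>' x (x - a)" if x: "x \<in> U" for x u
  proof -
    have pb: "\<phi> x - b = - \<phi>' x (x - a)" using b[OF x] by (simp add: algebra_simps)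
    show ?thesis unfolding M_def pb by simp
  qed
  define \<alpha> where "\<alpha> = 2 / s"
  have al: "\<alpha> > 0" using sp by (simp add: \<alpha>_def)
  have Minner: "M x0 u \<bullet> M x0 v = \<alpha>\<^sup>2 * (u \<bullet> v)" for u v
  proof -
    define y where "y = x0 - a"
    define n where "n = y \<bullet> y"
    have n: "n > 0" "\<rho> x0 = n / \<alpha>" using N[OF x0] rho[OF x0] by (auto simp: n_def y_def \<alpha>_def)
    have "M x0 u \<bullet> M x0 v = (n\<^sup>2 * (u \<bullet> v) - n * (2 * (y \<bullet> v)) * (u \<bullet> y) - (2 * (y \<bullet> u)) * n * (y \<bullet> v) + (2 * (y \<bullet> u)) * (2 * (y \<bullet> v)) * n) / (\<rho> x0)\<^sup>2"
      unfolding Meq[OF x0] y_def[symmetric] n_def[symmetric]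
      by (simp add: inner_diff_left inner_diff_right conf[OF x0] n_def[symmetric] power2_eq_square algebra_simps diff_divide_distrib add_divide_distrib)
    also have "\<dots> = n\<^sup>2 * (u \<bullet> v) / (\<rho> x0)\<^sup>2" by (simp add: inner_commute[of u y] algebra_simps)
    also have "\<dots> = \<alpha>\<^sup>2 * (u \<bullet> v)" unfolding n(2) using n(1) al by (simp add: power_divide)
    finally show ?thesis .
  qed
  have Mlin: "linear (M x0)"
    unfolding M_def using linP[OF x0]
    by (intro linearI) (auto simp: linear_add linear_scale inner_add_right algebra_simps)
  show ?thesis
  proof (rule that[OF aU al])
    show "orthogonal_transformation (\<lambda>v. (1 / \<alpha>) *\<^sub>R M x0 v)"
      unfolding orthogonal_transformation_def using Mlin al
      by (auto simp: Minner power2_eq_square intro: linear_compose_scale_right)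
    fix x assume x: "x \<in> U"
    show "\<rho> x = (norm (x - a))\<^sup>2 / \<alpha>" using rho[OF x] by (simp add: \<alpha>_def power2_norm_eq_inner)
    have pb: "\<phi>' x (x - a) = b - \<phi> x" using b[OF x] by (simp add: algebra_simps)
    define n where "n = (x - a) \<bullet> (x - a)"
    have "M x0 (x - a) = M x (x - a)" by (rule M[OF x, symmetric])
    also have "\<dots> = n *\<^sub>R (\<phi> x - b)"
    proof -
      have neg: "b - \<phi> x = - (\<phi> x - b)" by simp
      have "M x (x - a) = (2 * n) *\<^sub>R (\<phi> x - b) + n *\<^sub>R (- (\<phi> x - b))" unfolding M_def n_def pb neg ..
      also have "\<dots> = (2 * n - n) *\<^sub>R (\<phi> x - b)" by (simp only: scaleR_minus_right add_uminus_conv_diff scaleR_diff_left)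
      finally show ?thesis by simp
    qed
    finally have Mx: "M x0 (x - a) = n *\<^sub>R (\<phi> x - b)" .
    have "\<alpha> / n * (1 / \<alpha>) * n = 1" using N[OF x] al by (simp add: n_def)
    then have "(\<alpha> / n) *\<^sub>R (1 / \<alpha>) *\<^sub>R M x0 (x - a) = \<phi> x - b" unfolding Mx scaleR_scaleR by (simp only: mult.assoc scaleR_one)
    then show "\<phi> x = b + (\<alpha> / (norm (x - a))\<^sup>2) *\<^sub>R (1 / \<alpha>) *\<^sub>R M x0 (x - a)"
      unfolding power2_norm_eq_inner n_def[symmetric] by simp
  qed
qed

end

section \<open>Unique continuation for harmonic functions\<close>

definition moment :: "('a::euclidean_space \<Rightarrow> real) \<Rightarrow> nat \<Rightarrow> 'a \<Rightarrow> real \<Rightarrow> real"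
  where "moment f m x s = (LINT y|lborel. indicator (cball x s) y *\<^sub>R ((s\<^sup>2 - (y - x) \<bullet> (y - x)) ^ m * f y))"

text \<open>The centres range over a small ball, while the radii are limited only by the large ball on which \<open>f\<close> is
  continuous. Unlike harmonicity, this property is inherited by products with polynomials.\<close>

definition null_moments :: "'a::euclidean_space \<Rightarrow> real \<Rightarrow> real \<Rightarrow> ('a \<Rightarrow> real) \<Rightarrow> bool"
  where "null_moments z \<delta> R f \<longleftrightarrow> continuous_on (ball z R) f \<and>
     (\<forall>m x s. norm (x - z) < \<delta> \<longrightarrow> 0 < s \<longrightarrow> norm (x - z) + s < R \<longrightarrow> moment f m x s = 0)"

lemma cball_subset_ball_of_norm:
  fixes x z :: "'a::euclidean_space"
  assumes "norm (x - z) + s < R" shows "cball x s \<subseteq> ball z R"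
proof
  fix y assume "y \<in> cball x s"
  then have "norm (y - x) \<le> s" by (simp add: dist_norm norm_minus_commute)
  then have "norm (y - z) < R" using norm_triangle_ineq[of "y - x" "x - z"] assms by simp
  then show "y \<in> ball z R" by (simp add: dist_norm norm_minus_commute)
qed

text \<open>The moments of a harmonic function are multiples of its value at the centre.\<close>

lemma null_moments_of_harmonic:
  fixes f :: "'a::euclidean_space \<Rightarrow> real"
  assumes f: "harmonic_on f (ball z R)" and zero: "\<And>x. x \<in> ball z \<delta> \<Longrightarrow> f x = 0" 
  shows "null_moments z \<delta> R f"
  unfolding null_moments_def
proof (intro conjI allI impI)
  show fc: "continuous_on (ball z R) f" by (rule harmonic_on_continuous[OF f open_ball])
  fix m x s assume x: "norm (x - z) < \<delta>" and s: "0 < s" "norm (x - z) + s < R"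
  have sub: "cball x s \<subseteq> ball z R" by (rule cball_subset_ball_of_norm[OF s(2)])
  obtain R' where R': "s < R'" "ball x R' \<subseteq> ball z R" using cball_subset_open_imp_ball[OF open_ball sub] s(1) by auto
  have "(LINT y|lborel. indicator (cball 0 1) y *\<^sub>R ((1 - y \<bullet> y) ^ m *\<^sub>R f (x + s *\<^sub>R y)))
      = (LINT y|lborel. indicator (cball 0 1) (y::'a) *\<^sub>R (1 - y \<bullet> y) ^ m) *\<^sub>R f x"
    by (rule weighted_ball_mean[OF harmonic_on_subset[OF f R'(2)]]) (use s R' in simp)
  also have "f x = 0" using zero x by (simp add: dist_norm norm_minus_commute)
  finally have 0: "(LINT y|lborel. indicator (cball 0 1) y *\<^sub>R ((1 - y \<bullet> y) ^ m *\<^sub>R f (x + s *\<^sub>R y))) = 0" by simp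
  define k where "k y = indicator (cball x s) y *\<^sub>R ((s\<^sup>2 - (y - x) \<bullet> (y - x)) ^ m * f y)" for y
  have "k \<in> borel_measurable borel" unfolding k_def
    by (rule borel_measurable_continuous_on_indicator) (auto intro!: continuous_intros continuous_on_subset[OF fc sub])
  then have km: "(\<lambda>y. k (y + x)) \<in> borel_measurable borel" by measurable
  have "moment f m x s = (LINT y|lborel. k (y + x))" unfolding moment_def k_def[symmetric] by (rule integral_translate(2)[symmetric])
  also have "\<dots> = s ^ DIM('a) *\<^sub>R (LINT y|lborel. k (s *\<^sub>R y + x))" by (rule integral_lborel_scale[OF s(1) km])
  also have "(\<lambda>y. k (s *\<^sub>R y + x)) = (\<lambda>y. s ^ (2 * m) * (indicator (cball 0 1) y *\<^sub>R ((1 - y \<bullet> y) ^ m *\<^sub>R f (x + s *\<^sub>R y))))"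
  proof
    fix y :: 'a
    have "s *\<^sub>R y + x \<in> cball x s \<longleftrightarrow> y \<in> cball 0 1" using s(1) by (simp add: dist_norm)
    moreover have "(s\<^sup>2 - (s *\<^sub>R y + x - x) \<bullet> (s *\<^sub>R y + x - x)) ^ m = s ^ (2 * m) * (1 - y \<bullet> y) ^ m"
    proof -
      have "s\<^sup>2 - (s *\<^sub>R y + x - x) \<bullet> (s *\<^sub>R y + x - x) = s\<^sup>2 * (1 - y \<bullet> y)" by (simp add: power2_eq_square algebra_simps)
      then show ?thesis by (simp only: power_mult_distrib power_mult)
    qed
    ultimately show "k (s *\<^sub>R y + x) = s ^ (2 * m) * (indicator (cball 0 1) y *\<^sub>R ((1 - y \<bullet> y) ^ m *\<^sub>R f (x + s *\<^sub>R y)))"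
      unfolding k_def by (simp add: indicator_def add.commute)
  qed
  also have "(LINT y|lborel. s ^ (2 * m) * (indicator (cball 0 1) y *\<^sub>R ((1 - y \<bullet> y) ^ m *\<^sub>R f (x + s *\<^sub>R y)))) = 0"
    using 0 by (subst integral_mult_right_zero) simp
  finally show "moment f m x s = 0" by simp
qed

text \<open>The moment of order \<open>m + 1\<close> vanishes for all centres near \<open>x\<close>. Its derivative in the centre in direction \<open>v\<close> is
  \<open>2 (m + 1)\<close> times the moment of order \<open>m\<close> of \<open>(v \<bullet> (y - x)) * f y\<close>, because the weight of order \<open>m + 1\<close>
  vanishes on the boundary of the moving ball.\<close>

lemma null_moments_linear:
  fixes f :: "'a::euclidean_space \<Rightarrow> real"
  assumes f: "null_moments z \<delta> R f"
  shows "null_moments z \<delta> R (\<lambda>y. (v \<bullet> y) * f y)"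
  unfolding null_moments_def
proof (intro conjI allI impI)
  have fc: "continuous_on (ball z R) f" and f0: "\<And>m x s. norm (x - z) < \<delta> \<Longrightarrow> 0 < s \<Longrightarrow> norm (x - z) + s < R \<Longrightarrow> moment f m x s = 0"
    using f unfolding null_moments_def by auto
  show "continuous_on (ball z R) (\<lambda>y. (v \<bullet> y) * f y)" by (intro continuous_intros fc)
  fix m x s assume x: "norm (x - z) < \<delta>" and s: "0 < s" "norm (x - z) + s < R"
  define r where "r = (R - (norm (x - z) + s)) / 2"
  \<comment> \<open>For \<open>\<bar>t\<bar> < t0\<close> the centre \<open>x + t v\<close> stays within \<open>\<delta>\<close> of \<open>z\<close>, and all balls of radius \<open>s\<close> about these centres lie in the compact set \<open>C\<close> below, inside the ball on which \<open>f\<close> is continuous.\<close>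
  define t0 where "t0 = min r (\<delta> - norm (x - z)) / (norm v + 1)"
  have nv: "norm v + 1 > 0" by (simp add: add_nonneg_pos)
  have t0: "t0 > 0" using x s nv by (simp add: t0_def r_def)
  have tv: "norm (t *\<^sub>R v) < min r (\<delta> - norm (x - z))" if "\<bar>t\<bar> < t0" for t
  proof -
    have "\<bar>t\<bar> * norm v \<le> \<bar>t\<bar> * (norm v + 1)" by (intro mult_left_mono) auto
    also have "\<dots> < t0 * (norm v + 1)" using that nv by (rule mult_strict_right_mono)
    finally show ?thesis using nv by (simp add: t0_def)
  qed
  define C where "C = cball x (s + r)"
  have r0: "r > 0" using s by (simp add: r_def)
  have C: "compact C" "convex C" "C \<subseteq> ball z R"
  proof -
    show "C \<subseteq> ball z R" unfolding C_def by (rule cball_subset_ball_of_norm) (use s r0 in \<open>simp add: r_def field_simps\<close>)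
  qed (auto simp: C_def)
  have cs: "cball (x + t *\<^sub>R v) s \<subseteq> C" if "\<bar>t\<bar> < t0" for t
    using tv[OF that] unfolding C_def by (intro cball_subset_cball_iff[THEN iffD2] disjI1) (simp add: dist_norm)
  obtain M where M: "\<And>y. y \<in> C \<Longrightarrow> norm (f y) \<le> M"
    using compact_imp_bounded[OF compact_continuous_image[OF continuous_on_subset[OF fc C(3)] C(1)]]
    unfolding bounded_iff by (meson imageI)
  have "x \<in> C" using r0 s by (simp add: C_def)
  then have M0: "M \<ge> 0" using order_trans[OF norm_ge_zero M[of x]] by simp
  \<comment> \<open>The truncation replaces the moving domain of integration by a fixed one.\<close>
  define k where "k w = (max 0 (s\<^sup>2 - w \<bullet> w)) ^ Suc m" for w :: 'a
  define k' where "k' w u = (if norm w < s then real (Suc m) * (- (2 * (w \<bullet> u))) * (s\<^sup>2 - w \<bullet> w) ^ m else 0)" for w u :: 'a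
  have kd: "(k has_derivative k' w) (at w)" if "norm w \<noteq> s" for w
  proof (cases "norm w < s")
    case True
    have "((\<lambda>w. s\<^sup>2 - w \<bullet> w) has_derivative (\<lambda>u. - (2 * (w \<bullet> u)))) (at w)"
      by (auto intro!: derivative_eq_intros simp: inner_commute)
    from has_derivative_power[OF this, of "Suc m"]
    have "((\<lambda>w. (s\<^sup>2 - w \<bullet> w) ^ Suc m) has_derivative (\<lambda>u. real (Suc m) * (- (2 * (w \<bullet> u))) * (s\<^sup>2 - w \<bullet> w) ^ m)) (at w)"
      unfolding diff_Suc_1 .
    then have "((\<lambda>w. (s\<^sup>2 - w \<bullet> w) ^ Suc m) has_derivative k' w) (at w)" using True by (simp add: k'_def[abs_def])
    then show ?thesis
    proof (rule has_derivative_transform_within_open[of _ _ _ _ "ball 0 s"])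
      fix y :: 'a assume "y \<in> ball 0 s"
      then have "y \<bullet> y \<le> s\<^sup>2" using power_mono[of "norm y" s 2] by (simp add: power2_norm_eq_inner)
      then show "(s\<^sup>2 - y \<bullet> y) ^ Suc m = k y" by (simp add: k_def max_def)
    qed (use True in auto)
  next
    case False
    then have w: "norm w > s" using that by simp
    have "((\<lambda>w. 0) has_derivative k' w) (at w)" using False by (simp add: k'_def[abs_def])
    then show ?thesis
    proof (rule has_derivative_transform_within_open[of _ _ _ _ "- cball 0 s"])
      fix y :: 'a assume "y \<in> - cball 0 s"
      then have "y \<bullet> y \<ge> s\<^sup>2" using power_mono[of s "norm y" 2] s(1) by (simp add: power2_norm_eq_inner)
      then show "0 = k y" by (simp add: k_def max_def)
    qed (use w in auto)
  qed
  obtain K where K: "K \<ge> 0" "\<And>w w'. norm w \<le> s + 2 * r \<Longrightarrow> norm w' \<le> s + 2 * r \<Longrightarrow> \<bar>k w - k w'\<bar> \<le> K * norm (w - w')"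
  proof -
    define B where "B = real (Suc m) * (s\<^sup>2) ^ m"
    have g: "\<bar>a ^ Suc m - b ^ Suc m\<bar> \<le> B * \<bar>a - b\<bar>" if ab: "0 \<le> a" "a \<le> s\<^sup>2" "0 \<le> b" "b \<le> s\<^sup>2" for a b :: real
    proof -
      have "norm (a ^ Suc m - b ^ Suc m) \<le> B * norm (a - b)"
      proof (rule differentiable_bound[of "{0..s\<^sup>2}" "\<lambda>t. t ^ Suc m" "\<lambda>t h. real (Suc m) * h * t ^ m"])
        show "((\<lambda>t. t ^ Suc m) has_derivative (\<lambda>h. real (Suc m) * h * t ^ m)) (at t within {0..s\<^sup>2})" for t :: real
          using has_derivative_power[OF has_derivative_ident, of "Suc m" t "{0..s\<^sup>2}"] by simp
        show "onorm (\<lambda>h. real (Suc m) * h * t ^ m) \<le> B" if "t \<in> {0..s\<^sup>2}" for t :: real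
        proof (rule onorm_le)
          fix h :: real
          have "t ^ m \<le> (s\<^sup>2) ^ m" using that by (intro power_mono) auto
          then have "t ^ m * \<bar>h\<bar> \<le> (s\<^sup>2) ^ m * \<bar>h\<bar>" by (intro mult_right_mono) auto
          then have "real (Suc m) * (t ^ m * \<bar>h\<bar>) \<le> real (Suc m) * ((s\<^sup>2) ^ m * \<bar>h\<bar>)" by (intro mult_left_mono) auto
          moreover have "norm (real (Suc m) * h * t ^ m) = real (Suc m) * (t ^ m * \<bar>h\<bar>)"
            using that by (simp only: real_norm_def abs_mult) (simp add: mult_ac)
          ultimately show "norm (real (Suc m) * h * t ^ m) \<le> B * norm h" unfolding B_def by (simp add: mult_ac)
        qed
      qed (use ab in auto)
      then show ?thesis by simp
    qed
    have B0: "B \<ge> 0" by (simp add: B_def)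
    show ?thesis
    proof (rule that[of "B * (2 * (s + 2 * r))"])
      show "0 \<le> B * (2 * (s + 2 * r))" using B0 s r0 by simp
      fix w w' :: 'a assume w: "norm w \<le> s + 2 * r" "norm w' \<le> s + 2 * r"
      have "\<bar>k w - k w'\<bar> \<le> B * \<bar>max 0 (s\<^sup>2 - w \<bullet> w) - max 0 (s\<^sup>2 - w' \<bullet> w')\<bar>"
        unfolding k_def by (rule g) auto
      also have "\<bar>max 0 (s\<^sup>2 - w \<bullet> w) - max 0 (s\<^sup>2 - w' \<bullet> w')\<bar> \<le> \<bar>w' \<bullet> w' - w \<bullet> w\<bar>" by (auto simp: max_def)
      also have "w' \<bullet> w' - w \<bullet> w = (w' + w) \<bullet> (w' - w)" by (simp add: algebra_simps inner_commute)
      also have "\<bar>(w' + w) \<bullet> (w' - w)\<bar> \<le> norm (w' + w) * norm (w' - w)" by (rule Cauchy_Schwarz_ineq2)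
      also have "\<dots> \<le> (2 * (s + 2 * r)) * norm (w - w')"
        using norm_triangle_ineq[of w' w] w by (subst norm_minus_commute) (intro mult_right_mono, auto)
      finally show "\<bar>k w - k w'\<bar> \<le> B * (2 * (s + 2 * r)) * norm (w - w')" using B0 by (simp add: mult_left_mono mult.assoc)
    qed
  qed
  have kzero: "k w = 0" if "norm w \<ge> s" for w
    using power_mono[of s "norm w" 2] that s(1) by (simp add: k_def max_def power2_norm_eq_inner)
  have keq: "k w = (s\<^sup>2 - w \<bullet> w) ^ Suc m" if "norm w \<le> s" for w
  proof -
    have "w \<bullet> w \<le> s\<^sup>2" using power_mono[of "norm w" s 2] that by (simp add: power2_norm_eq_inner)
    then show ?thesis by (simp add: k_def max_def)
  qed
  define F where "F t y = indicator C y *\<^sub>R (k (y - (x + t *\<^sub>R v)) * f y)" for t y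
  have Fc: "continuous_on C (\<lambda>y. k (y - (x + t *\<^sub>R v)) * f y)" for t
    unfolding k_def by (intro continuous_intros continuous_on_subset[OF fc C(3)])
  have Fint: "integrable lborel (F t)" for t
    unfolding F_def by (rule borel_integrable_compact[OF C(1) Fc])
  have F0: "(LINT y|lborel. F t y) = 0" if t: "\<bar>t\<bar> < t0" for t
  proof -
    have "F t y = indicator (cball (x + t *\<^sub>R v) s) y *\<^sub>R ((s\<^sup>2 - (y - (x + t *\<^sub>R v)) \<bullet> (y - (x + t *\<^sub>R v))) ^ Suc m * f y)" for y
    proof (cases "y \<in> cball (x + t *\<^sub>R v) s")
      case True
      then have "norm (y - (x + t *\<^sub>R v)) \<le> s" by (simp add: dist_norm norm_minus_commute)
      from keq[OF this] show ?thesis using True cs[OF t] by (auto simp: F_def)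
    next
      case False
      then have "norm (y - (x + t *\<^sub>R v)) \<ge> s" by (simp add: dist_norm norm_minus_commute)
      from kzero[OF this] show ?thesis using False by (simp add: F_def)
    qed
    then have "(LINT y|lborel. F t y) = moment f (Suc m) (x + t *\<^sub>R v) s" unfolding moment_def by simp
    also have "\<dots> = 0"
    proof (rule f0[OF _ s(1)])
      have "norm (x + t *\<^sub>R v - z) \<le> norm (x - z) + norm (t *\<^sub>R v)" using norm_triangle_ineq[of "x - z" "t *\<^sub>R v"] by (simp add: algebra_simps)
      then show "norm (x + t *\<^sub>R v - z) < \<delta>" "norm (x + t *\<^sub>R v - z) + s < R"
        using tv[OF t] r0 by (auto simp: r_def field_simps)
    qed
    finally show ?thesis .
  qed
  define F' where "F' y = indicator (cball x s) y *\<^sub>R (real (Suc m) * (2 * ((y - x) \<bullet> v)) * (s\<^sup>2 - (y - x) \<bullet> (y - x)) ^ m * f y)" for y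
  have F'int: "integrable lborel F'"
    unfolding F'_def using C(3) cs[of 0] t0
    by (intro borel_integrable_compact compact_cball continuous_intros continuous_on_subset[OF fc]) auto
  have "((\<lambda>t. LINT y|lborel. F t y) has_vector_derivative (LINT y|lborel. F' y)) (at 0)"
  proof (rule has_vector_derivative_integral(2)[of t0 lborel F "\<lambda>y. indicator C y *\<^sub>R (K * norm v * M)" F', OF t0 Fint])
    show "integrable lborel (\<lambda>y. indicator C y *\<^sub>R (K * norm v * M))" by (intro borel_integrable_compact C continuous_on_const)
    show "norm (F t y - F 0 y) \<le> \<bar>t\<bar> * (indicator C y *\<^sub>R (K * norm v * M))" if t: "\<bar>t\<bar> < t0" for t y
    proof (cases "y \<in> C")
      case True
      have n: "norm (y - (x + t *\<^sub>R v)) \<le> s + 2 * r" if "\<bar>t\<bar> < t0" for t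
      proof -
        have "norm (y - x) \<le> s + r" using True by (simp add: C_def dist_norm norm_minus_commute)
        then show ?thesis using norm_triangle_ineq4[of "y - x" "t *\<^sub>R v"] tv[OF that] by (simp add: algebra_simps)
      qed
      have "\<bar>k (y - (x + t *\<^sub>R v)) - k (y - (x + 0 *\<^sub>R v))\<bar> \<le> K * norm ((y - (x + t *\<^sub>R v)) - (y - (x + 0 *\<^sub>R v)))"
        by (rule K(2)) (use n[OF t] n[of 0] t0 in auto)
      then have 1: "\<bar>k (y - (x + t *\<^sub>R v)) - k (y - (x + 0 *\<^sub>R v))\<bar> \<le> K * (\<bar>t\<bar> * norm v)" by simp
      have "norm (F t y - F 0 y) = \<bar>k (y - (x + t *\<^sub>R v)) - k (y - (x + 0 *\<^sub>R v))\<bar> * \<bar>f y\<bar>"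
        using True by (simp add: F_def abs_mult[symmetric] left_diff_distrib)
      also have "\<dots> \<le> (K * (\<bar>t\<bar> * norm v)) * M" using 1 M[OF True] K(1) by (intro mult_mono) auto
      finally show ?thesis using True by (simp add: mult_ac)
    qed (simp add: F_def)
    show "F' \<in> borel_measurable lborel" using F'int by auto
    show "AE y in lborel. ((\<lambda>t. F t y) has_vector_derivative F' y) (at 0)"
      using AE_not_in[OF sphere_null[of x s]]
    proof eventually_elim
      case (elim y)
      show ?case
      proof (cases "y \<in> C")
        case True
        have ny: "norm (y - x) \<noteq> s" using elim by (simp add: dist_norm norm_minus_commute)
        have "(k has_derivative k' (y - x)) (at ((y - x) + 0 *\<^sub>R (- v)))" using kd[OF ny] by simp
        from has_vector_derivative_along[OF this]
        have "((\<lambda>t. k (y - (x + t *\<^sub>R v))) has_vector_derivative k' (y - x) (- v)) (at 0)" by (simp add: algebra_simps)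
        then have "((\<lambda>t. k (y - (x + t *\<^sub>R v)) * f y) has_vector_derivative k' (y - x) (- v) * f y) (at 0)"
          by (rule has_vector_derivative_mult_left)
        moreover have "k' (y - x) (- v) * f y = F' y"
          using ny unfolding k'_def F'_def by (auto simp: indicator_def dist_norm norm_minus_commute)
        ultimately show ?thesis using True by (simp add: F_def)
      next
        case False
        then have "y \<notin> cball x s" using cs[of 0] t0 by auto
        then show ?thesis using False by (simp add: F_def F'_def)
      qed
    qed
  qed
  moreover have "((\<lambda>t. LINT y|lborel. F t y) has_vector_derivative 0) (at 0)"
    unfolding has_vector_derivative_def
  proof (rule has_derivative_transform_within_open[of "\<lambda>_. 0" _ _ _ "{-t0<..<t0}"])
    show "0 = (LINT y|lborel. F t y)" if "t \<in> {-t0<..<t0}" for t using F0[of t] that by auto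
  qed (use t0 in auto)
  ultimately have F'0: "(LINT y|lborel. F' y) = 0" using vector_derivative_at by metis
  have F'eq: "F' = (\<lambda>y. (2 * real (Suc m)) * (indicator (cball x s) y *\<^sub>R ((s\<^sup>2 - (y - x) \<bullet> (y - x)) ^ m * ((v \<bullet> y) * f y))
      - (v \<bullet> x) * (indicator (cball x s) y *\<^sub>R ((s\<^sup>2 - (y - x) \<bullet> (y - x)) ^ m * f y))))"
    unfolding F'_def by (rule ext) (simp add: indicator_def inner_diff_left inner_commute[of _ v] algebra_simps)
  have cxs: "cball x s \<subseteq> ball z R" using C(3) cs[of 0] t0 by auto
  have int1: "integrable lborel (\<lambda>y. indicator (cball x s) y *\<^sub>R ((s\<^sup>2 - (y - x) \<bullet> (y - x)) ^ m * ((v \<bullet> y) * f y)))"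
    by (rule borel_integrable_compact[OF compact_cball]) (intro continuous_intros continuous_on_subset[OF fc cxs])
  have int2: "integrable lborel (\<lambda>y. indicator (cball x s) y *\<^sub>R ((s\<^sup>2 - (y - x) \<bullet> (y - x)) ^ m * f y))"
    by (rule borel_integrable_compact[OF compact_cball]) (intro continuous_intros continuous_on_subset[OF fc cxs])
  have eq2: "(LINT y|lborel. (2 * real (Suc m)) * (indicator (cball x s) y *\<^sub>R ((s\<^sup>2 - (y - x) \<bullet> (y - x)) ^ m * ((v \<bullet> y) * f y))
      - (v \<bullet> x) * (indicator (cball x s) y *\<^sub>R ((s\<^sup>2 - (y - x) \<bullet> (y - x)) ^ m * f y))))
    = (2 * real (Suc m)) * (moment (\<lambda>y. (v \<bullet> y) * f y) m x s - (v \<bullet> x) * moment f m x s)"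
    unfolding moment_def using int1 int2
    by (subst integral_mult_right_zero, subst Bochner_Integration.integral_diff) (auto intro!: integrable_mult_right)
  have "(2 * real (Suc m)) * (moment (\<lambda>y. (v \<bullet> y) * f y) m x s - (v \<bullet> x) * moment f m x s) = 0"
    using F'0 unfolding F'eq eq2 .
  then show "moment (\<lambda>y. (v \<bullet> y) * f y) m x s = 0" using f0[OF x s, of m] by simp
qed

lemma integrable_moment:
  assumes f: "continuous_on (ball z R) f" and s: "norm (x - z) + s < R"
  shows "integrable lborel (\<lambda>y. indicator (cball x s) y *\<^sub>R ((s\<^sup>2 - (y - x) \<bullet> (y - x)) ^ m * f y))"
  by (rule borel_integrable_compact[OF compact_cball])
    (intro continuous_intros continuous_on_subset[OF f cball_subset_ball_of_norm[OF s]])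

lemma null_moments_polynomial:
  fixes f p :: "'a::euclidean_space \<Rightarrow> real"
  assumes p: "real_polynomial_function p" and f: "null_moments z \<delta> R f"
  shows "null_moments z \<delta> R (\<lambda>y. p y * f y)"
  using p f
proof (induction p arbitrary: f rule: real_polynomial_function.induct)
  case (linear p)
  define v where "v = (\<Sum>e\<in>Basis. p e *\<^sub>R e)"
  have "p y = v \<bullet> y" for y
    unfolding v_def inner_sum_left
    by (subst linear_eq_sum_Basis[OF bounded_linear.linear[OF linear(1)], of y]) (auto intro!: sum.cong simp: inner_commute)
  then show ?case using null_moments_linear[OF linear(2), of v] by simp
next
  case (const c)
  have "moment (\<lambda>y. c * f y) m x s = c * moment f m x s" for m x s
    unfolding moment_def by (subst integral_mult_right_zero[symmetric]) (simp add: mult_ac)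
  then show ?case using const unfolding null_moments_def by (auto intro!: continuous_intros)
next
  case (add p q)
  have n: "null_moments z \<delta> R (\<lambda>y. p y * f y)" "null_moments z \<delta> R (\<lambda>y. q y * f y)" using add by auto
  then have c: "continuous_on (ball z R) (\<lambda>y. p y * f y)" "continuous_on (ball z R) (\<lambda>y. q y * f y)"
    unfolding null_moments_def by auto
  have eq: "(p y + q y) * f y = p y * f y + q y * f y" for y by (simp add: distrib_right)
  have "moment (\<lambda>y. p y * f y + q y * f y) m x s = moment (\<lambda>y. p y * f y) m x s + moment (\<lambda>y. q y * f y) m x s"
    if "norm (x - z) + s < R" for m x s
    unfolding moment_def distrib_left scaleR_add_right
    by (rule Bochner_Integration.integral_add[OF integrable_moment[OF c(1) that] integrable_moment[OF c(2) that]])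
  then show ?case using n unfolding null_moments_def eq by (auto intro!: continuous_intros)
next
  case (mult p q)
  then show ?case using mult(3)[OF mult(4)[OF mult(5)]] by (simp add: mult.assoc)
qed

text \<open>By the Stone-Weierstrass theorem \<open>f\<close> is uniformly approximated by polynomials \<open>p\<close> on a ball; the integral of
  \<open>p * f\<close> vanishes, hence so does that of \<open>f * f\<close>.\<close>

lemma null_moments_imp_zero:
  fixes f :: "'a::euclidean_space \<Rightarrow> real"
  assumes f: "null_moments z \<delta> R f" and d: "\<delta> > 0" and y0: "y0 \<in> ball z R"
  shows "f y0 = 0"
proof (rule ccontr)
  assume ne: "f y0 \<noteq> 0"
  have fc: "continuous_on (ball z R) f" using f unfolding null_moments_def by simp
  define s where "s = (norm (y0 - z) + R) / 2"
  have s': "norm (y0 - z) < s" "s < R" using y0 by (auto simp: s_def dist_norm norm_minus_commute)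
  moreover have "0 < s" using s'(1) norm_ge_zero[of "y0 - z"] by linarith
  ultimately have s: "norm (y0 - z) < s" "s < R" "0 < s" by auto
  have sub: "cball z s \<subseteq> ball z R" using s by auto
  have fcs: "continuous_on (cball z s) f" by (rule continuous_on_subset[OF fc sub])
  have i1: "integrable lborel (\<lambda>y. indicator (cball z s) y *\<^sub>R \<bar>f y\<bar>)"
    by (rule borel_integrable_compact[OF compact_cball]) (intro continuous_intros fcs)
  have i2: "integrable lborel (\<lambda>y. indicator (cball z s) y *\<^sub>R (f y * f y))"
    by (rule borel_integrable_compact[OF compact_cball]) (intro continuous_intros fcs)
  define A where "A = (LINT y|lborel. indicator (cball z s) y *\<^sub>R \<bar>f y\<bar>)"
  have A0: "A \<ge> 0" unfolding A_def by (intro integral_nonneg_AE AE_I2) (simp add: indicator_def)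
  have "(LINT y|lborel. indicator (cball z s) y *\<^sub>R (f y * f y)) \<le> 0"
  proof (rule field_le_epsilon)
    fix e :: real assume e: "e > 0"
    define e' where "e' = e / (A + 1)"
    have e': "e' > 0" using e A0 by (simp add: e'_def)
    obtain p where p: "real_polynomial_function p" "\<And>y. y \<in> cball z s \<Longrightarrow> \<bar>f y - p y\<bar> < e'"
      using Stone_Weierstrass_real_polynomial_function[OF compact_cball fcs e'] by metis
    have np: "null_moments z \<delta> R (\<lambda>y. p y * f y)" by (rule null_moments_polynomial[OF p(1) f])
    then have "moment (\<lambda>y. p y * f y) 0 z s = 0" and pc: "continuous_on (ball z R) (\<lambda>y. p y * f y)"
      using d s unfolding null_moments_def by auto
    then have 0: "(LINT y|lborel. indicator (cball z s) y *\<^sub>R (p y * f y)) = 0" unfolding moment_def by simp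
    have i3: "integrable lborel (\<lambda>y. indicator (cball z s) y *\<^sub>R (p y * f y))"
      by (rule borel_integrable_compact[OF compact_cball continuous_on_subset[OF pc sub]])
    have "(LINT y|lborel. indicator (cball z s) y *\<^sub>R (f y * f y))
        = (LINT y|lborel. indicator (cball z s) y *\<^sub>R (f y * f y) - indicator (cball z s) y *\<^sub>R (p y * f y))"
      using 0 by (subst Bochner_Integration.integral_diff[OF i2 i3]) simp
    also have "\<dots> \<le> (LINT y|lborel. e' * (indicator (cball z s) y *\<^sub>R \<bar>f y\<bar>))"
    proof (rule integral_mono)
      show "integrable lborel (\<lambda>y. indicator (cball z s) y *\<^sub>R (f y * f y) - indicator (cball z s) y *\<^sub>R (p y * f y))"
        by (rule Bochner_Integration.integrable_diff[OF i2 i3])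
      show "integrable lborel (\<lambda>y. e' * (indicator (cball z s) y *\<^sub>R \<bar>f y\<bar>))" by (rule integrable_mult_right[OF i1])
      fix y
      show "indicator (cball z s) y *\<^sub>R (f y * f y) - indicator (cball z s) y *\<^sub>R (p y * f y) \<le> e' * (indicator (cball z s) y *\<^sub>R \<bar>f y\<bar>)"
      proof (cases "y \<in> cball z s")
        case True
        have "f y * f y - p y * f y \<le> \<bar>f y - p y\<bar> * \<bar>f y\<bar>"
          unfolding abs_mult[symmetric] left_diff_distrib by (rule abs_ge_self)
        also have "\<dots> \<le> e' * \<bar>f y\<bar>" using p(2)[OF True] by (intro mult_right_mono) auto
        finally show ?thesis using True by simp
      qed simp
    qed
    also have "\<dots> = e' * A" unfolding A_def by (rule integral_mult_right_zero)
    also have "\<dots> \<le> e" using A0 e by (simp add: e'_def field_simps)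
    finally show "(LINT y|lborel. indicator (cball z s) y *\<^sub>R (f y * f y)) \<le> 0 + e" by simp
  qed
  moreover have nn: "0 \<le> indicator (cball z s) y *\<^sub>R (f y * f y)" for y by (simp add: indicator_def)
  ultimately have "(LINT y|lborel. indicator (cball z s) y *\<^sub>R (f y * f y)) = 0"
    by (intro antisym integral_nonneg_AE AE_I2) auto
  then have ae: "AE y in lborel. indicator (cball z s) y *\<^sub>R (f y * f y) = 0"
    using integral_nonneg_eq_0_iff_AE[OF i2] nn by simp
  have "open (ball z s \<inter> f -` (- {0}))"
    by (rule continuous_open_preimage) (use sub fcs in \<open>auto intro: continuous_on_subset\<close>)
  moreover have "y0 \<in> ball z s \<inter> f -` (- {0})" using ne s by (simp add: dist_norm norm_minus_commute)
  ultimately obtain r where r: "r > 0" "ball y0 r \<subseteq> ball z s \<inter> f -` (- {0})" using open_contains_ball by metis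
  have "AE y in lborel. y \<notin> ball y0 r"
    using ae by eventually_elim (use r(2) in \<open>force simp: indicator_def\<close>)
  then have "ball y0 r \<in> null_sets lborel" by (subst AE_iff_null_sets) auto
  then have "measure lborel (ball y0 r) = 0" by (simp add: measure_eq_0_null_sets)
  then show False using content_ball_pos[OF r(1), of y0] by simp
qed

lemma harmonic_zero_on_ball:
  fixes f :: "'a::euclidean_space \<Rightarrow> real"
  assumes "harmonic_on f (ball z R)" "\<delta> > 0" "\<And>x. x \<in> ball z \<delta> \<Longrightarrow> f x = 0" "x \<in> ball z R"
  shows "f x = 0"
  using null_moments_imp_zero[OF null_moments_of_harmonic[OF assms(1,3)] assms(2,4)] .

text \<open>The interior of the zero set is relatively closed: near a limit point there is a ball that fits in \<open>S\<close>, is centred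
  in the zero set, and contains the limit point.\<close>

lemma harmonic_unique_continuation_real:
  fixes f :: "'a::euclidean_space \<Rightarrow> real"
  assumes f: "harmonic_on f S" and S: "open S" "connected S"
    and T: "open T" "T \<noteq> {}" "T \<subseteq> S" "\<And>x. x \<in> T \<Longrightarrow> f x = 0" and x: "x \<in> S"
  shows "f x = 0"
proof -
  define Z where "Z = interior {x \<in> S. f x = 0}"
  have Z: "open Z" "Z \<subseteq> {x \<in> S. f x = 0}" by (auto simp: Z_def interior_subset)
  have TZ: "T \<subseteq> Z" unfolding Z_def by (rule interior_maximal) (use T in auto)
  have clo: "y \<in> Z" if y: "y \<in> S" "y \<in> closure Z" for y
  proof -
    obtain r where r: "r > 0" "ball y r \<subseteq> S" using S(1) y(1) open_contains_ball by blast
    have "r / 3 > 0" using r(1) by simp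
    then obtain z where z: "z \<in> Z" "dist z y < r / 3" using y(2) unfolding closure_approachable by blast
    obtain \<delta> where d: "\<delta> > 0" "ball z \<delta> \<subseteq> Z" using Z(1) z(1) open_contains_ball by blast
    have "ball z (2 * r / 3) \<subseteq> ball y r"
    proof
      fix w assume "w \<in> ball z (2 * r / 3)"
      then show "w \<in> ball y r" using z(2) dist_triangle[of y w z] by (simp add: dist_commute)
    qed
    then have sub: "ball z (2 * r / 3) \<subseteq> S" using r(2) by blast
    have "f w = 0" if "w \<in> ball z (2 * r / 3)" for w
      using harmonic_zero_on_ball[OF harmonic_on_subset[OF f sub] d(1) _ that] d(2) Z(2) by blast
    then have "ball z (2 * r / 3) \<subseteq> Z" unfolding Z_def using sub by (intro interior_maximal) auto
    then show ?thesis using z(2) r(1) by auto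
  qed
  have "Z \<inter> S = {} \<or> (- closure Z) \<inter> S = {}"
  proof (rule connectedD[OF S(2)])
    show "Z \<inter> - closure Z \<inter> S = {}" using closure_subset by blast
    show "S \<subseteq> Z \<union> - closure Z" using clo by blast
  qed (use Z(1) in auto)
  moreover have "Z \<inter> S \<noteq> {}" using T TZ by blast
  ultimately show ?thesis using clo[OF x] x Z(2) by blast
qed

lemma harmonic_unique_continuation:
  fixes f :: "'a::euclidean_space \<Rightarrow> complex"
  assumes f: "harmonic_on f S" and S: "open S" "connected S"
    and T: "open T" "T \<noteq> {}" "T \<subseteq> S" "\<And>x. x \<in> T \<Longrightarrow> f x = 0" and x: "x \<in> S"
  shows "f x = 0"
proof (rule complex_eqI)
  show "Re (f x) = Re 0"
    using harmonic_unique_continuation_real[OF harmonic_on_bounded_linear[OF f S(1) bounded_linear_Re] S T(1,2,3) _ x] T(4) by simp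
  show "Im (f x) = Im 0"
    using harmonic_unique_continuation_real[OF harmonic_on_bounded_linear[OF f S(1) bounded_linear_Im] S T(1,2,3) _ x] T(4) by simp
qed

section \<open>Weighted composition operators preserving harmonicity\<close>

text \<open>All test functions used for necessity are bounded, so one argument serves every exponent.\<close>

lemma hp_of_bounded:
  fixes f :: "'a::euclidean_space \<Rightarrow> complex"
  assumes p: "1 \<le> p" and f: "harmonic_on f (ball 0 1)" and M: "\<And>x. x \<in> ball 0 1 \<Longrightarrow> cmod (f x) \<le> M"
  shows "f \<in> hp p"
proof -
  have M0: "0 \<le> M" using order_trans[OF norm_ge_zero M[of 0]] by simp
  have "hp_norm p f \<le> ereal M"
  proof (cases p)
    case (real q)
    then have q: "1 \<le> q" using p by (simp add: one_ereal_def)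
    show ?thesis unfolding real hp_norm_real
    proof (rule SUP_least)
      fix r :: real assume r: "r \<in> {0..<1}"
      have rb: "cball (0::'a) r \<subseteq> ball 0 1" using r by auto
      have c1: "continuous_on (sphere 0 1) (\<lambda>z. cmod (f (0 + r *\<^sub>R z)))"
        by (intro continuous_on_norm continuous_affine_on_sphere[OF harmonic_on_continuous[OF f open_ball] rb]) (use r in auto)
      have c: "continuous_on (sphere 0 1) (\<lambda>z. cmod (f (r *\<^sub>R z)) powr q)"
        by (rule continuous_on_powr'[OF _ continuous_on_const]) (use c1 q in auto)
      have "sphere_mean (\<lambda>z. cmod (f (r *\<^sub>R z)) powr q) \<le> sphere_mean (\<lambda>z::'a. M powr q)"
        by (rule sphere_mean_mono[OF c]) (use M r q in \<open>auto intro!: powr_mono2\<close>)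
      then have "sphere_mean (\<lambda>z. cmod (f (r *\<^sub>R z)) powr q) powr (1 / q) \<le> (M powr q) powr (1 / q)"
        using q by (intro powr_mono2 sphere_mean_nonneg) auto
      also have "\<dots> = M" using q M0 by (simp add: powr_powr)
      finally show "ereal (sphere_mean (\<lambda>z. cmod (f (r *\<^sub>R z)) powr q) powr (1 / q)) \<le> ereal M" by simp
    qed
  next
    case PInf
    show ?thesis unfolding PInf hp_norm_infinity by (rule SUP_least) (use M in simp)
  next
    case MInf
    then show ?thesis using p by simp
  qed
  then have "hp_norm p f < \<infinity>" by (auto intro: le_less_trans)
  then show ?thesis using f by (simp add: hp_def)
qed

lemma C2_derivs_inner:
  fixes u :: "'a::euclidean_space"
  shows "C2_derivs (\<lambda>x. u \<bullet> x) (\<lambda>_ w. u \<bullet> w) (\<lambda>_ _ _. 0) S"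
  using C2_derivs_linear[OF bounded_linear_inner_right[of u], of 0] by simp

lemma harmonic_on_product:
  fixes u v :: "'a::euclidean_space"
  assumes "u \<bullet> v = 0" "open S"
  shows "harmonic_on (\<lambda>x. (u \<bullet> x) * (v \<bullet> x)) S"
  unfolding harmonic_on_iff[OF C2_derivs_bilinear[OF bounded_bilinear_mult C2_derivs_inner C2_derivs_inner] assms(2)]
proof
  fix x
  have "(\<Sum>e\<in>Basis. (u \<bullet> x) * 0 + (u \<bullet> e) * (v \<bullet> e) + ((u \<bullet> e) * (v \<bullet> e) + 0 * (v \<bullet> x))) = 2 * (\<Sum>e\<in>Basis. (e \<bullet> u) * (e \<bullet> v))"
    unfolding sum_distrib_left by (rule sum.cong[OF refl]) (simp add: inner_commute)
  also have "\<dots> = 0" unfolding sum_Basis_inner assms(1) by simp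
  finally show "(\<Sum>e\<in>Basis. (u \<bullet> x) * 0 + (u \<bullet> e) * (v \<bullet> e) + ((u \<bullet> e) * (v \<bullet> e) + 0 * (v \<bullet> x))) = 0" .
qed

text \<open>Testing against functions on the image side controls \<open>A\<close> composed with its adjoint. For a square matrix that is
  a multiple of the identity, the product in the other order is the same multiple.\<close>

lemma conformal_of_adjoint_conformal:
  fixes A :: "'a::euclidean_space \<Rightarrow> 'a"
  assumes A: "linear A" and B: "\<And>u v. (\<Sum>e\<in>Basis. (A e \<bullet> u) * (A e \<bullet> v)) = \<mu> * (u \<bullet> v)" and mu: "\<mu> \<noteq> 0"
  shows "A p \<bullet> A q = \<mu> * (p \<bullet> q)"
proof -
  define T where "T = adjoint A"
  have T: "x \<bullet> T y = A x \<bullet> y" for x y unfolding T_def by (rule adjoint_works[OF A])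
  have lT: "linear T" unfolding T_def by (rule adjoint_linear[OF A])
  have TT: "T u \<bullet> T v = \<mu> * (u \<bullet> v)" for u v
  proof -
    have "T u \<bullet> b = A b \<bullet> u" for u b using T[of b u] by (simp add: inner_commute)
    then show ?thesis unfolding B[symmetric] by (subst euclidean_inner) simp
  qed
  have "inj T"
    unfolding linear_injective_0[OF lT]
  proof (intro allI impI)
    fix x assume "T x = 0"
    then show "x = 0" using TT[of x x] mu by simp
  qed
  then have "surj T" using linear_injective_imp_surjective[OF lT] by auto
  then obtain p' q' where pq: "p = T p'" "q = T q'" by (metis surjD)
  have AT: "A (T u) = \<mu> *\<^sub>R u" for u
  proof (rule vector_eq_rdot[THEN iffD1], rule allI)
    fix z show "A (T u) \<bullet> z = \<mu> *\<^sub>R u \<bullet> z" by (simp add: T[symmetric] TT)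
  qed
  show ?thesis unfolding pq AT TT by simp
qed

text \<open>By \<open>bdd\<close> the image of every bounded harmonic function is harmonic; all further conditions come from suitable
  choices of such test functions.\<close>

locale harmonic_preserving =
  fixes \<phi> :: "'a::euclidean_space \<Rightarrow> 'a" and \<phi>' \<phi>'' and \<psi> :: "'a \<Rightarrow> complex" and \<psi>' \<psi>'' and p :: ereal
  assumes dim: "3 \<le> DIM('a)" and p: "1 \<le> p"
    and maps: "\<phi> ` ball 0 1 \<subseteq> ball 0 1" and nonconst: "\<not> \<phi> constant_on ball 0 1"
    and P: "C2_derivs \<phi> \<phi>' \<phi>'' (ball 0 1)" and W: "C2_derivs \<psi> \<psi>' \<psi>'' (ball 0 1)"
    and psi_nonzero: "\<exists>x\<in>ball 0 1. \<psi> x \<noteq> 0"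
    and bdd: "\<And>f. f \<in> hp p \<Longrightarrow> weighted_comp \<phi> \<psi> f \<in> hp p"
begin

lemma linP: "x \<in> ball 0 1 \<Longrightarrow> linear (\<phi>' x)" by (rule linear_deriv1[OF P])

lemma weighted_harmonic:
  fixes g :: "'a \<Rightarrow> real"
  assumes g: "harmonic_on g (ball 0 1)" and M: "\<And>x. x \<in> ball 0 1 \<Longrightarrow> \<bar>g x\<bar> \<le> M"
  shows "harmonic_on (\<lambda>x. g (\<phi> x) *\<^sub>R \<psi> x) (ball 0 1)"
proof -
  have "(\<lambda>x. complex_of_real (g x)) \<in> hp p"
    by (rule hp_of_bounded[OF p harmonic_on_bounded_linear[OF g open_ball bounded_linear_of_real]]) (use M in simp)
  from bdd[OF this] have "harmonic_on (weighted_comp \<phi> \<psi> (\<lambda>x. complex_of_real (g x))) (ball 0 1)" by (simp add: hp_def)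
  then show ?thesis by (rule harmonic_on_cong) (auto simp: weighted_comp_def scaleR_conv_of_real)
qed

lemma psi_harmonic: "harmonic_on \<psi> (ball 0 1)"
proof (rule harmonic_on_cong)
  show "harmonic_on (\<lambda>x. (1 + 0 \<bullet> \<phi> x) *\<^sub>R \<psi> x) (ball 0 1)"
    by (rule weighted_harmonic[OF harmonic_on_affine, where M = 1]) auto
qed auto

lemma psi_laplacian: "x \<in> ball 0 1 \<Longrightarrow> (\<Sum>e\<in>Basis. \<psi>'' x e e) = 0"
  using psi_harmonic harmonic_on_iff[OF W open_ball] by blast

text \<open>The product rule, with the term containing the Laplacian of \<open>\<psi>\<close> removed.\<close>

lemma weighted_laplacian:
  assumes h: "C2_derivs h h' h'' (ball 0 1)" and harm: "harmonic_on (\<lambda>x. h x *\<^sub>R \<psi> x) (ball 0 1)" and x: "x \<in> ball 0 1"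
  shows "(\<Sum>e\<in>Basis. (2 * h' x e) *\<^sub>R \<psi>' x e) + (\<Sum>e\<in>Basis. h'' x e e) *\<^sub>R \<psi> x = 0"
proof -
  have "0 = (\<Sum>e\<in>Basis. h x *\<^sub>R \<psi>'' x e e + h' x e *\<^sub>R \<psi>' x e + (h' x e *\<^sub>R \<psi>' x e + h'' x e e *\<^sub>R \<psi> x))"
    using harm[unfolded harmonic_on_iff[OF C2_derivs_bilinear[OF bounded_bilinear_scaleR h W] open_ball]] x by simp
  also have "\<dots> = h x *\<^sub>R (\<Sum>e\<in>Basis. \<psi>'' x e e) + ((\<Sum>e\<in>Basis. (2 * h' x e) *\<^sub>R \<psi>' x e) + (\<Sum>e\<in>Basis. h'' x e e) *\<^sub>R \<psi> x)"
    unfolding scaleR_sum_right scaleR_sum_left mult_2 scaleR_add_left sum.distrib by simp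
  finally show ?thesis using psi_laplacian[OF x] by simp
qed

text \<open>Harmonicity of the image of the linear function \<open>u \<bullet> x\<close>.\<close>

lemma test_linear:
  assumes x: "x \<in> ball 0 1"
  shows "(\<Sum>e\<in>Basis. (2 * (u \<bullet> \<phi>' x e)) *\<^sub>R \<psi>' x e) + (\<Sum>e\<in>Basis. u \<bullet> \<phi>'' x e e) *\<^sub>R \<psi> x = 0"
proof (rule weighted_laplacian[OF C2_derivs_bounded_linear[OF P bounded_linear_inner_right] _ x])
  show "harmonic_on (\<lambda>x. (u \<bullet> \<phi> x) *\<^sub>R \<psi> x) (ball 0 1)"
  proof (rule harmonic_on_cong)
    show "harmonic_on (\<lambda>x. (0 + u \<bullet> \<phi> x) *\<^sub>R \<psi> x) (ball 0 1)"
    proof (rule weighted_harmonic[OF harmonic_on_affine[OF open_ball], where M = "norm u"])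
      fix x :: 'a assume x: "x \<in> ball 0 1"
      have "\<bar>u \<bullet> x\<bar> \<le> norm u * norm x" by (rule Cauchy_Schwarz_ineq2)
      also have "\<dots> \<le> norm u * 1" using x by (intro mult_left_mono) auto
      finally show "\<bar>0 + u \<bullet> x\<bar> \<le> norm u" by simp
    qed
  qed auto
qed

text \<open>In the Laplacian of \<open>(u \<bullet> \<phi>) (v \<bullet> \<phi>) \<psi>\<close> the terms that contain \<open>u \<bullet> \<phi>\<close> or \<open>v \<bullet> \<phi>\<close> undifferentiated cancel by
  \<open>test_linear\<close>. What remains is the mixed term.\<close>

lemma test_quadratic:
  assumes x: "x \<in> ball 0 1" and uv: "u \<bullet> v = 0" and nz: "\<psi> x \<noteq> 0"
  shows "(\<Sum>e\<in>Basis. (\<phi>' x e \<bullet> u) * (\<phi>' x e \<bullet> v)) = 0"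
proof -
  let ?B = "\<Sum>e\<in>Basis. (\<phi>' x e \<bullet> u) * (\<phi>' x e \<bullet> v)"
  note C = C2_derivs_bounded_linear[OF P bounded_linear_inner_right]
  have "harmonic_on (\<lambda>x. ((u \<bullet> \<phi> x) * (v \<bullet> \<phi> x)) *\<^sub>R \<psi> x) (ball 0 1)"
  proof (rule weighted_harmonic[OF harmonic_on_product[OF uv open_ball], where M = "norm u * norm v"])
    fix x :: 'a assume x: "x \<in> ball 0 1"
    have 1: "\<bar>w \<bullet> x\<bar> \<le> norm w" for w
    proof -
      have "\<bar>w \<bullet> x\<bar> \<le> norm w * norm x" by (rule Cauchy_Schwarz_ineq2)
      also have "\<dots> \<le> norm w * 1" using x by (intro mult_left_mono) auto
      finally show ?thesis by simp
    qed
    show "\<bar>(u \<bullet> x) * (v \<bullet> x)\<bar> \<le> norm u * norm v" unfolding abs_mult by (intro mult_mono 1) auto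
  qed
  from weighted_laplacian[OF C2_derivs_bilinear[OF bounded_bilinear_mult C C] this x]
  have "0 = (\<Sum>e\<in>Basis. (2 * ((u \<bullet> \<phi> x) * (v \<bullet> \<phi>' x e) + (u \<bullet> \<phi>' x e) * (v \<bullet> \<phi> x))) *\<^sub>R \<psi>' x e) +
      (\<Sum>e\<in>Basis. (u \<bullet> \<phi> x) * (v \<bullet> \<phi>'' x e e) + (u \<bullet> \<phi>' x e) * (v \<bullet> \<phi>' x e) + ((u \<bullet> \<phi>' x e) * (v \<bullet> \<phi>' x e) + (u \<bullet> \<phi>'' x e e) * (v \<bullet> \<phi> x))) *\<^sub>R \<psi> x"
    by simp
  also have "\<dots> = (u \<bullet> \<phi> x) *\<^sub>R ((\<Sum>e\<in>Basis. (2 * (v \<bullet> \<phi>' x e)) *\<^sub>R \<psi>' x e) + (\<Sum>e\<in>Basis. v \<bullet> \<phi>'' x e e) *\<^sub>R \<psi> x)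
     + (v \<bullet> \<phi> x) *\<^sub>R ((\<Sum>e\<in>Basis. (2 * (u \<bullet> \<phi>' x e)) *\<^sub>R \<psi>' x e) + (\<Sum>e\<in>Basis. u \<bullet> \<phi>'' x e e) *\<^sub>R \<psi> x)
     + (2 * ?B) *\<^sub>R \<psi> x"
  proof -
    have 1: "(\<Sum>e\<in>Basis. (2 * ((u \<bullet> \<phi> x) * (v \<bullet> \<phi>' x e) + (u \<bullet> \<phi>' x e) * (v \<bullet> \<phi> x))) *\<^sub>R \<psi>' x e)
       = (u \<bullet> \<phi> x) *\<^sub>R (\<Sum>e\<in>Basis. (2 * (v \<bullet> \<phi>' x e)) *\<^sub>R \<psi>' x e) + (v \<bullet> \<phi> x) *\<^sub>R (\<Sum>e\<in>Basis. (2 * (u \<bullet> \<phi>' x e)) *\<^sub>R \<psi>' x e)"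
      unfolding scaleR_sum_right sum.distrib[symmetric] by (rule sum.cong[OF refl]) (simp add: algebra_simps)
    have 2: "(\<Sum>e\<in>Basis. (u \<bullet> \<phi> x) * (v \<bullet> \<phi>'' x e e) + (u \<bullet> \<phi>' x e) * (v \<bullet> \<phi>' x e) + ((u \<bullet> \<phi>' x e) * (v \<bullet> \<phi>' x e) + (u \<bullet> \<phi>'' x e e) * (v \<bullet> \<phi> x)))
       = (u \<bullet> \<phi> x) * (\<Sum>e\<in>Basis. v \<bullet> \<phi>'' x e e) + (v \<bullet> \<phi> x) * (\<Sum>e\<in>Basis. u \<bullet> \<phi>'' x e e) + 2 * ?B"
      unfolding sum_distrib_left sum.distrib[symmetric] by (rule sum.cong[OF refl]) (simp add: algebra_simps inner_commute)
    show ?thesis unfolding 1 2 by (simp add: scaleR_add_left scaleR_add_right)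
  qed
  also have "\<dots> = (2 * ?B) *\<^sub>R \<psi> x" unfolding test_linear[OF x] by simp
  finally show ?thesis using nz by simp
qed

definition e0 :: 'a where "e0 = (SOME e. e \<in> Basis)"
lemma e0: "e0 \<in> Basis" unfolding e0_def using nonempty_Basis some_in_eq by blast

text \<open>Where \<open>\<phi>\<close> is conformal this is the square of its scale. The definition is a polynomial in the first derivatives,
  so \<open>\<mu>\<close> is differentiable on the whole ball.\<close>

definition \<mu> :: "'a \<Rightarrow> real" where "\<mu> x = (\<Sum>e\<in>Basis. (\<phi>' x e \<bullet> e0) * (\<phi>' x e \<bullet> e0))"

lemma adjoint_conformal:
  assumes x: "x \<in> ball 0 1" and nz: "\<psi> x \<noteq> 0"
  shows "(\<Sum>e\<in>Basis. (\<phi>' x e \<bullet> u) * (\<phi>' x e \<bullet> v)) = \<mu> x * (u \<bullet> v)"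
  unfolding \<mu>_def
proof (rule bilinear_multiple_of_inner[where B = "\<lambda>u v. \<Sum>e\<in>Basis. (\<phi>' x e \<bullet> u) * (\<phi>' x e \<bullet> v)", OF _ _ _ _ e0])
  show "linear (\<lambda>u. \<Sum>e\<in>Basis. (\<phi>' x e \<bullet> u) * (\<phi>' x e \<bullet> v))" for v
    by (intro linearI) (auto simp: inner_add_right sum.distrib algebra_simps sum_distrib_left)
  show "linear (\<lambda>v. \<Sum>e\<in>Basis. (\<phi>' x e \<bullet> u) * (\<phi>' x e \<bullet> v))" for u
    by (intro linearI) (auto simp: inner_add_right sum.distrib algebra_simps sum_distrib_left)
qed (auto simp: mult.commute test_quadratic[OF x _ nz])

lemma mu_nonneg: "0 \<le> \<mu> x" unfolding \<mu>_def by (intro sum_nonneg) simp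

lemma mu_continuous: "continuous_on (ball 0 1) \<mu>"
  unfolding \<mu>_def by (intro continuous_intros C2_derivs_continuous(2)[OF P])

lemma psi_continuous: "continuous_on (ball 0 1) \<psi>" by (rule C2_derivs_continuous(1)[OF W])

definition regular :: "'a set" where "regular = {x \<in> ball 0 1. \<psi> x \<noteq> 0 \<and> \<mu> x \<noteq> 0}"

lemma open_regular: "open regular"
proof -
  have "open (ball 0 1 \<inter> \<psi> -` (- {0}))" by (rule continuous_open_preimage[OF psi_continuous]) auto
  moreover have "open (ball 0 1 \<inter> \<mu> -` (- {0}))" by (rule continuous_open_preimage[OF mu_continuous]) auto
  moreover have "regular = (ball 0 1 \<inter> \<psi> -` (- {0})) \<inter> (ball 0 1 \<inter> \<mu> -` (- {0}))" by (auto simp: regular_def)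
  ultimately show ?thesis by auto
qed

text \<open>Otherwise \<open>\<phi>'\<close> vanishes wherever \<open>\<psi>\<close> does not. As \<open>\<phi>\<close> is not constant, \<open>\<phi>'\<close> is nonzero on some open set,
  where then \<open>\<psi>\<close> is zero; unique continuation makes \<open>\<psi>\<close> vanish identically.\<close>

lemma regular_nonempty: "regular \<noteq> {}"
proof
  assume em: "regular = {}"
  have d0: "\<phi>' x e = 0" if x: "x \<in> ball 0 1" "\<psi> x \<noteq> 0" and e: "e \<in> Basis" for x e
  proof -
    have "\<mu> x = 0" using em x by (auto simp: regular_def)
    then have "(\<Sum>d\<in>Basis. (\<phi>' x d \<bullet> \<phi>' x e) * (\<phi>' x d \<bullet> \<phi>' x e)) = 0" using adjoint_conformal[OF x] by simp
    then have "\<forall>d\<in>Basis. (\<phi>' x d \<bullet> \<phi>' x e) * (\<phi>' x d \<bullet> \<phi>' x e) = 0" by (subst (asm) sum_nonneg_eq_0_iff) auto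
    then show ?thesis using e by auto
  qed
  have d1: "\<phi>' x e = 0" if x: "x \<in> ball 0 1" and e: "e \<in> Basis" for x e
  proof (rule ccontr)
    assume ne: "\<phi>' x e \<noteq> 0"
    define T where "T = ball 0 1 \<inter> (\<lambda>x. \<phi>' x e) -` (- {0})"
    have T: "open T" unfolding T_def by (rule continuous_open_preimage[OF C2_derivs_continuous(2)[OF P]]) auto
    have "\<psi> y = 0" if "y \<in> ball 0 1" for y
      by (rule harmonic_unique_continuation[OF psi_harmonic open_ball connected_ball T _ _ _ that])
        (use x ne e d0 in \<open>auto simp: T_def\<close>)
    then show False using psi_nonzero by blast
  qed
  have "\<phi> constant_on ball 0 1"
  proof (rule has_derivative_zero_connected_constant_on[of _ "{}"])
    show "\<forall>x\<in>ball 0 1 - {}. (\<phi> has_derivative (\<lambda>h. 0)) (at x within ball 0 1)"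
    proof
      fix x :: 'a assume "x \<in> ball 0 1 - {}"
      then have x: "x \<in> ball 0 1" by simp
      have "\<phi>' x = (\<lambda>h. 0)" using linear_eq_sum_Basis[OF linP[OF x]] d1[OF x] by (auto simp: fun_eq_iff)
      then show "(\<phi> has_derivative (\<lambda>h. 0)) (at x within ball 0 1)"
        using has_derivative_at_withinI[OF C2_derivsD(1)[OF P x]] by simp
    qed
  qed (auto intro: C2_derivs_continuous(1)[OF P])
  then show False using nonconst by simp
qed

lemma conformal:
  assumes x: "x \<in> regular"
  shows "\<phi>' x u \<bullet> \<phi>' x v = \<mu> x * (u \<bullet> v)"
proof -
  have "x \<in> ball 0 1" "\<psi> x \<noteq> 0" "\<mu> x \<noteq> 0" using x by (auto simp: regular_def)
  then show ?thesis by (intro conformal_of_adjoint_conformal linP adjoint_conformal)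
qed

definition \<mu>' :: "'a \<Rightarrow> 'a \<Rightarrow> real" where
  "\<mu>' x w = (\<Sum>e\<in>Basis. (\<phi>' x e \<bullet> e0) * (\<phi>'' x e w \<bullet> e0) + (\<phi>'' x e w \<bullet> e0) * (\<phi>' x e \<bullet> e0))"

lemma mu_derivative: "x \<in> ball 0 1 \<Longrightarrow> (\<mu> has_derivative \<mu>' x) (at x)"
  unfolding \<mu>_def[abs_def] \<mu>'_def[abs_def]
  by (intro has_derivative_sum has_derivative_mult has_derivative_inner_left C2_derivsD(2)[OF P])

text \<open>Tracing the differentiated conformality relation gives \<open>\<phi>' x w \<bullet> \<Delta>\<phi> = - (n - 2) / 2 * \<mu>' x w\<close>. Insert this in
  \<open>test_linear\<close> with \<open>u = \<phi>' x w\<close>.\<close>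

lemma psi_derivative:
  assumes x: "x \<in> regular"
  shows "(2 * \<mu> x) *\<^sub>R \<psi>' x w = ((real DIM('a) - 2) / 2 * \<mu>' x w) *\<^sub>R \<psi> x"
proof -
  have xb: "x \<in> ball 0 1" using x by (simp add: regular_def)
  have c: "\<phi>' x u \<bullet> \<phi>'' x v w + \<phi>'' x u w \<bullet> \<phi>' x v = \<mu>' x w * (u \<bullet> v)" for u v w
  proof -
    have 1: "((\<lambda>y. \<phi>' y u \<bullet> \<phi>' y v) has_derivative (\<lambda>w. \<phi>' x u \<bullet> \<phi>'' x v w + \<phi>'' x u w \<bullet> \<phi>' x v)) (at x)"
      by (intro has_derivative_inner C2_derivsD(2)[OF P xb])
    have "((\<lambda>y. \<mu> y * (u \<bullet> v)) has_derivative (\<lambda>w. \<mu>' x w * (u \<bullet> v))) (at x)"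
      by (rule has_derivative_mult_left[OF mu_derivative[OF xb]])
    then have 2: "((\<lambda>y. \<phi>' y u \<bullet> \<phi>' y v) has_derivative (\<lambda>w. \<mu>' x w * (u \<bullet> v))) (at x)"
      by (rule has_derivative_transform_within_open[OF _ open_regular x]) (simp add: conformal)
    from fun_cong[OF has_derivative_unique[OF 1 2], of w] show ?thesis .
  qed
  have sym: "\<phi>'' x u v = \<phi>'' x v u" for u v by (rule symmetric_second_derivative[OF P open_ball xb])
  have tr: "\<phi>' x w \<bullet> \<phi>'' x e e = \<mu>' x e * (w \<bullet> e) - \<mu>' x w * (e \<bullet> e) / 2" for e
    using c[of w e e] c[of e e w] by (simp add: sym[of w e] inner_commute)
  have lmu: "linear (\<mu>' x)" by (rule has_derivative_linear[OF mu_derivative[OF xb]])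
  have "(\<Sum>e\<in>Basis. \<phi>' x w \<bullet> \<phi>'' x e e) = (\<Sum>e\<in>Basis. (w \<bullet> e) * \<mu>' x e) - (\<Sum>e\<in>(Basis::'a set). \<mu>' x w / 2)"
    unfolding tr sum_subtractf by (intro arg_cong2[where f="(-)"] sum.cong) auto
  also have "(\<Sum>e\<in>Basis. (w \<bullet> e) * \<mu>' x e) = \<mu>' x w" using linear_eq_sum_Basis[OF lmu, of w] by simp
  finally have s: "(\<Sum>e\<in>Basis. \<phi>' x w \<bullet> \<phi>'' x e e) = - ((real DIM('a) - 2) / 2 * \<mu>' x w)" by (simp add: algebra_simps diff_divide_distrib)
  have "(\<Sum>e\<in>Basis. (2 * (\<phi>' x w \<bullet> \<phi>' x e)) *\<^sub>R \<psi>' x e) = (2 * \<mu> x) *\<^sub>R (\<Sum>e\<in>Basis. (w \<bullet> e) *\<^sub>R \<psi>' x e)"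
    unfolding conformal[OF x] scaleR_sum_right by (simp add: mult.assoc)
  also have "(\<Sum>e\<in>Basis. (w \<bullet> e) *\<^sub>R \<psi>' x e) = \<psi>' x w" by (rule linear_eq_sum_Basis[OF linear_deriv1[OF W xb], symmetric])
  finally have "(2 * \<mu> x) *\<^sub>R \<psi>' x w + (- ((real DIM('a) - 2) / 2 * \<mu>' x w)) *\<^sub>R \<psi> x = 0"
    using test_linear[OF xb, of "\<phi>' x w"] unfolding s by (simp only:)
  then show ?thesis by (simp only: scaleR_minus_left add_uminus_conv_diff right_minus_eq)
qed

text \<open>The equation of \<open>psi_derivative\<close> says that \<open>\<mu> powr (- (n - 2) / 4) *\<^sub>R \<psi>\<close> has derivative 0.\<close>

lemma psi_eq_mu_powr:
  assumes U: "open U" "connected U" "U \<subseteq> regular" and x0: "x0 \<in> U"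
  obtains c where "c \<noteq> 0" "\<And>x. x \<in> U \<Longrightarrow> \<psi> x = c * complex_of_real (\<mu> x powr ((real DIM('a) - 2) / 4))"
proof -
  define k where "k = (real DIM('a) - 2) / 4"
  have mu: "\<mu> x > 0" if "x \<in> U" for x
    using that U(3) mu_nonneg[of x] by (auto simp: regular_def less_le)
  have const: "\<mu> x powr (- k) *\<^sub>R \<psi> x = \<mu> x0 powr (- k) *\<^sub>R \<psi> x0" if "x \<in> U" for x
  proof (rule eq_of_zero_derivative[of U "\<lambda>x. \<mu> x powr (- k) *\<^sub>R \<psi> x", OF U(1,2) _ that x0])
    fix x assume x: "x \<in> U"
    then have xr: "x \<in> regular" and xb: "x \<in> ball 0 1" using U(3) by (auto simp: regular_def)
    have "((\<lambda>x. \<mu> x powr (- k)) has_derivative (\<lambda>w. - k * (\<mu> x powr (- k) / \<mu> x) * \<mu>' x w)) (at x)"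
      by (rule has_derivative_compose[OF mu_derivative[OF xb] C2_derivsD(1)[OF C2_derivs_powr]]) (use mu[OF x] in simp)
    from has_derivative_scaleR[OF this C2_derivsD(1)[OF W xb]]
    have "((\<lambda>x. \<mu> x powr (- k) *\<^sub>R \<psi> x) has_derivative
       (\<lambda>w. \<mu> x powr (- k) *\<^sub>R \<psi>' x w + (- k * (\<mu> x powr (- k) / \<mu> x) * \<mu>' x w) *\<^sub>R \<psi> x)) (at x)" .
    moreover have "\<mu> x powr (- k) *\<^sub>R \<psi>' x w + (- k * (\<mu> x powr (- k) / \<mu> x) * \<mu>' x w) *\<^sub>R \<psi> x = 0" for w
    proof -
      define m where "m = \<mu> x powr (- k) / (2 * \<mu> x)"
      have "(- k * (\<mu> x powr (- k) / \<mu> x) * \<mu>' x w) *\<^sub>R \<psi> x = - (m *\<^sub>R (((real DIM('a) - 2) / 2 * \<mu>' x w) *\<^sub>R \<psi> x))"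
        using mu[OF x] by (simp add: m_def k_def field_simps)
      moreover have "\<mu> x powr (- k) *\<^sub>R \<psi>' x w = m *\<^sub>R ((2 * \<mu> x) *\<^sub>R \<psi>' x w)"
        using mu[OF x] by (simp add: m_def)
      ultimately show ?thesis unfolding psi_derivative[OF xr] by (simp only: add.right_inverse)
    qed
    ultimately show "((\<lambda>x. \<mu> x powr (- k) *\<^sub>R \<psi> x) has_derivative (\<lambda>w. 0)) (at x)" by simp
  qed
  define c where "c = \<mu> x0 powr (- k) *\<^sub>R \<psi> x0"
  show ?thesis
  proof (rule that)
    have "\<psi> x0 \<noteq> 0" using x0 U(3) by (auto simp: regular_def)
    then show "c \<noteq> 0" using mu[OF x0] by (simp add: c_def)
    fix x assume x: "x \<in> U"
    have "\<psi> x = (\<mu> x powr k * \<mu> x powr (- k)) *\<^sub>R \<psi> x" using mu[OF x] by (simp add: powr_add[symmetric])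
    also have "\<dots> = \<mu> x powr k *\<^sub>R c" unfolding c_def const[OF x, symmetric] by simp
    finally show "\<psi> x = c * complex_of_real (\<mu> x powr ((real DIM('a) - 2) / 4))"
      by (simp add: k_def scaleR_conv_of_real mult.commute)
  qed
qed

text \<open>Liouville's theorem is applied with \<open>\<rho> = \<mu> powr (- 1 / 2)\<close>. Since \<open>\<psi>\<close> divided by a constant is real and a power of \<open>\<mu>\<close>,
  the function \<open>\<rho>\<close> is \<open>C\<^sup>2\<close>; harmonicity of \<open>\<psi>\<close> is the flatness equation.\<close>

lemma local_moebius_form:
  assumes U: "open U" "connected U" "U \<subseteq> regular" and x0: "x0 \<in> U"
  obtains \<alpha> L \<epsilon> a b where "\<alpha> > 0" "orthogonal_transformation L" "\<epsilon> = 0 \<or> \<epsilon> = 2" "a \<notin> U"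
    "\<And>x. x \<in> U \<Longrightarrow> \<phi> x = moebius_form a b \<alpha> L \<epsilon> x" "\<And>x. x \<in> U \<Longrightarrow> \<mu> x = (\<alpha> / norm (x - a) powr \<epsilon>)\<^sup>2"
proof -
  obtain c where c: "c \<noteq> 0" "\<And>x. x \<in> U \<Longrightarrow> \<psi> x = c * complex_of_real (\<mu> x powr ((real DIM('a) - 2) / 4))"
    using psi_eq_mu_powr[OF assms] by metis
  have Ub: "U \<subseteq> ball 0 1" using U(3) by (auto simp: regular_def)
  \<comment> \<open>the exponent with \<open>w powr s = \<mu> powr (- 1 / 2)\<close>, where \<open>w = \<mu> powr ((n - 2) / 4)\<close> is harmonic\<close>
  define s where "s = - 2 / (real DIM('a) - 2)"
  have n: "real DIM('a) - 2 > 0" using dim by linarith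
  have mu: "\<mu> x > 0" if "x \<in> U" for x
    using that U(3) mu_nonneg[of x] by (auto simp: regular_def less_le)
  define w where "w = (\<lambda>x. Re (inverse c * \<psi> x))"
  have w: "w x = \<mu> x powr ((real DIM('a) - 2) / 4)" if "x \<in> U" for x
    by (simp only: w_def c(2)[OF that] mult.assoc[symmetric] left_inverse[OF c(1)] mult_1 Re_complex_of_real)
  have w0: "w x > 0" if "x \<in> U" for x using mu[OF that] by (simp add: w[OF that])
  have T: "bounded_linear (\<lambda>z. Re (inverse c * z))"
    by (rule bounded_linear_compose[OF bounded_linear_Re bounded_linear_mult_right])
  define w' where "w' = (\<lambda>x v. Re (inverse c * \<psi>' x v))"
  define w'' where "w'' = (\<lambda>x v u. Re (inverse c * \<psi>'' x v u))"
  have wC: "C2_derivs w w' w'' U"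
    unfolding w_def w'_def w''_def by (rule C2_derivs_subset[OF C2_derivs_bounded_linear[OF W T] Ub])
  have wh: "(\<Sum>e\<in>Basis. w'' x e e) = 0" if "x \<in> U" for x
  proof -
    have eq: "(\<Sum>e\<in>Basis. w'' x e e) = Re (inverse c * (\<Sum>e\<in>Basis. \<psi>'' x e e))"
      by (simp only: w''_def sum_distrib_left Re_sum)
    have "(\<Sum>e\<in>Basis. \<psi>'' x e e) = 0" using psi_laplacian that Ub by blast
    then show ?thesis unfolding eq by (simp only: mult_zero_right zero_complex.sel)
  qed
  have sub: "w ` U \<subseteq> {0<..}" using w0 by auto
  note rC = C2_derivs_compose[OF C2_derivs_powr[of s] wC open_greaterThan sub U(1)]
  have rho: "w x powr s = \<mu> x powr (- 1 / 2)" if "x \<in> U" for x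
  proof -
    have "d / 4 * (- 2 / d) = - 1 / 2" if "d \<noteq> 0" for d :: real using that by simp
    from this[of "real DIM('a) - 2"] have "(real DIM('a) - 2) / 4 * s = - 1 / 2" unfolding s_def using n by linarith
    then show ?thesis unfolding w[OF that] powr_powr by (simp only:)
  qed
  have rho2: "(w x powr s)\<^sup>2 = 1 / \<mu> x" if "x \<in> U" for x
  proof -
    have "(w x powr s)\<^sup>2 = \<mu> x powr (- 1 / 2) * \<mu> x powr (- 1 / 2)" by (simp add: rho[OF that] power2_eq_square)
    also have "\<dots> = \<mu> x powr (- 1)" by (simp add: powr_add[symmetric])
    finally show ?thesis using mu[OF that] by (simp add: powr_minus inverse_eq_divide)
  qed
  interpret F: conformal_flat \<phi> \<phi>' \<phi>'' "\<lambda>x. w x powr s" "\<lambda>x u. s * (w x powr s / w x) * w' x u"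
     "\<lambda>x u v. s * (s - 1) * (w x powr s / (w x)\<^sup>2) * w' x u * w' x v + s * (w x powr s / w x) * w'' x u v" U
  proof
    show "3 \<le> DIM('a)" by (rule dim)
    show "open U" "connected U" by (rule U)+
    show "U \<noteq> {}" using x0 by auto
    show "C2_derivs \<phi> \<phi>' \<phi>'' U" by (rule C2_derivs_subset[OF P Ub])
    show "C2_derivs (\<lambda>x. w x powr s) (\<lambda>x u. s * (w x powr s / w x) * w' x u)
     (\<lambda>x u v. s * (s - 1) * (w x powr s / (w x)\<^sup>2) * w' x u * w' x v + s * (w x powr s / w x) * w'' x u v) U"
      by (rule rC)
    fix x assume x: "x \<in> U"
    show "w x powr s > 0" using w0[OF x] by simp
    have xr: "x \<in> regular" using x U(3) by blast
    show "\<phi>' x u \<bullet> \<phi>' x v = (u \<bullet> v) / (w x powr s)\<^sup>2" for u v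
      unfolding rho2[OF x] conformal[OF xr] by simp
    define q where "q = w x powr s"
    define G where "G = (\<Sum>e\<in>Basis. (w' x e)\<^sup>2)"
    have 1: "(\<Sum>e\<in>Basis. s * (s - 1) * (q / (w x)\<^sup>2) * w' x e * w' x e + s * (q / w x) * w'' x e e) = s * (s - 1) * (q / (w x)\<^sup>2) * G"
    proof -
      have "(\<Sum>e\<in>Basis. s * (s - 1) * (q / (w x)\<^sup>2) * w' x e * w' x e + s * (q / w x) * w'' x e e)
         = s * (s - 1) * (q / (w x)\<^sup>2) * G + s * (q / w x) * (\<Sum>e\<in>Basis. w'' x e e)"
        unfolding G_def sum_distrib_left sum.distrib by (simp add: power2_eq_square mult.assoc)
      then show ?thesis using wh[OF x] by simp
    qed
    have 2: "(\<Sum>e\<in>Basis. (s * (q / w x) * w' x e)\<^sup>2) = s\<^sup>2 * (q\<^sup>2 / (w x)\<^sup>2) * G"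
      unfolding G_def sum_distrib_left by (simp add: power_mult_distrib power_divide)
    have 3: "s - 1 = real DIM('a) / 2 * s" using n by (simp add: s_def field_simps)
    show "w x powr s * (\<Sum>e\<in>Basis. s * (s - 1) * (w x powr s / (w x)\<^sup>2) * w' x e * w' x e + s * (w x powr s / w x) * w'' x e e)
        = real DIM('a) / 2 * (\<Sum>e\<in>Basis. (s * (w x powr s / w x) * w' x e)\<^sup>2)"
      unfolding q_def[symmetric] unfolding 1 2 unfolding 3 by (simp add: power2_eq_square)
  qed
  have mu_rho: "\<mu> x = (1 / r)\<^sup>2" if "x \<in> U" "w x powr s = r" for x r
  proof -
    have e: "r\<^sup>2 = 1 / \<mu> x" using rho2[OF that(1)] unfolding that(2) .
    show ?thesis unfolding power_divide e by simp
  qed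
  show ?thesis
  proof (cases "F.\<sigma> x0 = 0")
    case True
    then have s0: "F.\<sigma> x = 0" if "x \<in> U" for x using F.sigma_const[OF that x0] by simp
    show ?thesis
    proof (rule F.affine_case[OF s0])
      fix b \<alpha> L assume L: "\<alpha> > 0" "orthogonal_transformation L" "\<And>x. x \<in> U \<Longrightarrow> \<phi> x = b + \<alpha> *\<^sub>R L x" "\<And>x. x \<in> U \<Longrightarrow> w x powr s = 1 / \<alpha>"
      \<comment> \<open>A similarity has no distinguished centre; any point outside the ball will do.\<close>
      define a :: 'a where "a = 2 *\<^sub>R e0"
      have a: "a \<notin> ball 0 1" using e0 by (simp add: a_def)
      have ne: "norm (x - a) powr 0 = 1" if "x \<in> U" for x using that a Ub by auto
      show ?thesis
      proof (rule that[OF L(1,2), of 0 a "b + \<alpha> *\<^sub>R L a"])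
        show "a \<notin> U" using a Ub by blast
        fix x assume x: "x \<in> U"
        show "\<phi> x = moebius_form a (b + \<alpha> *\<^sub>R L a) \<alpha> L 0 x"
          unfolding moebius_form_def ne[OF x] L(3)[OF x] linear_diff[OF orthogonal_transformation_linear[OF L(2)]]
          by (simp add: scaleR_diff_right)
        show "\<mu> x = (\<alpha> / norm (x - a) powr 0)\<^sup>2" unfolding ne[OF x] using mu_rho[OF x L(4)[OF x]] by simp
      qed (use a in auto)
    qed
  next
    case False
    have s0: "F.\<sigma> x = F.\<sigma> x0" if "x \<in> U" for x by (rule F.sigma_const[OF that x0])
    show ?thesis
    proof (rule F.inversion_case[OF s0 False])
      fix a b \<alpha> L assume L: "a \<notin> U" "\<alpha> > 0" "orthogonal_transformation L"
        "\<And>x. x \<in> U \<Longrightarrow> \<phi> x = b + (\<alpha> / (norm (x - a))\<^sup>2) *\<^sub>R L (x - a)" "\<And>x. x \<in> U \<Longrightarrow> w x powr s = (norm (x - a))\<^sup>2 / \<alpha>"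
      have p2: "norm (x - a) powr 2 = (norm (x - a))\<^sup>2" for x by simp
      show ?thesis
      proof (rule that[OF L(2,3), of 2 a b])
        fix x assume x: "x \<in> U"
        show "\<phi> x = moebius_form a b \<alpha> L 2 x" unfolding moebius_form_def p2 by (rule L(4)[OF x])
        show "\<mu> x = (\<alpha> / norm (x - a) powr 2)\<^sup>2" unfolding p2 using mu_rho[OF x L(5)[OF x]] by simp
      qed (use L in auto)
    qed
  qed
qed

text \<open>On a component \<open>U\<close> of the regular set, \<open>\<mu>\<close> and \<open>|\<psi>|\<close> have positive lower bounds, since \<open>|x - a| \<le> 1 + |a|\<close> in the
  explicit formulas. By continuity the bounds persist at limit points of \<open>U\<close> in the ball, which are therefore
  regular; so \<open>U\<close> is relatively closed and is the whole ball.\<close>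

lemma moebius_form_of_harmonic_preserving:
  obtains a b \<alpha> L \<epsilon> c where "a \<notin> ball 0 1" "\<alpha> > 0" "orthogonal_transformation L" "\<epsilon> = 0 \<or> \<epsilon> = 2"
    "\<And>x. x \<in> ball 0 1 \<Longrightarrow> \<phi> x = moebius_form a b \<alpha> L \<epsilon> x"
    "\<And>x. x \<in> ball 0 1 \<Longrightarrow> \<psi> x = c * complex_of_real (norm (x - a) powr (\<epsilon> * (2 - real DIM('a)) / 2))"
proof -
  obtain x0 where x0: "x0 \<in> regular" using regular_nonempty by blast
  define U where "U = connected_component_set regular x0"
  have U: "open U" "connected U" "U \<subseteq> regular" "x0 \<in> U"
    using x0 open_regular by (auto simp: U_def open_connected_component connected_component_subset)
  have Ub: "U \<subseteq> ball 0 1" using U(3) by (auto simp: regular_def)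
  obtain c where c: "c \<noteq> 0" "\<And>x. x \<in> U \<Longrightarrow> \<psi> x = c * complex_of_real (\<mu> x powr ((real DIM('a) - 2) / 4))"
    using psi_eq_mu_powr[OF U] by metis
  show ?thesis
  proof (rule local_moebius_form[OF U])
    fix \<alpha> L \<epsilon> a b assume form: "\<alpha> > 0" "orthogonal_transformation L" "\<epsilon> = 0 \<or> \<epsilon> = 2" "a \<notin> U"
      "\<And>x. x \<in> U \<Longrightarrow> \<phi> x = moebius_form a b \<alpha> L \<epsilon> x" "\<And>x. x \<in> U \<Longrightarrow> \<mu> x = (\<alpha> / norm (x - a) powr \<epsilon>)\<^sup>2"
    define m where "m = (\<alpha> / (1 + norm a) powr \<epsilon>)\<^sup>2"
    have na: "1 + norm a > 0" by (simp add: add_pos_nonneg)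
    have m: "m > 0" using form(1) na by (simp add: m_def)
    have mu_ge: "\<mu> x \<ge> m" if x: "x \<in> U" for x
    proof -
      have "norm (x - a) \<le> 1 + norm a" using norm_triangle_ineq4[of x a] x Ub by (auto simp: subset_iff)
      moreover have "norm (x - a) > 0" using x form(4) by auto
      ultimately have "\<alpha> / (1 + norm a) powr \<epsilon> \<le> \<alpha> / norm (x - a) powr \<epsilon>"
        using form(1,3) na by (intro divide_left_mono powr_mono2) auto
      then show ?thesis unfolding m_def form(6)[OF x] using form(1) by (intro power_mono) auto
    qed
    define k where "k = (real DIM('a) - 2) / 4"
    have k: "k \<ge> 0" using dim by (simp add: k_def)
    have psi_ge: "cmod (\<psi> x) \<ge> cmod c * m powr k" if x: "x \<in> U" for x
      unfolding c(2)[OF x] norm_mult k_def[symmetric] using mu_ge[OF x] m k by (auto intro!: mult_left_mono powr_mono2)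
    have clo: "x \<in> U" if x: "x \<in> ball 0 1" "x \<in> closure U" for x
    proof -
      obtain X where X: "\<And>i. X i \<in> U" "X \<longlonglongrightarrow> x" using x(2) unfolding closure_sequential by blast
      have cont: "isCont \<mu> x" "isCont \<psi> x" using mu_continuous psi_continuous x(1) by (auto simp: continuous_on_eq_continuous_at)
      note lim = isCont_tendsto_compose[OF cont(1) X(2)] tendsto_norm[OF isCont_tendsto_compose[OF cont(2) X(2)]]
      have "m \<le> \<mu> x" by (rule LIMSEQ_le_const[OF lim(1)]) (use mu_ge X(1) in blast)
      moreover have "cmod c * m powr k \<le> cmod (\<psi> x)" by (rule LIMSEQ_le_const[OF lim(2)]) (use psi_ge X(1) in blast)
      moreover have "cmod c * m powr k > 0" using c(1) m by simp
      ultimately have xr: "x \<in> regular" using m x(1) by (auto simp: regular_def)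
      have "open (connected_component_set regular x)" by (rule open_connected_component[OF open_regular])
      moreover have "x \<in> connected_component_set regular x" using xr by simp
      ultimately have "connected_component_set regular x \<inter> U \<noteq> {}"
        using x(2) open_Int_closure_eq_empty by blast
      then obtain y where y: "y \<in> connected_component_set regular x0" "y \<in> connected_component_set regular x"
        unfolding U_def by blast
      have "connected_component_set regular x0 = connected_component_set regular x"
        using connected_component_eq[OF y(1)] connected_component_eq[OF y(2)] by simp
      then show ?thesis using xr unfolding U_def by simp
    qed
    have "U \<inter> ball 0 1 = {} \<or> (- closure U) \<inter> ball 0 1 = {}"
    proof (rule connectedD[OF connected_ball])
      show "U \<inter> - closure U \<inter> ball 0 1 = {}" using closure_subset by blast
      show "ball 0 1 \<subseteq> U \<union> - closure U" using clo by blast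
    qed (use U(1) in auto)
    then have UB: "U = ball 0 1" using clo U(4) Ub by blast
    have a: "a \<notin> ball 0 1" using form(4) UB by simp
    show ?thesis
    proof (rule that[OF a form(1,2,3), of b "c * complex_of_real (\<alpha> powr (2 * k))"])
      fix x :: 'a assume x: "x \<in> ball 0 1"
      show "\<phi> x = moebius_form a b \<alpha> L \<epsilon> x" using form(5) x UB by simp
      have n: "norm (x - a) > 0" using x a by auto
      have "\<mu> x powr k = (\<alpha> / norm (x - a) powr \<epsilon>) powr (2 * k)"
      proof -
        have "\<mu> x = (\<alpha> / norm (x - a) powr \<epsilon>) powr 2" using form(1,6) x UB n by simp
        then show ?thesis by (simp only: powr_powr)
      qed
      also have "\<dots> = \<alpha> powr (2 * k) * norm (x - a) powr (- (\<epsilon> * (2 * k)))"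
        using form(1) n by (simp add: powr_divide powr_powr powr_minus_divide)
      also have "- (\<epsilon> * (2 * k)) = \<epsilon> * (2 - real DIM('a)) / 2" by (simp add: k_def field_simps)
      finally have "\<mu> x powr k = \<alpha> powr (2 * k) * norm (x - a) powr (\<epsilon> * (2 - real DIM('a)) / 2)" .
      then show "\<psi> x = c * complex_of_real (\<alpha> powr (2 * k)) * complex_of_real (norm (x - a) powr (\<epsilon> * (2 - real DIM('a)) / 2))"
        using c(2)[unfolded k_def[symmetric]] x UB by simp
    qed
  qed
qed

end

section \<open>The Moebius group\<close>

text \<open>The normal form records the behaviour at the pole and at infinity, so that it is preserved by composing with
  reflections.\<close>

definition moebius_normal_form :: "('a::euclidean_space option \<Rightarrow> 'a option) \<Rightarrow> bool" where
  "moebius_normal_form M \<longleftrightarrow>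
    (\<exists>b \<alpha> L. \<alpha> \<noteq> 0 \<and> orthogonal_transformation L \<and> M None = None \<and> (\<forall>x. M (Some x) = Some (b + \<alpha> *\<^sub>R L x))) \<or>
    (\<exists>a b \<alpha> L. \<alpha> \<noteq> 0 \<and> orthogonal_transformation L \<and> M None = Some b \<and> M (Some a) = None \<and>
       (\<forall>x. x \<noteq> a \<longrightarrow> M (Some x) = Some (b + (\<alpha> / (norm (x - a))\<^sup>2) *\<^sub>R L (x - a))))"

lemma moebius_normal_form_affineI:
  "\<alpha> \<noteq> 0 \<Longrightarrow> orthogonal_transformation L \<Longrightarrow> M None = None \<Longrightarrow> (\<And>x. M (Some x) = Some (b + \<alpha> *\<^sub>R L x)) \<Longrightarrow> moebius_normal_form M"
  unfolding moebius_normal_form_def by blast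

lemma moebius_normal_form_inversionI:
  "\<alpha> \<noteq> 0 \<Longrightarrow> orthogonal_transformation L \<Longrightarrow> M None = Some b \<Longrightarrow> M (Some a) = None \<Longrightarrow>
   (\<And>x. x \<noteq> a \<Longrightarrow> M (Some x) = Some (b + (\<alpha> / (norm (x - a))\<^sup>2) *\<^sub>R L (x - a))) \<Longrightarrow> moebius_normal_form M"
  unfolding moebius_normal_form_def by blast

lemma moebius_normal_formE:
  assumes "moebius_normal_form M"
  obtains (affine) b \<alpha> L where "\<alpha> \<noteq> 0" "orthogonal_transformation L" "M None = None" "\<And>x. M (Some x) = Some (b + \<alpha> *\<^sub>R L x)"
  | (inversion) a b \<alpha> L where "\<alpha> \<noteq> 0" "orthogonal_transformation L" "M None = Some b" "M (Some a) = None"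
     "\<And>x. x \<noteq> a \<Longrightarrow> M (Some x) = Some (b + (\<alpha> / (norm (x - a))\<^sup>2) *\<^sub>R L (x - a))"
  using assms unfolding moebius_normal_form_def by metis

definition reflection_along :: "'a::real_inner \<Rightarrow> 'a \<Rightarrow> 'a" where
  "reflection_along v x = x - (2 * (x \<bullet> v) / (v \<bullet> v)) *\<^sub>R v"

lemma orthogonal_transformation_reflection_along: "v \<noteq> 0 \<Longrightarrow> orthogonal_transformation (reflection_along v)"
  unfolding orthogonal_transformation_def
proof (intro conjI allI)
  assume v: "v \<noteq> 0"
  show "linear (reflection_along v)"
    by (rule linearI) (auto simp: reflection_along_def algebra_simps add_divide_distrib)
  fix x y
  define n where "n = v \<bullet> v"
  have n: "n \<noteq> 0" using v by (simp add: n_def)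
  have "reflection_along v x \<bullet> reflection_along v y = x \<bullet> y - (2 * (y \<bullet> v) / n) * (x \<bullet> v) - (2 * (x \<bullet> v) / n) * (y \<bullet> v)
      + (2 * (x \<bullet> v) / n) * (2 * (y \<bullet> v) / n) * n"
    unfolding reflection_along_def n_def by (simp add: inner_diff_left inner_diff_right inner_commute[of v y])
  also have "\<dots> = x \<bullet> y" using n by (simp add: field_simps)
  finally show "reflection_along v x \<bullet> reflection_along v y = x \<bullet> y" .
qed

lemma moebius_normal_form_hyperplane:
  fixes a :: "'a::euclidean_space"
  assumes M: "moebius_normal_form M" and a: "norm a = 1"
  shows "moebius_normal_form (hyperplane_reflection a t \<circ> M)"
proof -
  have aa: "a \<bullet> a = 1" using a by (simp add: norm_eq_1)
  have R: "orthogonal_transformation (reflection_along a)" using a by (intro orthogonal_transformation_reflection_along) auto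
  have lR: "linear (reflection_along a)" by (rule orthogonal_transformation_linear[OF R])
  have h: "hyperplane_reflection a t (Some x) = Some ((2 * t) *\<^sub>R a + reflection_along a x)" for x
    unfolding hyperplane_reflection_def reflection_along_def aa by (simp add: algebra_simps)
  have h0: "hyperplane_reflection a t None = None" by (simp add: hyperplane_reflection_def)
  show ?thesis
    using M
  proof (cases rule: moebius_normal_formE)
    case (affine b \<alpha> L)
    show ?thesis
    proof (rule moebius_normal_form_affineI[OF affine(1) orthogonal_transformation_compose[OF R affine(2)]])
      show "(hyperplane_reflection a t \<circ> M) (Some x) = Some (((2 * t) *\<^sub>R a + reflection_along a b) + \<alpha> *\<^sub>R (reflection_along a \<circ> L) x)" for x
        by (simp add: affine h linear_add[OF lR] linear_scale[OF lR])
    qed (simp add: affine h0)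
  next
    case (inversion c b \<alpha> L)
    show ?thesis
    proof (rule moebius_normal_form_inversionI[OF inversion(1) orthogonal_transformation_compose[OF R inversion(2)]])
      show "(hyperplane_reflection a t \<circ> M) None = Some ((2 * t) *\<^sub>R a + reflection_along a b)" by (simp add: inversion h)
      show "(hyperplane_reflection a t \<circ> M) (Some c) = None" by (simp add: inversion h0)
      show "(hyperplane_reflection a t \<circ> M) (Some x) = Some (((2 * t) *\<^sub>R a + reflection_along a b) + (\<alpha> / (norm (x - c))\<^sup>2) *\<^sub>R (reflection_along a \<circ> L) (x - c))"
        if "x \<noteq> c" for x
        by (simp add: inversion(5)[OF that] h linear_add[OF lR] linear_scale[OF lR])
    qed
  qed
qed

text \<open>With \<open>I\<close> the inversion in the unit sphere, this computes \<open>I (I u - I v)\<close>. It contains the composition of two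
  inversions with different centres: the result is again an inversion, with centre \<open>v\<close>, up to a reflection and
  a translation.\<close>

lemma inversion_difference:
  fixes u v :: "'a::real_inner"
  assumes u: "u \<noteq> 0" and v: "v \<noteq> 0" and uv: "u \<noteq> v"
  defines "D \<equiv> (1 / (u \<bullet> u)) *\<^sub>R u - (1 / (v \<bullet> v)) *\<^sub>R v"
  shows "D \<bullet> D = ((u - v) \<bullet> (u - v)) / ((u \<bullet> u) * (v \<bullet> v))"
    and "(1 / (D \<bullet> D)) *\<^sub>R D = ((v \<bullet> v) / ((u - v) \<bullet> (u - v))) *\<^sub>R reflection_along v (u - v) - v"
proof -
  define U V W where "U = u \<bullet> u" and "V = v \<bullet> v" and "W = (u - v) \<bullet> (u - v)"
  have pos: "U \<noteq> 0" "V \<noteq> 0" "W \<noteq> 0" using u v uv by (auto simp: U_def V_def W_def)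
  have uv2: "u \<bullet> v = (U + V - W) / 2" unfolding U_def V_def W_def by (simp add: inner_diff_left inner_diff_right inner_commute)
  have "D \<bullet> D = (1 / U) * (1 / U) * U - 2 * (1 / U) * (1 / V) * (u \<bullet> v) + (1 / V) * (1 / V) * V"
    unfolding D_def by (simp add: inner_diff_left inner_diff_right inner_commute[of v u] U_def V_def
        diff_divide_distrib add_divide_distrib mult.commute)
  also have "\<dots> = W / (U * V)" unfolding uv2 using pos by (simp add: field_simps)
  finally have DD: "D \<bullet> D = W / (U * V)" .
  then show "D \<bullet> D = ((u - v) \<bullet> (u - v)) / ((u \<bullet> u) * (v \<bullet> v))" by (simp add: U_def V_def W_def)
  have "(1 / (D \<bullet> D)) *\<^sub>R D = (V / W) *\<^sub>R u - (U / W) *\<^sub>R v"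
    unfolding DD unfolding D_def U_def[symmetric] V_def[symmetric] using pos by (simp add: scaleR_diff_right)
  also have "\<dots> = (V / W) *\<^sub>R (u - v - (2 * ((u - v) \<bullet> v) / V) *\<^sub>R v) - v"
  proof -
    have "(u - v) \<bullet> v = (U - V - W) / 2" unfolding inner_diff_left uv2 V_def[symmetric] by (simp add: field_simps)
    then have c: "2 * ((u - v) \<bullet> v) / V = (U - V - W) / V" by simp
    have "V / W + V / W * ((U - V - W) / V) + 1 = U / W" using pos by (simp add: field_simps)
    then have "(U / W) *\<^sub>R v = (V / W) *\<^sub>R v + (V / W * ((U - V - W) / V)) *\<^sub>R v + v"
      by (metis scaleR_add_left scaleR_one)
    then show ?thesis unfolding c by (simp add: scaleR_diff_right)
  qed
  finally show "(1 / (D \<bullet> D)) *\<^sub>R D = ((v \<bullet> v) / ((u - v) \<bullet> (u - v))) *\<^sub>R reflection_along v (u - v) - v"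
    unfolding reflection_along_def V_def W_def .
qed

text \<open>A similarity becomes an inversion form. An inversion form becomes a similarity if its value at infinity is the
  centre \<open>c\<close> of the reflection; otherwise it becomes an inversion form whose pole is the preimage of \<open>c\<close>.\<close>

lemma moebius_normal_form_sphere:
  fixes c :: "'a::euclidean_space"
  assumes M: "moebius_normal_form M" and r: "r > 0"
  shows "moebius_normal_form (sphere_reflection c r \<circ> M)"
proof -
  have s: "sphere_reflection c r (Some x) = Some (c + (r\<^sup>2 / ((x - c) \<bullet> (x - c))) *\<^sub>R (x - c))" if "x \<noteq> c" for x
    using that by (simp add: sphere_reflection_def power2_norm_eq_inner)
  have s0: "sphere_reflection c r None = Some c" "sphere_reflection c r (Some c) = None" by (auto simp: sphere_reflection_def)
  show ?thesis
    using M
  proof (cases rule: moebius_normal_formE)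
    case (affine b \<alpha> L)
    have lL: "linear L" by (rule orthogonal_transformation_linear[OF affine(2)])
    have LL: "L p \<bullet> L q = p \<bullet> q" for p q using affine(2) by (simp add: orthogonal_transformation_def)
    obtain x0 where x0: "L x0 = (1 / \<alpha>) *\<^sub>R (c - b)" using orthogonal_transformation_surj[OF affine(2)] by (metis surjD)
    have Mx: "M (Some x) = Some (c + \<alpha> *\<^sub>R L (x - x0))" for x
      using affine(1) by (simp add: affine(4) linear_diff[OF lL] x0 scaleR_diff_right)
    show ?thesis
    proof (rule moebius_normal_form_inversionI[OF _ affine(2), of "r\<^sup>2 / \<alpha>" _ c x0])
      show "r\<^sup>2 / \<alpha> \<noteq> 0" using r affine(1) by simp
      show "(sphere_reflection c r \<circ> M) None = Some c" by (simp add: affine s0)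
      show "(sphere_reflection c r \<circ> M) (Some x0) = None" by (simp add: Mx s0 linear_0[OF lL])
      fix x assume x: "x \<noteq> x0"
      have "L (x - x0) \<noteq> 0" using x LL[of "x - x0" "x - x0"] by auto
      then have ne: "c + \<alpha> *\<^sub>R L (x - x0) \<noteq> c" using affine(1) by simp
      show "(sphere_reflection c r \<circ> M) (Some x) = Some (c + (r\<^sup>2 / \<alpha> / (norm (x - x0))\<^sup>2) *\<^sub>R L (x - x0))"
        using affine(1) x by (simp add: Mx s[OF ne] LL power2_norm_eq_inner)
    qed
  next
    case (inversion a b \<alpha> L)
    have lL: "linear L" by (rule orthogonal_transformation_linear[OF inversion(2)])
    have LL: "L p \<bullet> L q = p \<bullet> q" for p q using inversion(2) by (simp add: orthogonal_transformation_def)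
    have M5: "M (Some x) = Some (b + (\<alpha> / ((x - a) \<bullet> (x - a))) *\<^sub>R L (x - a))" if "x \<noteq> a" for x
      using inversion(5)[OF that] by (simp add: power2_norm_eq_inner)
    show ?thesis
    proof (cases "b = c")
      case True
      show ?thesis
      proof (rule moebius_normal_form_affineI[OF _ inversion(2), of "r\<^sup>2 / \<alpha>" _ "c - (r\<^sup>2 / \<alpha>) *\<^sub>R L a"])
        show "r\<^sup>2 / \<alpha> \<noteq> 0" using r inversion(1) by simp
        show "(sphere_reflection c r \<circ> M) None = None" by (simp add: inversion s0 True)
        fix x
        show "(sphere_reflection c r \<circ> M) (Some x) = Some (c - (r\<^sup>2 / \<alpha>) *\<^sub>R L a + (r\<^sup>2 / \<alpha>) *\<^sub>R L x)"
        proof (cases "x = a")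
          case True
          then show ?thesis by (simp add: inversion s0)
        next
          case False
          define y where "y = x - a"
          have y: "y \<bullet> y \<noteq> 0" using False by (simp add: y_def)
          have "L y \<noteq> 0" using y LL[of y y] by auto
          then have ne: "c + (\<alpha> / (y \<bullet> y)) *\<^sub>R L y \<noteq> c" using inversion(1) y by simp
          have "(sphere_reflection c r \<circ> M) (Some x) = Some (c + (r\<^sup>2 / \<alpha>) *\<^sub>R L y)"
            using inversion(1) y by (simp add: M5[OF False] True s[OF ne] LL y_def[symmetric])
          then show ?thesis by (simp add: y_def linear_diff[OF lL] scaleR_diff_right)
        qed
      qed
    next
      case False
      define d where "d = (1 / \<alpha>) *\<^sub>R (c - b)"
      have d: "d \<noteq> 0" using False inversion(1) by (simp add: d_def)
      then have dd: "d \<bullet> d \<noteq> 0" by simp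
      have cb: "c = b + \<alpha> *\<^sub>R d" using inversion(1) by (simp add: d_def)
      \<comment> \<open>\<open>a + v\<close> is the point that is mapped to the centre \<open>c\<close>\<close>
      obtain v where v: "L v = (1 / (d \<bullet> d)) *\<^sub>R d" using orthogonal_transformation_surj[OF inversion(2)] by (metis surjD)
      have vv: "v \<bullet> v = 1 / (d \<bullet> d)" using LL[of v v] dd by (simp add: v)
      have v0: "v \<noteq> 0" using vv dd by auto
      have dv: "d = (1 / (v \<bullet> v)) *\<^sub>R L v" using dd by (simp add: v vv)
      define y0 where "y0 = a + v"
      have y0a: "y0 \<noteq> a" "y0 - a = v" using v0 by (auto simp: y0_def)
      have R: "orthogonal_transformation (reflection_along v)" by (rule orthogonal_transformation_reflection_along[OF v0])
      show ?thesis
      proof (rule moebius_normal_form_inversionI[OF _ orthogonal_transformation_compose[OF inversion(2) R], of "r\<^sup>2 / \<alpha> * (v \<bullet> v)" _ "c - (r\<^sup>2 / \<alpha>) *\<^sub>R L v" y0])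
        show "r\<^sup>2 / \<alpha> * (v \<bullet> v) \<noteq> 0" using r inversion(1) v0 by simp
        have "(sphere_reflection c r \<circ> M) None = Some (c + (r\<^sup>2 / ((b - c) \<bullet> (b - c))) *\<^sub>R (b - c))"
          using s[OF False] by (simp add: inversion)
        also have "b - c = - (\<alpha> *\<^sub>R d)" by (simp add: cb)
        also have "c + (r\<^sup>2 / (- (\<alpha> *\<^sub>R d) \<bullet> - (\<alpha> *\<^sub>R d))) *\<^sub>R - (\<alpha> *\<^sub>R d) = c - (r\<^sup>2 / \<alpha>) *\<^sub>R L v"
          using inversion(1) dd by (simp add: v)
        finally show "(sphere_reflection c r \<circ> M) None = Some (c - (r\<^sup>2 / \<alpha>) *\<^sub>R L v)" .
        have "M (Some y0) = Some c" unfolding M5[OF y0a(1)] y0a(2) cb dv by simp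
        then show "(sphere_reflection c r \<circ> M) (Some y0) = None" by (simp add: s0)
        fix x assume x: "x \<noteq> y0"
        have xv: "x - a - v = x - y0" by (simp add: y0_def)
        show "(sphere_reflection c r \<circ> M) (Some x) = Some (c - (r\<^sup>2 / \<alpha>) *\<^sub>R L v + (r\<^sup>2 / \<alpha> * (v \<bullet> v) / (norm (x - y0))\<^sup>2) *\<^sub>R (L \<circ> reflection_along v) (x - y0))"
        proof (cases "x = a")
          case True
          have "reflection_along v (- v) = v" using v0 by (simp add: reflection_along_def scaleR_2)
          then have "(r\<^sup>2 / \<alpha> * (v \<bullet> v) / (norm (x - y0))\<^sup>2) *\<^sub>R (L \<circ> reflection_along v) (x - y0) = (r\<^sup>2 / \<alpha>) *\<^sub>R L v"
            using v0 True by (simp add: y0_def power2_norm_eq_inner)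
          then show ?thesis using True by (simp add: inversion s0)
        next
          case xa: False
          define u where "u = x - a"
          have u: "u \<noteq> 0" "u \<noteq> v" using xa x by (auto simp: u_def y0_def)
          define D where "D = (1 / (u \<bullet> u)) *\<^sub>R u - (1 / (v \<bullet> v)) *\<^sub>R v"
          note inv = inversion_difference[OF u(1) v0 u(2), folded D_def]
          have D0: "D \<bullet> D \<noteq> 0" unfolding inv(1) using u v0 by simp
          have Mx: "M (Some x) = Some (c + \<alpha> *\<^sub>R L D)"
            unfolding M5[OF xa] u_def[symmetric] cb dv D_def by (simp add: linear_diff[OF lL] linear_scale[OF lL] scaleR_diff_right)
          have "L D \<noteq> 0" using D0 LL[of D D] by auto
          then have ne: "c + \<alpha> *\<^sub>R L D \<noteq> c" using inversion(1) by simp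
          have "(sphere_reflection c r \<circ> M) (Some x) = Some (c + (r\<^sup>2 / \<alpha>) *\<^sub>R L ((1 / (D \<bullet> D)) *\<^sub>R D))"
            using inversion(1) D0 by (simp add: Mx s[OF ne] LL linear_scale[OF lL])
          also have "L ((1 / (D \<bullet> D)) *\<^sub>R D) = ((v \<bullet> v) / ((x - y0) \<bullet> (x - y0))) *\<^sub>R L (reflection_along v (x - y0)) - L v"
            unfolding inv(2) u_def xv by (simp add: linear_diff[OF lL] linear_scale[OF lL])
          finally show ?thesis by (simp add: scaleR_diff_right power2_norm_eq_inner)
        qed
      qed
    qed
  qed
qed

lemma moebius_map_normal_form:
  fixes M :: "'a::euclidean_space option \<Rightarrow> 'a option"
  assumes "moebius_map M" shows "moebius_normal_form M"
  using assms
proof (induction rule: moebius_map.induct)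
  case moebius_id
  show ?case by (rule moebius_normal_form_affineI[of 1 "\<lambda>x. x" id 0]) auto
next
  case (moebius_sphere M r a)
  then show ?case by (intro moebius_normal_form_sphere)
next
  case (moebius_hyperplane M a t)
  then show ?case by (intro moebius_normal_form_hyperplane)
qed

lemma moebius_map_compose:
  assumes "moebius_map M" "moebius_map N" shows "moebius_map (M \<circ> N)"
  using assms by (induction rule: moebius_map.induct) (auto simp: comp_assoc intro: moebius_map.intros)

lemma moebius_map_hyperplane_reflection: "norm a = 1 \<Longrightarrow> moebius_map (hyperplane_reflection a t)"
  using moebius_hyperplane[OF moebius_id, of a t] by simp

lemma moebius_map_sphere_reflection: "r > 0 \<Longrightarrow> moebius_map (sphere_reflection a r)"
  using moebius_sphere[OF moebius_id, of r a] by simp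

text \<open>Two reflections in parallel hyperplanes.\<close>

lemma moebius_map_translation:
  fixes b :: "'a::euclidean_space"
  shows "moebius_map (map_option (\<lambda>x. x + b))"
proof (cases "b = 0")
  case True
  then have "map_option (\<lambda>x. x + b) = id" by (auto simp: fun_eq_iff option.map_ident)
  then show ?thesis by (simp add: moebius_id)
next
  case False
  define a where "a = sgn b"
  have a: "norm a = 1" "a \<bullet> a = 1" using False by (auto simp: a_def norm_sgn norm_eq_1[symmetric])
  have b: "b = norm b *\<^sub>R a" using False by (simp add: a_def sgn_div_norm)
  have "map_option (\<lambda>x. x + b) = hyperplane_reflection a (norm b / 2) \<circ> hyperplane_reflection a 0"
  proof
    fix y show "map_option (\<lambda>x. x + b) y = (hyperplane_reflection a (norm b / 2) \<circ> hyperplane_reflection a 0) y"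
    proof (cases y)
      case (Some x)
      have "x - (2 * (x \<bullet> a)) *\<^sub>R a - (2 * ((x - (2 * (x \<bullet> a)) *\<^sub>R a) \<bullet> a - norm b / 2)) *\<^sub>R a = x + norm b *\<^sub>R a"
        by (simp add: inner_diff_left a(2) algebra_simps)
      then show ?thesis using Some b by (simp add: hyperplane_reflection_def)
    qed (simp add: hyperplane_reflection_def)
  qed
  then show ?thesis using moebius_map_compose moebius_map_hyperplane_reflection[OF a(1)] by metis
qed

text \<open>The argument of Cartan and Dieudonne. If \<open>L\<close> moves a basis vector \<open>e\<close>, the reflection along \<open>L e - e\<close> takes \<open>L e\<close>
  back to \<open>e\<close> and keeps the basis vectors that \<open>L\<close> fixes, since these are orthogonal to \<open>L e - e\<close>.\<close>

lemma moebius_map_orthogonal: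
  fixes L :: "'a::euclidean_space \<Rightarrow> 'a"
  assumes "orthogonal_transformation L"
  shows "moebius_map (map_option L)"
  using assms
proof (induction "card {e \<in> Basis. L e \<noteq> e}" arbitrary: L rule: less_induct)
  case less
  have lL: "linear L" by (rule orthogonal_transformation_linear[OF less(2)])
  have LL: "L p \<bullet> L q = p \<bullet> q" for p q using less(2) by (simp add: orthogonal_transformation_def)
  show ?case
  proof (cases "\<forall>e\<in>Basis. L e = e")
    case True
    have "L x = x" for x using linear_eq_sum_Basis[OF lL, of x] True by (simp add: euclidean_representation)
    then have "L = id" by (simp add: fun_eq_iff)
    then have "map_option L = id" by (simp add: option.map_id0)
    then show ?thesis by (simp add: moebius_id)
  next
    case False
    then obtain e where e: "e \<in> Basis" "L e \<noteq> e" by blast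
    define v where "v = L e - e"
    have v: "v \<noteq> 0" using e by (simp add: v_def)
    define R where "R = reflection_along v"
    have R: "orthogonal_transformation R" unfolding R_def by (rule orthogonal_transformation_reflection_along[OF v])
    have RR: "R (R x) = x" for x
    proof -
      have lR: "linear R" by (rule orthogonal_transformation_linear[OF R])
      have "R v = - v" using v by (simp add: R_def reflection_along_def scaleR_2)
      then show ?thesis unfolding R_def reflection_along_def[of v x] using lR
        by (simp add: linear_diff linear_scale R_def) (simp add: reflection_along_def)
    qed
    have "v \<bullet> v = 2 * (L e \<bullet> v)" using LL[of e e] by (simp add: v_def inner_diff_left inner_diff_right inner_commute)
    moreover have "v \<bullet> v \<noteq> 0" using v by simp
    ultimately have "2 * (L e \<bullet> v) / (v \<bullet> v) = 1" by (metis divide_self)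
    then have Re: "R (L e) = e" unfolding R_def reflection_along_def by (simp only: scaleR_one) (simp add: v_def)
    have Rd: "R (L d) = d" if "d \<in> Basis" "L d = d" for d
    proof -
      have "d \<bullet> v = 0" using LL[of d e] that(2) by (simp add: v_def inner_diff_right)
      then show ?thesis using that(2) by (simp add: R_def reflection_along_def)
    qed
    have "{d \<in> Basis. (R \<circ> L) d \<noteq> d} \<subset> {d \<in> Basis. L d \<noteq> d}" using Re Rd e by auto
    then have "card {d \<in> Basis. (R \<circ> L) d \<noteq> d} < card {d \<in> Basis. L d \<noteq> d}" by (intro psubset_card_mono) auto
    then have IH: "moebius_map (map_option (R \<circ> L))"
      by (rule less(1)) (rule orthogonal_transformation_compose[OF R less(2)])
    define a where "a = sgn v"
    have a: "norm a = 1" using v by (simp add: a_def norm_sgn)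
    have "hyperplane_reflection a 0 = map_option R"
    proof
      fix y show "hyperplane_reflection a 0 y = map_option R y"
        using v by (cases y) (auto simp: hyperplane_reflection_def R_def reflection_along_def a_def sgn_div_norm power2_norm_eq_inner[symmetric] power2_eq_square divide_inverse mult_ac)
    qed
    then have "moebius_map (map_option R)" using moebius_map_hyperplane_reflection[OF a] by metis
    from moebius_map_compose[OF this IH] have "moebius_map (map_option R \<circ> map_option (R \<circ> L))" .
    moreover have "map_option R \<circ> map_option (R \<circ> L) = map_option L"
      by (auto simp: fun_eq_iff option.map_comp o_def RR)
    ultimately show ?thesis by simp
  qed
qed

text \<open>Two reflections in concentric spheres.\<close>

lemma moebius_map_dilation:
  assumes "\<alpha> > 0"
  shows "moebius_map (map_option (\<lambda>x::'a::euclidean_space. \<alpha> *\<^sub>R x))"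
proof -
  have "map_option (\<lambda>x::'a. \<alpha> *\<^sub>R x) = sphere_reflection 0 (sqrt \<alpha>) \<circ> sphere_reflection 0 1"
  proof
    fix y :: "'a option"
    show "map_option (\<lambda>x. \<alpha> *\<^sub>R x) y = (sphere_reflection 0 (sqrt \<alpha>) \<circ> sphere_reflection 0 1) y"
      using assms by (cases y) (auto simp: sphere_reflection_def power2_eq_square divide_simps)
  qed
  moreover have "moebius_map (sphere_reflection (0::'a) (sqrt \<alpha>) \<circ> sphere_reflection 0 1)"
    by (intro moebius_map_compose moebius_map_sphere_reflection) (use assms in auto)
  ultimately show ?thesis by (simp only:)
qed

text \<open>A negative factor is absorbed into the orthogonal map.\<close>

lemma moebius_map_similarity:
  fixes L :: "'a::euclidean_space \<Rightarrow> 'a"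
  assumes "\<alpha> \<noteq> 0" and L: "orthogonal_transformation L"
  shows "moebius_map (map_option (\<lambda>x. b + \<alpha> *\<^sub>R L (x - a)))"
proof -
  have pos: "moebius_map (map_option (\<lambda>x. b + \<beta> *\<^sub>R K (x - a)))"
    if "\<beta> > 0" and K: "orthogonal_transformation K" for \<beta> and K :: "'a \<Rightarrow> 'a"
  proof -
    have "moebius_map (map_option (\<lambda>x. x + b) \<circ> (map_option (\<lambda>x. \<beta> *\<^sub>R x) \<circ> (map_option K \<circ> map_option (\<lambda>x. x + (- a)))))"
      by (intro moebius_map_compose moebius_map_translation moebius_map_dilation moebius_map_orthogonal that)
    moreover have "map_option (\<lambda>x. x + b) \<circ> (map_option (\<lambda>x. \<beta> *\<^sub>R x) \<circ> (map_option K \<circ> map_option (\<lambda>x. x + (- a)))) = map_option (\<lambda>x. b + \<beta> *\<^sub>R K (x - a))"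
      by (auto simp: fun_eq_iff option.map_comp o_def add.commute)
    ultimately show ?thesis by simp
  qed
  show ?thesis
  proof (cases "\<alpha> > 0")
    case False
    have "moebius_map (map_option (\<lambda>x. b + (- \<alpha>) *\<^sub>R (- L (x - a))))"
      by (rule pos) (use False assms in \<open>auto simp: orthogonal_transformation_neg\<close>)
    then show ?thesis by simp
  qed (use pos L in blast)
qed

lemma moebius_form_extends_to_moebius_map:
  fixes L :: "'a::euclidean_space \<Rightarrow> 'a"
  assumes "\<alpha> \<noteq> 0" and L: "orthogonal_transformation L" and eps: "\<epsilon> = 0 \<or> \<epsilon> = 2"
  shows "\<exists>M. moebius_map M \<and> (\<forall>x. x \<noteq> a \<longrightarrow> M (Some x) = Some (moebius_form a b \<alpha> L \<epsilon> x))"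
  using eps
proof
  assume e: "\<epsilon> = 0"
  show ?thesis
    by (rule exI[of _ "map_option (\<lambda>x. b + \<alpha> *\<^sub>R L (x - a))"])
      (use moebius_map_similarity[OF assms(1,2)] e in \<open>auto simp: moebius_form_def\<close>)
next
  assume e: "\<epsilon> = 2"
  have lL: "linear L" by (rule orthogonal_transformation_linear[OF L])
  show ?thesis
    by (rule exI[of _ "map_option (\<lambda>x. b + \<alpha> *\<^sub>R L (x - a)) \<circ> sphere_reflection a 1"])
      (use moebius_map_compose[OF moebius_map_similarity[OF assms(1,2)] moebius_map_sphere_reflection] e in
        \<open>auto simp: moebius_form_def sphere_reflection_def linear_scale[OF lL]\<close>)
qed

text \<open>The pole of the transformation lies outside the ball because \<open>\<phi>\<close> takes finite values there.\<close>

lemma moebius_form_of_moebius_map: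
  fixes \<phi> :: "'a::euclidean_space \<Rightarrow> 'a"
  assumes M: "moebius_map M" and phi: "\<And>x. x \<in> ball 0 1 \<Longrightarrow> M (Some x) = Some (\<phi> x)"
  obtains a b \<alpha> L \<epsilon> where "a \<notin> ball 0 1" "\<alpha> \<noteq> 0" "orthogonal_transformation L" "\<epsilon> = 0 \<or> \<epsilon> = 2"
    "\<And>x. x \<in> ball 0 1 \<Longrightarrow> \<phi> x = moebius_form a b \<alpha> L \<epsilon> x"
  using moebius_map_normal_form[OF M]
proof (cases rule: moebius_normal_formE)
  case (affine b \<alpha> L)
  have lL: "linear L" by (rule orthogonal_transformation_linear[OF affine(2)])
  obtain e :: 'a where e: "e \<in> Basis" using nonempty_Basis by blast
  \<comment> \<open>A similarity has no distinguished centre; any point outside the ball will do.\<close>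
  define a where "a = 2 *\<^sub>R e"
  have a: "a \<notin> ball 0 1" using e by (simp add: a_def)
  show ?thesis
  proof (rule that[OF a affine(1,2), of 0 "b + \<alpha> *\<^sub>R L a"])
    fix x :: 'a assume x: "x \<in> ball 0 1"
    then have "x \<noteq> a" using a by auto
    then show "\<phi> x = moebius_form a (b + \<alpha> *\<^sub>R L a) \<alpha> L 0 x"
      using phi[OF x] affine(4)[of x] by (simp add: moebius_form_def linear_diff[OF lL] scaleR_diff_right)
  qed simp
next
  case (inversion a b \<alpha> L)
  have a: "a \<notin> ball 0 1" using phi[of a] inversion(4) by auto
  show ?thesis
  proof (rule that[OF a inversion(1,2), of 2 b])
    fix x :: 'a assume x: "x \<in> ball 0 1"
    then have "x \<noteq> a" using a by auto
    then show "\<phi> x = moebius_form a b \<alpha> L 2 x"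
      using phi[OF x] inversion(5)[of x] by (simp add: moebius_form_def)
  qed simp
qed

text \<open>Divided by the factor \<open>\<kappa>\<close>, the derivative is an orthogonal map and has determinant 1 or -1.\<close>

lemma jacobian_abs_conformal:
  fixes D :: "real^'n \<Rightarrow> real^'n"
  assumes d: "(\<phi> has_derivative D) (at x)" and l: "\<kappa> > 0" and D: "\<And>u v. D u \<bullet> D v = \<kappa>\<^sup>2 * (u \<bullet> v)"
  shows "jacobian_abs \<phi> x = \<kappa>"
proof -
  have lD: "linear D" by (rule has_derivative_linear[OF d])
  define Q where "Q v = (1 / \<kappa>) *\<^sub>R D v" for v
  have lQ: "linear Q" unfolding Q_def by (rule linear_compose_scale_right[OF lD])
  have Q: "orthogonal_transformation Q"
    unfolding orthogonal_transformation_def using lQ l by (auto simp: Q_def D power2_eq_square)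
  have "jacobian \<phi> (at x) = matrix D"
    unfolding jacobian_def using frechet_derivative_at[OF d] by simp
  moreover have "matrix D = matrix (((*\<^sub>R) \<kappa>) \<circ> Q)"
    using l by (intro arg_cong[where f=matrix]) (auto simp: Q_def fun_eq_iff)
  moreover have "matrix (((*\<^sub>R) \<kappa>) \<circ> Q) = matrix ((*\<^sub>R) \<kappa>) ** matrix Q"
    by (rule matrix_compose[OF lQ]) (rule linear_scale_self)
  ultimately have "jacobian_det \<phi> x = \<kappa> ^ CARD('n) * det (matrix Q)"
    unfolding jacobian_det_def by (simp add: det_mul)
  moreover have "\<bar>det (matrix Q)\<bar> = 1"
    using det_orthogonal_matrix[of "matrix Q"] Q by (auto simp: orthogonal_transformation_matrix)
  ultimately have "\<bar>jacobian_det \<phi> x\<bar> = \<kappa> ^ CARD('n)" using l by (simp add: abs_mult)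
  then show ?thesis unfolding jacobian_abs_def using l by (simp add: powr_realpow[symmetric] powr_powr)
qed

text \<open>The derivative of an inversion is \<open>\<alpha> / |x - a|\<^sup>2\<close> times a reflection followed by an orthogonal map.\<close>

lemma jacobian_abs_moebius_form:
  fixes L :: "real^'n \<Rightarrow> real^'n"
  assumes S: "open S" "a \<notin> S" and x: "x \<in> S" and al: "\<alpha> \<noteq> 0" and L: "orthogonal_transformation L" and eps: "\<epsilon> = 0 \<or> \<epsilon> = 2"
    and phi: "\<And>x. x \<in> S \<Longrightarrow> \<phi> x = moebius_form a b \<alpha> L \<epsilon> x"
  shows "jacobian_abs \<phi> x = \<bar>\<alpha>\<bar> / norm (x - a) powr \<epsilon>"
  using eps
proof
  have lL: "linear L" by (rule orthogonal_transformation_linear[OF L])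
  then have bL: "bounded_linear L" by (rule linear_conv_bounded_linear[THEN iffD1])
  have LL: "L p \<bullet> L q = p \<bullet> q" for p q using L by (simp add: orthogonal_transformation_def)
  have xa: "x \<noteq> a" using x S by auto
  {
    assume e: "\<epsilon> = 0"
    have "((\<lambda>x. b + \<alpha> *\<^sub>R L (x - a)) has_derivative (\<lambda>u. \<alpha> *\<^sub>R L u)) (at x)"
      by (auto intro!: derivative_eq_intros bounded_linear.has_derivative[OF bL])
    then have "(\<phi> has_derivative (\<lambda>u. \<alpha> *\<^sub>R L u)) (at x)"
      by (rule has_derivative_transform_within_open[OF _ S(1) x]) (use phi e S(2) in \<open>auto simp: moebius_form_def\<close>)
    from jacobian_abs_conformal[OF this, of "\<bar>\<alpha>\<bar>"] show ?thesis using al e xa by (simp add: LL power2_eq_square)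
  next
    assume e: "\<epsilon> = 2"
    define y where "y = x - a"
    define n where "n = y \<bullet> y"
    have n: "n > 0" using xa by (simp add: n_def y_def)
    have y0: "y \<noteq> 0" using xa by (simp add: y_def)
    have "(moebius_form a b \<alpha> L 2 has_derivative (\<lambda>u. (\<alpha> / n) *\<^sub>R (L u - (2 * (y \<bullet> u) / n) *\<^sub>R L y))) (at x)"
      using C2_derivsD(1)[OF C2_derivs_inversion[OF bL S] x] unfolding n_def y_def .
    then have "(\<phi> has_derivative (\<lambda>u. (\<alpha> / n) *\<^sub>R (L u - (2 * (y \<bullet> u) / n) *\<^sub>R L y))) (at x)"
      by (rule has_derivative_transform_within_open[OF _ S(1) x]) (use phi e in auto)
    moreover have "(\<lambda>u. (\<alpha> / n) *\<^sub>R (L u - (2 * (y \<bullet> u) / n) *\<^sub>R L y)) = (\<lambda>u. (\<alpha> / n) *\<^sub>R L (reflection_along y u))"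
      by (auto simp: fun_eq_iff reflection_along_def linear_diff[OF lL] linear_scale[OF lL] n_def inner_commute)
    ultimately have "(\<phi> has_derivative (\<lambda>u. (\<alpha> / n) *\<^sub>R L (reflection_along y u))) (at x)" by simp
    moreover have "((\<alpha> / n) *\<^sub>R L (reflection_along y u)) \<bullet> ((\<alpha> / n) *\<^sub>R L (reflection_along y v)) = (\<bar>\<alpha>\<bar> / n)\<^sup>2 * (u \<bullet> v)" for u v
      using orthogonal_transformation_reflection_along[OF y0] by (simp add: LL orthogonal_transformation_def power2_eq_square)
    moreover have "\<bar>\<alpha>\<bar> / n > 0" using al n by simp
    ultimately have "jacobian_abs \<phi> x = \<bar>\<alpha>\<bar> / n" using jacobian_abs_conformal by blast
    moreover have "norm (x - a) powr \<epsilon> = n" using e xa by (simp add: n_def y_def power2_norm_eq_inner)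
    ultimately show ?thesis by simp
  }
qed

section \<open>The characterization\<close>

theorem theorem1p1:
  fixes \<phi> :: "real^'n \<Rightarrow> real^'n" and \<psi> :: "real^'n \<Rightarrow> complex" and p :: ereal
  assumes dim: "CARD('n) \<ge> 3"
    and p: "1 \<le> p"
    and maps: "\<phi> ` ball 0 1 \<subseteq> ball 0 1"
    and nonconst: "\<not> \<phi> constant_on ball 0 1"
    and phi_C2: "C2_on \<phi> (ball 0 1)"
    and sign: "(\<forall>x\<in>ball 0 1. jacobian_det \<phi> x \<ge> 0) \<or> (\<forall>x\<in>ball 0 1. jacobian_det \<phi> x \<le> 0)"
    and psi_C2: "C2_on \<psi> (ball 0 1)"
    and psi_nonzero: "\<exists>x\<in>ball 0 1. \<psi> x \<noteq> 0"
  shows "(bounded_on_hp p (weighted_comp \<phi> \<psi>) \<longleftrightarrow>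
            (\<exists>M. moebius_map M \<and> (\<forall>x\<in>ball 0 1. M (Some x) = Some (\<phi> x))) \<and>
            (\<exists>c::complex. \<forall>x\<in>ball 0 1.
               \<psi> x = c * of_real (jacobian_abs \<phi> x powr ((real CARD('n) - 2) / 2))))
       \<and> (bounded_on_hp p (weighted_comp \<phi> \<psi>) \<longleftrightarrow>
            (\<exists>(a::real^'n) (b::real^'n) (\<alpha>::real) (A::real^'n^'n) (\<epsilon>::real).
               a \<notin> ball 0 1 \<and> orthogonal_matrix A \<and> (\<epsilon> = 0 \<or> \<epsilon> = 2) \<and>
               (\<forall>x\<in>ball 0 1.
                  \<phi> x = b + (\<alpha> / norm (x - a) powr \<epsilon>) *\<^sub>R (A *v (x - a))) \<and>
               (\<exists>c::complex. \<forall>x\<in>ball 0 1.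
                  \<psi> x = c * of_real (norm (x - a) powr (\<epsilon> * (2 - real CARD('n)) / 2)))))"
    (is "(?B \<longleftrightarrow> ?M \<and> ?J) \<and> (?B \<longleftrightarrow> ?F)")
proof -
  define explicit where "explicit a b \<alpha> L \<epsilon> \<longleftrightarrow> a \<notin> ball 0 1 \<and> \<alpha> \<noteq> 0 \<and> orthogonal_transformation L \<and> (\<epsilon> = 0 \<or> \<epsilon> = 2) \<and>
      (\<forall>x\<in>ball 0 1. \<phi> x = moebius_form a b \<alpha> L \<epsilon> x)" for a b :: "real^'n" and \<alpha> L \<epsilon>
  define weight where "weight a \<epsilon> c \<longleftrightarrow> (\<forall>x\<in>ball 0 1. \<psi> x = c * complex_of_real (norm (x - a) powr (\<epsilon> * (2 - real CARD('n)) / 2)))"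
    for a :: "real^'n" and \<epsilon> and c :: complex
  have F: "?F \<longleftrightarrow> (\<exists>a b \<alpha> L \<epsilon> c. explicit a b \<alpha> L \<epsilon> \<and> weight a \<epsilon> c)"
  proof
    assume ?F
    then obtain a b \<alpha> A \<epsilon> c where A: "a \<notin> ball 0 1" "orthogonal_matrix A" "\<epsilon> = 0 \<or> \<epsilon> = 2"
      "\<And>x. x \<in> ball 0 1 \<Longrightarrow> \<phi> x = b + (\<alpha> / norm (x - a) powr \<epsilon>) *\<^sub>R (A *v (x - a))" "weight a \<epsilon> c"
      unfolding weight_def by blast
    have "\<alpha> \<noteq> 0" using nonconst A(4) unfolding constant_on_def by auto
    moreover have "orthogonal_transformation ((*v) A)"
      using A(2) by (simp add: orthogonal_transformation_matrix)
    ultimately have "explicit a b \<alpha> ((*v) A) \<epsilon>" unfolding explicit_def moebius_form_def using A by blast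
    then show "\<exists>a b \<alpha> L \<epsilon> c. explicit a b \<alpha> L \<epsilon> \<and> weight a \<epsilon> c" using A(5) by blast
  next
    assume "\<exists>a b \<alpha> L \<epsilon> c. explicit a b \<alpha> L \<epsilon> \<and> weight a \<epsilon> c"
    then obtain a b \<alpha> L \<epsilon> c where E: "explicit a b \<alpha> L \<epsilon>" "weight a \<epsilon> c" by blast
    then have L: "orthogonal_transformation L" by (simp add: explicit_def)
    have "orthogonal_matrix (matrix L)" using L by (simp add: orthogonal_transformation_matrix)
    moreover have "matrix L *v x = L x" for x by (rule fun_cong[OF matrix_vector_mul(2)[OF orthogonal_transformation_linear[OF L]]])
    ultimately show ?F using E unfolding explicit_def weight_def moebius_form_def by metis
  qed
  have jac: "jacobian_abs \<phi> x powr ((real CARD('n) - 2) / 2)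
      = \<bar>\<alpha>\<bar> powr ((real CARD('n) - 2) / 2) * norm (x - a) powr (\<epsilon> * (2 - real CARD('n)) / 2)"
    if E: "explicit a b \<alpha> L \<epsilon>" and x: "x \<in> ball 0 1" for a b \<alpha> L \<epsilon> x
  proof -
    have e: "a \<notin> ball 0 1" "\<alpha> \<noteq> 0" "orthogonal_transformation L" "\<epsilon> = 0 \<or> \<epsilon> = 2"
      "\<And>x. x \<in> ball 0 1 \<Longrightarrow> \<phi> x = moebius_form a b \<alpha> L \<epsilon> x" using E unfolding explicit_def by auto
    have n: "norm (x - a) > 0" using x e(1) by auto
    have "jacobian_abs \<phi> x = \<bar>\<alpha>\<bar> / norm (x - a) powr \<epsilon>"
      by (rule jacobian_abs_moebius_form[OF open_ball e(1) x e(2,3,4,5)])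
    then have "jacobian_abs \<phi> x powr ((real CARD('n) - 2) / 2)
       = \<bar>\<alpha>\<bar> powr ((real CARD('n) - 2) / 2) * norm (x - a) powr (- (\<epsilon> * ((real CARD('n) - 2) / 2)))"
      using n by (simp add: powr_divide powr_powr powr_minus_divide)
    also have "- (\<epsilon> * ((real CARD('n) - 2) / 2)) = \<epsilon> * (2 - real CARD('n)) / 2" by (simp add: field_simps)
    finally show ?thesis .
  qed
  have J: "?J \<longleftrightarrow> (\<exists>c. weight a \<epsilon> c)" if E: "explicit a b \<alpha> L \<epsilon>" for a b \<alpha> L \<epsilon>
  proof
    define m where "m = \<bar>\<alpha>\<bar> powr ((real CARD('n) - 2) / 2)"
    have m: "m \<noteq> 0" using E by (simp add: m_def explicit_def)
    {
      assume ?J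
      then obtain c where "\<forall>x\<in>ball 0 1. \<psi> x = c * of_real (jacobian_abs \<phi> x powr ((real CARD('n) - 2) / 2))" by blast
      then have "weight a \<epsilon> (c * of_real m)" unfolding weight_def using jac[OF E] by (simp add: m_def)
      then show "\<exists>c. weight a \<epsilon> c" by blast
    next
      assume "\<exists>c. weight a \<epsilon> c"
      then obtain c where "weight a \<epsilon> c" by blast
      then have "\<forall>x\<in>ball 0 1. \<psi> x = (c / of_real m) * of_real (jacobian_abs \<phi> x powr ((real CARD('n) - 2) / 2))"
        unfolding weight_def using jac[OF E] m by (simp add: m_def)
      then show ?J by blast
    }
  qed
  have M: "?M \<longleftrightarrow> (\<exists>a b \<alpha> L \<epsilon>. explicit a b \<alpha> L \<epsilon>)"
  proof
    assume ?M
    then obtain M where M: "moebius_map M" "\<And>x. x \<in> ball 0 1 \<Longrightarrow> M (Some x) = Some (\<phi> x)" by blast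
    show "\<exists>a b \<alpha> L \<epsilon>. explicit a b \<alpha> L \<epsilon>"
    proof (rule moebius_form_of_moebius_map[OF M])
      fix a b \<alpha> L \<epsilon>
      assume "a \<notin> ball 0 1" "\<alpha> \<noteq> 0" "orthogonal_transformation L" "\<epsilon> = 0 \<or> \<epsilon> = 2"
        "\<And>x. x \<in> ball 0 1 \<Longrightarrow> \<phi> x = moebius_form a b \<alpha> L \<epsilon> x"
      then have "explicit a b \<alpha> L \<epsilon>" unfolding explicit_def by auto
      then show "\<exists>a b \<alpha> L \<epsilon>. explicit a b \<alpha> L \<epsilon>" by blast
    qed
  next
    assume "\<exists>a b \<alpha> L \<epsilon>. explicit a b \<alpha> L \<epsilon>"
    then obtain a b \<alpha> L \<epsilon> where E: "a \<notin> ball 0 1" "\<alpha> \<noteq> 0" "orthogonal_transformation L" "\<epsilon> = 0 \<or> \<epsilon> = 2"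
      "\<forall>x\<in>ball 0 1. \<phi> x = moebius_form a b \<alpha> L \<epsilon> x" unfolding explicit_def by blast
    obtain M where M: "moebius_map M" "\<forall>x. x \<noteq> a \<longrightarrow> M (Some x) = Some (moebius_form a b \<alpha> L \<epsilon> x)"
      using moebius_form_extends_to_moebius_map[OF E(2,3,4)] by blast
    have "\<forall>x\<in>ball 0 1. M (Some x) = Some (\<phi> x)"
    proof
      fix x :: "real^'n" assume x: "x \<in> ball 0 1"
      then have "x \<noteq> a" using E(1) by auto
      then show "M (Some x) = Some (\<phi> x)" using M(2) E(5) x by simp
    qed
    then show ?M using M(1) by blast
  qed
  have MJF: "?M \<and> ?J \<longleftrightarrow> ?F" 
  proof
    assume "?M \<and> ?J"
    then obtain a b \<alpha> L \<epsilon> where E: "explicit a b \<alpha> L \<epsilon>" unfolding M by blast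
    from J[OF E] \<open>?M \<and> ?J\<close> obtain c where "weight a \<epsilon> c" by blast
    then show ?F unfolding F using E by blast
  next
    assume ?F
    then obtain a b \<alpha> L \<epsilon> c where E: "explicit a b \<alpha> L \<epsilon>" "weight a \<epsilon> c" unfolding F by blast
    from E(1) have ?M unfolding M by blast
    moreover have ?J unfolding J[OF E(1)] using E(2) by blast
    ultimately show "?M \<and> ?J" by (rule conjI)
  qed
  have BF: "?B \<longleftrightarrow> ?F"
  proof
    assume B: ?B
    obtain \<phi>' \<phi>'' where P: "C2_derivs \<phi> \<phi>' \<phi>'' (ball 0 1)" using C2_on_imp_C2_derivs[OF phi_C2] by blast
    obtain \<psi>' \<psi>'' where W: "C2_derivs \<psi> \<psi>' \<psi>'' (ball 0 1)" using C2_on_imp_C2_derivs[OF psi_C2] by blast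
    interpret harmonic_preserving \<phi> \<phi>' \<phi>'' \<psi> \<psi>' \<psi>'' p
    proof
      show "3 \<le> DIM(real^'n)" using dim by simp
      show "weighted_comp \<phi> \<psi> f \<in> hp p" if "f \<in> hp p" for f
        using B that unfolding bounded_on_hp_def by blast
    qed (rule p maps nonconst P W psi_nonzero)+
    show ?F unfolding F
    proof (rule moebius_form_of_harmonic_preserving)
      fix a b \<alpha> L \<epsilon> c
      assume "a \<notin> ball 0 1" "\<alpha> > 0" "orthogonal_transformation L" "\<epsilon> = 0 \<or> \<epsilon> = 2"
        "\<And>x. x \<in> ball 0 1 \<Longrightarrow> \<phi> x = moebius_form a b \<alpha> L \<epsilon> x"
        "\<And>x. x \<in> ball 0 1 \<Longrightarrow> \<psi> x = c * complex_of_real (norm (x - a) powr (\<epsilon> * (2 - real DIM(real^'n)) / 2))"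
      then have "explicit a b \<alpha> L \<epsilon>" "weight a \<epsilon> c" unfolding explicit_def weight_def by auto
      then show "\<exists>a b \<alpha> L \<epsilon> c. explicit a b \<alpha> L \<epsilon> \<and> weight a \<epsilon> c" by blast
    qed
  next
    assume ?F
    then obtain a b \<alpha> L \<epsilon> c where E: "a \<notin> ball 0 1" "\<alpha> \<noteq> 0" "orthogonal_transformation L" "\<epsilon> = 0 \<or> \<epsilon> = 2"
      "\<And>x. x \<in> ball 0 1 \<Longrightarrow> \<phi> x = moebius_form a b \<alpha> L \<epsilon> x" "weight a \<epsilon> c" unfolding F explicit_def by blast
    show ?B
      by (rule moebius_form_imp_bounded_on_hp[OF p _ E(3,4,1,2) maps E(5)])
        (use dim E(6) in \<open>auto simp: weight_def\<close>)
  qed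
  have "?B \<longleftrightarrow> ?M \<and> ?J" unfolding MJF by (rule BF)
  then show ?thesis using BF by (rule conjI)
qed

end
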